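(* Let $\Delta>0$ and suppose assumptions A1), A2), A3), A4) listed in the context hold. Let $d(t)=\mu^{(1)}(t)-\mu^{(2)}(t)$, $d_1=\|\mu^{(1)}-\mu^{(2)}\|_1$, $\mathcal N=\{t\in[0,1]: d(t)=0\}$, and $$\hat T_{n,\Delta}=\sqrt n\Big(\sup_{s\in[0,1]}\|\mathbb U_n(s)\|_1-\hat s(1-\hat s)\Delta\Big).$$ Then, as $n\to\infty$, $$\hat T_{n,\Delta}\overset{d}{\rightarrow}\begin{cases}-\infty & \text{if } d_1<\Delta,\\ T & \text{if } d_1=\Delta,\\ \infty & \text{if } d_1>\Delta,\end{cases}$$ where $T$ is distributed as $$T\overset{d}{=}\int_{\mathcal N^c}\operatorname{sgn}(d(t))\,(\mathbb W(s^* )-s^*\mathbb W(1))(t)\,dt+\int_{\mathcal N}\big|(\mathbb W(s^* )-s^*\mathbb W(1))(t)\big|\,dt$$ and $\mathbb W$ is an $L^1$-valued Brownian motion with covariance operator $C$.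
   Context: $L^1=L^1[0,1]$ carries the norm $\|f\|_1=\int_0^1|f(x)|dx$ and its Borel $\sigma$-field; expectations are Bochner integrals. $(L^1)^*=L^\infty$. A centered $L^1$-valued random variable $X$ is Gaussian if $(l_1(X),\dots,l_k(X))$ is centered normal with covariance matrix $(\mathbb E[l_i(X)l_j(X)])_{i,j}$ for every finite collection $l_1,\dots,l_k\in (L^1)^*$. The covariance operator of $X$ is $T_X(l,l')=\mathbb E[l(X)l'(X)]$; $\mathcal N(0,S)$ denotes the centered Gaussian variable on $L^1$ with covariance operator $S$, if it exists. $X$ is pregaussian if $\mathcal N(0,T_X)$ exists; $G_X$ denotes a Gaussian variable with this law. An $L^1$-valued Brownian motion with covariance operator $S$ is a continuous $L^1$-valued process $(B(t))_{t\ge0}$ with $B(0)=0$, stationary independent Gaussian increments and $B(1)\sim\mathcal N(0,S)$. Convergence in distribution to $\pm\infty$ means divergence to $\pm\infty$ in probability. Model: $X_i=X_{n,i}=\mu_{n,i}+\epsilon_i$, $i=1,\dots,n$, are $L^1$-valued, $(\epsilon_i)_{i\in\mathbb N}$ is a mean zero stationary sequence, and for $k^*=\lfloor ns^*\rfloor$ with $s^*\in(0,1)$, $\mu_{n,i}=\mu^{(1)}$ for $i\le k^*$ and $\mu_{n,i}=\mu^{(2)}$ for $i>k^*$. Assumptions: A1) $\mathbb E[\|\epsilon_i\|_1^{2+\delta}]<\infty$ for some $\delta>0$. A2) $(\epsilon_i)$ is $\beta$-mixing with coefficients $\beta(k)=\sup_j\mathbb E\big[\sup_{A\in\sigma(\epsilon_i,\,i\ge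 j+k)}|\mathbb P(A\mid\sigma(\epsilon_i,\,i\le j))-\mathbb P(A)|\big]$ satisfying $\beta(k)\le k^{-(1+\epsilon)(1+2/\delta)}$ and $\sum_{k\ge1}k^{1/(1/2-\tau)}\beta(k)^{\delta/(2+\delta)}<\infty$ for some $\epsilon>0$ and some $\tau\in(1/(2+2\delta),1/2)$. $C$ denotes the long run covariance operator $C(l,l')=\mathbb E[l(\epsilon_1)l'(\epsilon_1)]+\sum_{j\ge1}\big(\mathbb E[l(\epsilon_1)l'(\epsilon_{1+j})]+\mathbb E[l(\epsilon_{1+j})l'(\epsilon_1)]\big)$. A3) $\int_0^1\sqrt{\mathbb E[\epsilon_i(t)^2]}\,dt<\infty$. A4) For some $\alpha>0$ and $C_1>0$, $\mathbb E[\|G_{\epsilon_1}(\cdot)-G_{\epsilon_1}(\cdot+y)\|_1^2]^{1/2}\le C_1y^\alpha$ for $y\ge0$ (functions extended by $0$ outside $[0,1]$). Sums with non-integer bounds are linearly interpolated: $\sum_{i=1}^{x}a_i=\sum_{i=1}^{\lfloor x\rfloor}a_i+(x-\lfloor x\rfloor)a_{\lfloor x\rfloor+1}$. Set $\mathbb U_n(s)=\frac1n\big(\sum_{i=1}^{ns}X_i-s\sum_{i=1}^nX_i\big)$ and $\hat s=\arg\max_{s\in[0,1]}\|\mathbb U_n(s)\|_1$.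
   Formalization: If μ^(1)=μ^(2), C is additionally assumed not identically zero (the claim fails for ε=0, μ^(1)=μ^(2)); existence of W is not asserted, since A1–A4 need not make C pregaussian: for d_1=Δ the limit law is proved for every L^1 Brownian motion W with covariance operator C. *)

theory Defs
  imports "HOL-Probability.Probability"
begin

section \<open>The Banach space \<open>L\<^sup>1[0,1]\<close>\<close>

abbreviation leb01 :: "real measure" where
  "leb01 \<equiv> restrict_space lborel {0..1}"

definition l1_eq :: "(real \<Rightarrow> real) \<Rightarrow> (real \<Rightarrow> real) \<Rightarrow> bool" where
  "l1_eq f g \<longleftrightarrow> integrable leb01 f \<and> integrable leb01 g \<and> (AE t in leb01. f t = g t)"

lemma part_equivp_l1_eq: "part_equivp l1_eq"
proof (rule part_equivpI)
  show "\<exists>f. l1_eq f f"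
    by (rule exI[of _ "\<lambda>_. 0"]) (simp add: l1_eq_def)
  show "symp l1_eq"
    by (auto simp: symp_def l1_eq_def elim: eventually_mono)
  show "transp l1_eq"
  proof (rule transpI)
    fix f g h assume fg: "l1_eq f g" and gh: "l1_eq g h"
    have "AE t in leb01. f t = h t"
      using fg gh unfolding l1_eq_def by auto
    with fg gh show "l1_eq f h" by (simp add: l1_eq_def)
  qed
qed

quotient_type L1 = "real \<Rightarrow> real" / partial: l1_eq
  by (rule part_equivp_l1_eq)

lemma rep_L1_refl: "l1_eq (rep_L1 x) (rep_L1 x)"
  by (rule Quotient3_rep_reflp[OF Quotient3_L1])

lemma integrable_rep_L1 [simp, intro]: "integrable leb01 (rep_L1 x)"
  using rep_L1_refl[of x] by (simp add: l1_eq_def)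

lemma rep_abs_L1:
  assumes "integrable leb01 f"
  shows "AE t in leb01. rep_L1 (abs_L1 f) t = f t"
proof -
  have "l1_eq f f" using assms by (simp add: l1_eq_def)
  from rep_abs_rsp_left[OF Quotient3_L1, OF this] show ?thesis by (simp add: l1_eq_def)
qed

instantiation L1 :: real_vector
begin

lift_definition zero_L1 :: L1 is "\<lambda>_. 0"
  by (simp add: l1_eq_def)

lift_definition plus_L1 :: "L1 \<Rightarrow> L1 \<Rightarrow> L1" is "\<lambda>f g t. f t + g t"
  by (auto simp: l1_eq_def)

lift_definition minus_L1 :: "L1 \<Rightarrow> L1 \<Rightarrow> L1" is "\<lambda>f g t. f t - g t"
  by (auto simp: l1_eq_def)

lift_definition uminus_L1 :: "L1 \<Rightarrow> L1" is "\<lambda>f t. - f t"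
  by (auto simp: l1_eq_def)

lift_definition scaleR_L1 :: "real \<Rightarrow> L1 \<Rightarrow> L1" is "\<lambda>c f t. c * f t"
  by (auto simp: l1_eq_def)

instance
  by standard (transfer; auto simp: l1_eq_def algebra_simps)+

end

instantiation L1 :: real_normed_vector
begin

lift_definition norm_L1 :: "L1 \<Rightarrow> real" is "\<lambda>f. \<integral>t. \<bar>f t\<bar> \<partial>leb01"
  unfolding l1_eq_def by (rule integral_cong_AE) auto

definition dist_L1 :: "L1 \<Rightarrow> L1 \<Rightarrow> real" where
  "dist_L1 x y = norm (x - y)"

definition sgn_L1 :: "L1 \<Rightarrow> L1" where
  "sgn_L1 x = x /\<^sub>R norm x"

definition uniformity_L1 :: "(L1 \<times> L1) filter" where
  "uniformity_L1 = (INF e\<in>{0<..}. principal {(x, y). dist x y < e})"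

definition open_L1 :: "L1 set \<Rightarrow> bool" where
  "open_L1 U \<longleftrightarrow> (\<forall>x\<in>U. \<forall>\<^sub>F (x', y) in uniformity. x' = x \<longrightarrow> y \<in> U)"

instance
proof
  fix x y :: L1 and c :: real and U :: "L1 set"
  show "dist x y = norm (x - y)" by (rule dist_L1_def)
  show "sgn x = x /\<^sub>R norm x" by (rule sgn_L1_def)
  show "uniformity = (INF e\<in>{0<..}. principal {(x :: L1, y). dist x y < e})"
    by (rule uniformity_L1_def)
  show "open U = (\<forall>x\<in>U. \<forall>\<^sub>F (x', y) in uniformity. x' = x \<longrightarrow> y \<in> U)"
    by (rule open_L1_def)
  show "norm x = 0 \<longleftrightarrow> x = 0"
  proof transfer
    fix f assume "l1_eq f f"
    then have "integrable leb01 (\<lambda>t. \<bar>f t\<bar>)" by (simp add: l1_eq_def)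
    from integral_nonneg_eq_0_iff_AE[OF this] \<open>l1_eq f f\<close>
    show "(\<integral>t. \<bar>f t\<bar> \<partial>leb01) = 0 \<longleftrightarrow> l1_eq f (\<lambda>_. 0)"
      by (simp add: l1_eq_def)
  qed
  show "norm (x + y) \<le> norm x + norm y"
  proof transfer
    fix f g assume "l1_eq f f" "l1_eq g g"
    then have i: "integrable leb01 f" "integrable leb01 g" by (simp_all add: l1_eq_def)
    have "(\<integral>t. \<bar>f t + g t\<bar> \<partial>leb01) \<le> (\<integral>t. \<bar>f t\<bar> + \<bar>g t\<bar> \<partial>leb01)"
      using i by (intro integral_mono) auto
    also have "\<dots> = (\<integral>t. \<bar>f t\<bar> \<partial>leb01) + (\<integral>t. \<bar>g t\<bar> \<partial>leb01)"
      using i by (intro Bochner_Integration.integral_add) auto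
    finally show "(\<integral>t. \<bar>f t + g t\<bar> \<partial>leb01) \<le> (\<integral>t. \<bar>f t\<bar> \<partial>leb01) + (\<integral>t. \<bar>g t\<bar> \<partial>leb01)" .
  qed
  show "norm (c *\<^sub>R x) = \<bar>c\<bar> * norm x"
    by transfer (simp add: abs_mult)
qed

end

lemma norm_L1_rep: "norm x = (\<integral>t. \<bar>rep_L1 x t\<bar> \<partial>leb01)"
  by (simp add: norm_L1.rep_eq)

lemma rep_L1_minus: "AE t in leb01. rep_L1 (x - y) t = rep_L1 x t - rep_L1 y t"
  unfolding minus_L1_def by (simp add: rep_abs_L1)

lemma rep_L1_add: "AE t in leb01. rep_L1 (x + y) t = rep_L1 x t + rep_L1 y t"
  unfolding plus_L1_def by (simp add: rep_abs_L1)

lemma rep_L1_scaleR: "AE t in leb01. rep_L1 (c *\<^sub>R x) t = c * rep_L1 x t"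
  unfolding scaleR_L1_def by (simp add: rep_abs_L1)

lemma dist_L1_rep: "dist x y = (\<integral>t. \<bar>rep_L1 x t - rep_L1 y t\<bar> \<partial>leb01)"
  unfolding dist_L1_def norm_L1_rep
  by (rule integral_cong_AE) (use rep_L1_minus[of x y] in \<open>auto intro: borel_measurable_integrable\<close>)

lemma dist_abs_L1:
  assumes "integrable leb01 f"
  shows "dist x (abs_L1 f) = (\<integral>t. \<bar>rep_L1 x t - f t\<bar> \<partial>leb01)"
  unfolding dist_L1_rep
  by (rule integral_cong_AE)
     (use rep_abs_L1[OF assms] assms in \<open>auto intro: borel_measurable_integrable\<close>)

instance L1 :: banach
proof
  fix X :: "nat \<Rightarrow> L1"
  assume C: "Cauchy X"
  have "\<exists>N. \<forall>m\<ge>N. \<forall>n\<ge>N. dist (X m) (X n) < (1/2)^k" for k :: nat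
    using C by (simp add: Cauchy_def)
  then obtain N where N: "\<And>k m n. m \<ge> N k \<Longrightarrow> n \<ge> N k \<Longrightarrow> dist (X m) (X n) < (1/2)^k"
    by metis
  define r where "r k = (\<Sum>i\<le>k. Suc (N i))" for k
  have r: "strict_mono r" by (rule strict_mono_Suc_iff[THEN iffD2]) (simp add: r_def)
  have rN: "r k \<ge> N k" for k
    using member_le_sum[of k "{..k}" "\<lambda>i. Suc (N i)"] by (simp add: r_def)
  define F where "F k = rep_L1 (X (r k))" for k
  have intF [simp, intro]: "integrable leb01 (F k)" for k by (simp add: F_def)
  define D where "D k t = F (Suc k) t - F k t" for k t
  have intD [simp, intro]: "integrable leb01 (D k)" for k unfolding D_def[abs_def] by auto
  have Dk: "(\<integral>t. norm (D k t) \<partial>leb01) \<le> (1/2)^k" for k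
  proof -
    have "r (Suc k) \<ge> N k" using rN[of k] strict_monoD[OF r, of k "Suc k"] by simp
    with N[OF this rN[of k]] show ?thesis
      by (simp add: dist_L1_rep D_def F_def)
  qed
  have sumI: "summable (\<lambda>k. \<integral>t. norm (D k t) \<partial>leb01)"
    by (rule summable_comparison_test'[of "\<lambda>k. (1/2::real)^k" 0]) (use Dk in auto)
  have "(\<integral>\<^sup>+t. (\<Sum>k. ennreal (norm (D k t))) \<partial>leb01) = (\<Sum>k. \<integral>\<^sup>+t. norm (D k t) \<partial>leb01)"
    by (intro nn_integral_suminf) (auto intro!: borel_measurable_integrable measurable_compose[OF _ measurable_ennreal])
  also have "\<dots> = (\<Sum>k. ennreal (\<integral>t. norm (D k t) \<partial>leb01))"
    by (intro arg_cong[where f=suminf] ext nn_integral_eq_integral integrable_norm) auto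
  also have "\<dots> \<noteq> \<infinity>"
    using sumI by (simp add: ennreal_suminf_neq_top)
  finally have "(\<integral>\<^sup>+t. (\<Sum>k. ennreal (norm (D k t))) \<partial>leb01) \<noteq> \<infinity>" .
  then have "AE t in leb01. (\<Sum>k. ennreal (norm (D k t))) \<noteq> \<infinity>"
    by (intro nn_integral_PInf_AE) (auto intro!: borel_measurable_suminf_order borel_measurable_integrable measurable_compose[OF _ measurable_ennreal])
  then have AEs: "AE t in leb01. summable (\<lambda>k. norm (D k t))"
    by eventually_elim (auto intro: summable_suminf_not_top)
  define w where "w t = (\<Sum>k. norm (D k t))" for t
  have intw: "integrable leb01 w"
    unfolding w_def by (rule integrable_suminf) (use AEs sumI in auto)
  define S where "S t = (\<Sum>k. D k t)" for t
  have intS: "integrable leb01 S"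
    unfolding S_def by (rule integrable_suminf) (use AEs sumI in auto)
  define f where "f t = F 0 t + S t" for t
  have intf: "integrable leb01 f" unfolding f_def[abs_def] using intS by auto
  have tele: "F n t - F 0 t = (\<Sum>k<n. D k t)" for n t
    by (induction n) (auto simp: D_def)
  have "(\<lambda>n. \<integral>t. \<bar>F n t - f t\<bar> \<partial>leb01) \<longlonglongrightarrow> (\<integral>t. (0::real) \<partial>leb01)"
  proof (rule integral_dominated_convergence[where w = "\<lambda>t. 2 * w t"])
    show "(\<lambda>t. \<bar>F n t - f t\<bar>) \<in> borel_measurable leb01" for n
      using intF[of n] intf by (intro borel_measurable_integrable integrable_abs Bochner_Integration.integrable_diff)
    show "integrable leb01 (\<lambda>t. 2 * w t)"
      using intw by simp
    show "AE t in leb01. (\<lambda>n. \<bar>F n t - f t\<bar>) \<longlonglongrightarrow> 0"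
      using AEs
    proof eventually_elim
      case (elim t)
      have "(\<lambda>n. \<Sum>k<n. D k t) \<longlonglongrightarrow> S t"
        unfolding S_def by (rule summable_LIMSEQ[OF summable_norm_cancel[OF elim]])
      then have "(\<lambda>n. (\<Sum>k<n. D k t) - S t) \<longlonglongrightarrow> 0" by (simp add: LIM_zero_iff)
      moreover have "(\<Sum>k<n. D k t) - S t = F n t - f t" for n
        using tele[of n t] by (simp add: f_def)
      ultimately have "(\<lambda>n. F n t - f t) \<longlonglongrightarrow> 0" by simp
      then show ?case by (rule tendsto_rabs_zero)
    qed
    show "AE t in leb01. norm \<bar>F n t - f t\<bar> \<le> 2 * w t" for n
      using AEs
    proof eventually_elim
      case (elim t)
      have "norm (\<Sum>k<n. D k t) \<le> (\<Sum>k<n. norm (D k t))" by (rule norm_sum)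
      also have "\<dots> \<le> w t" unfolding w_def by (rule sum_le_suminf) (use elim in auto)
      finally have "norm (\<Sum>k<n. D k t) \<le> w t" .
      moreover have "norm (S t) \<le> w t"
        unfolding S_def w_def by (rule summable_norm[OF elim])
      moreover have "F n t - f t = (\<Sum>k<n. D k t) - S t"
        using tele[of n t] by (simp add: f_def)
      ultimately show ?case by auto
    qed
  qed simp
  then have "(\<lambda>n. dist (X (r n)) (abs_L1 f)) \<longlonglongrightarrow> 0"
    by (simp add: dist_abs_L1[OF intf] F_def)
  then have "(X \<circ> r) \<longlonglongrightarrow> abs_L1 f"
    by (subst tendsto_dist_iff) (simp add: o_def)
  with Cauchy_converges_subseq[OF C r] show "convergent X"
    by (auto simp: convergent_def)
qed

lemma space_leb01 [simp]: "space leb01 = {0..1}"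
  by (simp add: space_restrict_space)

lemma finite_measure_leb01: "finite_measure leb01"
  by (rule finite_measureI) (simp add: emeasure_restrict_space)

lemma integrable_continuous_leb01:
  assumes "continuous_on {0..1} (f :: real \<Rightarrow> real)"
  shows "integrable leb01 f"
proof -
  have "bounded (f ` {0..1})"
    by (intro compact_imp_bounded compact_continuous_image assms) auto
  then obtain B where B: "\<And>t. t \<in> {0..1} \<Longrightarrow> norm (f t) \<le> B"
    unfolding bounded_iff by blast
  interpret finite_measure leb01 by (rule finite_measure_leb01)
  have "f \<in> borel_measurable (restrict_space borel {0..1})"
    by (rule borel_measurable_continuous_on_restrict[OF assms])
  then have "f \<in> borel_measurable leb01"
    by (simp cong: measurable_cong_sets add: sets_restrict_space)
  then show ?thesis
    by (intro integrable_const_bound[of _ B] AE_I2) (auto simp del: real_norm_def intro!: B)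
qed

lemma L1_approx_continuous:
  assumes "integrable leb01 f" "0 < e"
  shows "\<exists>g. continuous_on {0..1} g \<and> (\<integral>t. \<bar>f t - g t\<bar> \<partial>leb01) < (e::real)"
  using assms
proof (induction arbitrary: e)
  case (base A c)
  then have A: "A \<in> sets borel" "A \<subseteq> {0..1}"
    by (auto simp: sets_restrict_space)
  define d where "d = e / (2 * (\<bar>c\<bar> + 1))"
  have d: "d > 0" using base by (simp add: d_def)
  have AL: "A \<in> sets lebesgue" using A by auto
  obtain U where U: "open U" "A \<subseteq> U" "(U - A) \<in> lmeasurable" "emeasure lebesgue (U - A) < ennreal d"
    using sets_lebesgue_outer_open[OF AL d] by blast
  obtain K where K: "closed K" "K \<subseteq> A" "(A - K) \<in> lmeasurable" "emeasure lebesgue (A - K) < ennreal d"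
    using sets_lebesgue_inner_closed[OF AL d] by blast
  have UK: "U - K = (U - A) \<union> (A - K)" using U K by auto
  have [measurable]: "U \<in> sets borel" "K \<in> sets borel" using U K by auto
  have "emeasure lborel (U - K) = emeasure lebesgue (U - K)"
    by (simp add: emeasure_completion)
  also have "\<dots> \<le> emeasure lebesgue (U - A) + emeasure lebesgue (A - K)"
    unfolding UK by (rule emeasure_subadditive) (use U K in \<open>auto simp: fmeasurable_def\<close>)
  also have "\<dots> < ennreal d + ennreal d"
    by (rule add_strict_mono[OF U(4) K(4)])
  also have "\<dots> = ennreal (2 * d)" using d by (simp flip: ennreal_plus)
  finally have mUK: "emeasure lborel (U - K) < ennreal (2 * d)" .
  obtain g :: "real \<Rightarrow> real" where g: "continuous_on UNIV g"
      "\<And>x. g x \<in> closed_segment 1 0" "\<And>x. x \<in> K \<Longrightarrow> g x = 1" "\<And>x. x \<in> - U \<Longrightarrow> g x = 0"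
    using Urysohn[of K "- U" 1 "0::real"] U K by (metis Diff_disjoint Diff_eq closed_Compl disjoint_eq_subset_Compl double_compl subset_trans)
  have cg: "continuous_on {0..1} (\<lambda>t. g t * c)"
    using g(1) by (intro continuous_intros continuous_on_subset[OF g(1)]) auto
  have g01: "0 \<le> g x" "g x \<le> 1" for x
    using g(2)[of x] by (auto simp: closed_segment_eq_real_ivl)
  have pt: "\<bar>indicator A t *\<^sub>R c - g t * c\<bar> \<le> indicator (U - K) t * \<bar>c\<bar>" for t
  proof -
    have "\<bar>indicator A t - g t\<bar> \<le> indicator (U - K) t"
      using g01[of t] g(3,4)[of t] U(2) K(2) by (auto simp: indicator_def)
    then show ?thesis
      by (simp flip: left_diff_distrib add: abs_mult mult_right_mono)
  qed
  have iUK: "integrable lborel (indicator (U - K) :: real \<Rightarrow> real)"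
    using mUK by (auto simp: integrable_indicator_iff intro: order.strict_trans)
  have iUK': "integrable leb01 (indicator (U - K) :: real \<Rightarrow> real)"
    by (rule finite_measure.integrable_const_bound[OF finite_measure_leb01, where B = 1])
       (auto simp: indicator_def intro: measurable_restrict_space1)
  have "(\<integral>t. \<bar>indicator A t *\<^sub>R c - g t * c\<bar> \<partial>leb01) \<le> (\<integral>t. indicator (U - K) t * \<bar>c\<bar> \<partial>leb01)"
  proof (rule integral_mono)
    have "integrable leb01 (indicator A :: real \<Rightarrow> real)"
      by (rule integrable_real_indicator[OF base(1,2)])
    then have "integrable leb01 (\<lambda>t. indicator A t *\<^sub>R c)" by simp
    with integrable_continuous_leb01[OF cg]
    show "integrable leb01 (\<lambda>t. \<bar>indicator A t *\<^sub>R c - g t * c\<bar>)"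
      by (intro integrable_abs Bochner_Integration.integrable_diff)
    show "integrable leb01 (\<lambda>t. indicator (U - K) t * \<bar>c\<bar>)"
      using iUK' by simp
  qed (rule pt)
  also have "\<dots> = (\<integral>t. indicator (U - K) t \<partial>leb01) * \<bar>c\<bar>" by simp
  also have "(\<integral>t. indicator (U - K) t \<partial>leb01) \<le> (2 * d :: real)"
  proof -
    have "(\<integral>t. indicator (U - K) t \<partial>leb01) \<le> (\<integral>t. indicator (U - K) t \<partial>lborel :: real)"
    proof (subst integral_restrict_space)
      show "(\<integral>t. indicator {0..1} t *\<^sub>R indicator (U - K) t \<partial>lborel) \<le> (\<integral>t. indicator (U - K) t \<partial>lborel :: real)"
        by (rule integral_mono[OF integrable_mult_indicator[OF _ iUK] iUK]) (auto simp: indicator_def)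
    qed simp
    also have "\<dots> = measure lborel (U - K)" by simp
    also have "\<dots> \<le> 2 * d"
      unfolding measure_def by (rule enn2real_leI) (use mUK d in auto)
    finally show ?thesis .
  qed
  finally have "(\<integral>t. \<bar>indicator A t *\<^sub>R c - g t * c\<bar> \<partial>leb01) \<le> 2 * d * \<bar>c\<bar>"
    by (simp add: mult_right_mono)
  also have "2 * d * \<bar>c\<bar> < e"
    using base by (simp add: d_def field_simps)
  finally show ?case using cg by auto
next
  case (add f g)
  obtain f' g' where fg: "continuous_on {0..1} f'" "(\<integral>t. \<bar>f t - f' t\<bar> \<partial>leb01) < e/2"
      "continuous_on {0..1} g'" "(\<integral>t. \<bar>g t - g' t\<bar> \<partial>leb01) < e/2"
    using add.IH[of "e/2"] add.prems by (meson half_gt_zero)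
  note i = add.hyps(1,2) integrable_continuous_leb01[OF fg(1)] integrable_continuous_leb01[OF fg(3)]
  have "(\<integral>t. \<bar>f t + g t - (f' t + g' t)\<bar> \<partial>leb01)
      \<le> (\<integral>t. \<bar>f t - f' t\<bar> + \<bar>g t - g' t\<bar> \<partial>leb01)"
    using i by (intro integral_mono) auto
  also have "\<dots> = (\<integral>t. \<bar>f t - f' t\<bar> \<partial>leb01) + (\<integral>t. \<bar>g t - g' t\<bar> \<partial>leb01)"
    using i by (intro Bochner_Integration.integral_add) auto
  also have "\<dots> < e" using fg by simp
  finally show ?case using fg by (intro exI[of _ "\<lambda>t. f' t + g' t"]) (auto intro: continuous_intros)
next
  case (lim f s)
  have "(\<lambda>i. \<integral>t. \<bar>f t - s i t\<bar> \<partial>leb01) \<longlonglongrightarrow> (\<integral>t. (0::real) \<partial>leb01)"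
  proof (rule integral_dominated_convergence[where w = "\<lambda>t. 3 * \<bar>f t\<bar>"])
    show "AE t in leb01. (\<lambda>i. \<bar>f t - s i t\<bar>) \<longlonglongrightarrow> 0"
    proof (rule AE_I2)
      fix t assume "t \<in> space leb01"
      from tendsto_diff[OF tendsto_const[of "f t"] lim.hyps(2)[OF this]]
      show "(\<lambda>i. \<bar>f t - s i t\<bar>) \<longlonglongrightarrow> 0" by (simp add: tendsto_rabs_zero)
    qed
    show "AE t in leb01. norm \<bar>f t - s i t\<bar> \<le> 3 * \<bar>f t\<bar>" for i
    proof (rule AE_I2)
      fix t assume "t \<in> space leb01"
      from lim.hyps(3)[OF this, of i] show "norm \<bar>f t - s i t\<bar> \<le> 3 * \<bar>f t\<bar>" by simp
    qed
    show "(\<lambda>t. \<bar>f t - s i t\<bar>) \<in> borel_measurable leb01" for i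
      using lim.hyps(1)[of i] lim.hyps(4)
      by (intro borel_measurable_integrable integrable_abs Bochner_Integration.integrable_diff)
    show "integrable leb01 (\<lambda>t. 3 * \<bar>f t\<bar>)"
      using lim.hyps(4) by simp
  qed simp
  then have "\<forall>\<^sub>F i in sequentially. (\<integral>t. \<bar>f t - s i t\<bar> \<partial>leb01) < e/2"
    using lim.prems by (intro order_tendstoD) auto
  then obtain i where i: "(\<integral>t. \<bar>f t - s i t\<bar> \<partial>leb01) < e/2"
    by (auto simp: eventually_sequentially)
  obtain g where g: "continuous_on {0..1} g" "(\<integral>t. \<bar>s i t - g t\<bar> \<partial>leb01) < e/2"
    using lim.IH[of "e/2" i] lim.prems by (meson half_gt_zero)
  note ii = lim.hyps(1)[of i] lim.hyps(4) integrable_continuous_leb01[OF g(1)]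
  have "(\<integral>t. \<bar>f t - g t\<bar> \<partial>leb01) \<le> (\<integral>t. \<bar>f t - s i t\<bar> + \<bar>s i t - g t\<bar> \<partial>leb01)"
    using ii by (intro integral_mono) auto
  also have "\<dots> = (\<integral>t. \<bar>f t - s i t\<bar> \<partial>leb01) + (\<integral>t. \<bar>s i t - g t\<bar> \<partial>leb01)"
    using ii by (intro Bochner_Integration.integral_add) auto
  also have "\<dots> < e" using g i by simp
  finally show ?case using g by auto
qed

text \<open>A countable dense family: Bernstein polynomials with rational coefficients.\<close>

definition bern :: "nat \<times> rat list \<Rightarrow> real \<Rightarrow> real" where
  "bern p t = (\<Sum>k\<le>fst p. of_rat (snd p ! k) * Bernstein (fst p) k t)"

lemma continuous_bern: "continuous_on S (bern p)"
  unfolding bern_def[abs_def] Bernstein_def by (intro continuous_intros)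

lemma L1_dense:
  assumes "0 < e"
  shows "\<exists>p. dist x (abs_L1 (bern p)) < e"
proof -
  obtain g where g: "continuous_on {0..1} g" "(\<integral>t. \<bar>rep_L1 x t - g t\<bar> \<partial>leb01) < e/2"
    using L1_approx_continuous[OF integrable_rep_L1, of "e/2" x] assms by auto
  have "0 < e/4" using assms by simp
  from Bernstein_Weierstrass[OF g(1) this] obtain n where n: "\<And>t. t \<in> {0..1} \<Longrightarrow> \<bar>g t - (\<Sum>k\<le>n. g (k/n) * Bernstein n k t)\<bar> < e/4"
    by blast
  have "\<exists>q. \<bar>g (k/n) - of_rat q\<bar> < e/4" for k :: nat
  proof -
    obtain q where "g (k/n) - e/4 < of_rat q" "of_rat q < g (k/n) + e/4"
      using of_rat_dense[of "g (k/n) - e/4" "g (k/n) + e/4"] assms by auto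
    then have "\<bar>g (k/n) - of_rat q\<bar> < e/4" by linarith
    then show ?thesis ..
  qed
  then obtain q where q: "\<And>k. \<bar>g (real k/n) - of_rat (q k)\<bar> < e/4" by metis
  define p where "p = (n, map q [0..<Suc n])"
  have pe: "bern p t = (\<Sum>k\<le>n. of_rat (q k) * Bernstein n k t)" for t
    unfolding bern_def p_def by (auto intro!: sum.cong simp del: upt_Suc)
  have close: "\<bar>g t - bern p t\<bar> \<le> e/2" if t: "t \<in> {0..1}" for t
  proof -
    have "\<bar>(\<Sum>k\<le>n. g (k/n) * Bernstein n k t) - bern p t\<bar>
        = \<bar>\<Sum>k\<le>n. (g (k/n) - of_rat (q k)) * Bernstein n k t\<bar>"
      by (simp add: pe sum_subtractf left_diff_distrib)
    also have "\<dots> \<le> (\<Sum>k\<le>n. \<bar>(g (k/n) - of_rat (q k)) * Bernstein n k t\<bar>)" by (rule sum_abs)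
    also have "\<dots> \<le> (\<Sum>k\<le>n. e/4 * Bernstein n k t)"
    proof (rule sum_mono)
      fix k
      have B: "0 \<le> Bernstein n k t" using t by (simp add: Bernstein_nonneg)
      show "\<bar>(g (k/n) - of_rat (q k)) * Bernstein n k t\<bar> \<le> e/4 * Bernstein n k t"
        unfolding abs_mult abs_of_nonneg[OF B] by (rule mult_right_mono[OF less_imp_le[OF q] B])
    qed
    also have "\<dots> = e/4" unfolding sum_distrib_left[symmetric] by simp
    finally show ?thesis using n[OF t] by linarith
  qed
  have ib: "integrable leb01 (bern p)"
    by (rule integrable_continuous_leb01[OF continuous_bern])
  note ig = integrable_continuous_leb01[OF g(1)]
  interpret finite_measure leb01 by (rule finite_measure_leb01)
  have "dist x (abs_L1 (bern p)) = (\<integral>t. \<bar>rep_L1 x t - bern p t\<bar> \<partial>leb01)"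
    by (rule dist_abs_L1[OF ib])
  also have "\<dots> \<le> (\<integral>t. \<bar>rep_L1 x t - g t\<bar> + e/2 \<partial>leb01)"
  proof (rule integral_mono)
    show "integrable leb01 (\<lambda>t. \<bar>rep_L1 x t - bern p t\<bar>)" using ib by simp
    show "integrable leb01 (\<lambda>t. \<bar>rep_L1 x t - g t\<bar> + e/2)" using ig by simp
    fix t assume "t \<in> space leb01"
    then have "\<bar>g t - bern p t\<bar> \<le> e/2" using close[of t] by simp
    then show "\<bar>rep_L1 x t - bern p t\<bar> \<le> \<bar>rep_L1 x t - g t\<bar> + e/2" by linarith
  qed
  also have "\<dots> = (\<integral>t. \<bar>rep_L1 x t - g t\<bar> \<partial>leb01) + e/2"
  proof (subst Bochner_Integration.integral_add)
    show "integrable leb01 (\<lambda>t. \<bar>rep_L1 x t - g t\<bar>)" using ig by simp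
  qed (simp_all add: measure_restrict_space)
  also have "\<dots> < e" using g by simp
  finally show ?thesis by blast
qed

instance L1 :: second_countable_topology
proof
  define B :: "L1 set set" where
    "B = (\<lambda>(p, n::nat). ball (abs_L1 (bern p)) (inverse (Suc n))) ` UNIV"
  have "topological_basis B"
  proof (rule topological_basisI)
    show "open U" if "U \<in> B" for U using that by (auto simp: B_def)
    fix U and x :: L1 assume "open U" "x \<in> U"
    then obtain e where e: "e > 0" "ball x e \<subseteq> U" by (auto simp: open_contains_ball)
    obtain n where n: "inverse (real (Suc n)) < e/2"
      using e(1) reals_Archimedean[of "e/2"] by auto
    obtain p where p: "dist x (abs_L1 (bern p)) < inverse (Suc n)"
      using L1_dense[of "inverse (Suc n)" x] by auto
    have "ball (abs_L1 (bern p)) (inverse (Suc n)) \<subseteq> ball x e"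
    proof
      fix y assume "y \<in> ball (abs_L1 (bern p)) (inverse (Suc n))"
      then have "dist x y < e"
        using p n dist_triangle[of x y "abs_L1 (bern p)"] by (simp add: mem_ball)
      then show "y \<in> ball x e" by simp
    qed
    with e p show "\<exists>U'\<in>B. x \<in> U' \<and> U' \<subseteq> U"
      by (intro bexI[of _ "ball (abs_L1 (bern p)) (inverse (Suc n))"])
         (auto simp: B_def dist_commute)
  qed
  then have "open = generate_topology B" by (rule topological_basis_imp_subbasis)
  moreover have "countable B" unfolding B_def by (intro countable_image countableI_type)
  ultimately show "\<exists>B :: L1 set set. countable B \<and> open = generate_topology B"
    by metis
qed

text \<open>Translation by \<open>y\<close>, functions being extended by \<open>0\<close> outside \<open>[0,1]\<close>.\<close>

lift_definition shift_L1 :: "real \<Rightarrow> L1 \<Rightarrow> L1"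
  is "\<lambda>y f t. if t + y \<in> {0..1} then f (t + y) else 0"
proof -
  fix y :: real and f g :: "real \<Rightarrow> real"
  assume fg: "l1_eq f g"
  have int: "integrable leb01 (\<lambda>t. if t + y \<in> {0..1} then h (t + y) else 0)"
    if h: "integrable leb01 h" for h :: "real \<Rightarrow> real"
  proof -
    have "integrable lborel (\<lambda>t. indicator {0..1} t *\<^sub>R h t)"
      using h by (simp add: integrable_restrict_space)
    from lborel_integrable_real_affine[OF this, of 1 y]
    have "integrable lborel (\<lambda>t. indicator {0..1} (y + t) *\<^sub>R h (y + t))" by simp
    then have "integrable lborel (\<lambda>t. indicator {0..1} t *\<^sub>R (indicator {0..1} (y + t) *\<^sub>R h (y + t)))"
      by (rule integrable_mult_indicator[rotated]) simp
    also have "(\<lambda>t. indicator {0..1} t *\<^sub>R (indicator {0..1} (y + t) *\<^sub>R h (y + t)))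
        = (\<lambda>t. indicator {0..1} t *\<^sub>R (if t + y \<in> {0..1} then h (t + y) else 0))"
      by (auto simp: indicator_def add.commute)
    finally show ?thesis by (simp add: integrable_restrict_space)
  qed
  define k where "k t = indicator {0..1} t *\<^sub>R f t - indicator {0..1} t *\<^sub>R g t" for t
  have "integrable lborel k"
    using fg unfolding k_def[abs_def] l1_eq_def
    by (intro Bochner_Integration.integrable_diff) (simp_all add: integrable_restrict_space)
  then have [measurable]: "k \<in> borel_measurable borel"
    using borel_measurable_integrable by force
  have "AE t in lborel. t \<in> {0..1} \<longrightarrow> f t = g t"
    using fg by (simp add: l1_eq_def AE_restrict_space_iff)
  then have "AE t in lborel. k t = 0"
    by eventually_elim (auto simp: k_def indicator_def)
  then have "AE t in lborel. k (y + 1 * t) = 0"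
    by (intro AE_borel_affine) simp_all
  then have "AE t in leb01. (if t + y \<in> {0..1} then f (t + y) else 0)
      = (if t + y \<in> {0..1} then g (t + y) else 0)"
    by (subst AE_restrict_space_iff) (auto simp: k_def add.commute elim!: eventually_mono)
  with fg int show "l1_eq (\<lambda>t. if t + y \<in> {0..1} then f (t + y) else 0)
      (\<lambda>t. if t + y \<in> {0..1} then g (t + y) else 0)"
    by (simp add: l1_eq_def)
qed


section \<open>Gaussian variables and Brownian motion in \<open>L\<^sup>1[0,1]\<close>\<close>

type_synonym L1_dual = "L1 \<Rightarrow>\<^sub>L real"

definition cov_op :: "'a measure \<Rightarrow> ('a \<Rightarrow> L1) \<Rightarrow> L1_dual \<Rightarrow> L1_dual \<Rightarrow> real" where
  "cov_op M X l l' = (\<integral>\<omega>. l (X \<omega>) * l' (X \<omega>) \<partial>M)"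

text \<open>The normal law with mean \<open>0\<close> and variance \<open>v \<ge> 0\<close>; the case \<open>v = 0\<close> is a point mass.\<close>

definition centered_normal :: "real \<Rightarrow> real measure" where
  "centered_normal v =
     (if v = 0 then return borel 0 else density lborel (\<lambda>x. ennreal (normal_density 0 (sqrt v) x)))"

text \<open>
  Multivariate normality, including singular covariance matrices: every linear combination of the
  coordinates is univariate normal, with the variance prescribed by the matrix.
\<close>

definition centered_mvn ::
    "'a measure \<Rightarrow> nat \<Rightarrow> (nat \<Rightarrow> 'a \<Rightarrow> real) \<Rightarrow> (nat \<Rightarrow> nat \<Rightarrow> real) \<Rightarrow> bool" where
  "centered_mvn M k Y \<Sigma> \<longleftrightarrow>
     (\<forall>i<k. Y i \<in> borel_measurable M) \<and>
     (\<forall>u :: nat \<Rightarrow> real. distr M borel (\<lambda>\<omega>. \<Sum>i<k. u i * Y i \<omega>) =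
        centered_normal (\<Sum>i<k. \<Sum>j<k. u i * u j * \<Sigma> i j))"

definition gaussian_L1 :: "'a measure \<Rightarrow> ('a \<Rightarrow> L1) \<Rightarrow> bool" where
  "gaussian_L1 M X \<longleftrightarrow>
     integrable M X \<and> integral\<^sup>L M X = 0 \<and>
     (\<forall>k (l :: nat \<Rightarrow> L1_dual).
        centered_mvn M k (\<lambda>i \<omega>. l i (X \<omega>)) (\<lambda>i j. \<integral>\<omega>. l i (X \<omega>) * l j (X \<omega>) \<partial>M))"

definition is_N0 :: "'a measure \<Rightarrow> ('a \<Rightarrow> L1) \<Rightarrow> (L1_dual \<Rightarrow> L1_dual \<Rightarrow> real) \<Rightarrow> bool" where
  "is_N0 M X S \<longleftrightarrow> gaussian_L1 M X \<and> cov_op M X = S"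

definition brownian_motion_L1 ::
    "'a measure \<Rightarrow> (real \<Rightarrow> 'a \<Rightarrow> L1) \<Rightarrow> (L1_dual \<Rightarrow> L1_dual \<Rightarrow> real) \<Rightarrow> bool" where
  "brownian_motion_L1 M B S \<longleftrightarrow>
     prob_space M \<and>
     (\<forall>t\<ge>0. B t \<in> borel_measurable M) \<and>
     (AE \<omega> in M. B 0 \<omega> = 0 \<and> continuous_on {0..} (\<lambda>t. B t \<omega>)) \<and>
     (\<forall>s t. 0 \<le> s \<and> s \<le> t \<longrightarrow> gaussian_L1 M (\<lambda>\<omega>. B t \<omega> - B s \<omega>)) \<and>
     (\<forall>s t h. 0 \<le> s \<and> s \<le> t \<and> 0 \<le> h \<longrightarrow>
        distr M borel (\<lambda>\<omega>. B (t + h) \<omega> - B (s + h) \<omega>) = distr M borel (\<lambda>\<omega>. B t \<omega> - B s \<omega>)) \<and>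
     (\<forall>(t :: nat \<Rightarrow> real) k. 0 \<le> t 0 \<and> (\<forall>i<k. t i \<le> t (Suc i)) \<longrightarrow>
        prob_space.indep_vars M (\<lambda>_. borel) (\<lambda>i \<omega>. B (t (Suc i)) \<omega> - B (t i) \<omega>) {..<k}) \<and>
     is_N0 M (B 1) S"


section \<open>The error sequence\<close>

text \<open>Sequences indexed by \<open>{1, 2, \<dots>}\<close> are functions on \<open>nat\<close> whose value at \<open>0\<close> is never used.\<close>

definition stationary_seq :: "'a measure \<Rightarrow> (nat \<Rightarrow> 'a \<Rightarrow> L1) \<Rightarrow> bool" where
  "stationary_seq M \<epsilon> \<longleftrightarrow>
     (\<forall>h. distr M (PiM {1..} (\<lambda>_. borel)) (\<lambda>\<omega>. \<lambda>i\<in>{1..}. \<epsilon> (i + h) \<omega>) =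
          distr M (PiM {1..} (\<lambda>_. borel)) (\<lambda>\<omega>. \<lambda>i\<in>{1..}. \<epsilon> i \<omega>))"

definition sigma_field :: "'a measure \<Rightarrow> (nat \<Rightarrow> 'a \<Rightarrow> L1) \<Rightarrow> nat set \<Rightarrow> 'a measure" where
  "sigma_field M \<epsilon> I =
     sigma (space M) (\<Union>i\<in>I. {\<epsilon> i -` B \<inter> space M | B. B \<in> sets borel})"

text \<open>
  Conditional probabilities are only determined almost surely, so the supremum over the
  (uncountably many) events in the mixing coefficient is the essential supremum of a family of
  random variables, i.e. its least upper bound with respect to almost sure inequality. It is
  determined up to null sets and exists for families that are bounded above.
\<close>

definition is_ess_sup :: "'a measure \<Rightarrow> 'b set \<Rightarrow> ('b \<Rightarrow> 'a \<Rightarrow> real) \<Rightarrow> ('a \<Rightarrow> real) \<Rightarrow> bool" where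
  "is_ess_sup M I Y Z \<longleftrightarrow>
     Z \<in> borel_measurable M \<and>
     (\<forall>i\<in>I. AE \<omega> in M. Y i \<omega> \<le> Z \<omega>) \<and>
     (\<forall>Z' \<in> borel_measurable M. (\<forall>i\<in>I. AE \<omega> in M. Y i \<omega> \<le> Z' \<omega>) \<longrightarrow> (AE \<omega> in M. Z \<omega> \<le> Z' \<omega>))"

definition ess_sup :: "'a measure \<Rightarrow> 'b set \<Rightarrow> ('b \<Rightarrow> 'a \<Rightarrow> real) \<Rightarrow> 'a \<Rightarrow> real" where
  "ess_sup M I Y = (SOME Z. is_ess_sup M I Y Z)"

definition beta_coeff :: "'a measure \<Rightarrow> (nat \<Rightarrow> 'a \<Rightarrow> L1) \<Rightarrow> nat \<Rightarrow> real" where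
  "beta_coeff M \<epsilon> k =
     (SUP j\<in>{1..}. \<integral>\<omega>. ess_sup M (sets (sigma_field M \<epsilon> {j + k..}))
        (\<lambda>A \<omega>'. \<bar>real_cond_exp M (sigma_field M \<epsilon> {1..j}) (indicator A) \<omega>' - measure M A\<bar>) \<omega> \<partial>M)"

definition long_run_cov ::
    "'a measure \<Rightarrow> (nat \<Rightarrow> 'a \<Rightarrow> L1) \<Rightarrow> L1_dual \<Rightarrow> L1_dual \<Rightarrow> real" where
  "long_run_cov M \<epsilon> l l' =
     (\<integral>\<omega>. l (\<epsilon> 1 \<omega>) * l' (\<epsilon> 1 \<omega>) \<partial>M) +
     (\<Sum>j. (\<integral>\<omega>. l (\<epsilon> 1 \<omega>) * l' (\<epsilon> (1 + Suc j) \<omega>) \<partial>M) + (\<integral>\<omega>. l (\<epsilon> (1 + Suc j) \<omega>) * l' (\<epsilon> 1 \<omega>) \<partial>M))"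

text \<open>
  Point evaluations of an \<open>L1\<close>-valued random variable refer to a jointly measurable version.
  Such a version always exists and is unique up to a null set of the product measure, so the
  condition below does not depend on its choice.
\<close>

definition joint_version :: "'a measure \<Rightarrow> ('a \<Rightarrow> L1) \<Rightarrow> ('a \<Rightarrow> real \<Rightarrow> real) \<Rightarrow> bool" where
  "joint_version M X f \<longleftrightarrow>
     case_prod f \<in> borel_measurable (M \<Otimes>\<^sub>M leb01) \<and>
     (AE \<omega> in M. AE t in leb01. f \<omega> t = rep_L1 (X \<omega>) t)"

definition integrable_pointwise_sd :: "'a measure \<Rightarrow> ('a \<Rightarrow> L1) \<Rightarrow> bool" where
  "integrable_pointwise_sd M X \<longleftrightarrow>
     (\<exists>f. joint_version M X f \<and>
        (AE t in leb01. integrable M (\<lambda>\<omega>. (f \<omega> t)\<^sup>2)) \<and>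
        integrable leb01 (\<lambda>t. sqrt (\<integral>\<omega>. (f \<omega> t)\<^sup>2 \<partial>M)))"


section \<open>The change point statistic and its limit\<close>

definition interp_sum :: "(nat \<Rightarrow> L1) \<Rightarrow> real \<Rightarrow> L1" where
  "interp_sum a x = (\<Sum>i=1..nat \<lfloor>x\<rfloor>. a i) + (x - \<lfloor>x\<rfloor>) *\<^sub>R a (nat \<lfloor>x\<rfloor> + 1)"

definition cusum :: "(nat \<Rightarrow> L1) \<Rightarrow> nat \<Rightarrow> real \<Rightarrow> L1" where
  "cusum x n s = (1 / real n) *\<^sub>R (interp_sum x (real n * s) - s *\<^sub>R (\<Sum>i=1..n. x i))"

definition T_stat :: "real \<Rightarrow> nat \<Rightarrow> (nat \<Rightarrow> L1) \<Rightarrow> real \<Rightarrow> real" where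
  "T_stat \<Delta> n x s_hat =
     sqrt (real n) * ((SUP s\<in>{0..1}. norm (cusum x n s)) - s_hat * (1 - s_hat) * \<Delta>)"

definition T_limit :: "L1 \<Rightarrow> L1 \<Rightarrow> real" where
  "T_limit d w =
     (let N = {t \<in> {0..1}. rep_L1 d t = 0}
      in (LINT t:({0..1} - N)|lborel. sgn (rep_L1 d t) * rep_L1 w t)
         + (LINT t:N|lborel. \<bar>rep_L1 w t\<bar>))"

definition diverges_to_PInf_in_prob :: "'a measure \<Rightarrow> (nat \<Rightarrow> 'a \<Rightarrow> real) \<Rightarrow> bool" where
  "diverges_to_PInf_in_prob M Y \<longleftrightarrow>
     (\<forall>K. (\<lambda>n. measure M {\<omega> \<in> space M. K < Y n \<omega>}) \<longlonglongrightarrow> 1)"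

definition diverges_to_MInf_in_prob :: "'a measure \<Rightarrow> (nat \<Rightarrow> 'a \<Rightarrow> real) \<Rightarrow> bool" where
  "diverges_to_MInf_in_prob M Y \<longleftrightarrow>
     (\<forall>K. (\<lambda>n. measure M {\<omega> \<in> space M. Y n \<omega> < K}) \<longlonglongrightarrow> 1)"

end

theory Submission
  imports Defs "HOL-Real_Asymp.Real_Asymp" "HOL-Library.Discrete_Functions"
begin

text \<open>
Write \<open>d = \<mu>\<^sub>1 - \<mu>\<^sub>2\<close>. Up to \<open>O(1/n)\<close>, the CUSUM process is a tent function with peak \<open>s\<^sub>0 (1 - s\<^sub>0) d\<close> at the change
point plus the noise bridge divided by \<open>n\<close>. A law of large numbers that is uniform over windows growing from the change
point makes the loss of drift at distance \<open>m / n\<close> from the peak exceed the gain of noise, so the maximizer lies within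
\<open>O\<^sub>P(1/n)\<close> of the peak. Hence the statistic is \<open>a\<^sub>n (\<parallel>d\<parallel> - \<Delta>) + (\<parallel>a\<^sub>n d + V\<^sub>n\<parallel> - a\<^sub>n \<parallel>d\<parallel>) + o\<^sub>P(1)\<close>, where \<open>V\<^sub>n\<close> is the noise
bridge at the change point over \<open>\<surd>n\<close> and \<open>a\<^sub>n \<rightarrow> \<infinity>\<close>. The middle term is 1-Lipschitz in \<open>V\<^sub>n\<close> and, as \<open>a\<^sub>n\<close> grows, decreases to the
directional derivative of the norm at \<open>d\<close>, so it remains to show that \<open>V\<^sub>n\<close> converges weakly in \<open>L\<^sup>1\<close>.

The one-dimensional projections of \<open>V\<^sub>n\<close> converge by Bernstein's blocks. For tightness one bounds \<open>\<parallel>S\<^sub>n - P\<^sub>m S\<^sub>n\<parallel> / \<surd>n\<close> in mean, where \<open>P\<^sub>m\<close>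
averages over cells of length \<open>1/m\<close>: with \<open>N\<close> a large power of \<open>n\<close>, the part \<open>S\<^sub>n - P\<^sub>N S\<^sub>n\<close> is small by A4, and the rest is a
sum over cells of \<open>E |v S\<^sub>n| / \<surd>n\<close>. Splitting into blocks and a lower bound for sums of independent variables show that
passing from \<open>n\<close> to \<open>n\<^bsup>1.1\<^esup>\<close> loses only a constant factor, so after finitely many steps the sample size exceeds the number of
cells, where the long run variances take over; these are controlled by the Gaussian variable with covariance \<open>C\<close>.
\<close>

text \<open>\<open>L1\<close> is not of type 2: second moments of single errors do not bound the
  mean norm of a sum by a multiple of \<open>sqrt n\<close>, so tightness has to come from the two
  Gaussian variables. For a family of cells the variances of a sum differ from \<open>n\<close>
  times the long run variances by a total independent of the number of cells, but after square roots
  the error grows like the root of that number divided by the sample size. A small exponent in A4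
  forces a high power of \<open>n\<close> as number of cells, hence the detour through longer
  samples; no constant on the way may depend on the number of cells, which is why covariance bounds
  are proved for kernels on pairs of vectors and not functional by functional. For
  \<open>d = 0\<close> the tent is absent and the maximizer does not localize. The bridge is then
  compared with \<open>s * (1 - s)\<close>: the law of large numbers from both ends bounds it by a
  small multiple of \<open>n * (s * (1 - s))\<close> wherever it is large, and a functional with
  positive long run variance keeps its maximum of order at least \<open>sqrt n\<close>. So the
  penalty at the maximizer outweighs the maximum.\<close>

lemmas intg_diff = Bochner_Integration.integrable_diff
  and intg_add = Bochner_Integration.integrable_add
  and intg_sum = Bochner_Integration.integrable_sum
  and intl_diff = Bochner_Integration.integral_diff
  and intg_bound = Bochner_Integration.integrable_bound

abbreviation lim_to :: "(nat \<Rightarrow> 'a::topological_space) \<Rightarrow> 'a \<Rightarrow> bool" (infixr "---->" 60)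
  where "f ----> l \<equiv> f \<longlonglongrightarrow> l"

abbreviation eventually_seq :: "(nat => bool) => bool" (binder "EV " 10)
  where "EV n. P n \<equiv> \<forall>\<^sub>F n in sequentially. P n"

lemma integral_norm_diff_le:
 fixes f g :: "'a => 'b::{banach, second_countable_topology}"
 assumes "integrable M f" "integrable M g" "integrable M w" "\<And>x. x \<in> space M ==> norm (f x - g x) <= w x"
 shows "norm ((\<integral>x. f x \<partial>M) - (\<integral>x. g x \<partial>M)) <= (\<integral>x. w x \<partial>M)"
proof -
 have "norm ((\<integral>x. f x \<partial>M) - (\<integral>x. g x \<partial>M)) = norm (\<integral>x. f x - g x \<partial>M)" using assms by simp
 also have "... <= (\<integral>x. norm (f x - g x) \<partial>M)" by (rule integral_norm_bound)
 also have "... <= (\<integral>x. w x \<partial>M)"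
  using assms by (intro integral_mono integrable_norm intg_diff) auto
 finally show ?thesis .
qed

lemmas integral_abs_diff_le = integral_norm_diff_le[where 'b = real, unfolded real_norm_def]

lemma (in prob_space) integral_abs_diff_le_const:
 fixes f g :: "'a => real"
 assumes "integrable M f" "integrable M g" "\<And>x. x \<in> space M ==> \<bar>f x - g x\<bar> <= c"
 shows "\<bar>(\<integral>x. f x \<partial>M) - (\<integral>x. g x \<partial>M)\<bar> <= c"
 using integral_abs_diff_le[OF assms(1,2) integrable_const[of c] assms(3)] by (simp add: prob_space)

lemma (in prob_space) integral_abs_le_const:
 assumes "f \<in> borel_measurable M" "\<And>x. x \<in> space M ==> \<bar>f x :: real\<bar> <= c"
 shows "integrable M f" "\<bar>\<integral>x. f x \<partial>M\<bar> <= c"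
proof -
 show "integrable M f" using assms by (intro integrable_const_bound[of _ c]) auto
 from integral_abs_diff_le_const[OF this integrable_zero, of c] assms(2) show "\<bar>\<integral>x. f x \<partial>M\<bar> <= c" by simp
qed

lemma integrable_dominated:
 fixes f :: "'a => real"
 assumes "integrable M w" "f \<in> borel_measurable M" "\<And>x. \<bar>f x\<bar> <= w x"
 shows "integrable M f"
 using assms(1,2) by (rule intg_bound) (use assms(3) in \<open>auto intro: order_trans[OF _ abs_ge_self]\<close>)

lemma borel_measurable_leb01:
 "f \<in> borel_measurable borel ==> f \<in> borel_measurable leb01"
 by (simp add: measurable_restrict_space1)

lemma rep_L1_measurable [measurable]: "rep_L1 x \<in> borel_measurable leb01"
 by (rule borel_measurable_integrable) simp

lemma integral_rep_L1_mult_integrable: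
 assumes "f \<in> borel_measurable leb01" "\<And>t. t \<in> {0..1} ==> \<bar>f t\<bar> <= B"
 shows "integrable leb01 (\<lambda>t. f t * rep_L1 x t)"
proof (rule intg_bound)
 show "integrable leb01 (\<lambda>t. B * rep_L1 x t)" by simp
 show "(\<lambda>t. f t * rep_L1 x t) \<in> borel_measurable leb01"
  using assms(1) by measurable
 show "AE t in leb01. norm (f t * rep_L1 x t) <= norm (B * rep_L1 x t)"
 proof (rule AE_I2)
  fix t assume "t \<in> space leb01"
  then have "\<bar>f t\<bar> <= B" using assms(2) by simp
  then have "\<bar>f t\<bar> * \<bar>rep_L1 x t\<bar> <= \<bar>B\<bar> * \<bar>rep_L1 x t\<bar>"
   by (intro mult_right_mono) auto
  then show "norm (f t * rep_L1 x t) <= norm (B * rep_L1 x t)" by (simp add: abs_mult)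
 qed
qed

section \<open>Averages over cells\<close>

text \<open>The functional on \<open>L1\<close> given by a bounded function \<open>f\<close>.
  \<open>Blinfun\<close> takes the intended value only if the integral is bounded and linear in
  \<open>x\<close>, which \<open>dualf_apply\<close> derives from a bound of \<open>f\<close> on
  [0,1].\<close>

definition dualf :: "(real => real) => L1_dual" where
 "dualf f = Blinfun (\<lambda>x. \<integral>t. f t * rep_L1 x t \<partial>leb01)"

lemma dualf_apply:
 assumes "f \<in> borel_measurable leb01" "\<And>t. t \<in> {0..1} ==> \<bar>f t\<bar> <= B"
 shows "dualf f x = (\<integral>t. f t * rep_L1 x t \<partial>leb01)"
proof -
 note i = integral_rep_L1_mult_integrable[OF assms]
 have b: "\<bar>\<integral>t. f t * rep_L1 x t \<partial>leb01\<bar> <= B * norm x" for x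
 proof -
  have "\<bar>\<integral>t. f t * rep_L1 x t \<partial>leb01\<bar> <= (\<integral>t. B * \<bar>rep_L1 x t\<bar> \<partial>leb01)"
   by (rule order_trans[OF _ integral_abs_diff_le[OF i[of x] integrable_zero]])
    (use assms(2) in \<open>auto simp: abs_mult intro!: mult_right_mono\<close>)
  also have "... = B * norm x" by (simp add: norm_L1_rep)
  finally show ?thesis .
 qed
 have "bounded_linear (\<lambda>x. \<integral>t. f t * rep_L1 x t \<partial>leb01)"
 proof (rule bounded_linear_intro)
  fix x y :: L1 and r :: real
  have "(\<integral>t. f t * rep_L1 (x + y) t \<partial>leb01) = (\<integral>t. f t * rep_L1 x t + f t * rep_L1 y t \<partial>leb01)"
   using rep_L1_add[of x y] assms(1)
   by (intro integral_cong_AE) (auto simp: algebra_simps)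
  then show "(\<integral>t. f t * rep_L1 (x + y) t \<partial>leb01)
    = (\<integral>t. f t * rep_L1 x t \<partial>leb01) + (\<integral>t. f t * rep_L1 y t \<partial>leb01)"
   using i by simp
  have "(\<integral>t. f t * rep_L1 (r *\<^sub>R x) t \<partial>leb01) = (\<integral>t. r * (f t * rep_L1 x t) \<partial>leb01)"
   using rep_L1_scaleR[of r x] assms(1)
   by (intro integral_cong_AE) (auto simp: algebra_simps)
  then show "(\<integral>t. f t * rep_L1 (r *\<^sub>R x) t \<partial>leb01) = r *\<^sub>R (\<integral>t. f t * rep_L1 x t \<partial>leb01)"
   by simp
  show "norm (\<integral>t. f t * rep_L1 x t \<partial>leb01) <= norm x * B"
   using b[of x] by (simp add: mult.commute)
 qed
 then show "dualf f x = (\<integral>t. f t * rep_L1 x t \<partial>leb01)"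
  by (simp add: dualf_def bounded_linear_Blinfun_apply)
qed

text \<open>Half open, so that the \<open>N\<close> cells partition [0,1) without overlap; the point
  1 that they miss is a null set.\<close>

definition cell :: "nat => nat => real set" where
 "cell N j = {real j / real N..<(real j + 1) / real N}"

definition cellf :: "nat => nat => L1_dual" where
 "cellf N j = dualf (indicator (cell N j))"

lemma cell_measurable [measurable]: "cell N j \<in> sets borel"
 by (simp add: cell_def)

lemma indicator_leb01_measurable [measurable]:
 "A \<in> sets borel ==> (indicator A :: real => real) \<in> borel_measurable leb01"
 by (rule borel_measurable_leb01) (rule borel_measurable_indicator)

lemma integrable_indicator_mult_leb01:
 fixes f :: "real => real"
 assumes "integrable leb01 f" "A \<in> sets borel"
 shows "integrable leb01 (\<lambda>t. indicator A t * f t)"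
proof (rule intg_bound[OF assms(1)])
 show "(\<lambda>t. indicator A t * f t) \<in> borel_measurable leb01"
  using assms by (intro borel_measurable_times indicator_leb01_measurable) auto
qed (auto simp: indicator_def)

lemma integrable_indicator_leb01:
 "A \<in> sets borel ==> integrable leb01 (indicator A :: real => real)"
 using finite_measure.integrable_const[OF finite_measure_leb01, of "1::real"]
  integrable_indicator_mult_leb01[of "\<lambda>_. 1" A] by simp

lemma cellf_apply: "cellf N j x = (\<integral>t. indicator (cell N j) t * rep_L1 x t \<partial>leb01)"
 unfolding cellf_def by (rule dualf_apply[where B = 1, OF indicator_leb01_measurable]) (auto simp: indicator_def)

lemma cell_unique:
 assumes "N > 0" "t \<in> cell N i" "t \<in> cell N j"
 shows "i = j"
proof -
 have "real i <= real N * t" "real N * t < real i + 1" "real j <= real N * t" "real N * t < real j + 1"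
  using assms by (auto simp: cell_def field_simps)
 then show ?thesis by linarith
qed

lemma cell_subset:
 assumes "j < N"
 shows "cell N j \<subseteq> {0..1}"
proof -
 have "(real j + 1) / real N <= 1" using assms by (simp add: field_simps)
 moreover have "0 <= real j / real N" by simp
 ultimately show ?thesis unfolding cell_def by (intro subsetI) (metis atLeastAtMost_iff atLeastLessThan_iff less_eq_real_def order_trans)
qed

lemma cell_exists:
 assumes "N > 0" "0 <= t" "t < 1"
 shows "\<exists>j<N. t \<in> cell N j"
proof (intro exI conjI)
 let ?j = "nat \<lfloor>real N * t\<rfloor>"
 have "0 <= real N * t" "real N * t < real N" using assms by auto
 then show "?j < N" by linarith
 have "real ?j <= real N * t" "real N * t < real ?j + 1"
  using \<open>0 <= real N * t\<close> by linarith+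
 then show "t \<in> cell N ?j" using assms by (auto simp: cell_def field_simps)
qed

lemma sum_indicator_cell:
 assumes "N > 0"
 shows "(\<Sum>j<N. indicator (cell N j) t :: real) = indicator {0..<1} t"
proof (cases "t \<in> {0..<1}")
 case True
 then obtain i where i: "i < N" "t \<in> cell N i" using cell_exists assms by auto
 have "(\<Sum>j<N. indicator (cell N j) t :: real) = (\<Sum>j<N. if j = i then 1 else 0)"
  using i cell_unique[OF assms] by (intro sum.cong) (auto simp: indicator_def)
 with i True show ?thesis by simp
next
 case False
 have "t \<notin> cell N j" if "j < N" for j
 proof
  assume t: "t \<in> cell N j"
  have "(real j + 1) / real N <= 1" using that by (simp add: field_simps)
  with t have "t < 1" by (auto simp: cell_def)
  moreover have "0 <= t" using t by (auto simp: cell_def intro: order_trans[rotated])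
  ultimately show False using False by simp
 qed
 then show ?thesis using False by (simp add: indicator_def)
qed

text \<open>Disjoint supports: all cell integrals together cost only one norm, whatever
  \<open>N\<close> is. This is the source of the later bounds that do not depend on the number of
  cells.\<close>

lemma sum_abs_cellf_le:
 assumes "N > 0"
 shows "(\<Sum>j<N. \<bar>cellf N j x\<bar>) <= norm x"
proof -
 have i: "integrable leb01 (\<lambda>t. indicator (cell N j) t * \<bar>rep_L1 x t\<bar>)" for j
  by (intro integrable_indicator_mult_leb01) auto
 have "(\<Sum>j<N. \<bar>cellf N j x\<bar>) <= (\<Sum>j<N. \<integral>t. indicator (cell N j) t * \<bar>rep_L1 x t\<bar> \<partial>leb01)"
 proof (rule sum_mono)
  fix j
  have "\<bar>cellf N j x\<bar> <= (\<integral>t. \<bar>indicator (cell N j) t * rep_L1 x t\<bar> \<partial>leb01)"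
   unfolding cellf_apply by (rule integral_abs_bound)
  then show "\<bar>cellf N j x\<bar> <= (\<integral>t. indicator (cell N j) t * \<bar>rep_L1 x t\<bar> \<partial>leb01)"
   by (simp add: abs_mult)
 qed
 also have "... = (\<integral>t. (\<Sum>j<N. indicator (cell N j) t * \<bar>rep_L1 x t\<bar>) \<partial>leb01)"
  by (rule Bochner_Integration.integral_sum[symmetric]) (rule i)
 also have "... <= (\<integral>t. \<bar>rep_L1 x t\<bar> \<partial>leb01)"
 proof (rule integral_mono)
  show "integrable leb01 (\<lambda>t. \<Sum>j<N. indicator (cell N j) t * \<bar>rep_L1 x t\<bar>)"
   by (rule intg_sum) (rule i)
  fix t
  show "(\<Sum>j<N. indicator (cell N j) t * \<bar>rep_L1 x t\<bar>) <= \<bar>rep_L1 x t\<bar>"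
   unfolding sum_distrib_right[symmetric] sum_indicator_cell[OF assms]
   by (simp add: indicator_def)
 qed simp
 finally show ?thesis by (simp add: norm_L1_rep)
qed

section \<open>Step functions and the averaging projection\<close>

lemma l1_eq_refl_iff: "l1_eq f f \<longleftrightarrow> integrable leb01 f"
 by (simp add: l1_eq_def)

lemma norm_abs_L1: "integrable leb01 f ==> norm (abs_L1 f) = (\<integral>t. \<bar>f t\<bar> \<partial>leb01)"
 by (rule norm_L1.abs_eq) (simp add: l1_eq_refl_iff)

lemma abs_L1_scaleR: "integrable leb01 f ==> c *\<^sub>R abs_L1 f = abs_L1 (\<lambda>t. c * f t)"
 by (rule scaleR_L1.abs_eq) (simp add: l1_eq_refl_iff)

lemma abs_L1_diff:
 "integrable leb01 f ==> integrable leb01 g ==> abs_L1 f - abs_L1 g = abs_L1 (\<lambda>t. f t - g t)"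
 by (rule minus_L1.abs_eq) (simp_all add: l1_eq_refl_iff)

lemma abs_L1_sum:
 assumes "\<And>i. i \<in> I ==> integrable leb01 (f i)"
 shows "(\<Sum>i\<in>I. abs_L1 (f i)) = abs_L1 (\<lambda>t. \<Sum>i\<in>I. f i t)"
 using assms
proof (induction I rule: infinite_finite_induct)
 case (insert i I)
 then have "(\<Sum>i\<in>insert i I. abs_L1 (f i)) = abs_L1 (f i) + abs_L1 (\<lambda>t. \<Sum>i\<in>I. f i t)" by simp
 also have "... = abs_L1 (\<lambda>t. f i t + (\<Sum>i\<in>I. f i t))"
  using insert by (intro plus_L1.abs_eq) (simp_all add: l1_eq_refl_iff)
 finally show ?case using insert by simp
qed (simp_all add: zero_L1_def)

lemma abs_rep_L1: "abs_L1 (rep_L1 x) = x"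
 by (rule Quotient3_abs_rep[OF Quotient3_L1])

lemma cellf_abs_L1:
 assumes "integrable leb01 f"
 shows "cellf N j (abs_L1 f) = (\<integral>t. indicator (cell N j) t * f t \<partial>leb01)"
 unfolding cellf_apply
 using rep_abs_L1[OF assms] assms
 by (intro integral_cong_AE borel_measurable_times indicator_leb01_measurable) auto

definition stepe :: "nat => nat => L1" where
 "stepe N j = abs_L1 (indicator (cell N j))"

definition proj :: "nat => L1 => L1" where
 "proj N x = (\<Sum>j<N. (real N * cellf N j x) *\<^sub>R stepe N j)"

lemma integral_indicator_leb01:
 assumes "A \<in> sets borel" "A \<subseteq> {0..1}"
 shows "(\<integral>t. indicator A t \<partial>leb01) = measure lborel A"
 using assms by (subst Bochner_Integration.integral_indicator)
  (auto simp: measure_restrict_space Int_absorb2)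

lemma measure_cell: "N > 0 ==> measure lborel (cell N j) = 1 / real N"
 by (simp add: cell_def field_simps)

lemma norm_stepe:
 assumes "j < N"
 shows "norm (stepe N j) = 1 / real N"
proof -
 have "norm (stepe N j) = (\<integral>t. \<bar>indicator (cell N j) t :: real\<bar> \<partial>leb01)"
  unfolding stepe_def by (intro norm_abs_L1 integrable_indicator_leb01) simp
 also have "... = (\<integral>t. indicator (cell N j) t \<partial>leb01)" by simp
 also have "... = measure lborel (cell N j)"
  by (rule integral_indicator_leb01) (use cell_subset[OF assms] in auto)
 finally show ?thesis using assms by (simp add: measure_cell)
qed

text \<open>Fine cells are numbered consecutively, so integer division by \<open>R\<close> gives the
  number of the surrounding coarse cell.\<close>

lemma cell_div:
 assumes "M > 0" "R > 0" "t \<in> cell (M * R) i"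
 shows "t \<in> cell M (i div R)"
proof -
 have t: "real i <= real M * real R * t" "real M * real R * t < real i + 1"
  using assms by (auto simp: cell_def field_simps)
 have "(i div R) * R <= i" by simp
 then have "real (i div R) * real R <= real i" by (metis of_nat_le_iff of_nat_mult)
 then have "real (i div R) * real R <= real M * t * real R" using t by (simp add: algebra_simps)
 then have 1: "real (i div R) <= real M * t" using assms by simp
 have "i < Suc (i div R) * R" using assms(2) by (simp add: dividend_less_div_times add.commute)
 then have "real i + 1 <= (real (i div R) + 1) * real R"
  by (metis Suc_leI of_nat_Suc of_nat_le_iff of_nat_mult add.commute)
 then have "real M * t * real R < (real (i div R) + 1) * real R"
  using t by (simp add: algebra_simps)
 then have 2: "real M * t < real (i div R) + 1" using assms by simp
 show ?thesis using 1 2 assms by (auto simp: cell_def field_simps)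
qed

lemma indicator_cell_refine:
 assumes "M > 0" "R > 0" "j < M"
 shows "(\<Sum>i\<in>{i. i < M * R \<and> i div R = j}. indicator (cell (M * R) i) t :: real) = indicator (cell M j) t"
proof (cases "t \<in> cell M j")
 case True
 have N: "M * R > 0" using assms by simp
 have "real j + 1 <= real M" using assms by simp
 then have "(real j + 1) / real M <= 1" using assms by (simp add: field_simps)
 with True have "t < 1" by (auto simp: cell_def)
 moreover have "0 <= t" using cell_subset[OF assms(3)] True by auto
 ultimately obtain i where i: "i < M * R" "t \<in> cell (M * R) i" using cell_exists N by blast
 have d: "i div R = j"
  using cell_unique[OF assms(1) cell_div[OF assms(1,2) i(2)] True] .
 have "(\<Sum>i\<in>{i. i < M * R \<and> i div R = j}. indicator (cell (M * R) i) t :: real)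
   = (\<Sum>k\<in>{i. i < M * R \<and> i div R = j}. if k = i then 1 else 0)"
  using i cell_unique[OF N] by (intro sum.cong) (auto simp: indicator_def)
 also have "... = 1" using i d by simp
 finally show ?thesis using True by simp
next
 case False
 then show ?thesis using cell_div[OF assms(1,2)] by (auto simp: indicator_def intro!: sum.neutral)
qed

lemma cellf_refine:
 assumes "M > 0" "R > 0" "j < M"
 shows "cellf M j x = (\<Sum>i\<in>{i. i < M * R \<and> i div R = j}. cellf (M * R) i x)"
 unfolding cellf_apply
 by (subst Bochner_Integration.integral_sum[symmetric])
   (simp_all add: sum_distrib_right[symmetric] indicator_cell_refine[OF assms] integrable_indicator_mult_leb01)

lemma cellf_stepe:
 assumes "M > 0" "R > 0" "i < M * R" "j < M"
 shows "cellf (M * R) i (stepe M j) = (if i div R = j then 1 / real (M * R) else 0)"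
proof -
 have "cellf (M * R) i (stepe M j) = (\<integral>t. indicator (cell (M * R) i) t * indicator (cell M j) t \<partial>leb01)"
  unfolding stepe_def by (intro cellf_abs_L1 integrable_indicator_leb01) simp
 also have "... = (\<integral>t. (if i div R = j then indicator (cell (M * R) i) t else 0) \<partial>leb01)"
  using cell_div[OF assms(1,2), of _ i] cell_unique[OF assms(1), of _ "i div R" j]
  by (intro Bochner_Integration.integral_cong) (auto simp: indicator_def split: if_splits)
 also have "... = (if i div R = j then 1 / real (M * R) else 0)"
  using assms integral_indicator_leb01[OF _ cell_subset[OF assms(3)]] by (simp add: measure_cell)
 finally show ?thesis .
qed

lemma bounded_linear_proj: "bounded_linear (proj N)"
 unfolding proj_def[abs_def]
 by (intro bounded_linear_sum bounded_linear_scaleR_const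
   bounded_linear_const_mult[OF blinfun.bounded_linear_right])

lemmas proj_diff = linear_diff[OF bounded_linear.linear[OF bounded_linear_proj]]
 and proj_sum = linear_sum[OF bounded_linear.linear[OF bounded_linear_proj]]
 and proj_scaleR = linear_scale[OF bounded_linear.linear[OF bounded_linear_proj]]

lemma norm_proj_le_sum: "norm (proj N x) <= (\<Sum>j<N. \<bar>cellf N j x\<bar>)"
 unfolding proj_def
proof (rule sum_norm_le)
 fix j assume "j \<in> {..<N}"
 then show "norm ((real N * cellf N j x) *\<^sub>R stepe N j) <= \<bar>cellf N j x\<bar>"
  by (simp add: norm_stepe abs_mult)
qed

lemma norm_proj_le: "norm (proj N x) <= norm x"
 by (cases "N = 0") (use norm_proj_le_sum[of N x] sum_abs_cellf_le[of N x] in \<open>auto simp: proj_def\<close>)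

lemma proj_stepe:
 assumes "M > 0" "R > 0" "j < M"
 shows "proj (M * R) (stepe M j) = stepe M j"
proof -
 have "proj (M * R) (stepe M j) = (\<Sum>i<M * R. (if i div R = j then stepe (M * R) i else 0))"
  unfolding proj_def using assms by (intro sum.cong refl) (auto simp: cellf_stepe)
 also have "... = (\<Sum>i\<in>{i. i < M * R \<and> i div R = j}. stepe (M * R) i)"
  by (subst sum.inter_filter[symmetric]) auto
 also have "... = abs_L1 (\<lambda>t. \<Sum>i\<in>{i. i < M * R \<and> i div R = j}. indicator (cell (M * R) i) t)"
  unfolding stepe_def by (rule abs_L1_sum) (simp add: integrable_indicator_leb01)
 also have "... = stepe M j"
  unfolding stepe_def indicator_cell_refine[OF assms] ..
 finally show ?thesis .
qed

lemma proj_proj: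
 assumes "M > 0" "R > 0"
 shows "proj (M * R) (proj M x) = proj M x"
proof -
 have "proj (M * R) (proj M x) = (\<Sum>j<M. (real M * cellf M j x) *\<^sub>R proj (M * R) (stepe M j))"
  unfolding proj_def[of M x] by (simp add: proj_sum proj_scaleR)
 also have "... = proj M x"
  unfolding proj_def[of M x] using assms by (intro sum.cong refl) (simp add: proj_stepe)
 finally show ?thesis .
qed

text \<open>Since \<open>proj (M * R)\<close> fixes the range of \<open>proj M\<close>, the residual
  splits into what the fine cells do not resolve and a function constant on fine cells. The norm of
  the latter is controlled by finitely many functionals.\<close>

lemma norm_diff_proj_refine_le:
 assumes "M > 0" "R > 0"
 shows "norm (x - proj M x) <= norm (x - proj (M * R) x) + (\<Sum>j<M * R. \<bar>cellf (M * R) j (x - proj M x)\<bar>)"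
proof -
 have "x - proj M x = (x - proj (M * R) x) + proj (M * R) (x - proj M x)"
  using proj_proj[OF assms] by (simp add: proj_diff)
 then have "norm (x - proj M x) <= norm (x - proj (M * R) x) + norm (proj (M * R) (x - proj M x))"
  by (metis norm_triangle_ineq)
 with norm_proj_le_sum[of "M * R" "x - proj M x"] show ?thesis by linarith
qed

lemma proj_eq_abs_L1: "proj N x = abs_L1 (\<lambda>t. \<Sum>j<N. (real N * cellf N j x) * indicator (cell N j) t)"
 unfolding proj_def stepe_def
 by (simp add: abs_L1_scaleR integrable_indicator_leb01 abs_L1_sum)

lemma AE_leb01_less_1: "AE t in leb01. t \<in> {0..<1}"
proof -
 have "AE t in lborel. t \<noteq> (1::real)" by (rule AE_lborel_singleton)
 then have "AE t in lborel. t \<in> {0..1} \<longrightarrow> t \<in> {0..<1::real}" by eventually_elim auto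
 then show ?thesis by (subst AE_restrict_space_iff) auto
qed

lemma measure_leb01_space: "measure leb01 {0..1} = 1"
 by (simp add: measure_restrict_space)

section \<open>Strong convergence of the averages\<close>

lemma proj_continuous_close:
 assumes g: "continuous_on {0..1} g" and e: "e > 0"
 shows "\<exists>N0>0. \<forall>N\<ge>N0. norm (abs_L1 g - proj N (abs_L1 g)) <= e"
proof -
 have ig: "integrable leb01 g" by (rule integrable_continuous_leb01[OF g])
 have "uniformly_continuous_on {0..1} g"
  using g by (rule compact_uniformly_continuous) simp
 then obtain d where d: "d > 0" "\<And>s t. s \<in> {0..1} ==> t \<in> {0..1} ==> dist s t < d ==> dist (g s) (g t) < e"
  unfolding uniformly_continuous_on_def using e by metis
 obtain N0 :: nat where N0: "1 / d < real N0" using reals_Archimedean2 by blast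
 have "N0 > 0" using N0 d(1) by (metis divide_pos_pos gr0I less_asym of_nat_0 zero_less_one)
 moreover have "norm (abs_L1 g - proj N (abs_L1 g)) <= e" if "N >= N0" for N
 proof -
  have N: "N > 0" using that \<open>N0 > 0\<close> by simp
  have "1 / d < real N" using that N0 by (meson less_le_trans of_nat_le_iff)
  then have Nd: "1 / real N < d" using d(1) N by (simp add: field_simps)
  let ?a = "\<lambda>j. real N * cellf N j (abs_L1 g)"
  have close: "\<bar>g t - ?a j\<bar> <= e" if j: "j < N" and t: "t \<in> cell N j" for j t
  proof -
   have t01: "t \<in> {0..1}" using t cell_subset[OF j] by auto
   have ii: "integrable leb01 (\<lambda>s. indicator (cell N j) s * (g t - g s))"
    by (intro integrable_indicator_mult_leb01 intg_diff ig
      finite_measure.integrable_const[OF finite_measure_leb01]) simp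
   have ic: "(\<integral>s. indicator (cell N j) s \<partial>leb01) = 1 / real N"
    using integral_indicator_leb01[OF _ cell_subset[OF j]] measure_cell[OF N] by simp
   have "(\<integral>s. indicator (cell N j) s * (g t - g s) \<partial>leb01)
     = (\<integral>s. indicator (cell N j) s * g t - indicator (cell N j) s * g s \<partial>leb01)"
    by (simp add: algebra_simps)
   also have "... = (\<integral>s. indicator (cell N j) s * g t \<partial>leb01) - cellf N j (abs_L1 g)"
    using ig by (subst intl_diff)
     (auto simp: cellf_abs_L1 integrable_indicator_mult_leb01 integrable_indicator_leb01)
   also have "... = g t / real N - cellf N j (abs_L1 g)"
    using ic by simp
   finally have eq: "g t - ?a j = real N * (\<integral>s. indicator (cell N j) s * (g t - g s) \<partial>leb01)"
    using N by (simp add: field_simps)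
   have "\<bar>\<integral>s. indicator (cell N j) s * (g t - g s) \<partial>leb01\<bar>
     <= (\<integral>s. \<bar>indicator (cell N j) s * (g t - g s)\<bar> \<partial>leb01)"
    by (rule integral_abs_bound)
   also have "... <= (\<integral>s. indicator (cell N j) s * e \<partial>leb01)"
   proof (rule integral_mono)
    show "integrable leb01 (\<lambda>s. indicator (cell N j) s * e)"
     by (simp add: integrable_indicator_leb01)
    show "integrable leb01 (\<lambda>s. \<bar>indicator (cell N j) s * (g t - g s)\<bar>)"
     using ii by simp
    fix s assume "s \<in> space leb01"
    then have s01: "s \<in> {0..1}" by simp
    show "\<bar>indicator (cell N j) s * (g t - g s)\<bar> <= indicator (cell N j) s * e"
    proof (cases "s \<in> cell N j")
     case True
     have "\<bar>t - s\<bar> < 1 / real N"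
      using True t by (auto simp: cell_def add_divide_distrib)
     then have "dist (g t) (g s) < e" using d(2)[OF t01 s01] Nd by (simp add: dist_real_def)
     then show ?thesis using True by (simp add: dist_real_def)
    qed (simp add: indicator_def)
   qed
   also have "... = e / real N" using ic by simp
   finally show ?thesis unfolding eq using N by (simp add: abs_mult field_simps)
  qed
  have isum: "integrable leb01 (\<lambda>t. \<Sum>j<N. ?a j * indicator (cell N j) t)"
   by (intro intg_sum integrable_mult_right integrable_indicator_leb01) simp
  have "norm (abs_L1 g - proj N (abs_L1 g)) = (\<integral>t. \<bar>g t - (\<Sum>j<N. ?a j * indicator (cell N j) t)\<bar> \<partial>leb01)"
   unfolding proj_eq_abs_L1 using ig isum by (simp add: abs_L1_diff norm_abs_L1)
  also have "... <= (\<integral>t. e \<partial>leb01)"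
  proof (rule integral_mono_AE)
   show "integrable leb01 (\<lambda>t. \<bar>g t - (\<Sum>j<N. ?a j * indicator (cell N j) t)\<bar>)"
    using ig isum by simp
   show "integrable leb01 (\<lambda>t. e)" by (rule finite_measure.integrable_const[OF finite_measure_leb01])
   show "AE t in leb01. \<bar>g t - (\<Sum>j<N. ?a j * indicator (cell N j) t)\<bar> <= e"
    using AE_leb01_less_1
   proof eventually_elim
    case (elim t)
    then obtain i where i: "i < N" "t \<in> cell N i" using cell_exists N by auto
    have "(\<Sum>j<N. ?a j * indicator (cell N j) t) = (\<Sum>j<N. if j = i then ?a i else 0)"
     using i cell_unique[OF N] by (intro sum.cong) (auto simp: indicator_def)
    also have "... = ?a i" using i by simp
    finally show ?case using close[OF i] by simp
   qed
  qed
  also have "... = e" by (simp add: measure_leb01_space)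
  finally show ?thesis .
 qed
 ultimately show ?thesis by blast
qed

lemma proj_close:
 assumes "e > 0"
 shows "\<exists>N0>0. \<forall>N\<ge>N0. norm (x - proj N x) < e"
proof -
 obtain g where g: "continuous_on {0..1} g" "(\<integral>t. \<bar>rep_L1 x t - g t\<bar> \<partial>leb01) < e/4"
  using L1_approx_continuous[OF integrable_rep_L1, of "e/4" x] assms by auto
 have xg: "norm (x - abs_L1 g) < e / 4"
  using g dist_abs_L1[OF integrable_continuous_leb01[OF g(1)], of x] by (simp add: dist_norm)
 obtain N0 where N0: "N0 > 0" "\<And>N. N >= N0 ==> norm (abs_L1 g - proj N (abs_L1 g)) <= e / 4"
  using proj_continuous_close[OF g(1), of "e/4"] assms by auto
 have "norm (x - proj N x) < e" if "N >= N0" for N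
 proof -
  have "x - proj N x = (x - abs_L1 g) + (abs_L1 g - proj N (abs_L1 g)) + proj N (abs_L1 g - x)"
   by (simp add: proj_diff)
  then have "norm (x - proj N x) <= norm (x - abs_L1 g) + norm (abs_L1 g - proj N (abs_L1 g)) + norm (proj N (abs_L1 g - x))"
   by (metis norm_triangle_mono norm_triangle_ineq order_refl)
  also have "norm (proj N (abs_L1 g - x)) <= norm (x - abs_L1 g)"
   using norm_proj_le by (metis norm_minus_commute)
  finally show ?thesis using xg N0(2)[OF that] assms by linarith
 qed
 then show ?thesis using N0(1) by blast
qed

lemma norm_diff_proj_le: "norm (x - proj N x) <= 2 * norm x"
 using norm_triangle_ineq4[of x "proj N x"] norm_proj_le[of N x] by linarith

text \<open>The condition \<open>j + r < N\<close> keeps the translated cell inside [0,1], so the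
  extension by 0 never intervenes.\<close>

lemma cellf_shift:
 assumes "j + r < N"
 shows "cellf N j (shift_L1 (real r / real N) x) = cellf N (j + r) x"
proof -
 let ?y = "real r / real N" and ?f = "rep_L1 x"
 have N: "N > 0" using assms by simp
 have l1: "l1_eq ?f ?f" by (rule rep_L1_refl)
 have eq: "shift_L1 ?y x = abs_L1 (\<lambda>t. if t + ?y \<in> {0..1} then ?f (t + ?y) else 0)"
  by (subst abs_rep_L1[of x, symmetric]) (rule shift_L1.abs_eq[OF l1])
 have "l1_eq (rep_L1 (shift_L1 ?y x)) (rep_L1 (shift_L1 ?y x))" by (rule rep_L1_refl)
 define h where "h s = indicator (cell N (j + r)) s * (indicator {0..1} s * ?f s)" for s
 have "integrable lborel (\<lambda>s. indicator {0..1} s *\<^sub>R ?f s)"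
  using integrable_rep_L1[of x] by (simp only: integrable_restrict_space sets.Int_space_eq2 sets_lborel space_borel Int_UNIV_right atLeastAtMost_borel)
 then have ih: "integrable lborel h"
  unfolding h_def using integrable_mult_indicator[of "cell N (j + r)" lborel "\<lambda>s. indicator {0..1} s *\<^sub>R ?f s"]
  by simp
 then have hm: "h \<in> borel_measurable borel" by (auto dest: borel_measurable_integrable)
 have cj: "cell N j \<subseteq> {0..1}" "cell N (j + r) \<subseteq> {0..1}" using assms by (auto intro!: cell_subset del: subsetI)
 have mem: "t \<in> cell N j \<longleftrightarrow> t + ?y \<in> cell N (j + r)" for t
  using N by (auto simp: cell_def add_divide_distrib)
 have pt: "indicator {0..1} t *\<^sub>R (indicator (cell N j) t * (if t + ?y \<in> {0..1} then ?f (t + ?y) else 0)) = h (?y + 1 * t)" for t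
  using cj mem[of t] by (auto simp: h_def indicator_def add.commute)
 have intg: "integrable leb01 (\<lambda>t. if t + ?y \<in> {0..1} then ?f (t + ?y) else 0)"
  using shift_L1.rsp[unfolded rel_fun_def, rule_format, OF refl l1, of ?y] by (simp add: l1_eq_def)
 have "cellf N j (shift_L1 ?y x) = (\<integral>t. indicator (cell N j) t * (if t + ?y \<in> {0..1} then ?f (t + ?y) else 0) \<partial>leb01)"
  unfolding eq by (rule cellf_abs_L1[OF intg])
 also have "... = (\<integral>t. h (?y + 1 * t) \<partial>lborel)"
  by (subst integral_restrict_space) (simp_all only: pt, simp)
 also have "... = (\<integral>t. h t \<partial>lborel)"
  using lborel_integral_real_affine[of 1 h ?y] by simp
 also have "... = (\<integral>t. indicator (cell N (j + r)) t * ?f t \<partial>leb01)"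
  by (subst integral_restrict_space) (simp, simp add: h_def[abs_def] mult_ac)
 finally show ?thesis by (simp add: cellf_apply)
qed

text \<open>Two indices of one block differ by less than \<open>R\<close>, so the pairs can be
  grouped by their difference \<open>r\<close>. The factor 2 covers both orders of a pair; the
  diagonal, counted twice, contributes 0.\<close>

lemma sum_pairs_same_block_le:
 fixes a :: "nat => real"
 assumes "R > 0"
 shows "(\<Sum>j<n. \<Sum>i\<in>{i. i < n \<and> i div R = j div R}. \<bar>a j - a i\<bar>)
   <= 2 * (\<Sum>r<R. \<Sum>j\<in>{j. j + r < n}. \<bar>a j - a (j + r)\<bar>)"
proof -
 define G where "G = {(j, i). j < n \<and> i < n \<and> i div R = j div R}"
 have finG: "finite G"
  by (rule finite_subset[of _ "{..<n} \<times> {..<n}"]) (auto simp: G_def)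
 define T where "T = (SIGMA r:{..<R}. {j. j + r < n})"
 have fin: "finite {j. j + r < n}" for r by (rule finite_subset[of _ "{..<n}"]) auto
 have finT: "finite T" unfolding T_def using fin by (intro finite_SigmaI) auto
 have blk: "i - j < R" if "i div R = j div R" "j <= i" for i j
 proof -
  have "i = i div R * R + i mod R" "j = j div R * R + j mod R" by simp_all
  moreover have "i mod R < R" using assms by simp
  ultimately show ?thesis using that(1) by (metis add_diff_cancel_left diff_le_self le_less_trans diff_add_inverse less_imp_diff_less diff_diff_left)
 qed
 let ?D = "\<lambda>(r, j). \<bar>a j - a (j + r)\<bar>"
 have 1: "(\<Sum>(j, i)\<in>{(j, i)\<in>G. j <= i}. \<bar>a j - a i\<bar>) <= sum ?D T"
 proof -
  have "(\<Sum>(j, i)\<in>{(j, i)\<in>G. j <= i}. \<bar>a j - a i\<bar>) = sum ?D ((\<lambda>(j, i). (i - j, j)) ` {(j, i)\<in>G. j <= i})"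
   by (subst sum.reindex) (auto simp: inj_on_def intro!: sum.cong)
  also have "... <= sum ?D T"
   using finT by (rule sum_mono2) (use blk in \<open>auto simp: G_def T_def\<close>)
  finally show ?thesis .
 qed
 have 2: "(\<Sum>(j, i)\<in>{(j, i)\<in>G. i <= j}. \<bar>a j - a i\<bar>) <= sum ?D T"
 proof -
  have "(\<Sum>(j, i)\<in>{(j, i)\<in>G. i <= j}. \<bar>a j - a i\<bar>) = sum ?D ((\<lambda>(j, i). (j - i, i)) ` {(j, i)\<in>G. i <= j})"
   by (subst sum.reindex) (auto simp: inj_on_def abs_minus_commute intro!: sum.cong)
  also have "... <= sum ?D T"
   using finT by (rule sum_mono2) (use blk in \<open>auto simp: G_def T_def\<close>)
  finally show ?thesis .
 qed
 have "(\<Sum>j<n. \<Sum>i\<in>{i. i < n \<and> i div R = j div R}. \<bar>a j - a i\<bar>) = (\<Sum>(j, i)\<in>G. \<bar>a j - a i\<bar>)"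
  by (subst sum.Sigma) (auto simp: G_def intro!: sum.cong)
 also have "... <= (\<Sum>(j, i)\<in>{(j, i)\<in>G. j <= i} \<union> {(j, i)\<in>G. i <= j}. \<bar>a j - a i\<bar>)"
  by (rule sum_mono2) (auto intro: finite_subset[OF _ finG])
 also have "... <= (\<Sum>(j, i)\<in>{(j, i)\<in>G. j <= i}. \<bar>a j - a i\<bar>) + (\<Sum>(j, i)\<in>{(j, i)\<in>G. i <= j}. \<bar>a j - a i\<bar>)"
  by (subst sum.union_inter[symmetric])
   (auto intro: finite_subset[OF _ finG] intro!: sum_nonneg)
 also have "... <= 2 * sum ?D T" using 1 2 by linarith
 also have "sum ?D T = (\<Sum>r<R. \<Sum>j\<in>{j. j + r < n}. \<bar>a j - a (j + r)\<bar>)"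
  unfolding T_def using fin by (subst sum.Sigma) auto
 finally show ?thesis .
qed

lemma card_block:
 assumes "R > 0" "k < (M::nat)"
 shows "card {i. i < M * R \<and> i div R = k} = R"
proof -
 have "{i. i < M * R \<and> i div R = k} = {k * R..<k * R + R}"
 proof (intro equalityI subsetI)
  fix i assume "i \<in> {k * R..<k * R + R}"
  then have "i div R = k" using assms by (intro div_nat_eqI) (auto simp: mult.commute)
  moreover have "k * R + R <= M * R" using assms by (metis Suc_leI add.commute mult_Suc mult_le_mono1)
  ultimately show "i \<in> {i. i < M * R \<and> i div R = k}" using \<open>i \<in> _\<close> by auto
 next
  fix i assume "i \<in> {i. i < M * R \<and> i div R = k}"
  then show "i \<in> {k * R..<k * R + R}"
   using assms div_times_less_eq_dividend[of i R] dividend_less_div_times[of R i] by auto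
 qed
 then show ?thesis by simp
qed

lemma cellf_proj:
 assumes "M > 0" "R > 0" "i < M * R"
 shows "cellf (M * R) i (proj M x) = (1 / real R) * cellf M (i div R) x"
proof -
 have k: "i div R < M" using assms by (simp add: less_mult_imp_div_less)
 have "cellf (M * R) i (proj M x) = (\<Sum>j<M. real M * cellf M j x * cellf (M * R) i (stepe M j))"
  by (simp add: proj_def blinfun.sum_right blinfun.scaleR_right)
 also have "... = (\<Sum>j<M. if j = i div R then real M * cellf M j x / real (M * R) else 0)"
  using assms by (intro sum.cong) (auto simp: cellf_stepe)
 also have "... = (1 / real R) * cellf M (i div R) x" using k assms by simp
 finally show ?thesis .
qed

text \<open>On a fine cell the residual is the average of the differences to the \<open>R\<close>
  fine cells of the same coarse cell. Grouped by the index difference \<open>r\<close>, these are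
  cell integrals of \<open>x\<close> minus its translate by \<open>r / (M * R)\<close>, a distance
  below \<open>1 / M\<close>. Through this bound A4 becomes applicable to residuals.\<close>

lemma sum_cellf_diff_proj_le_shift:
 assumes "M > 0" "R > 0"
 shows "(\<Sum>j<M * R. \<bar>cellf (M * R) j (x - proj M x)\<bar>)
   <= (2 / real R) * (\<Sum>r<R. norm (x - shift_L1 (real r / real (M * R)) x))"
proof -
 let ?N = "M * R"
 define a where "a j = cellf ?N j x" for j
 have N: "?N > 0" using assms by simp
 have "\<bar>cellf ?N j (x - proj M x)\<bar> <= (1 / real R) * (\<Sum>i\<in>{i. i < ?N \<and> i div R = j div R}. \<bar>a j - a i\<bar>)"
  if j: "j < ?N" for j
 proof -
  have k: "j div R < M" using j by (simp add: less_mult_imp_div_less)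
  have "cellf ?N j (x - proj M x) = a j - (1 / real R) * (\<Sum>i\<in>{i. i < ?N \<and> i div R = j div R}. a i)"
   using cellf_proj[OF assms j, of x] cellf_refine[OF assms k, of x]
   by (simp add: blinfun.diff_right a_def)
  also have "... = (1 / real R) * (\<Sum>i\<in>{i. i < ?N \<and> i div R = j div R}. a j - a i)"
   using card_block[OF assms(2) k] assms(2) by (simp add: sum_subtractf field_simps)
  finally show ?thesis by (simp add: abs_mult divide_right_mono)
 qed
 then have "(\<Sum>j<?N. \<bar>cellf ?N j (x - proj M x)\<bar>)
   <= (\<Sum>j<?N. (1 / real R) * (\<Sum>i\<in>{i. i < ?N \<and> i div R = j div R}. \<bar>a j - a i\<bar>))"
  by (intro sum_mono) auto
 also have "... = (1 / real R) * (\<Sum>j<?N. \<Sum>i\<in>{i. i < ?N \<and> i div R = j div R}. \<bar>a j - a i\<bar>)"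
  by (simp add: sum_distrib_left)
 also have "... <= (1 / real R) * (2 * (\<Sum>r<R. \<Sum>j\<in>{j. j + r < ?N}. \<bar>a j - a (j + r)\<bar>))"
  by (intro mult_left_mono sum_pairs_same_block_le assms) simp
 also have "... <= (1 / real R) * (2 * (\<Sum>r<R. norm (x - shift_L1 (real r / real ?N) x)))"
 proof (intro mult_left_mono sum_mono)
  fix r
  have "(\<Sum>j\<in>{j. j + r < ?N}. \<bar>a j - a (j + r)\<bar>)
    = (\<Sum>j\<in>{j. j + r < ?N}. \<bar>cellf ?N j (x - shift_L1 (real r / real ?N) x)\<bar>)"
   by (intro sum.cong refl) (simp add: a_def blinfun.diff_right cellf_shift del: of_nat_mult)
  also have "... <= (\<Sum>j<?N. \<bar>cellf ?N j (x - shift_L1 (real r / real ?N) x)\<bar>)"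
   by (rule sum_mono2) auto
  also have "... <= norm (x - shift_L1 (real r / real ?N) x)" by (rule sum_abs_cellf_le[OF N])
  finally show "(\<Sum>j\<in>{j. j + r < ?N}. \<bar>a j - a (j + r)\<bar>) <= norm (x - shift_L1 (real r / real ?N) x)" .
 qed auto
 finally show ?thesis by simp
qed

lemma proj_error_tendsto:
 assumes X: "integrable M X"
 shows "(\<lambda>N. \<integral>x. norm (X x - proj N (X x)) \<partial>M) ----> 0"
proof -
 have "(\<lambda>N. \<integral>x. norm (X x - proj N (X x)) \<partial>M) ----> (\<integral>x. 0 \<partial>M)"
 proof (rule integral_dominated_convergence[where w = "\<lambda>x. 2 * norm (X x)"])
  show "integrable M (\<lambda>x. 2 * norm (X x))" using X by simp
  show "(\<lambda>x. norm (X x - proj N (X x))) \<in> borel_measurable M" for N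
   using X integrable_bounded_linear[OF bounded_linear_proj X, of N]
   by (intro borel_measurable_norm borel_measurable_diff borel_measurable_integrable) auto
  show "AE x in M. (\<lambda>N. norm (X x - proj N (X x))) ----> 0"
  proof (rule AE_I2, rule LIMSEQ_I)
   fix x and e :: real assume "e > 0"
   from proj_close[OF this, of "X x"] show "\<exists>n0. \<forall>n\<ge>n0. norm (norm (X x - proj n (X x)) - 0) < e" by auto
  qed
  show "AE x in M. norm (norm (X x - proj N (X x))) <= 2 * norm (X x)" for N using norm_diff_proj_le by (intro AE_I2) simp
 qed simp
 then show ?thesis by simp
qed

section \<open>Covariance inequalities under mixing\<close>

text \<open>\<open>ess_sup\<close> is chosen by \<open>SOME\<close>, so nothing is known of it
  before existence is shown. Exhaustion: a countable union \<open>C\<close> of finite subfamilies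
  attains the supremum of the expected finite maxima; one further member cannot raise the
  expectation, so it lies below the supremum over \<open>C\<close> almost surely.\<close>

lemma is_ess_sup_exists:
 assumes "prob_space M" and "I \<noteq> {}"
  and meas: "\<And>i. i \<in> I ==> Y i \<in> borel_measurable M"
  and bnd: "\<And>i. i \<in> I ==> AE x in M. 0 <= Y i x \<and> Y i x <= (1::real)"
 shows "\<exists>Z. is_ess_sup M I Y Z"
proof -
 interpret prob_space M by fact
 \<comment> \<open>Clipping turns the almost sure bounds into pointwise ones, so that all suprema
   below are bounded without exceptional sets.\<close>
 define y where "y i x = max 0 (min 1 (Y i x))" for i x
 have y01: "0 <= y i x" "y i x <= 1" for i x by (auto simp: y_def)
 have ym [measurable]: "i \<in> I ==> y i \<in> borel_measurable M" for i
  unfolding y_def[abs_def] using meas by measurable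
 have yY: "AE x in M. y i x = Y i x" if "i \<in> I" for i
  using bnd[OF that] by eventually_elim (auto simp: y_def)
 define S where "S F x = (SUP i\<in>F. y i x)" for F x
 have bdd: "bdd_above ((\<lambda>i. y i x) ` F)" for F x
  using y01 by (intro bdd_aboveI[of _ 1]) auto
 have Sm [measurable]: "S F \<in> borel_measurable M" if "countable F" "F \<subseteq> I" for F
  unfolding S_def[abs_def] using that bdd by (intro borel_measurable_cSUP) (auto intro: ym)
 have Sup: "y i x <= S F x" if "i \<in> F" for i F x
  unfolding S_def using that bdd by (intro cSUP_upper)
 have S01: "0 <= S F x" "S F x <= 1" if ne: "F \<noteq> {}" for F x
 proof -
  obtain i where "i \<in> F" using ne by auto
  then show "0 <= S F x" using Sup[of i F x] y01(1)[of i x] by linarith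
  show "S F x <= 1" unfolding S_def using ne y01 by (intro cSUP_least) auto
 qed
 have Smono: "S F x <= S F' x" if "F \<subseteq> F'" "F \<noteq> {}" for F F' x
  unfolding S_def using that bdd by (intro cSUP_subset_mono) auto
 have Sint: "integrable M (S F)" if "countable F" "F \<subseteq> I" "F \<noteq> {}" for F
  using S01[OF that(3)] Sm[OF that(1,2)] by (intro integrable_const_bound[of _ 1]) auto
 define \<F> where "\<F> = {F. finite F \<and> F \<noteq> {} \<and> F \<subseteq> I}"
 define s where "s = (SUP F\<in>\<F>. integral\<^sup>L M (S F))"
 have Fc: "countable F" "F \<subseteq> I" "F \<noteq> {}" if "F \<in> \<F>" for F
  using that by (auto simp: \<F>_def countable_finite)
 have \<F>ne: "\<F> \<noteq> {}" using \<open>I \<noteq> {}\<close> by (auto simp: \<F>_def intro!: exI[of _ "{SOME i. i \<in> I}"] some_in_eq[THEN iffD2])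
 have le1: "integral\<^sup>L M (S F) <= 1" if "F \<in> \<F>" for F
  using S01[OF Fc(3)[OF that]] Sint[OF Fc[OF that]] by (intro integral_le_const) auto
 have bddF: "bdd_above ((\<lambda>F. integral\<^sup>L M (S F)) ` \<F>)"
  using le1 by (intro bdd_aboveI[of _ 1]) auto
 have "\<exists>F\<in>\<F>. s - 1 / real (Suc n) < integral\<^sup>L M (S F)" for n
  unfolding s_def using less_cSUP_iff[OF \<F>ne bddF, of "s - 1 / real (Suc n)"]
  by (simp add: s_def)
 then obtain F where F: "\<And>n. F n \<in> \<F>" "\<And>n. s - 1 / real (Suc n) < integral\<^sup>L M (S (F n))"
  by metis
 define C where "C = (\<Union>n. F n)"
 have C: "countable C" "C \<subseteq> I" "C \<noteq> {}"
 proof -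
  show "countable C" unfolding C_def by (rule countable_UN) (simp_all add: Fc(1)[OF F(1)])
  show "C \<subseteq> I" unfolding C_def using Fc(2)[OF F(1)] by auto
  show "C \<noteq> {}" unfolding C_def using Fc(3)[OF F(1), of 0] by auto
 qed
 have "is_ess_sup M I Y (S C)"
  unfolding is_ess_sup_def
 proof (intro conjI ballI impI)
  show "S C \<in> borel_measurable M" using C by measurable
  fix i assume i: "i \<in> I"
  let ?D = "\<lambda>x. max 0 (y i x - S C x)"
  have Dint: "integrable M ?D"
  proof (rule integrable_const_bound[of _ 1])
   have "\<bar>?D x\<bar> <= 1" for x using y01(2)[of i x] S01(1)[OF C(3), of x] by linarith
   then show "AE x in M. norm (?D x) <= 1" by simp
   show "?D \<in> borel_measurable M" using ym[OF i] Sm[OF C(1,2)] by measurable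
  qed
  have "integral\<^sup>L M ?D <= 1 / real (Suc n)" for n
  proof -
   have ins: "insert i (F n) \<in> \<F>" using F(1)[of n] i by (auto simp: \<F>_def)
   have "integral\<^sup>L M ?D <= (\<integral>x. S (insert i (F n)) x - S (F n) x \<partial>M)"
   proof (rule integral_mono[OF Dint])
    show "integrable M (\<lambda>x. S (insert i (F n)) x - S (F n) x)"
     using Sint[OF Fc[OF ins]] Sint[OF Fc[OF F(1)]] by auto
    fix x
    have "S (F n) x <= S C x" using Fc(3)[OF F(1)] by (intro Smono) (auto simp: C_def)
    moreover have "y i x <= S (insert i (F n)) x" by (rule Sup) simp
    moreover have "S (F n) x <= S (insert i (F n)) x" using Fc(3)[OF F(1)] by (intro Smono) auto
    ultimately show "?D x <= S (insert i (F n)) x - S (F n) x" by linarith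
   qed
   also have "... = integral\<^sup>L M (S (insert i (F n))) - integral\<^sup>L M (S (F n))"
    using Sint[OF Fc[OF ins]] Sint[OF Fc[OF F(1)]] by simp
   also have "integral\<^sup>L M (S (insert i (F n))) <= s"
    unfolding s_def using ins bddF by (rule cSUP_upper)
   finally show ?thesis using F(2)[of n] by linarith
  qed
  then have "integral\<^sup>L M ?D <= 0"
   using LIMSEQ_inverse_real_of_nat by (intro LIMSEQ_le_const[OF LIMSEQ_inverse_real_of_nat]) (auto simp: inverse_eq_divide)
  then have "integral\<^sup>L M ?D = 0" by (intro antisym Bochner_Integration.integral_nonneg) auto
  then have "AE x in M. ?D x = 0" using integral_nonneg_eq_0_iff_AE[OF Dint] by simp
  then show "AE x in M. Y i x <= S C x" using yY[OF i] by eventually_elim auto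
 next
  fix Z' assume Z': "\<forall>i\<in>I. AE x in M. Y i x <= Z' x"
  have "AE x in M. y i x <= Z' x" if "i \<in> C" for i
  proof -
   have "i \<in> I" using C(2) that by auto
   with Z' have "AE x in M. Y i x <= Z' x" by blast
   with yY[OF \<open>i \<in> I\<close>] show ?thesis by eventually_elim simp
  qed
  then have "AE x in M. \<forall>i\<in>C. y i x <= Z' x" by (simp add: AE_ball_countable[OF C(1)])
  then show "AE x in M. S C x <= Z' x"
   by eventually_elim (auto simp: S_def intro!: cSUP_least C(3))
 qed
 then show ?thesis by (rule exI[of _ "S C"])
qed

lemma space_sigma_field [simp]: "space (sigma_field M eps I) = space M"
 by (simp add: sigma_field_def space_measure_of_conv)

lemma sigma_field_subalgebra:
 assumes "\<And>i. i \<in> I ==> eps i \<in> borel_measurable M"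
 shows "subalgebra M (sigma_field M eps I)"
proof -
 have "(\<Union>i\<in>I. {eps i -` B \<inter> space M | B. B \<in> sets borel}) \<subseteq> sets M"
  using assms by (auto intro: measurable_sets)
 moreover have "(\<Union>i\<in>I. {eps i -` B \<inter> space M | B. B \<in> sets borel}) \<subseteq> Pow (space M)" by auto
 ultimately show ?thesis
  by (auto simp: subalgebra_def sigma_field_def intro: sets.sigma_sets_subset[THEN subsetD])
qed

lemma sigma_field_measurable:
 assumes "i \<in> I"
 shows "eps i \<in> measurable (sigma_field M eps I) borel"
proof (rule measurableI)
 fix B :: "L1 set" assume B: "B \<in> sets borel"
 have "(\<Union>i\<in>I. {eps i -` B \<inter> space M | B. B \<in> sets borel}) \<subseteq> Pow (space M)" by auto
 then show "eps i -` B \<inter> space (sigma_field M eps I) \<in> sets (sigma_field M eps I)"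
  unfolding space_sigma_field using assms B
  by (auto simp: sigma_field_def intro!: sigma_sets.Basic)
qed simp

text \<open>One variable dominates the conditional deviations of all future events at once, which is
  the strength of \<beta>-mixing. Keeping \<open>indicator A\<close> inside the integral matters:
  over a partition of the past the bounds add up to the integral of \<open>Z\<close>, instead of
  growing with the number of parts.\<close>

lemma beta_coeff_majorant:
 assumes "prob_space M" and me: "\<And>i. i >= 1 ==> eps i \<in> borel_measurable M" and j: "j >= (1::nat)"
 obtains Z where "integrable M Z" "integral\<^sup>L M Z <= beta_coeff M eps k"
  "\<And>A B. A \<in> sets (sigma_field M eps {1..j}) ==> B \<in> sets (sigma_field M eps {j + k..}) ==>
   \<bar>measure M (A \<inter> B) - measure M A * measure M B\<bar> <= (\<integral>x. indicator A x * Z x \<partial>M)"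
proof -
 interpret prob_space M by fact
 define F where "F j = sigma_field M eps {1..j}" for j
 define H where "H j = sigma_field M eps {j + k..}" for j
 define Y where "Y j A x = \<bar>real_cond_exp M (F j) (indicator A) x - measure M A\<bar>" for j A x
 define Z where "Z j = ess_sup M (sets (H j)) (Y j)" for j
 have subF: "subalgebra M (F j)" for j
  unfolding F_def by (rule sigma_field_subalgebra) (use me in auto)
 have subH: "subalgebra M (H j)" if "j >= 1" for j
  unfolding H_def by (rule sigma_field_subalgebra) (use me that in auto)
 have fms: "finite_measure_subalgebra M (F j)" for j
  by unfold_locales (rule subF)
 have HM: "A \<in> sets M" if "A \<in> sets (H j)" "j >= 1" for A j
  using that subH by (auto simp: subalgebra_def)
 have Ym: "Y j A \<in> borel_measurable M" for j A
 proof -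
  interpret F: finite_measure_subalgebra M "F j" by (rule fms)
  show ?thesis unfolding Y_def[abs_def] by measurable
 qed
 have Yb: "AE x in M. 0 <= Y j A x \<and> Y j A x <= 1" if A: "A \<in> sets (H j)" "j >= 1" for j A
 proof -
  interpret F: finite_measure_subalgebra M "F j" by (rule fms)
  have i: "integrable M (indicator A :: 'a => real)"
   using HM[OF A] by (intro integrable_real_indicator) (auto simp: emeasure_eq_measure)
  have 1: "AE x in M. real_cond_exp M (F j) (indicator A) x >= 0"
   by (rule F.real_cond_exp_ge_c[OF i]) auto
  have 2: "AE x in M. real_cond_exp M (F j) (indicator A) x <= 1"
   by (rule F.real_cond_exp_le_c[OF i]) (auto simp: indicator_def)
  have 3: "0 <= measure M A" "measure M A <= 1" by auto
  from 1 2 show ?thesis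
  proof eventually_elim
   case (elim x)
   with 3 show ?case unfolding Y_def by linarith
  qed
 qed
 have Zes: "is_ess_sup M (sets (H j)) (Y j) (Z j)" if "j >= 1" for j
 proof -
  have "sets (H j) \<noteq> {}" using sets.empty_sets by blast
  from is_ess_sup_exists[OF \<open>prob_space M\<close> this Ym Yb[OF _ that]]
  show ?thesis unfolding Z_def ess_sup_def by (rule someI_ex)
 qed
 have Zm: "Z j \<in> borel_measurable M" if "j >= 1" for j using Zes[OF that] by (simp add: is_ess_sup_def)
 have Z1: "AE x in M. Z j x <= 1" if "j >= 1" for j
 proof -
  have "\<forall>A\<in>sets (H j). AE x in M. Y j A x <= 1"
  proof
   fix A assume "A \<in> sets (H j)"
   from Yb[OF this that] show "AE x in M. Y j A x <= 1" by eventually_elim simp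
  qed
  then show ?thesis using Zes[OF that] unfolding is_ess_sup_def by (elim conjE ballE[of _ _ "\<lambda>_. 1"]) auto
 qed
 have YZ: "AE x in M. Y j A x <= Z j x" if "j >= 1" "A \<in> sets (H j)" for j A
  using Zes[OF that(1)] that(2) by (simp add: is_ess_sup_def)
 have Z0: "AE x in M. 0 <= Z j x" if "j >= 1" for j
  using YZ[OF that sets.empty_sets] by eventually_elim (auto simp: Y_def)
 have Zi: "integrable M (Z j)" if "j >= 1" for j
  using Z0[OF that] Z1[OF that] Zm[OF that] by (intro integrable_const_bound[of _ 1]) (auto elim: eventually_elim2)
 have le: "integral\<^sup>L M (Z j) <= 1" if "j >= 1" for j
  using Z1[OF that] Zi[OF that] by (intro integral_le_const) auto
 have "integral\<^sup>L M (Z j) <= (SUP j\<in>{1..}. integral\<^sup>L M (Z j))"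
  using le j by (intro cSUP_upper bdd_aboveI[of _ 1]) auto
 then have 2: "integral\<^sup>L M (Z j) <= beta_coeff M eps k"
  unfolding beta_coeff_def Z_def F_def H_def Y_def[abs_def] .
 have 3: "\<bar>measure M (A \<inter> B) - measure M A * measure M B\<bar> <= (\<integral>x. indicator A x * Z j x \<partial>M)"
  if A: "A \<in> sets (F j)" and B: "B \<in> sets (H j)" for A B
 proof -
  interpret F: finite_measure_subalgebra M "F j" by (rule fms)
  have BM: "B \<in> sets M" using HM[OF B j] .
  have AM: "A \<in> sets M" using A subF by (auto simp: subalgebra_def)
  have i: "integrable M (indicator B :: 'a => real)"
   using BM by (intro integrable_real_indicator) (auto simp: emeasure_eq_measure)
  let ?c = "real_cond_exp M (F j) (indicator B)"
  have ic: "integrable M ?c" by (rule F.real_cond_exp_int(1)[OF i])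
  have iAc: "integrable M (\<lambda>x. indicator A x * ?c x)"
   using integrable_mult_indicator[OF AM ic] by simp
  have "measure M (A \<inter> B) = (\<integral>x. indicator A x * indicator B x \<partial>M)"
   using AM BM by (simp add: indicator_inter_arith[symmetric])
  also have "... = (\<integral>x. indicator A x * ?c x \<partial>M)"
   using F.real_cond_exp_intA[OF i A] by (simp add: set_lebesgue_integral_def)
  finally have eq: "measure M (A \<inter> B) - measure M A * measure M B
    = (\<integral>x. indicator A x * ?c x \<partial>M) - (\<integral>x. indicator A x * measure M B \<partial>M)"
   using AM by simp
  have iAB: "integrable M (\<lambda>x. indicator A x * measure M B)"
   using AM by (auto simp: integrable_indicator_iff emeasure_eq_measure)
  have "\<bar>measure M (A \<inter> B) - measure M A * measure M B\<bar>
    <= (\<integral>x. \<bar>indicator A x * ?c x - indicator A x * measure M B\<bar> \<partial>M)"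
   unfolding eq by (intro integral_abs_diff_le iAc iAB integrable_abs intg_diff) simp
  also have "... <= (\<integral>x. indicator A x * Z j x \<partial>M)"
  proof (rule integral_mono_AE[OF integrable_abs[OF intg_diff[OF iAc iAB]]])
   show "integrable M (\<lambda>x. indicator A x * Z j x)"
    using integrable_mult_indicator[OF AM Zi[OF j]] by simp
   show "AE x in M. \<bar>indicator A x * ?c x - indicator A x * measure M B\<bar> <= indicator A x * Z j x"
    using YZ[OF j B] by eventually_elim (auto simp: Y_def indicator_def)
  qed
  finally show ?thesis .
 qed
 show ?thesis by (rule that[OF Zi[OF j] 2]) (use 3 in \<open>auto simp: F_def H_def\<close>)
qed

section \<open>Decoupling two random variables under mixing\<close>

lemma sum_indicator_le_eq_floor:
 assumes "0 <= x" "x <= real m"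
 shows "(\<Sum>i=1..m. if real i <= x then 1 else 0) = real (nat \<lfloor>x\<rfloor>)"
proof -
 have "{i \<in> {1..m}. real i <= x} = {1..nat \<lfloor>x\<rfloor>}"
  using assms by (auto simp: le_nat_iff le_floor_iff)
 then show ?thesis by (simp add: sum.inter_filter[symmetric])
qed

context
 fixes M F1 F2 :: "'a measure" and Z :: "'a => real"
 assumes P: "prob_space M" and sub1: "subalgebra M F1" and sub2: "subalgebra M F2"
  and Zint: "integrable M Z"
  and mix: "\<And>A B. A \<in> sets F1 ==> B \<in> sets F2 ==>
   \<bar>measure M (A \<inter> B) - measure M A * measure M B\<bar> <= (\<integral>x. indicator A x * Z x \<partial>M)"
begin

interpretation prob_space M by (rule P)

text \<open>Layer cake: \<open>G\<close> is within \<open>1 / m\<close> of the average of the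
  indicators of its level sets, to each of which \<open>mix\<close> applies; the resulting error
  \<open>2 / m\<close> vanishes as \<open>m\<close> grows.\<close>

lemma mixing_indicator_unit:
 assumes A: "A \<in> sets F1" and G: "G \<in> borel_measurable F2" and G01: "\<And>x. 0 <= G x \<and> G x <= 1"
 shows "\<bar>(\<integral>x. indicator A x * G x \<partial>M) - measure M A * (\<integral>x. G x \<partial>M)\<bar> <= (\<integral>x. indicator A x * Z x \<partial>M)"
proof -
 have AM: "A \<in> sets M" using A sub1 by (auto simp: subalgebra_def)
 have GM: "G \<in> borel_measurable M" using measurable_from_subalg[OF sub2 G] .
 have iG: "integrable M G" using GM G01 by (intro integrable_const_bound[of _ 1]) auto
 have iAG: "integrable M (\<lambda>x. indicator A x * G x)" using integrable_mult_indicator[OF AM iG] by simp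
 let ?I = "\<integral>x. indicator A x * Z x \<partial>M"
 have approx: "\<bar>(\<integral>x. indicator A x * G x \<partial>M) - measure M A * (\<integral>x. G x \<partial>M)\<bar> <= ?I + 2 / real m"
  if m: "m > 0" for m
 proof -
  define B where "B i = {x \<in> space M. real i / real m <= G x}" for i
  have sp: "space F2 = space M" using sub2 by (simp add: subalgebra_def)
  have BF: "B i \<in> sets F2" for i
   unfolding B_def sp[symmetric] using G by measurable
  have BM: "B i \<in> sets M" for i using BF sub2 by (auto simp: subalgebra_def)
  define Gm where "Gm x = (1 / real m) * (\<Sum>i=1..m. indicator (B i) x)" for x
  have iB: "integrable M (indicator (B i) :: 'a => real)" for i
   using BM by (intro integrable_real_indicator) (auto simp: emeasure_eq_measure)
  have iGm: "integrable M Gm" unfolding Gm_def[abs_def] using iB by auto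
  have iAGm: "integrable M (\<lambda>x. indicator A x * Gm x)" using integrable_mult_indicator[OF AM iGm] by simp
  have close: "\<bar>G x - Gm x\<bar> <= 1 / real m" if "x \<in> space M" for x
  proof -
   have "(\<Sum>i=1..m. indicator (B i) x) = (\<Sum>i=1..m. if real i <= real m * G x then 1 else 0 :: real)"
    using that m by (intro sum.cong) (auto simp: B_def indicator_def field_simps)
   also have "... = real (nat \<lfloor>real m * G x\<rfloor>)"
    using G01[of x] m by (intro sum_indicator_le_eq_floor) (auto intro: mult_left_le)
   finally have "real m * Gm x = real (nat \<lfloor>real m * G x\<rfloor>)" using m by (simp add: Gm_def)
   moreover have "0 <= real m * G x" using G01[of x] by simp
   ultimately have "\<bar>real m * G x - real m * Gm x\<bar> <= 1" by linarith
   then have "real m * \<bar>G x - Gm x\<bar> <= 1" by (simp add: abs_mult flip: right_diff_distrib)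
   then show ?thesis using m by (simp add: field_simps)
  qed
  have c1: "\<bar>(\<integral>x. indicator A x * G x \<partial>M) - (\<integral>x. indicator A x * Gm x \<partial>M)\<bar> <= 1 / real m"
   using close by (intro integral_abs_diff_le_const iAG iAGm) (auto simp: indicator_def)
  have c2: "\<bar>(\<integral>x. G x \<partial>M) - (\<integral>x. Gm x \<partial>M)\<bar> <= 1 / real m"
   by (intro integral_abs_diff_le_const iG iGm close)
  have e1: "(\<integral>x. indicator A x * Gm x \<partial>M) = (1 / real m) * (\<Sum>i=1..m. measure M (A \<inter> B i))"
  proof -
   have "(\<integral>x. indicator A x * Gm x \<partial>M) = (\<integral>x. (1 / real m) * (\<Sum>i=1..m. indicator (A \<inter> B i) x) \<partial>M)"
    unfolding Gm_def indicator_inter_arith sum_distrib_left[symmetric] by (simp add: mult_ac)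
   also have "... = (1 / real m) * (\<Sum>i=1..m. \<integral>x. indicator (A \<inter> B i) x \<partial>M)"
    using AM BM by (simp add: integrable_indicator_iff emeasure_eq_measure)
   finally show ?thesis using AM BM by simp
  qed
  have e2: "(\<integral>x. Gm x \<partial>M) = (1 / real m) * (\<Sum>i=1..m. measure M (B i))"
   unfolding Gm_def using iB BM by simp
  have "(\<integral>x. indicator A x * Gm x \<partial>M) - measure M A * (\<integral>x. Gm x \<partial>M)
    = (1 / real m) * (\<Sum>i=1..m. (measure M (A \<inter> B i) - measure M A * measure M (B i)))"
   unfolding e1 e2 sum_subtractf sum_distrib_left[symmetric] by (simp add: diff_divide_distrib)
  then have "\<bar>(\<integral>x. indicator A x * Gm x \<partial>M) - measure M A * (\<integral>x. Gm x \<partial>M)\<bar>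
    = (1 / real m) * \<bar>\<Sum>i=1..m. (measure M (A \<inter> B i) - measure M A * measure M (B i))\<bar>"
   by (simp add: abs_mult)
  also have "... <= (1 / real m) * (\<Sum>i=1..m. ?I)"
   by (intro mult_left_mono order_trans[OF sum_abs] sum_mono mix A BF) auto
  also have "... = ?I" using m by simp
  finally have main: "\<bar>(\<integral>x. indicator A x * Gm x \<partial>M) - measure M A * (\<integral>x. Gm x \<partial>M)\<bar> <= ?I" .
  have "\<bar>measure M A * (\<integral>x. G x \<partial>M) - measure M A * (\<integral>x. Gm x \<partial>M)\<bar>
    = measure M A * \<bar>(\<integral>x. G x \<partial>M) - (\<integral>x. Gm x \<partial>M)\<bar>"
   by (simp add: abs_mult flip: right_diff_distrib)
  also have "... <= 1 * (1 / real m)" using c2 by (intro mult_mono) auto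
  finally show ?thesis using c1 main by linarith
 qed
 have "(\<lambda>m. ?I + 2 * inverse (real (Suc m))) ----> ?I + 2 * 0"
  by (intro tendsto_intros LIMSEQ_inverse_real_of_nat)
 then have "(\<lambda>m. ?I + 2 * inverse (real (Suc m))) ----> ?I" by simp
 then show ?thesis
  by (rule LIMSEQ_le_const) (use approx[of "Suc _"] in \<open>auto simp: divide_inverse intro!: exI[of _ 0]\<close>)
qed

lemma mixing_indicator_bounded:
 assumes A: "A \<in> sets F1" and G: "G \<in> borel_measurable F2" and GK: "\<And>x. \<bar>G x\<bar> <= K" and K: "K > 0"
 shows "\<bar>(\<integral>x. indicator A x * G x \<partial>M) - measure M A * (\<integral>x. G x \<partial>M)\<bar> <= 2 * K * (\<integral>x. indicator A x * Z x \<partial>M)"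
proof -
 have AM: "A \<in> sets M" using A sub1 by (auto simp: subalgebra_def)
 have GM: "G \<in> borel_measurable M" using measurable_from_subalg[OF sub2 G] .
 have iG: "integrable M G" using GM GK by (intro integrable_const_bound[of _ K]) auto
 have iAG: "integrable M (\<lambda>x. indicator A x * G x)" using integrable_mult_indicator[OF AM iG] by simp
 have iA: "integrable M (indicator A :: 'a => real)"
  using AM by (intro integrable_real_indicator) (auto simp: emeasure_eq_measure)
 define H where "H x = (G x + K) / (2 * K)" for x
 have "G x + K >= 0 \<and> G x + K <= 2 * K" for x using GK[of x] by auto
 then have H01: "0 <= H x \<and> H x <= 1" for x using K by (simp add: H_def)
 have Hm: "H \<in> borel_measurable F2" unfolding H_def[abs_def] using G by measurable
 have iH: "integrable M H" unfolding H_def[abs_def] using iG by auto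
 have iAH: "integrable M (\<lambda>x. indicator A x * H x)" using integrable_mult_indicator[OF AM iH] by simp
 have G: "G x = 2 * K * H x - K" for x using K by (simp add: H_def)
 have "(\<integral>x. indicator A x * G x \<partial>M) = (\<integral>x. 2 * K * (indicator A x * H x) - K * indicator A x \<partial>M)"
  unfolding G by (simp add: algebra_simps)
 also have "... = 2 * K * (\<integral>x. indicator A x * H x \<partial>M) - K * measure M A"
  using iAH iA AM by simp
 finally have 1: "(\<integral>x. indicator A x * G x \<partial>M) = 2 * K * (\<integral>x. indicator A x * H x \<partial>M) - K * measure M A" .
 have 2: "(\<integral>x. G x \<partial>M) = 2 * K * (\<integral>x. H x \<partial>M) - K"
  unfolding G using iH by (simp add: prob_space)
 have "(\<integral>x. indicator A x * G x \<partial>M) - measure M A * (\<integral>x. G x \<partial>M)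
   = 2 * K * ((\<integral>x. indicator A x * H x \<partial>M) - measure M A * (\<integral>x. H x \<partial>M))"
  unfolding 1 2 by (simp add: algebra_simps)
 then have "\<bar>(\<integral>x. indicator A x * G x \<partial>M) - measure M A * (\<integral>x. G x \<partial>M)\<bar>
   = 2 * K * \<bar>(\<integral>x. indicator A x * H x \<partial>M) - measure M A * (\<integral>x. H x \<partial>M)\<bar>"
  using K by (simp add: abs_mult)
 also have "... <= 2 * K * (\<integral>x. indicator A x * Z x \<partial>M)"
  using K by (intro mult_left_mono mixing_indicator_unit A Hm H01) auto
 finally show ?thesis .
qed

text \<open>For simple \<open>U\<close> the preceding bound is applied on each level set with the
  value of \<open>U\<close> frozen; the level sets partition the space, so only the integral of
  \<open>Z\<close> remains. The general case is a limit of simple functions, for which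
  \<open>h\<close> is taken continuous in its first argument.\<close>

lemma mixing_pair_bounded:
 fixes h :: "'b::{metric_space, second_countable_topology} => 'c::topological_space => real"
 assumes U: "U \<in> borel_measurable F1" and V: "V \<in> borel_measurable F2"
  and hm: "case_prod h \<in> borel_measurable (borel \<Otimes>\<^sub>M borel)"
  and hc: "\<And>v. continuous_on UNIV (\<lambda>u. h u v)"
  and hK: "\<And>u v. \<bar>h u v\<bar> <= K" and K: "K > 0"
 shows "\<bar>(\<integral>x. h (U x) (V x) \<partial>M) - (\<integral>x. \<integral>x'. h (U x) (V x') \<partial>M \<partial>M)\<bar> <= 2 * K * (\<integral>x. Z x \<partial>M)"
proof -
 have sp1: "space F1 = space M" and sp2: "space F2 = space M"
  using sub1 sub2 by (auto simp: subalgebra_def)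
 have VM: "V \<in> borel_measurable M" using measurable_from_subalg[OF sub2 V] .
 have hu: "(\<lambda>v. h u v) \<in> borel_measurable borel" for u
  using measurable_compose[OF measurable_Pair1'[of u borel borel] hm] by simp
 have huV: "(\<lambda>x. h u (V x)) \<in> borel_measurable F2" for u
  using measurable_compose[OF V hu] .
 have huVM: "(\<lambda>x. h u (V x)) \<in> borel_measurable M" for u
  using measurable_compose[OF VM hu] .
 define k where "k u = (\<integral>x'. h u (V x') \<partial>M)" for u
 have kK: "\<bar>k u\<bar> <= K" for u
  unfolding k_def by (rule integral_abs_le_const(2)[OF huVM hK])
 have simple: "\<bar>(\<integral>x. h (S x) (V x) \<partial>M) - (\<integral>x. k (S x) \<partial>M)\<bar> <= 2 * K * (\<integral>x. Z x \<partial>M)"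
  if S: "simple_function F1 S" for S
 proof -
  define R where "R = S ` space M"
  have finR: "finite R" using S by (simp add: R_def simple_function_def sp1)
  define A where "A u = S -` {u} \<inter> space M" for u
  have A1: "A u \<in> sets F1" for u
   using simple_functionD(2)[OF S, of "{u}"] by (simp add: A_def sp1)
  have AM: "A u \<in> sets M" for u using A1 sub1 by (auto simp: subalgebra_def)
  have pt: "g (S x) x = (\<Sum>u\<in>R. indicator (A u) x * g u x)" if "x \<in> space M" for g :: "'b => 'a => real" and x
  proof -
   have "(\<Sum>u\<in>R. indicator (A u) x * g u x) = (\<Sum>u\<in>R. if u = S x then g u x else 0)"
    using that by (intro sum.cong) (auto simp: A_def indicator_def)
   also have "... = g (S x) x" using finR that by (simp add: R_def)
   finally show ?thesis by simp
  qed
  have iA: "integrable M (indicator (A u) :: 'a => real)" for u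
   using AM by (intro integrable_real_indicator) (auto simp: emeasure_eq_measure)
  have ih: "integrable M (\<lambda>x. indicator (A u) x * h u (V x))" for u
   using integrable_mult_indicator[OF AM, of "\<lambda>x. h u (V x)" u] huVM hK
   by (simp add: integrable_const_bound[of _ K])
  have e1: "(\<integral>x. h (S x) (V x) \<partial>M) = (\<Sum>u\<in>R. \<integral>x. indicator (A u) x * h u (V x) \<partial>M)"
  proof -
   have "(\<integral>x. h (S x) (V x) \<partial>M) = (\<integral>x. (\<Sum>u\<in>R. indicator (A u) x * h u (V x)) \<partial>M)"
    by (intro Bochner_Integration.integral_cong refl pt[of _ "\<lambda>u x. h u (V x)"])
   also have "... = (\<Sum>u\<in>R. \<integral>x. indicator (A u) x * h u (V x) \<partial>M)"
    by (rule Bochner_Integration.integral_sum) (rule ih)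
   finally show ?thesis .
  qed
  have e2: "(\<integral>x. k (S x) \<partial>M) = (\<Sum>u\<in>R. measure M (A u) * k u)"
  proof -
   have "(\<integral>x. k (S x) \<partial>M) = (\<integral>x. (\<Sum>u\<in>R. indicator (A u) x * k u) \<partial>M)"
    by (intro Bochner_Integration.integral_cong refl pt[of _ "\<lambda>u x. k u"])
   also have "... = (\<Sum>u\<in>R. measure M (A u) * k u)"
    using iA AM by simp
   finally show ?thesis .
  qed
  have iZ: "integrable M (\<lambda>x. indicator (A u) x * Z x)" for u
   using integrable_mult_indicator[OF AM Zint] by simp
  have "\<bar>(\<integral>x. h (S x) (V x) \<partial>M) - (\<integral>x. k (S x) \<partial>M)\<bar>
    <= (\<Sum>u\<in>R. 2 * K * (\<integral>x. indicator (A u) x * Z x \<partial>M))"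
   unfolding e1 e2 unfolding sum_subtractf[symmetric] k_def
   by (intro order_trans[OF sum_abs] sum_mono mixing_indicator_bounded A1 huV hK K)
  also have "... = 2 * K * (\<integral>x. (\<Sum>u\<in>R. indicator (A u) x * Z x) \<partial>M)"
   using iZ by (simp add: sum_distrib_left)
  also have "(\<integral>x. (\<Sum>u\<in>R. indicator (A u) x * Z x) \<partial>M) = (\<integral>x. Z x \<partial>M)"
   by (intro Bochner_Integration.integral_cong refl pt[of _ "\<lambda>u. Z", symmetric])
  finally show ?thesis .
 qed
 obtain S where S: "\<And>i. simple_function F1 (S i)" "\<And>x. x \<in> space F1 ==> (\<lambda>i. S i x) ----> U x"
  using borel_measurable_implies_sequence_metric[OF U, of undefined] by blast
 have SM: "S i \<in> borel_measurable M" for i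
  by (rule measurable_from_subalg[OF sub1 borel_measurable_simple_function[OF S(1)]])
 have UM: "U \<in> borel_measurable M" using measurable_from_subalg[OF sub1 U] .
 have pm: "(\<lambda>x. h (W x) (V x)) \<in> borel_measurable M" if "W \<in> borel_measurable M" for W
  using measurable_compose[OF measurable_Pair[OF that VM] hm] by simp
 have hlim: "(\<lambda>i. h (S i x) v) ----> h (U x) v" if "x \<in> space M" for x v
  using hc[of v] S(2)[of x] that sp1
  by (intro continuous_on_tendsto_compose[of UNIV "\<lambda>u. h u v"]) auto
 have l1: "(\<lambda>i. \<integral>x. h (S i x) (V x) \<partial>M) ----> (\<integral>x. h (U x) (V x) \<partial>M)"
  using hlim hK by (intro integral_dominated_convergence[where w = "\<lambda>_. K"] pm SM UM) auto
 have klim: "(\<lambda>i. k (S i x)) ----> k (U x)" if "x \<in> space M" for x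
  unfolding k_def using hlim[OF that] hK
  by (intro integral_dominated_convergence[where w = "\<lambda>_. K"] huVM) auto
 have km: "(\<lambda>x. k (W x)) \<in> borel_measurable M" if W: "W \<in> borel_measurable M" for W
 proof -
  have "(\<lambda>(x, x'). h (W x) (V x')) \<in> borel_measurable (M \<Otimes>\<^sub>M M)"
   using measurable_compose[OF measurable_Pair[OF measurable_compose[OF measurable_fst W] measurable_compose[OF measurable_snd VM]] hm]
   by (simp add: case_prod_beta)
  then show ?thesis unfolding k_def by (rule borel_measurable_lebesgue_integral)
 qed
 have l2: "(\<lambda>i. \<integral>x. k (S i x) \<partial>M) ----> (\<integral>x. k (U x) \<partial>M)"
  using klim kK by (intro integral_dominated_convergence[where w = "\<lambda>_. K"] km SM UM) auto
 have "(\<lambda>i. \<bar>(\<integral>x. h (S i x) (V x) \<partial>M) - (\<integral>x. k (S i x) \<partial>M)\<bar>)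
   ----> \<bar>(\<integral>x. h (U x) (V x) \<partial>M) - (\<integral>x. k (U x) \<partial>M)\<bar>"
  by (intro tendsto_rabs tendsto_diff l1 l2)
 from LIMSEQ_le_const2[OF this] simple[OF S(1)] show ?thesis
  unfolding k_def by blast
qed

end

text \<open>Truncation at height \<open>K\<close>. The moment hypothesis is a sum
  \<open>f u + g v\<close> and not a joint moment, so that it controls the tails under the joint law
  and under the product of the marginals alike.\<close>

lemma mixing_pair_moment:
 fixes h :: "'b::{metric_space, second_countable_topology} => 'c::topological_space => real"
 assumes P: "prob_space M" and sub1: "subalgebra M F1" and sub2: "subalgebra M F2"
  and Zint: "integrable M Z"
  and mix: "\<And>A B. A \<in> sets F1 ==> B \<in> sets F2 ==>
   \<bar>measure M (A \<inter> B) - measure M A * measure M B\<bar> <= (\<integral>z. indicator A z * Z z \<partial>M)"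
  and Zb: "(\<integral>z. Z z \<partial>M) <= b" and b: "b > 0" and r: "r > 1"
  and U: "U \<in> borel_measurable F1" and V: "V \<in> borel_measurable F2"
  and hm: "case_prod h \<in> borel_measurable (borel \<Otimes>\<^sub>M borel)"
  and hc: "\<And>v. continuous_on UNIV (\<lambda>u. h u v)"
  and hr: "\<And>u v. \<bar>h u v\<bar> powr r <= f u + g v"
  and fi: "integrable M (\<lambda>z. f (U z))" and gi: "integrable M (\<lambda>z. g (V z))"
 shows "integrable M (\<lambda>z. h (U z) (V z))"
  and "\<bar>(\<integral>z. h (U z) (V z) \<partial>M) - (\<integral>z. \<integral>z'. h (U z) (V z') \<partial>M \<partial>M)\<bar>
   <= (2 + 2 * ((\<integral>z. f (U z) \<partial>M) + (\<integral>z. g (V z) \<partial>M))) * b powr (1 - 1 / r)"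
proof -
 interpret prob_space M by fact
 have VM: "V \<in> borel_measurable M" using measurable_from_subalg[OF sub2 V] .
 have UM: "U \<in> borel_measurable M" using measurable_from_subalg[OF sub1 U] .
 have hu: "(\<lambda>v. h u v) \<in> borel_measurable borel" for u
  using measurable_compose[OF measurable_Pair1'[of u borel borel] hm] by simp
 have huVM: "(\<lambda>z. h u (V z)) \<in> borel_measurable M" for u
  using measurable_compose[OF VM hu] .
 have pm: "(\<lambda>z. h (U z) (V z)) \<in> borel_measurable M"
  using measurable_compose[OF measurable_Pair[OF UM VM] hm] by simp
 \<comment> \<open>The truncated part costs \<open>2 * K * b\<close>, the tails a multiple of
   \<open>K powr (1 - r)\<close>; this \<open>K\<close> makes both of order
   \<open>b powr (1 - 1 / r)\<close>.\<close>
 define K where "K = b powr (- (1 / r))"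
 have K: "K > 0" using b by (simp add: K_def)
 define hK where "hK u v = max (- K) (min K (h u v))" for u v
 have hKK: "\<bar>hK u v\<bar> <= K" for u v using K by (auto simp: hK_def)
 have hKm: "case_prod hK \<in> borel_measurable (borel \<Otimes>\<^sub>M borel)"
 proof -
  have "(\<lambda>x. max (- K) (min K (case_prod h x))) \<in> borel_measurable (borel \<Otimes>\<^sub>M borel)"
   using hm by measurable
  also have "(\<lambda>x. max (- K) (min K (case_prod h x))) = case_prod hK"
   by (auto simp: hK_def)
  finally show ?thesis .
 qed
 have hKc: "continuous_on UNIV (\<lambda>u. hK u v)" for v
  unfolding hK_def by (intro continuous_intros hc)
 have hKu: "(\<lambda>v. hK u v) \<in> borel_measurable borel" for u
  using measurable_compose[OF measurable_Pair1'[of u borel borel] hKm] by simp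
 have hKuVM: "(\<lambda>z. hK u (V z)) \<in> borel_measurable M" for u
  using measurable_compose[OF VM hKu] .
 have pmK: "(\<lambda>z. hK (U z) (V z)) \<in> borel_measurable M"
  using measurable_compose[OF measurable_Pair[OF UM VM] hKm] by simp
 define C where "C = K powr (1 - r)"
 have C: "C > 0" using K by (simp add: C_def)
 have diff: "\<bar>h u v - hK u v\<bar> <= C * (f u + g v)" for u v
 proof (cases "\<bar>h u v\<bar> <= K")
  case True
  then have "h u v - hK u v = 0" by (auto simp: hK_def abs_le_iff)
  moreover have "0 <= f u + g v" using hr[of u v] by (meson order_trans powr_ge_zero)
  ultimately show ?thesis using C by simp
 next
  case False
  then have "\<bar>h u v - hK u v\<bar> <= \<bar>h u v\<bar>" using K by (auto simp: hK_def)
  also have "\<bar>h u v\<bar> = \<bar>h u v\<bar> powr r * \<bar>h u v\<bar> powr (1 - r)"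
   using False K by (subst powr_add[symmetric]) simp
  also have "... <= \<bar>h u v\<bar> powr r * C"
  proof (rule mult_left_mono)
   have "\<bar>h u v\<bar> powr (1 - r) <= K powr (1 - r)"
    using False K r by (intro powr_mono2') auto
   then show "\<bar>h u v\<bar> powr (1 - r) <= C" by (simp add: C_def)
  qed simp
  also have "... <= (f u + g v) * C" using hr C by (intro mult_right_mono) auto
  finally show ?thesis by (simp add: mult.commute)
 qed
 have bnd: "\<bar>h u v\<bar> <= K + C * (f u + g v)" for u v
  using diff[of u v] hKK[of u v] by linarith
 have ifg: "integrable M (\<lambda>z. f (U z) + g (V z))" using fi gi by simp
 show ih: "integrable M (\<lambda>z. h (U z) (V z))"
  using ifg by (intro integrable_dominated[OF _ pm bnd]) simp
 have ihK: "integrable M (\<lambda>z. hK (U z) (V z))" by (rule integral_abs_le_const(1)[OF pmK hKK])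
 let ?m = "(\<integral>z. f (U z) \<partial>M) + (\<integral>z. g (V z) \<partial>M)"
 have 1: "\<bar>(\<integral>z. h (U z) (V z) \<partial>M) - (\<integral>z. hK (U z) (V z) \<partial>M)\<bar> <= C * ?m"
  using integral_abs_diff_le[OF ih ihK integrable_mult_right[OF ifg, of C] diff] fi gi by simp
 have inner: "\<bar>(\<integral>z'. h u (V z') \<partial>M) - (\<integral>z'. hK u (V z') \<partial>M)\<bar> <= C * (f u + (\<integral>z'. g (V z') \<partial>M))" for u
 proof -
  have ig: "integrable M (\<lambda>z'. C * (f u + g (V z')))" using gi by simp
  have "integrable M (\<lambda>z'. h u (V z'))"
   using ig by (intro integrable_dominated[OF _ huVM bnd]) simp
  from integral_abs_diff_le[OF this integral_abs_le_const(1)[OF hKuVM hKK] ig diff]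
  show ?thesis using gi by (simp add: prob_space)
 qed
 have im: "(\<lambda>z. \<integral>z'. q (U z) (V z') \<partial>M) \<in> borel_measurable M"
  if "case_prod q \<in> borel_measurable (borel \<Otimes>\<^sub>M borel)" for q :: "'b => 'c => real"
 proof -
  have "(\<lambda>(z, z'). q (U z) (V z')) \<in> borel_measurable (M \<Otimes>\<^sub>M M)"
   using measurable_compose[OF measurable_Pair[OF measurable_compose[OF measurable_fst UM] measurable_compose[OF measurable_snd VM]] that]
   by (simp add: case_prod_beta)
  then show ?thesis by (rule borel_measurable_lebesgue_integral)
 qed
 have iKU: "integrable M (\<lambda>z. \<integral>z'. hK (U z) (V z') \<partial>M)"
  by (rule integral_abs_le_const(1)[OF im[OF hKm] integral_abs_le_const(2)[OF hKuVM hKK]])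
 have iD: "integrable M (\<lambda>z. (\<integral>z'. h (U z) (V z') \<partial>M) - (\<integral>z'. hK (U z) (V z') \<partial>M))"
  using fi by (intro integrable_dominated[OF _ _ inner] borel_measurable_diff im hm hKm) simp
 have ihU: "integrable M (\<lambda>z. \<integral>z'. h (U z) (V z') \<partial>M)"
  using intg_add[OF iD iKU] by simp
 have "integrable M (\<lambda>z. C * (f (U z) + (\<integral>z'. g (V z') \<partial>M)))" using fi by simp
 from integral_abs_diff_le[OF ihU iKU this inner]
 have 2: "\<bar>(\<integral>z. \<integral>z'. h (U z) (V z') \<partial>M \<partial>M) - (\<integral>z. \<integral>z'. hK (U z) (V z') \<partial>M \<partial>M)\<bar> <= C * ?m"
  using fi by (simp add: prob_space)
 have "\<bar>(\<integral>z. hK (U z) (V z) \<partial>M) - (\<integral>z. \<integral>z'. hK (U z) (V z') \<partial>M \<partial>M)\<bar> <= 2 * K * (\<integral>z. Z z \<partial>M)"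
  by (rule mixing_pair_bounded[OF P sub1 sub2 Zint mix U V hKm hKc hKK K])
 also have "... <= 2 * K * b" using K Zb by (intro mult_left_mono) auto
 also have "... = 2 * b powr (1 - 1 / r)"
  using b by (simp add: K_def powr_diff powr_minus field_simps)
 finally have 3: "\<bar>(\<integral>z. hK (U z) (V z) \<partial>M) - (\<integral>z. \<integral>z'. hK (U z) (V z') \<partial>M \<partial>M)\<bar> <= 2 * b powr (1 - 1 / r)" .
 have "C = b powr (1 - 1 / r)"
 proof -
  have "- (1 / r) * (1 - r) = 1 - 1 / r" using r by (simp add: field_simps)
  then show ?thesis unfolding C_def K_def powr_powr by (simp only:)
 qed
 then show "\<bar>(\<integral>z. h (U z) (V z) \<partial>M) - (\<integral>z. \<integral>z'. h (U z) (V z') \<partial>M \<partial>M)\<bar> <= (2 + 2 * ?m) * b powr (1 - 1 / r)"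
  using 1 2 3 by (simp add: algebra_simps)
qed

text \<open>By \<open>beta_le\<close> the power \<delta> / (2 + \<delta>) of the mixing coefficient
  is at most \<open>B * k powr - a\<close>. In the application \<open>a\<close> is
  \<open>1 / (1 / 2 - \<tau>)\<close> and \<open>B\<close> bounds the terms of the convergent series
  in A2; the lower bound for \<tau> turns into \<open>a_gt\<close>.\<close>

locale mixing_seq = prob_space M for M :: "'a measure" +
 fixes eps :: "nat => 'a => L1" and \<delta> a B :: real
 assumes eps_meas: "i >= 1 ==> eps i \<in> borel_measurable M"
  and stat: "stationary_seq M eps"
  and mean0: "i >= 1 ==> integral\<^sup>L M (eps i) = 0"
  and delta: "\<delta> > 0"
  and moment: "i >= 1 ==> integrable M (\<lambda>x. norm (eps i x) powr (2 + \<delta>))"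
  and a_gt: "a > 2 + 2 / \<delta>" and B_pos: "B > 0"
  and beta_le: "k >= 1 ==> beta_coeff M eps k <= (B * real k powr - a) powr ((2 + \<delta>) / \<delta>)"
begin

abbreviation mean :: "('a \<Rightarrow> 'b::{banach, second_countable_topology}) \<Rightarrow> 'b" (binder "\<E>" 10)
  where "mean f \<equiv> integral\<^sup>L M f"

abbreviation lrc :: "L1_dual \<Rightarrow> L1_dual \<Rightarrow> real" where "lrc \<equiv> long_run_cov M eps"

definition psum :: "nat set => 'a => L1" where "psum I x = (\<Sum>i\<in>I. eps i x)"

lemma psum_meas: "I \<subseteq> {1..} ==> psum I \<in> borel_measurable M"
 unfolding psum_def[abs_def] by (intro borel_measurable_sum) (auto intro!: eps_meas)

lemma psum_meas_sigma: "I \<subseteq> J ==> psum I \<in> borel_measurable (sigma_field M eps J)"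
 unfolding psum_def[abs_def] by (intro borel_measurable_sum) (auto intro!: sigma_field_measurable)

section \<open>Stationarity and moments\<close>

lemma stat_distr:
 assumes \<Phi>: "\<Phi> \<in> measurable (PiM {1..} (\<lambda>_. borel)) N"
 shows "distr M N (\<lambda>x. \<Phi> (\<lambda>i\<in>{1..}. eps (i + h) x)) = distr M N (\<lambda>x. \<Phi> (\<lambda>i\<in>{1..}. eps i x))"
proof -
 have m: "(\<lambda>x. \<lambda>i\<in>{1..}. eps (i + k) x) \<in> measurable M (PiM {1..} (\<lambda>_. borel))" for k
  by (intro measurable_restrict eps_meas) auto
 have "distr (distr M (PiM {1..} (\<lambda>_. borel)) (\<lambda>x. \<lambda>i\<in>{1..}. eps (i + h) x)) N \<Phi>
   = distr (distr M (PiM {1..} (\<lambda>_. borel)) (\<lambda>x. \<lambda>i\<in>{1..}. eps i x)) N \<Phi>"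
  using stat by (simp add: stationary_seq_def)
 then show ?thesis
  using m[of h] m[of 0] \<Phi> by (simp add: distr_distr o_def)
qed

lemma distr_psum_shift:
 assumes "I \<subseteq> {1..}"
 shows "distr M borel (psum ((\<lambda>i. i + h) ` I)) = distr M borel (psum I)"
proof -
 have "(\<lambda>x. \<Sum>i\<in>I. x i) \<in> borel_measurable (PiM {1..} (\<lambda>_. borel :: L1 measure))"
  using assms by (intro borel_measurable_sum measurable_component_singleton) auto
 from stat_distr[OF this, of h]
 have "distr M borel (\<lambda>z. \<Sum>i\<in>I. (\<lambda>i\<in>{1..}. eps (i + h) z) i) = distr M borel (\<lambda>z. \<Sum>i\<in>I. (\<lambda>i\<in>{1..}. eps i z) i)" .
 moreover have "(\<Sum>i\<in>I. (\<lambda>i\<in>{1..}. eps (i + h) z) i) = psum ((\<lambda>i. i + h) ` I) z" for z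
  unfolding psum_def using assms by (subst sum.reindex) (auto intro!: sum.cong)
 moreover have "(\<Sum>i\<in>I. (\<lambda>i\<in>{1..}. eps i z) i) = psum I z" for z
  unfolding psum_def using assms by (auto intro!: sum.cong)
 ultimately show ?thesis by (simp add: fun_eq_iff[symmetric])
qed

lemma distr_eps: "i >= 1 ==> distr M borel (eps i) = distr M borel (eps 1)"
 using distr_psum_shift[of "{1}" "i - 1"] by (simp add: psum_def[abs_def])

lemma distr_pair_shift:
 assumes "i >= 1" "j >= 1"
 shows "distr M (borel \<Otimes>\<^sub>M borel) (\<lambda>z. (eps (i + h) z, eps (j + h) z)) = distr M (borel \<Otimes>\<^sub>M borel) (\<lambda>z. (eps i z, eps j z))"
proof -
 have "(\<lambda>x. (x i, x j)) \<in> measurable (PiM {1..} (\<lambda>_. borel :: L1 measure)) (borel \<Otimes>\<^sub>M borel)"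
  using assms by (intro measurable_Pair measurable_component_singleton) auto
 from stat_distr[OF this, of h] show ?thesis using assms by simp
qed

lemma expectation_eq_of_distr:
 fixes f :: "L1 => 'b::{banach, second_countable_topology}"
 assumes "distr M borel X = distr M borel Y" "X \<in> borel_measurable M" "Y \<in> borel_measurable M"
  and "f \<in> borel_measurable borel"
 shows "(\<E> x. f (X x)) = (\<E> x. f (Y x))" "integrable M (\<lambda>x. f (X x)) \<longleftrightarrow> integrable M (\<lambda>x. f (Y x))"
 using assms integral_distr[of X M borel f] integral_distr[of Y M borel f]
  integrable_distr_eq[of X M borel f] integrable_distr_eq[of Y M borel f] by auto

lemma expectation_eps:
 fixes f :: "L1 => 'b::{banach, second_countable_topology}"
 assumes "i >= 1" "f \<in> borel_measurable borel"
 shows "(\<E> x. f (eps i x)) = (\<E> x. f (eps 1 x))"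
 using expectation_eq_of_distr(1)[OF distr_eps[OF assms(1)] eps_meas[OF assms(1)] eps_meas[of 1] assms(2)] by simp

text \<open>Adding 1 to the norm lets this single constant dominate every moment of order at most 2
  + \<delta>.\<close>

definition m_r :: real where "m_r = (\<E> x. (1 + norm (eps 1 x)) powr (2 + \<delta>))"

lemma moment1: 
 assumes "i >= 1"
 shows "integrable M (\<lambda>z. (1 + norm (eps i z)) powr (2 + \<delta>))"
  and "(\<E> z. (1 + norm (eps i z)) powr (2 + \<delta>)) = m_r"
proof -
 show "integrable M (\<lambda>z. (1 + norm (eps i z)) powr (2 + \<delta>))"
 proof (rule intg_bound)
  show "integrable M (\<lambda>z. 2 powr (2 + \<delta>) * (1 + norm (eps i z) powr (2 + \<delta>)))"
   using moment[OF assms] by simp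
  show "(\<lambda>z. (1 + norm (eps i z)) powr (2 + \<delta>)) \<in> borel_measurable M"
   using eps_meas[OF assms] by measurable
  have "(1 + x) powr (2 + \<delta>) <= 2 powr (2 + \<delta>) * (1 + x powr (2 + \<delta>))" if "x >= 0" for x
  proof (cases "x <= 1")
   case True
   then have "(1 + x) powr (2 + \<delta>) <= 2 powr (2 + \<delta>) * 1" using that delta by (auto intro!: powr_mono2)
   also have "... <= 2 powr (2 + \<delta>) * (1 + x powr (2 + \<delta>))" by (intro mult_left_mono) auto
   finally show ?thesis .
  next
   case False
   then have "(1 + x) powr (2 + \<delta>) <= (2 * x) powr (2 + \<delta>)" using delta by (auto intro!: powr_mono2)
   also have "... = 2 powr (2 + \<delta>) * x powr (2 + \<delta>)" using that by (simp add: powr_mult)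
   also have "... <= 2 powr (2 + \<delta>) * (1 + x powr (2 + \<delta>))" by (intro mult_left_mono) auto
   finally show ?thesis .
  qed
  then show "AE z in M. norm ((1 + norm (eps i z)) powr (2 + \<delta>))
    <= norm (2 powr (2 + \<delta>) * (1 + norm (eps i z) powr (2 + \<delta>)))" by (auto simp: abs_mult)
 qed
 show "(\<E> z. (1 + norm (eps i z)) powr (2 + \<delta>)) = m_r"
  unfolding m_r_def by (rule expectation_eps[OF assms]) measurable
qed

lemma m_r_ge1: "m_r >= 1"
proof -
 have "(\<E> x. 1) <= m_r" unfolding m_r_def
  using moment1(1)[of 1] delta by (intro integral_mono) (auto intro!: ge_one_powr_ge_zero)
 then show ?thesis by (simp add: prob_space)
qed

lemma integrable_norm_power:
 assumes "i >= 1" "p <= 2"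
 shows "integrable M (\<lambda>x. norm (eps i x) ^ p)" "(\<E> x. norm (eps i x) ^ p) <= m_r"
proof -
 have le: "norm (eps i x) ^ p <= (1 + norm (eps i x)) powr (2 + \<delta>)" for x
 proof -
  have "norm (eps i x) ^ p <= (1 + norm (eps i x)) ^ p" by (intro power_mono) auto
  also have "... <= (1 + norm (eps i x)) ^ 2" using assms by (intro power_increasing) auto
  also have "... = (1 + norm (eps i x)) powr 2"
   by (simp add: powr_numeral add_pos_nonneg)
  also have "... <= (1 + norm (eps i x)) powr (2 + \<delta>)" using delta by (intro powr_mono) auto
  finally show ?thesis .
 qed
 show i: "integrable M (\<lambda>x. norm (eps i x) ^ p)"
  by (rule intg_bound[OF moment1(1)[OF assms(1)]])
   (use le eps_meas[OF assms(1)] in auto)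
 show "(\<E> x. norm (eps i x) ^ p) <= m_r"
  using integral_mono[OF i moment1(1)[OF assms(1)] le] moment1(2)[OF assms(1)] by simp
qed

lemma integrable_eps: "i >= 1 ==> integrable M (eps i)"
 using integrable_norm_power(1)[of i 1] eps_meas by (simp add: integrable_norm_iff)

lemma integrable_norm_eps: "i >= 1 ==> integrable M (\<lambda>x. norm (eps i x))"
 using integrable_norm_power(1)[of i 1] by simp

lemma integrable_psum: "I \<subseteq> {1..} ==> integrable M (psum I)"
 unfolding psum_def[abs_def] by (intro intg_sum integrable_eps) auto

lemma integral_functional_eps:
 assumes "i >= 1"
 shows "(\<E> x. blinfun_apply l (eps i x)) = 0"
 using integral_bounded_linear[OF blinfun.bounded_linear_right integrable_eps[OF assms], of l] mean0[OF assms]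
 by (simp add: blinfun.zero_right)

section \<open>Covariance and decoupling inequalities\<close>

definition b :: "nat => real" where "b k = (B * real k powr - a) powr ((2 + \<delta>) / \<delta>)"

lemma b_pos: "k >= 1 ==> b k > 0"
 using B_pos by (simp add: b_def)

definition Cc :: real where "Cc = (2 + 2 * m_r) * B"

text \<open>Stated for a kernel \<open>h\<close> that need not be linear or a product, so that a
  signed sum over all cells can be handled in one application. With
  \<open>r = (2 + \<delta>) / 2\<close> the exponent \<open>1 - 1 / r\<close> is \<delta> / (2 +
  \<delta>), the power of the mixing coefficient that decays like \<open>k powr - a\<close>.\<close>

lemma covariance_bound:
 fixes h :: "L1 => L1 => real"
 assumes ik: "i >= 1" "k >= 1"
  and hm: "case_prod h \<in> borel_measurable (borel \<Otimes>\<^sub>M borel)"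
  and hc: "\<And>v. continuous_on UNIV (\<lambda>u. h u v)"
  and hr: "\<And>u v. \<bar>h u v\<bar> <= norm u * norm v"
 shows "integrable M (\<lambda>x. h (eps i x) (eps (i + k) x))"
  and "\<bar>(\<E> x. h (eps i x) (eps (i + k) x)) - (\<E> x. \<E> x'. h (eps i x) (eps (i + k) x'))\<bar> <= Cc * real k powr - a"
proof -
 obtain Z where Z: "integrable M Z" "integral\<^sup>L M Z <= beta_coeff M eps k"
  "\<And>A B. A \<in> sets (sigma_field M eps {1..i}) ==> B \<in> sets (sigma_field M eps {i + k..}) ==>
   \<bar>measure M (A \<inter> B) - measure M A * measure M B\<bar> <= (\<E> x. indicator A x * Z x)"
  by (rule beta_coeff_majorant[where k = k, OF prob_space_axioms eps_meas ik(1)]) blast+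
 define r where "r = (2 + \<delta>) / 2"
 have r: "r > 1" using delta by (simp add: r_def)
 have ff: "norm u powr (2 + \<delta>) / 2 <= (1 + norm u) powr (2 + \<delta>) / 2" for u :: L1
  using delta by (auto intro!: powr_mono2)
 define f where "f u = (1 + norm u) powr (2 + \<delta>) / 2" for u :: L1
 have sub: "subalgebra M (sigma_field M eps {1..i})" "subalgebra M (sigma_field M eps {i + k..})"
  using ik by (auto intro!: sigma_field_subalgebra eps_meas)
 have hb: "\<bar>h u v\<bar> powr r <= f u + f v" for u v
 proof -
  have "\<bar>h u v\<bar> powr r <= (norm u * norm v) powr r" using hr r by (intro powr_mono2) auto
  also have "... = norm u powr r * norm v powr r" by (simp add: powr_mult)
  also have "... <= ((norm u powr r)\<^sup>2 + (norm v powr r)\<^sup>2) / 2"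
   using sum_squares_bound[of "norm u powr r" "norm v powr r"] by simp
  also have "... = norm u powr (2 + \<delta>) / 2 + norm v powr (2 + \<delta>) / 2"
   by (simp add: power2_eq_square powr_add[symmetric] r_def add_divide_distrib)
  finally show ?thesis using ff[of u] ff[of v] unfolding f_def by linarith
 qed
 have fi: "integrable M (\<lambda>x. f (eps j x))" "(\<E> x. f (eps j x)) = m_r / 2" if "j >= 1" for j
  unfolding f_def using moment1[OF that] by auto
 note Zb = order_trans[OF Z(2) beta_le[OF ik(2)], folded b_def]
 note U = sigma_field_measurable[of i "{1..i}" eps M] and V = sigma_field_measurable[of "i + k" "{i + k..}" eps M]
 have U': "eps i \<in> borel_measurable (sigma_field M eps {1..i})" "eps (i + k) \<in> borel_measurable (sigma_field M eps {i + k..})"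
  using U V ik by auto
 have j1: "i + k >= 1" using ik by simp
 note main = mixing_pair_moment[OF prob_space_axioms sub Z(1,3) Zb b_pos[OF ik(2)] r U' hm hc hb fi(1)[OF ik(1)] fi(1)[OF j1]]
 show "integrable M (\<lambda>x. h (eps i x) (eps (i + k) x))" by (rule main(1))
 have "1 - 1 / r = \<delta> / (2 + \<delta>)" using delta by (simp add: r_def field_simps)
 then have bk: "b k powr (1 - 1 / r) = B * real k powr - a"
  using B_pos delta ik by (simp add: b_def powr_powr)
 have "(2 + 2 * ((\<E> x. f (eps i x)) + (\<E> x. f (eps (i + k) x)))) * b k powr (1 - 1 / r) = Cc * real k powr - a"
  unfolding bk fi(2)[OF ik(1)] fi(2)[OF j1] Cc_def by (simp only: field_sum_of_halves mult.assoc)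
 with main(2) show "\<bar>(\<E> x. h (eps i x) (eps (i + k) x)) - (\<E> x. \<E> x'. h (eps i x) (eps (i + k) x'))\<bar> <= Cc * real k powr - a"
  by (simp only:)
qed

text \<open>The decay rate in \<open>decouple_step\<close>. There only one of the two arguments
  needs a moment, of order 2 + \<delta>, so the power of the mixing coefficient is (1 + \<delta>) /
  (2 + \<delta>) instead of \<delta> / (2 + \<delta>).\<close>

definition a' :: real where "a' = a * (1 + \<delta>) / \<delta>"
definition Cd :: real where "Cd = (2 + 2 * m_r) * B powr ((1 + \<delta>) / \<delta>)"

lemma norm_psum_le: "norm (psum I x) <= (\<Sum>i\<in>I. norm (eps i x))"
 unfolding psum_def by (rule norm_sum)

lemma lipschitz_continuous:
 fixes g :: "L1 => real"
 assumes g: "\<And>x y. \<bar>g x - g y\<bar> <= c * norm (x - y)"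
 shows "continuous_on UNIV g"
proof (rule continuous_onI)
 fix x :: L1 and e :: real assume e: "e > 0"
 show "\<exists>d>0. \<forall>x'\<in>UNIV. dist x' x < d \<longrightarrow> dist (g x') (g x) <= e"
 proof (intro exI conjI ballI impI)
  show "e / (\<bar>c\<bar> + 1) > 0" using e by (simp add: add_nonneg_pos)
  fix x' assume d: "dist x' x < e / (\<bar>c\<bar> + 1)"
  have "dist (g x') (g x) <= c * norm (x' - x)" using g by (simp add: dist_real_def)
  also have "... <= (\<bar>c\<bar> + 1) * norm (x' - x)" by (intro mult_right_mono) auto
  also have "... <= e" using d by (simp add: dist_norm field_simps)
  finally show "dist (g x') (g x) <= e" .
 qed
qed

lemma integrable_lipschitz_comp:
 fixes g :: "L1 => real"
 assumes U: "integrable M U" and g: "\<And>x y. \<bar>g x - g y\<bar> <= c * norm (x - y)"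
 shows "integrable M (\<lambda>z. g (U z))"
proof -
 have gc: "continuous_on UNIV g" by (rule lipschitz_continuous[OF g])
 show ?thesis
 proof (rule intg_bound)
  show "integrable M (\<lambda>z. \<bar>g 0\<bar> + \<bar>c\<bar> * norm (U z))" using U by simp
  show "(\<lambda>z. g (U z)) \<in> borel_measurable M"
   using borel_measurable_integrable[OF U] borel_measurable_continuous_onI[OF gc]
   by (rule measurable_compose)
  have "\<bar>g x\<bar> <= \<bar>g 0\<bar> + \<bar>c\<bar> * norm x" for x
   using g[of x 0] mult_right_mono[OF abs_ge_self[of c], of "norm x"] by auto
  then show "AE z in M. norm (g (U z)) <= norm (\<bar>g 0\<bar> + \<bar>c\<bar> * norm (U z))" by auto
 qed
qed

text \<open>Convexity of the power, whatever the dependence; the price is normalization by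
  \<open>card I\<close> instead of its square root.\<close>

lemma psum_moment:
 assumes I: "finite I" "I \<noteq> {}" "I \<subseteq> {1..}" and r: "1 <= r" "r <= 2 + \<delta>"
 shows "integrable M (\<lambda>x. (norm (psum I x) / real (card I)) powr r)"
  and "(\<E> x. (norm (psum I x) / real (card I)) powr r) <= m_r"
proof -
 let ?L = "real (card I)" and ?f = "\<lambda>x. (norm (psum I x) / real (card I)) powr r"
 let ?s = "\<lambda>x. \<Sum>i\<in>I. (1 / ?L) * (1 + norm (eps i x)) powr (2 + \<delta>)"
 have L: "?L > 0" using I by (simp add: card_gt_0_iff)
 have fle: "?f x <= ?s x" for x
 proof -
  have "norm (psum I x) <= (\<Sum>i\<in>I. 1 + norm (eps i x))"
   using norm_psum_le by (rule order_trans) (simp add: sum_mono)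
  then have "norm (psum I x) / ?L <= (\<Sum>i\<in>I. (1 / ?L) *\<^sub>R (1 + norm (eps i x)))"
   using L by (simp add: sum_divide_distrib[symmetric] divide_right_mono)
  then have "?f x <= (\<Sum>i\<in>I. (1 / ?L) *\<^sub>R (1 + norm (eps i x))) powr r"
   using r L by (intro powr_mono2) auto
  also have "... <= (\<Sum>i\<in>I. (1 / ?L) * (1 + norm (eps i x)) powr r)"
   using I r L by (intro convex_on_sum[where C = "{0<..}"] powr_convex) (auto simp: add_pos_nonneg)
  also have "... <= ?s x" using r by (intro sum_mono mult_left_mono powr_mono) auto
  finally show ?thesis .
 qed
 have I1: "i >= 1" if "i \<in> I" for i using I(3) that by auto
 have isum: "integrable M ?s" using moment1(1)[OF I1] by auto
 have "psum I \<in> borel_measurable M" by (rule psum_meas[OF I(3)])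
 then have "?f \<in> borel_measurable M" by measurable
 from integrable_dominated[OF isum this] fle show i: "integrable M ?f" by simp
 have "(\<E> x. ?f x) <= (\<E> x. ?s x)" by (rule integral_mono[OF i isum fle])
 also have "... = (\<Sum>i\<in>I. (1 / ?L) * (\<E> x. (1 + norm (eps i x)) powr (2 + \<delta>)))"
  using moment1(1)[OF I1] by (subst Bochner_Integration.integral_sum) auto
 also have "... = (\<Sum>i\<in>I. (1 / ?L) * m_r)" using moment1(2)[OF I1] by simp
 also have "... = m_r" using L by simp
 finally show "(\<E> x. ?f x) <= m_r" .
qed

text \<open>The increment \<open>g (u + v) - g u\<close> is bounded by \<open>c * norm v\<close> for
  every \<open>u\<close>. Divided by \<open>c\<close> and the number of summands it satisfies the
  moment bound with \<open>f\<close> equal to 0, so no moment of the past sum \<open>U\<close>,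
  however long, enters the error.\<close>

lemma decouple_step:
 fixes g :: "L1 => real"
 assumes jk: "j >= 1" "k >= 1" and I: "finite I" "I \<subseteq> {j + k..}"
  and U: "U \<in> borel_measurable (sigma_field M eps {1..j})" "integrable M U"
  and g: "\<And>x y. \<bar>g x - g y\<bar> <= c * norm (x - y)"
 shows "\<bar>(\<E> w. g (U w + psum I w)) - (\<E> w. \<E> w'. g (U w + psum I w'))\<bar>
  <= c * real (card I) * Cd * real k powr - a'"
proof (cases "I = {}")
 case True
 then show ?thesis by (simp add: psum_def prob_space)
next
 case False
 define L where "L = real (card I)"
 have L: "L > 0" using False I by (simp add: L_def card_gt_0_iff)
 show ?thesis
 proof (cases "c = 0")
  case True
  define k where "k = g 0"
  have "g x = k" for x using g[of x 0] True by (simp add: k_def)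
  then show ?thesis using True by (simp add: prob_space)
 next
  case False
  \<comment> \<open>A vector of norm 1 exists, so the Lipschitz constant cannot be negative.\<close>
  have "0 <= c * norm (abs_L1 (\<lambda>_. 1) - 0)" using g by (meson abs_ge_zero order_trans)
  moreover have "norm (abs_L1 (\<lambda>_. 1) - 0) = 1"
   using norm_abs_L1[of "\<lambda>_. 1"] finite_measure.integrable_const[OF finite_measure_leb01, of "1::real"]
   by (simp add: measure_leb01_space)
  ultimately have c: "c > 0" using False by simp
  obtain Z where Z: "integrable M Z" "integral\<^sup>L M Z <= beta_coeff M eps k"
   "\<And>A B. A \<in> sets (sigma_field M eps {1..j}) ==> B \<in> sets (sigma_field M eps {j + k..}) ==>
    \<bar>measure M (A \<inter> B) - measure M A * measure M B\<bar> <= (\<E> w. indicator A w * Z w)"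
   by (rule beta_coeff_majorant[where k = k, OF prob_space_axioms eps_meas jk(1)]) blast+
  define r where "r = 2 + \<delta>"
  have r: "r > 1" using delta by (simp add: r_def)
  have sub: "subalgebra M (sigma_field M eps {1..j})" "subalgebra M (sigma_field M eps {j + k..})"
   using jk by (auto intro!: sigma_field_subalgebra eps_meas)
  define h where "h u v = (g (u + v) - g u) / (c * L)" for u v
  have gc: "continuous_on UNIV g" by (rule lipschitz_continuous[OF g])
  have hc: "continuous_on UNIV (\<lambda>u. h u v)" for v
   unfolding h_def using c L by (intro continuous_intros continuous_on_compose2[OF gc]) auto
  have hm: "case_prod h \<in> borel_measurable (borel \<Otimes>\<^sub>M borel)"
  proof -
   have "continuous_on UNIV (\<lambda>x. (g (fst x + snd x) - g (fst x)) / (c * L))"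
    using c L by (intro continuous_intros continuous_on_compose2[OF gc]) auto
   from borel_measurable_continuous_onI[OF this] show ?thesis
    by (simp add: borel_prod h_def[abs_def] case_prod_beta')
  qed
  define f where "f v = (norm v / L) powr r" for v :: L1
  have hb: "\<bar>h u v\<bar> powr r <= 0 + f v" for u v
  proof -
   have "\<bar>g (u + v) - g u\<bar> <= c * norm v" using g[of "u + v" u] by simp
   then have "\<bar>h u v\<bar> <= norm v / L" using c L by (simp add: h_def abs_mult field_simps)
   then show ?thesis using r by (simp add: f_def powr_mono2)
  qed
  have I1: "I \<subseteq> {1..}" using I(2) jk by auto
  have fi: "integrable M (\<lambda>w. f (psum I w))" and fm: "(\<E> w. f (psum I w)) <= m_r"
   unfolding f_def L_def r_def using delta by (auto intro!: psum_moment I(1) I1 \<open>I \<noteq> {}\<close>)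
  have V: "psum I \<in> borel_measurable (sigma_field M eps {j + k..})" by (rule psum_meas_sigma[OF I(2)])
  note Zb = order_trans[OF Z(2) beta_le[OF jk(2)], folded b_def]
  have UM: "U \<in> borel_measurable M" using U(2) by auto
  note main = mixing_pair_moment[where f = "\<lambda>_. 0" and g = f,
    OF prob_space_axioms sub Z(1,3) Zb b_pos[OF jk(2)] r U(1) V hm hc hb integrable_zero fi]
  have "1 - 1 / r = (1 + \<delta>) / (2 + \<delta>)" using delta by (simp add: r_def field_simps)
  then have bk: "b k powr (1 - 1 / r) = B powr ((1 + \<delta>) / \<delta>) * real k powr - a'"
  proof -
   assume e: "1 - 1 / r = (1 + \<delta>) / (2 + \<delta>)"
   have "(2 + \<delta>) / \<delta> * ((1 + \<delta>) / (2 + \<delta>)) = (1 + \<delta>) / \<delta>" using delta by simp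
   then have "b k powr (1 - 1 / r) = (B * real k powr - a) powr ((1 + \<delta>) / \<delta>)"
    unfolding e b_def powr_powr by (simp only:)
   also have "... = B powr ((1 + \<delta>) / \<delta>) * real k powr (- a * ((1 + \<delta>) / \<delta>))"
    using B_pos by (subst powr_mult) (simp_all add: powr_powr)
   also have "- a * ((1 + \<delta>) / \<delta>) = - a'" by (simp add: a'_def)
   finally show ?thesis .
  qed
  have ig: "integrable M (\<lambda>w. g (U w))" by (rule integrable_lipschitz_comp[OF U(2) g])
  have ih: "integrable M (\<lambda>w. h (U w) (psum I w))" by (rule main(1))
  have mb: "\<bar>(\<E> w. h (U w) (psum I w)) - (\<E> w. \<E> w'. h (U w) (psum I w'))\<bar>
    <= (2 + 2 * ((\<E> w. 0) + (\<E> w. f (psum I w)))) * b k powr (1 - 1 / r)"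
   by (rule main(2))
  also have "... <= (2 + 2 * m_r) * b k powr (1 - 1 / r)"
   using fm by (intro mult_right_mono) (auto simp: lebesgue_integral_const)
  also have "... = Cd * real k powr - a'" unfolding bk Cd_def by simp
  finally have mb: "\<bar>(\<E> w. h (U w) (psum I w)) - (\<E> w. \<E> w'. h (U w) (psum I w'))\<bar> <= Cd * real k powr - a'" .
  have geq: "g (u + v) = c * L * h u v + g u" for u v using c L by (simp add: h_def)
  have e1: "(\<E> w. g (U w + psum I w)) = c * L * (\<E> w. h (U w) (psum I w)) + (\<E> w. g (U w))"
   unfolding geq using ih ig by simp
  have ipI: "integrable M (psum I)" by (rule integrable_psum[OF I1])
  have igu: "integrable M (\<lambda>w'. g (u + psum I w'))" for u
   using ipI by (intro integrable_lipschitz_comp[OF _ g]) auto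
  have ihu: "integrable M (\<lambda>w'. h u (psum I w'))" for u
   unfolding h_def using igu by auto
  have e2': "(\<E> w'. g (u + psum I w')) = c * L * (\<E> w'. h u (psum I w')) + g u" for u
   unfolding geq using ihu by (simp add: prob_space)
  have lipA: "\<bar>(\<E> w'. g (x + psum I w')) - (\<E> w'. g (y + psum I w'))\<bar> <= c * norm (x - y)" for x y
  proof -
   have gg: "\<bar>g (x + z) - g (y + z)\<bar> <= c * norm (x - y)" for z using g[of "x + z" "y + z"] by simp
   show ?thesis by (rule integral_abs_diff_le_const[OF igu igu gg])
  qed
  have iA: "integrable M (\<lambda>w. \<E> w'. g (U w + psum I w'))"
   by (rule integrable_lipschitz_comp[OF U(2) lipA])
  have ihA: "integrable M (\<lambda>w. c * L * (\<E> w'. h (U w) (psum I w')))"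
   using intg_diff[OF iA ig] unfolding e2' by simp
  have e2: "(\<E> w. \<E> w'. g (U w + psum I w')) = c * L * (\<E> w. \<E> w'. h (U w) (psum I w')) + (\<E> w. g (U w))"
   unfolding e2' using ihA ig by simp
  have "\<bar>(\<E> w. g (U w + psum I w)) - (\<E> w. \<E> w'. g (U w + psum I w'))\<bar>
    = \<bar>c * L * ((\<E> w. h (U w) (psum I w)) - (\<E> w. \<E> w'. h (U w) (psum I w')))\<bar>"
   unfolding e1 e2 by (simp add: algebra_simps)
  also have "... = c * L * \<bar>(\<E> w. h (U w) (psum I w)) - (\<E> w. \<E> w'. h (U w) (psum I w'))\<bar>"
   using c L by (simp add: abs_mult)
  also have "... <= c * L * (Cd * real k powr - a')"
   using c L mb by (intro mult_left_mono) auto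
  finally show ?thesis by (simp add: L_def mult.assoc)
 qed
qed

section \<open>Decoupling of blocks\<close>

text \<open>Averaging over one block. The \<open>J\<close>-fold iterate is the expectation of
  \<open>g\<close> at \<open>x\<close> plus \<open>J\<close> independent copies of the block sum, so
  independent copies are available without a product space.\<close>

definition Aop :: "nat => (L1 => real) => L1 => real" where
 "Aop p g x = (\<E> z. g (x + psum {1..p} z))"

lemma integrable_shifted:
 fixes g :: "L1 => real"
 assumes "integrable M V" and g: "\<And>x y. \<bar>g x - g y\<bar> <= c * norm (x - y)"
 shows "integrable M (\<lambda>z. g (x + V z))"
 using assms(1) by (intro integrable_lipschitz_comp[OF _ g]) auto

lemma integrable_psum_atLeast1: "integrable M (psum {1..p})"
 by (rule integrable_psum) auto

lemma Aop_lipschitz: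
 assumes g: "\<And>x y. \<bar>g x - g y\<bar> <= c * norm (x - y)"
 shows "\<bar>Aop p g x - Aop p g y\<bar> <= c * norm (x - y)"
proof -
 note i = integrable_shifted[OF integrable_psum_atLeast1 g]
 have gg: "\<bar>g (x + z) - g (y + z)\<bar> <= c * norm (x - y)" for z using g[of "x + z" "y + z"] by simp
 show ?thesis unfolding Aop_def by (rule integral_abs_diff_le_const[OF i i gg])
qed

lemma Aop_funpow_lipschitz:
 assumes g: "\<And>x y. \<bar>g x - g y\<bar> <= c * norm (x - y)"
 shows "\<bar>(Aop p ^^ J) g x - (Aop p ^^ J) g y\<bar> <= c * norm (x - y)"
proof (induction J arbitrary: x y)
 case (Suc J)
 show ?case using Aop_lipschitz[OF Suc.IH] by simp
qed (simp add: g)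

text \<open>The \<open>j\<close>-th block of length \<open>p\<close> when blocks are separated by
  gaps of length \<open>q\<close>, after an offset \<open>s\<close>. The gaps themselves are
  \<open>blk p q p\<close>, the same scheme with the lengths exchanged.\<close>

definition blk :: "nat => nat => nat => nat => nat set" where
 "blk s p q j = {s + j * (p + q) + 1..s + j * (p + q) + p}"

lemma blk_eq_image: "blk s p q j = (\<lambda>i. i + (s + j * (p + q))) ` {1..p}"
 unfolding blk_def image_add_atLeastAtMost' by (simp add: add.commute)

lemma integral_psum_blk:
 assumes g: "\<And>x y. \<bar>g x - g y\<bar> <= c * norm (x - y)"
 shows "(\<E> z. g (x + psum (blk s p q j) z)) = Aop p g x"
proof -
 have "(\<lambda>y. g (x + y)) \<in> borel_measurable borel"
  using lipschitz_continuous[OF g]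
  by (intro borel_measurable_continuous_onI continuous_on_compose2[OF lipschitz_continuous[OF g]] continuous_intros) auto
 then show ?thesis
  unfolding Aop_def blk_eq_image
  by (intro expectation_eq_of_distr(1)[where f = "\<lambda>y. g (x + y)", OF distr_psum_shift] psum_meas) auto
qed

text \<open>The last block is separated from the others by a gap of length \<open>q\<close>.
  Replacing it by an independent copy turns \<open>g\<close> into \<open>Aop p g\<close>, again
  Lipschitz with the same constant, and the induction continues with this function.\<close>

lemma decouple_blocks:
 assumes "p >= 1" "q >= 1" and g: "\<And>x y. \<bar>g x - g y\<bar> <= c * norm (x - y)"
 shows "\<bar>(\<E> z. g (x + (\<Sum>j<J. psum (blk s p q j) z))) - (Aop p ^^ J) g x\<bar>
  <= real J * (c * real p * Cd * real q powr - a')"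
 using g
proof (induction J arbitrary: g)
 case (Suc J)
 let ?E = "c * real p * Cd * real q powr - a'"
 define U where "U z = x + (\<Sum>j<J. psum (blk s p q j) z)" for z
 have sub1: "blk s p q j \<subseteq> {1..}" for j by (auto simp: blk_def)
 have iU: "integrable M U" unfolding U_def[abs_def] using integrable_psum[OF sub1] by auto
 have step: "\<bar>(\<E> z. g (U z + psum (blk s p q J) z)) - (\<E> z. Aop p g (U z))\<bar> <= ?E"
 proof (cases "J = 0")
  \<comment> \<open>Without earlier blocks \<open>U\<close> is constant: the replacement is exact by
    stationarity, and only nonnegativity of the error has to be checked.\<close>
  case True
  have "0 <= c * norm (abs_L1 (\<lambda>_. 1) - 0)" using Suc.prems by (meson abs_ge_zero order_trans)
  moreover have "norm (abs_L1 (\<lambda>_. 1) - 0) = 1"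
   using norm_abs_L1[of "\<lambda>_. 1"] finite_measure.integrable_const[OF finite_measure_leb01, of "1::real"]
   by (simp add: measure_leb01_space)
  ultimately have "c >= 0" by simp
  then have "?E >= 0" using m_r_ge1 by (simp add: Cd_def)
  moreover have "(\<E> z. g (U z + psum (blk s p q J) z)) = (\<E> z. Aop p g (U z))"
   using True integral_psum_blk[OF Suc.prems] by (simp add: U_def prob_space)
  ultimately show ?thesis by simp
 next
  case False
  \<comment> \<open>The last index used by the first \<open>J\<close> blocks; the next block starts
    at \<open>j0 + q + 1\<close>.\<close>
  define j0 where "j0 = s + (J - 1) * (p + q) + p"
  have j0: "j0 >= 1" using \<open>p >= 1\<close> by (simp add: j0_def)
  have Jeq: "s + J * (p + q) = j0 + q"
   using False by (cases J) (auto simp: j0_def)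
  have I: "blk s p q J \<subseteq> {j0 + q..}" unfolding blk_def Jeq by auto
  have "blk s p q j \<subseteq> {1..j0}" if "j < J" for j
  proof -
   have "j * (p + q) <= (J - 1) * (p + q)" using that by (intro mult_le_mono1) simp
   then show ?thesis by (auto simp: blk_def j0_def)
  qed
  then have Um: "U \<in> borel_measurable (sigma_field M eps {1..j0})"
   unfolding U_def[abs_def] by (intro borel_measurable_add borel_measurable_sum psum_meas_sigma) auto
  have fin: "finite (blk s p q J)" "card (blk s p q J) = p" by (simp_all add: blk_def)
  show ?thesis
   using decouple_step[OF j0 \<open>q >= 1\<close> fin(1) I Um iU Suc.prems]
   unfolding fin(2) integral_psum_blk[OF Suc.prems] .
 qed
 have IH: "\<bar>(\<E> z. Aop p g (U z)) - (Aop p ^^ J) (Aop p g) x\<bar> <= real J * ?E"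
  unfolding U_def by (rule Suc.IH[OF Aop_lipschitz[OF Suc.prems]])
 have "(Aop p ^^ Suc J) g x = (Aop p ^^ J) (Aop p g) x" by (simp add: funpow_swap1)
 moreover have "(\<E> z. g (x + (\<Sum>j<Suc J. psum (blk s p q j) z))) = (\<E> z. g (U z + psum (blk s p q J) z))"
  by (simp add: U_def add.assoc)
 ultimately show ?case using step IH by (simp add: distrib_right)
qed (simp add: prob_space)

section \<open>Absolute moments of sums of independent blocks\<close>

lemma abs_functional_lipschitz: "\<bar>\<bar>blinfun_apply v x\<bar> - \<bar>v y\<bar>\<bar> <= norm v * norm (x - y)"
proof -
 have "\<bar>\<bar>v x\<bar> - \<bar>v y\<bar>\<bar> <= \<bar>v (x - y)\<bar>"
  by (simp add: blinfun.diff_right)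
 also have "... <= norm v * norm (x - y)" using norm_blinfun[of v "x - y"] by simp
 finally show ?thesis .
qed

lemma integrable_functional_psum: "I \<subseteq> {1..} ==> integrable M (\<lambda>x. blinfun_apply v (psum I x))"
 by (intro integrable_bounded_linear[OF blinfun.bounded_linear_right] integrable_psum)

lemma integral_functional_psum:
 assumes "I \<subseteq> {1..}" shows "(\<E> x. blinfun_apply v (psum I x)) = 0"
proof -
 have i: "integrable M (\<lambda>x. v (eps i x))" if "i \<in> I" for i
  using integrable_bounded_linear[OF blinfun.bounded_linear_right integrable_eps] that assms by auto
 have "(\<E> x. v (psum I x)) = (\<Sum>i\<in>I. \<E> x. v (eps i x))"
  unfolding psum_def using i by (simp add: blinfun.sum_right)
 also have "... = 0" using assms by (intro sum.neutral ballI integral_functional_eps) auto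
 finally show ?thesis .
qed

lemma Aop_funpow_nonneg:
 assumes "\<And>x. g x >= 0" shows "(Aop p ^^ J) g x >= 0"
proof (induction J arbitrary: x)
 case (Suc J)
 show ?case by (simp add: Aop_def[of p "(Aop p ^^ J) g"] Bochner_Integration.integral_nonneg Suc)
qed (simp add: assms)

text \<open>Riesz product: the factors \<open>1 + \<i> g / \<surd>n\<close>, written as rotations of \<open>(x, y)\<close>, have a product of
 bounded modulus, and pairing it with the sum of the independent copies picks up every
 \<open>E (v X g)\<close> with the same sign.\<close>

lemma Aop_funpow_abs_ge_aux:
 fixes v :: L1_dual and p n :: nat
 assumes n: "n > 0"
 defines "m \<equiv> (\<E> w. \<bar>blinfun_apply v (psum {1..p} w)\<bar>)"
 shows "v z * y + real J * x * (m / 2) / sqrt n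
  <= (Aop p ^^ J) (\<lambda>z. \<bar>v z\<bar>) z * sqrt (1 + 1 / real n) ^ J * sqrt (x\<^sup>2 + y\<^sup>2)"
proof (induction J arbitrary: z x y)
 case 0
 have "\<bar>y\<bar> <= sqrt (x\<^sup>2 + y\<^sup>2)" by (rule real_le_rsqrt) simp
 then have "\<bar>v z\<bar> * \<bar>y\<bar> <= \<bar>v z\<bar> * sqrt (x\<^sup>2 + y\<^sup>2)"
  by (intro mult_left_mono) auto
 moreover have "v z * y <= \<bar>v z\<bar> * \<bar>y\<bar>" by (metis abs_ge_self abs_mult)
 ultimately show ?case by simp
next
 case (Suc J)
 define X where "X w = v (psum {1..p} w)" for w
 define e where "e = (\<E> w. sgn (X w))"
 \<comment> \<open>Half the centered sign of \<open>X\<close>: bounded by 1 and of mean 0. As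
   \<open>X\<close> has mean 0 too, \<open>X * g\<close> has mean \<open>m / 2\<close>.\<close>
 define g where "g w = (sgn (X w) - e) / 2" for w
 define R where "R = (Aop p ^^ J) (\<lambda>z. \<bar>v z\<bar>)"
 define K where "K = sqrt (1 + 1 / real n)"
 have iX: "integrable M X" unfolding X_def by (rule integrable_functional_psum) auto
 have EX: "(\<E> w. X w) = 0" unfolding X_def by (rule integral_functional_psum) auto
 have Xm: "X \<in> borel_measurable M" using iX by auto
 have isg: "integrable M (\<lambda>w. sgn (X w))"
  using Xm by (intro integrable_const_bound[of _ 1]) (auto simp: sgn_real_def)
 have e1: "\<bar>e\<bar> <= 1"
  unfolding e_def by (rule integral_abs_le_const(2)[OF borel_measurable_integrable[OF isg]]) (simp add: sgn_real_def)
 have g1: "\<bar>g w\<bar> <= 1" for w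
 proof -
  have "\<bar>sgn (X w)\<bar> <= 1" by (simp add: sgn_real_def)
  then have "\<bar>sgn (X w) - e\<bar> <= 2" using e1 by linarith
  then show ?thesis by (simp add: g_def)
 qed
 have gsq: "(g w)\<^sup>2 <= 1" for w using g1[of w] by (simp add: abs_square_le_1)
 have ig: "integrable M g" unfolding g_def[abs_def] using isg by auto
 have Eg: "(\<E> w. g w) = 0" unfolding g_def using isg by (simp add: e_def prob_space)
 have iXg: "integrable M (\<lambda>w. X w * g w)"
  using Xm g1 ig by (intro intg_bound[OF iX]) (auto simp: abs_mult intro!: mult_left_le)
 have EXg: "(\<E> w. X w * g w) = m / 2"
 proof -
  have "X w * g w = \<bar>X w\<bar> / 2 - (e / 2) * X w" for w
   by (simp add: g_def abs_sgn right_diff_distrib diff_divide_distrib mult.commute)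
  then have "(\<E> w. X w * g w) = (\<E> w. \<bar>X w\<bar> / 2 - (e / 2) * X w)" by simp
  also have "... = (\<E> w. \<bar>X w\<bar>) / 2" using iX EX by simp
  finally show ?thesis by (simp add: m_def X_def)
 qed
 have Rlip: "\<bar>R x - R y\<bar> <= norm v * norm (x - y)" for x y
  unfolding R_def by (rule Aop_funpow_lipschitz[OF abs_functional_lipschitz])
 have Rnn: "R z >= 0" for z unfolding R_def by (rule Aop_funpow_nonneg) simp
 have iR: "integrable M (\<lambda>w. R (z + psum {1..p} w))"
  by (rule integrable_shifted[OF integrable_psum_atLeast1 Rlip])
 have n0: "sqrt n > 0" using n by simp
 have K0: "K > 0" "K\<^sup>2 = 1 + 1 / real n" by (simp_all add: K_def add_pos_nonneg)
 \<comment> \<open>The pair is multiplied by \<open>1 + \<i> * g / sqrt n\<close>. In mean the terms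
   with \<open>X\<close> or \<open>g\<close> alone vanish, the product \<open>X * g\<close> adds one
   more \<open>m / 2\<close>, and the radius grows at most by the factor \<open>K\<close>.\<close>
 let ?x = "\<lambda>w. x - y * g w / sqrt n" and ?y = "\<lambda>w. y + x * g w / sqrt n"
 let ?c = "m / 2 / sqrt n"
 have rot: "sqrt ((?x w)\<^sup>2 + (?y w)\<^sup>2) <= K * sqrt (x\<^sup>2 + y\<^sup>2)" for w
 proof -
  define t where "t = g w / sqrt n"
  have t2: "t\<^sup>2 <= 1 / real n" using gsq[of w] n by (simp add: t_def power_divide divide_right_mono)
  have "(?x w)\<^sup>2 + (?y w)\<^sup>2 = (x - y * t)\<^sup>2 + (y + x * t)\<^sup>2" by (simp add: t_def)
  also have "... = (x\<^sup>2 + y\<^sup>2) * (1 + t\<^sup>2)" by (simp add: power2_eq_square algebra_simps)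
  also have "... <= (x\<^sup>2 + y\<^sup>2) * (1 + 1 / real n)" using t2 by (intro mult_left_mono) auto
  finally have "sqrt ((?x w)\<^sup>2 + (?y w)\<^sup>2) <= sqrt ((x\<^sup>2 + y\<^sup>2) * (1 + 1 / real n))" by (rule real_sqrt_le_mono)
  then show ?thesis by (simp add: K_def real_sqrt_mult mult.commute)
 qed
 let ?L = "\<lambda>w. v (z + psum {1..p} w) * ?y w + real J * ?x w * (m / 2) / sqrt n"
 have L: "?L w = (v z * y + real J * x * ?c) + y * X w + (v z * x / sqrt n - real J * y * ?c / sqrt n) * g w
   + x / sqrt n * (X w * g w)" for w
  by (simp add: X_def blinfun.add_right algebra_simps add_divide_distrib diff_divide_distrib)
 have iL: "integrable M ?L" unfolding L using iX ig iXg by auto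
 have EL: "(\<E> w. ?L w) = v z * y + real (Suc J) * x * (m / 2) / sqrt n"
 proof -
  have "(\<E> w. ?L w) = (v z * y + real J * x * ?c) + x / sqrt n * (m / 2)"
   unfolding L using iX ig iXg by (simp add: prob_space EX Eg EXg)
  then show ?thesis by (simp add: algebra_simps add_divide_distrib)
 qed
 have "(\<E> w. ?L w) <= (\<E> w. R (z + psum {1..p} w) * (K ^ Suc J * sqrt (x\<^sup>2 + y\<^sup>2)))"
 proof (rule integral_mono[OF iL])
  show "integrable M (\<lambda>w. R (z + psum {1..p} w) * (K ^ Suc J * sqrt (x\<^sup>2 + y\<^sup>2)))" using iR by simp
  fix w
  have "?L w <= R (z + psum {1..p} w) * K ^ J * sqrt ((?x w)\<^sup>2 + (?y w)\<^sup>2)"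
   unfolding R_def K_def by (rule Suc.IH)
  also have "... <= R (z + psum {1..p} w) * K ^ J * (K * sqrt (x\<^sup>2 + y\<^sup>2))"
   using K0(1) Rnn by (intro mult_left_mono rot) auto
  finally show "?L w <= R (z + psum {1..p} w) * (K ^ Suc J * sqrt (x\<^sup>2 + y\<^sup>2))" by (simp add: mult_ac)
 qed
 also have "... = Aop p R z * (K ^ Suc J * sqrt (x\<^sup>2 + y\<^sup>2))" unfolding Aop_def by simp
 finally show ?case unfolding EL R_def K_def by (simp add: mult.assoc)
qed

text \<open>The rotation starts at (1, 0) with \<open>n = J\<close>; the radius then grows by at
  most \<open>1 + 1 / J\<close> to the power \<open>J / 2\<close>, which is below 2. The bound
  compares first moments only and its constant is universal, so it can be summed over all
  cells.\<close>

lemma Aop_funpow_abs_ge: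
 fixes v :: L1_dual
 shows "sqrt (real J) * (\<E> x. \<bar>blinfun_apply v (psum {1..p} x)\<bar>) <= 4 * (Aop p ^^ J) (\<lambda>z. \<bar>v z\<bar>) 0"
proof (cases "J = 0")
 case False
 let ?m = "\<E> x. \<bar>v (psum {1..p} x)\<bar>"
 let ?R = "(Aop p ^^ J) (\<lambda>z. \<bar>v z\<bar>) 0"
 have J: "J > 0" using False by simp
 have 1: "real J * (?m / 2) / sqrt (real J) <= ?R * sqrt (1 + 1 / real J) ^ J"
  using Aop_funpow_abs_ge_aux[OF J, of v 0 0 J 1 p] by (simp add: blinfun.zero_right)
 have 2: "real J * (?m / 2) / sqrt (real J) = sqrt (real J) * (?m / 2)"
 proof -
  define s where "s = sqrt (real J)"
  have "s > 0" "real J = s * s" using J by (simp_all add: s_def)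
  then show ?thesis unfolding s_def[symmetric] by simp
 qed
 have 3: "sqrt (1 + 1 / real J) ^ J <= 2"
 proof -
  have "(1 + 1 / real J) ^ J <= exp (1 / real J) ^ J"
   using exp_ge_add_one_self[of "1 / real J"] by (intro power_mono) auto
  also have "... = exp 1" using J by (simp add: exp_of_nat_mult[symmetric])
  also have "... <= 3" by (rule exp_le)
  also have "... <= (2::real)\<^sup>2" by simp
  finally have "sqrt ((1 + 1 / real J) ^ J) <= sqrt (2\<^sup>2)" by (rule real_sqrt_le_mono)
  then show ?thesis by (simp add: real_sqrt_power)
 qed
 have 4: "?R >= 0" by (rule Aop_funpow_nonneg) simp
 show ?thesis using 1 2 mult_left_mono[OF 3 4] by linarith
qed (simp add: blinfun.zero_right)

lemma (in prob_space) expectation_le_sqrt: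
 assumes "integrable M (\<lambda>x. (Y x)\<^sup>2)" "Y \<in> borel_measurable M"
 shows "integrable M Y" "\<bar>expectation Y\<bar> <= sqrt (expectation (\<lambda>x. (Y x)\<^sup>2))"
proof -
 show i: "integrable M Y"
 proof (rule intg_bound)
  show "integrable M (\<lambda>x. 1 + (Y x)\<^sup>2)" using assms by simp
  have "\<bar>y\<bar> <= 1 + y\<^sup>2" for y :: real using sum_squares_bound[of "1::real" "\<bar>y\<bar>"] by simp
  then show "AE x in M. norm (Y x) <= norm (1 + (Y x)\<^sup>2)" by (intro AE_I2) (auto intro: order_trans[OF _ abs_ge_self])
 qed (rule assms)
 have "(expectation Y)\<^sup>2 <= expectation (\<lambda>x. (Y x)\<^sup>2)"
  using variance_positive[of Y] variance_eq[OF i assms(1)] by simp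
 then show "\<bar>expectation Y\<bar> <= sqrt (expectation (\<lambda>x. (Y x)\<^sup>2))"
  by (metis real_sqrt_abs real_sqrt_le_mono)
qed

lemma square_functional_psum:
 fixes v :: L1_dual
 assumes "finite I" "I \<subseteq> {1..}"
 shows "integrable M (\<lambda>z. (blinfun_apply v (psum I z))\<^sup>2)"
  and "(\<E> z. (v (psum I z))\<^sup>2) <= (real (card I))\<^sup>2 * (\<E> z. (v (eps 1 z))\<^sup>2)"
proof -
 have vm: "(\<lambda>x. (v x)\<^sup>2) \<in> borel_measurable borel"
  by (intro borel_measurable_continuous_onI continuous_intros)
 have i1: "integrable M (\<lambda>z. (v (eps i z))\<^sup>2)" if "i >= 1" for i
 proof (rule intg_bound)
  show "integrable M (\<lambda>z. (norm v)\<^sup>2 * (norm (eps i z))\<^sup>2)" using integrable_norm_power(1)[OF that, of 2] by simp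
  show "(\<lambda>z. (v (eps i z))\<^sup>2) \<in> borel_measurable M"
   by (rule measurable_compose[OF eps_meas[OF that] vm])
  show "AE z in M. norm ((v (eps i z))\<^sup>2) <= norm ((norm v)\<^sup>2 * (norm (eps i z))\<^sup>2)"
  proof (rule AE_I2)
   fix z
   have "\<bar>v (eps i z)\<bar> <= \<bar>norm v * norm (eps i z)\<bar>" using norm_blinfun[of v "eps i z"] by simp
   from power_mono[OF this abs_ge_zero, of 2]
   show "norm ((v (eps i z))\<^sup>2) <= norm ((norm v)\<^sup>2 * (norm (eps i z))\<^sup>2)"
    by (simp add: power_mult_distrib)
  qed
 qed
 have cs: "(v (psum I z))\<^sup>2 <= real (card I) * (\<Sum>i\<in>I. (v (eps i z))\<^sup>2)" for z
 proof -
  have "(\<Sum>i\<in>I. v (eps i z) * 1)\<^sup>2 <= (\<Sum>i\<in>I. (v (eps i z))\<^sup>2) * (\<Sum>i\<in>I. 1\<^sup>2)"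
   by (rule Cauchy_Schwarz_ineq_sum)
  then show ?thesis by (simp add: psum_def blinfun.sum_right mult.commute)
 qed
 have isum: "integrable M (\<lambda>z. real (card I) * (\<Sum>i\<in>I. (v (eps i z))\<^sup>2))"
  using i1 assms by (intro integrable_mult_right intg_sum) auto
 show i: "integrable M (\<lambda>z. (v (psum I z))\<^sup>2)"
 proof (rule intg_bound[OF isum])
  show "(\<lambda>z. (v (psum I z))\<^sup>2) \<in> borel_measurable M"
   by (rule measurable_compose[OF psum_meas[OF assms(2)] vm])
  show "AE z in M. norm ((v (psum I z))\<^sup>2) <= norm (real (card I) * (\<Sum>i\<in>I. (v (eps i z))\<^sup>2))"
   using cs by (intro AE_I2) (auto intro: order_trans[OF _ abs_ge_self])
 qed
 have "(\<E> z. (v (psum I z))\<^sup>2) <= (\<E> z. real (card I) * (\<Sum>i\<in>I. (v (eps i z))\<^sup>2))"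
  by (rule integral_mono[OF i isum cs])
 also have "... = real (card I) * (\<Sum>i\<in>I. \<E> z. (v (eps i z))\<^sup>2)"
  using i1 assms by (subst integral_mult_right_zero, subst Bochner_Integration.integral_sum) auto
 also have "... = real (card I) * (\<Sum>i\<in>I. \<E> z. (v (eps 1 z))\<^sup>2)"
  using assms(2) by (intro arg_cong[where f = "(*) _"] sum.cong refl expectation_eps[OF _ vm]) auto
 also have "... = (real (card I))\<^sup>2 * (\<E> z. (v (eps 1 z))\<^sup>2)"
  by (simp add: power2_eq_square)
 finally show "(\<E> z. (v (psum I z))\<^sup>2) <= (real (card I))\<^sup>2 * (\<E> z. (v (eps 1 z))\<^sup>2)" .
qed

text \<open>One block is integrated out at a time, for all starting points \<open>z\<close>, hence
  the square of \<open>v z\<close> under the root. Each step bounds a mean by the root of the second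
  moment, in which the mixed term vanishes.\<close>

lemma Aop_funpow_abs_le:
 fixes v :: L1_dual and p :: nat
 defines "e2 \<equiv> (\<E> w. (blinfun_apply v (psum {1..p} w))\<^sup>2)"
 shows "(Aop p ^^ J) (\<lambda>z. \<bar>v z\<bar>) z <= sqrt ((v z)\<^sup>2 + real J * e2)"
proof (induction J arbitrary: z)
 case (Suc J)
 define R where "R = (Aop p ^^ J) (\<lambda>z. \<bar>v z\<bar>)"
 define X where "X w = v (psum {1..p} w)" for w
 have s0: "e2 >= 0" unfolding e2_def by simp
 have iX: "integrable M X" unfolding X_def by (rule integrable_functional_psum) auto
 have EX: "(\<E> w. X w) = 0" unfolding X_def by (rule integral_functional_psum) auto
 have iX2: "integrable M (\<lambda>w. (X w)\<^sup>2)" unfolding X_def by (rule square_functional_psum) auto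
 define Y where "Y w = sqrt ((v (z + psum {1..p} w))\<^sup>2 + real J * e2)" for w
 have Y2: "(Y w)\<^sup>2 = (v z)\<^sup>2 + 2 * v z * X w + (X w)\<^sup>2 + real J * e2" for w
 proof -
  have "(Y w)\<^sup>2 = (v z + X w)\<^sup>2 + real J * e2"
   using s0 by (simp add: Y_def X_def blinfun.add_right)
  then show ?thesis by (simp add: power2_sum)
 qed
 have iY2: "integrable M (\<lambda>w. (Y w)\<^sup>2)" unfolding Y2 using iX iX2 by auto
 have EY2: "(\<E> w. (Y w)\<^sup>2) = (v z)\<^sup>2 + real (Suc J) * e2"
 proof -
  have "(\<E> w. (X w)\<^sup>2) = e2" by (simp add: e2_def X_def)
  then show ?thesis unfolding Y2 using iX iX2 by (simp add: prob_space EX distrib_right)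
 qed
 have Ym: "Y \<in> borel_measurable M"
 proof -
  have "X \<in> borel_measurable M" using iX by auto
  then show ?thesis unfolding Y_def[abs_def] blinfun.add_right X_def[symmetric] by measurable
 qed
 have Rlip: "\<bar>R x - R y\<bar> <= norm v * norm (x - y)" for x y
  unfolding R_def by (rule Aop_funpow_lipschitz[OF abs_functional_lipschitz])
 have iR: "integrable M (\<lambda>w. R (z + psum {1..p} w))"
  by (rule integrable_shifted[OF integrable_psum_atLeast1 Rlip])
 have "Aop p R z <= (\<E> w. Y w)"
  unfolding Aop_def using Suc.IH
  by (intro integral_mono[OF iR expectation_le_sqrt(1)[OF iY2 Ym]]) (simp add: R_def Y_def)
 also have "... <= sqrt ((v z)\<^sup>2 + real (Suc J) * e2)"
  using expectation_le_sqrt(2)[OF iY2 Ym] unfolding EY2 by linarith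
 finally show ?case by (simp add: R_def)
qed simp

text \<open>Linearity needs integrability at every stage, which the Lipschitz hypotheses
  provide.\<close>

lemma Aop_funpow_sum:
 assumes "\<And>c. c \<in> I ==> \<exists>K. \<forall>x y. \<bar>f c x - f c y\<bar> <= K * norm (x - y)"
 shows "(Aop p ^^ J) (\<lambda>z. \<Sum>c\<in>I. f c z) z = (\<Sum>c\<in>I. (Aop p ^^ J) (f c) z)"
proof (induction J arbitrary: z)
 case (Suc J)
 have "(Aop p ^^ Suc J) (\<lambda>z. \<Sum>c\<in>I. f c z) z = (\<E> w. (\<Sum>c\<in>I. (Aop p ^^ J) (f c) (z + psum {1..p} w)))"
  by (simp add: Aop_def[of p "(Aop p ^^ J) _"] Suc)
 also have "... = (\<Sum>c\<in>I. \<E> w. (Aop p ^^ J) (f c) (z + psum {1..p} w))"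
 proof (rule Bochner_Integration.integral_sum)
  fix c assume "c \<in> I"
  then obtain K where K: "\<And>x y. \<bar>f c x - f c y\<bar> <= K * norm (x - y)" using assms by blast
  show "integrable M (\<lambda>w. (Aop p ^^ J) (f c) (z + psum {1..p} w))"
   by (rule integrable_shifted[OF integrable_psum_atLeast1 Aop_funpow_lipschitz[OF K]])
 qed
 finally show ?case by (simp add: Aop_def[of p "(Aop p ^^ J) _"])
qed simp

lemma psum_union_blocks:
 "psum {1..J * (p + q)} x = (\<Sum>j<J. psum (blk 0 p q j) x) + (\<Sum>j<J. psum (blk p q p j) x)"
proof (induction J)
 case (Suc J)
 define h where "h = J * (p + q)"
 have eqs: "{1..Suc J * (p + q)} = {1..p + q + h}" "blk 0 p q J = {h + 1..h + p}" "blk p q p J = {p + h + 1..p + h + q}"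
  by (simp_all add: blk_def h_def add.commute)
 have "{1..p + q + h} = {1..h} \<union> ({h + 1..h + p} \<union> {p + h + 1..p + h + q})" by auto
 moreover have "{1..h} \<inter> ({h + 1..h + p} \<union> {p + h + 1..p + h + q}) = {}"
  "{h + 1..h + p} \<inter> {p + h + 1..p + h + q} = {}" by auto
 ultimately have "psum {1..Suc J * (p + q)} x = psum {1..h} x + (psum (blk 0 p q J) x + psum (blk p q p J) x)"
  unfolding psum_def eqs by (simp only: sum.union_disjoint finite_atLeastAtMost finite_UnI)
 then show ?case using Suc by (simp add: h_def)
qed (simp add: psum_def)

section \<open>Long run covariance\<close>

definition acov :: "L1_dual => nat => real" where
 "acov v k = (\<E> x. blinfun_apply v (eps 1 x) * v (eps (1 + k) x))"

lemma functional_product_integrable: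
 fixes v w :: L1_dual
 assumes "i >= 1" "j >= 1"
 shows "integrable M (\<lambda>z. blinfun_apply v (eps i z) * blinfun_apply w (eps j z))"
proof (rule intg_bound)
 show "integrable M (\<lambda>z. (v (psum {i} z))\<^sup>2 + (w (psum {j} z))\<^sup>2)"
  using assms by (intro intg_add square_functional_psum) auto
 show "(\<lambda>z. v (eps i z) * w (eps j z)) \<in> borel_measurable M"
  using integrable_bounded_linear[OF blinfun.bounded_linear_right integrable_eps[OF assms(1)]]
   integrable_bounded_linear[OF blinfun.bounded_linear_right integrable_eps[OF assms(2)]]
  by (intro borel_measurable_times borel_measurable_integrable)
 have "\<bar>x * y\<bar> <= x\<^sup>2 + y\<^sup>2" for x y :: real
 proof -
  have "2 * (\<bar>x\<bar> * \<bar>y\<bar>) <= x\<^sup>2 + y\<^sup>2" using sum_squares_bound[of "\<bar>x\<bar>" "\<bar>y\<bar>"] by simp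
  moreover have "0 <= \<bar>x\<bar> * \<bar>y\<bar>" by simp
  ultimately show ?thesis unfolding abs_mult by linarith
 qed
 then show "AE z in M. norm (v (eps i z) * w (eps j z))
   <= norm ((v (psum {i} z))\<^sup>2 + (w (psum {j} z))\<^sup>2)"
  by (intro AE_I2) (simp add: psum_def)
qed

lemma acov_shift:
 assumes "i >= 1"
 shows "(\<E> x. blinfun_apply v (eps i x) * v (eps (i + k) x)) = acov v k"
proof -
 let ?f = "\<lambda>z. v (fst z) * v (snd z)"
 have f: "?f \<in> borel_measurable (borel \<Otimes>\<^sub>M borel)"
  unfolding borel_prod by (intro borel_measurable_continuous_onI continuous_intros)
 have m: "(\<lambda>x. (eps (1 + h) x, eps (1 + k + h) x)) \<in> measurable M (borel \<Otimes>\<^sub>M borel)" for h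
  by (intro measurable_Pair eps_meas) auto
 have "(\<integral>z. ?f z \<partial>distr M (borel \<Otimes>\<^sub>M borel) (\<lambda>x. (eps (1 + (i - 1)) x, eps (1 + k + (i - 1)) x)))
   = (\<integral>z. ?f z \<partial>distr M (borel \<Otimes>\<^sub>M borel) (\<lambda>x. (eps 1 x, eps (1 + k) x)))"
  by (subst distr_pair_shift) auto
 then show ?thesis
  using assms m[of "i - 1"] m[of 0] f by (simp add: integral_distr acov_def add.commute)
qed

text \<open>The signs of the autocovariances are absorbed into a single kernel; after division by
  \<open>K\<^sup>2\<close> the joint bound of the functionals makes it at most
  \<open>norm x * norm y\<close>. One application of \<open>covariance_bound\<close> then treats the
  whole family, independently of its size.\<close>

lemma sum_acov_le:
 assumes I: "finite I" and K: "K > 0" "\<And>x. (\<Sum>c\<in>I. \<bar>blinfun_apply (v c) x\<bar>) <= K * norm x" and k: "k >= 1"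
 shows "(\<Sum>c\<in>I. \<bar>acov (v c) k\<bar>) <= K\<^sup>2 * Cc * real k powr - a"
proof -
 define s where "s c = sgn (acov (v c) k)" for c
 define h where "h x y = (\<Sum>c\<in>I. s c * ((v c) x * (v c) y)) / K\<^sup>2" for x y
 have s1: "\<bar>s c\<bar> <= 1" for c by (simp add: s_def sgn_real_def)
 have hm: "case_prod h \<in> borel_measurable (borel \<Otimes>\<^sub>M borel)"
  unfolding borel_prod h_def case_prod_beta' using K
  by (intro borel_measurable_continuous_onI continuous_intros) auto
 have hc: "continuous_on UNIV (\<lambda>x. h x y)" for y
  unfolding h_def using K by (intro continuous_intros) auto
 have hb: "\<bar>h x y\<bar> <= norm x * norm y" for x y
 proof -
  have "\<bar>\<Sum>c\<in>I. s c * ((v c) x * (v c) y)\<bar>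
    <= (\<Sum>c\<in>I. \<bar>(v c) x\<bar> * \<bar>(v c) y\<bar>)"
  proof (rule order_trans[OF sum_abs] , rule sum_mono)
   fix c
   have "\<bar>s c * ((v c) x * (v c) y)\<bar> <= 1 * (\<bar>(v c) x\<bar> * \<bar>(v c) y\<bar>)"
    unfolding abs_mult using s1 by (intro mult_right_mono) auto
   then show "\<bar>s c * ((v c) x * (v c) y)\<bar> <= \<bar>(v c) x\<bar> * \<bar>(v c) y\<bar>" by simp
  qed
  also have "... <= (\<Sum>c\<in>I. \<bar>(v c) x\<bar> * (K * norm y))"
  proof (intro sum_mono mult_left_mono)
   fix c assume "c \<in> I"
   then have "\<bar>(v c) y\<bar> <= (\<Sum>c\<in>I. \<bar>(v c) y\<bar>)" using I by (intro member_le_sum) auto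
   then show "\<bar>(v c) y\<bar> <= K * norm y" using K(2)[of y] by simp
  qed auto
  also have "... <= (K * norm x) * (K * norm y)"
   unfolding sum_distrib_right[symmetric] using K by (intro mult_right_mono) auto
  finally show ?thesis using K(1) by (simp add: h_def abs_divide power2_eq_square field_simps)
 qed
 have iv: "integrable M (\<lambda>w. (v c) (eps i w))" if "i >= 1" for c i
  using integrable_bounded_linear[OF blinfun.bounded_linear_right integrable_eps[OF that]] .
 have inner: "(\<E> w'. h x (eps (1 + k) w')) = 0" for x
 proof -
  have z: "(\<E> w'. (v c) (eps (Suc k) w')) = 0" for c
   by (rule integral_functional_eps) simp
  show ?thesis unfolding h_def using iv[of "Suc k"] by (simp add: z)
 qed
 have "(\<E> w. h (eps 1 w) (eps (1 + k) w)) = (\<Sum>c\<in>I. s c * acov (v c) k) / K\<^sup>2"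
  unfolding h_def acov_def using functional_product_integrable[of 1 "1 + k"] by simp
 moreover have "s c * acov (v c) k = \<bar>acov (v c) k\<bar>" for c by (simp add: s_def abs_sgn mult.commute)
 ultimately have eq: "(\<E> w. h (eps 1 w) (eps (1 + k) w)) = (\<Sum>c\<in>I. \<bar>acov (v c) k\<bar>) / K\<^sup>2" by simp
 have "\<bar>(\<Sum>c\<in>I. \<bar>acov (v c) k\<bar>) / K\<^sup>2\<bar> <= Cc * real k powr - a"
  using covariance_bound(2)[OF order_refl k hm hc hb] unfolding eq inner by simp
 then have "(\<Sum>c\<in>I. \<bar>acov (v c) k\<bar>) / K\<^sup>2 <= Cc * real k powr - a" by linarith
 then show ?thesis using K(1) by (simp add: field_simps)
qed

lemma square_psum_eq:
 "(\<E> z. (blinfun_apply v (psum {1..m} z))\<^sup>2)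
  = real m * acov v 0 + 2 * (\<Sum>k<m. (real m - real (Suc k)) * acov v (Suc k))"
proof (induction m)
 case (Suc m)
 have i1: "integrable M (\<lambda>z. (v (psum {1..m} z))\<^sup>2)" by (rule square_functional_psum) auto
 have split: "(v (psum {1..Suc m} z))\<^sup>2 = (v (psum {1..m} z))\<^sup>2
   + 2 * (\<Sum>i=1..m. v (eps i z) * v (eps (Suc m) z))
   + v (eps (Suc m) z) * v (eps (Suc m) z)" for z
 proof -
  let ?x = "v (psum {1..m} z)" and ?y = "v (eps (Suc m) z)"
  have 1: "v (psum {1..Suc m} z) = v (psum {1..m} z) + v (eps (Suc m) z)"
   by (simp add: psum_def blinfun.add_right)
  have 2: "?x * ?y = (\<Sum>i=1..m. v (eps i z) * v (eps (Suc m) z))"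
   by (simp add: psum_def blinfun.sum_right sum_distrib_right)
  have "(?x + ?y)\<^sup>2 = ?x\<^sup>2 + 2 * (?x * ?y) + ?y * ?y" by (simp add: power2_eq_square algebra_simps)
  then show ?thesis unfolding 1 2 .
 qed
 have "(\<E> z. (v (psum {1..Suc m} z))\<^sup>2) = (\<E> z. (v (psum {1..m} z))\<^sup>2)
   + 2 * (\<Sum>i=1..m. \<E> z. v (eps i z) * v (eps (Suc m) z))
   + (\<E> z. v (eps (Suc m) z) * v (eps (Suc m) z))"
 proof -
  have iP: "integrable M (\<lambda>z. v (eps i z) * v (eps (Suc m) z))" if "i \<in> {1..Suc m}" for i
   using that by (intro functional_product_integrable) auto
  have iS: "integrable M (\<lambda>z. 2 * (\<Sum>i=1..m. v (eps i z) * v (eps (Suc m) z)))"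
   by (intro integrable_mult_right intg_sum iP) auto
  have "(\<E> z. 2 * (\<Sum>i=1..m. v (eps i z) * v (eps (Suc m) z)))
    = 2 * (\<Sum>i=1..m. \<E> z. v (eps i z) * v (eps (Suc m) z))"
   by (subst integral_mult_right_zero, subst Bochner_Integration.integral_sum) (auto intro!: iP)
  then show ?thesis unfolding split
   using Bochner_Integration.integral_add[OF intg_add[OF i1 iS] iP[of "Suc m"]]
    Bochner_Integration.integral_add[OF i1 iS] by simp
 qed
 also have "(\<E> z. v (eps (Suc m) z) * v (eps (Suc m) z)) = acov v 0"
  using acov_shift[of "Suc m" v 0] by simp
 also have "(\<Sum>i=1..m. \<E> z. v (eps i z) * v (eps (Suc m) z)) = (\<Sum>i=1..m. acov v (Suc m - i))"
  by (intro sum.cong refl) (use acov_shift[of _ v] in \<open>metis add_diff_inverse_nat atLeastAtMost_iff le_SucI not_less\<close>)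
 also have "(\<Sum>i=1..m. acov v (Suc m - i)) = (\<Sum>k<m. acov v (Suc k))"
  by (rule sum.reindex_bij_witness[of _ "\<lambda>k. m - k" "\<lambda>i. m - i"]) (auto simp: Suc_diff_le)
 finally have "(\<E> z. (v (psum {1..Suc m} z))\<^sup>2)
   = real m * acov v 0 + 2 * (\<Sum>k<m. (real m - real (Suc k)) * acov v (Suc k)) + 2 * (\<Sum>k<m. acov v (Suc k)) + acov v 0"
  using Suc.IH by simp
 also have "... = real (Suc m) * acov v 0 + 2 * (\<Sum>k<Suc m. (real (Suc m) - real (Suc k)) * acov v (Suc k))"
  by (simp add: algebra_simps sum.distrib sum_subtractf sum_distrib_left)
 finally show ?case .
qed (simp add: psum_def blinfun.zero_right)

lemma a_gt2: "a > 2"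
 by (rule less_trans[OF _ a_gt]) (use delta in simp)

lemma summable_weights: "summable (\<lambda>k. real (Suc k) * real (Suc k) powr - a)"
proof -
 have "summable (\<lambda>k. real k powr (1 - a))"
  using a_gt2 by (subst summable_real_powr_iff) auto
 then have "summable (\<lambda>k. real (Suc k) powr (1 - a))" by (rule summable_Suc_iff[THEN iffD2])
 moreover have "real (Suc k) powr (1 - a) = real (Suc k) * real (Suc k) powr - a" for k
  using powr_add[of "real (Suc k)" 1 "- a"] by simp
 ultimately show ?thesis by simp
qed

definition Dc :: real where "Dc = 2 * Cc * (\<Sum>k. real (Suc k) * real (Suc k) powr - a)"

lemma Cc_pos: "Cc > 0" using m_r_ge1 B_pos by (simp add: Cc_def)

lemma Dc_nonneg: "Dc >= 0"
 unfolding Dc_def using Cc_pos by (intro mult_nonneg_nonneg suminf_nonneg summable_weights) auto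

lemma acov_le: "k >= 1 ==> \<bar>acov v k\<bar> <= (1 + norm v)\<^sup>2 * Cc * real k powr - a"
proof -
 have "\<bar>blinfun_apply v x\<bar> <= (1 + norm v) * norm x" for x
  using norm_blinfun[of v x] by (simp add: distrib_right add_increasing)
 then show "k >= 1 ==> ?thesis"
  using sum_acov_le[of "{()}" "1 + norm v" "\<lambda>_. v" k] by (simp add: add_pos_nonneg)
qed

lemma summable_acov: "summable (\<lambda>k. real (Suc k) * \<bar>acov v (Suc k)\<bar>)" "summable (\<lambda>k. \<bar>acov v (Suc k)\<bar>)" "summable (\<lambda>k. acov v (Suc k))"
proof -
 have b: "real (Suc k) * \<bar>acov v (Suc k)\<bar> <= ((1 + norm v)\<^sup>2 * Cc) * (real (Suc k) * real (Suc k) powr - a)" for k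
  using mult_left_mono[OF acov_le[of "Suc k" v], of "real (Suc k)"] by (simp add: mult_ac)
 show 1: "summable (\<lambda>k. real (Suc k) * \<bar>acov v (Suc k)\<bar>)"
  by (rule summable_comparison_test'[OF summable_mult[OF summable_weights, of "(1 + norm v)\<^sup>2 * Cc"], of 0]) (use b in auto)
 show 2: "summable (\<lambda>k. \<bar>acov v (Suc k)\<bar>)"
  by (rule summable_comparison_test'[OF 1, of 0]) (auto simp: mult_le_cancel_right1)
 show "summable (\<lambda>k. acov v (Suc k))" by (rule summable_rabs_cancel[OF 2])
qed

lemma long_run_cov_eq: "lrc v v = acov v 0 + 2 * (\<Sum>k. acov v (Suc k))"
proof -
 have "lrc v v = acov v 0 + (\<Sum>k. 2 * acov v (Suc k))"
  by (simp add: long_run_cov_def acov_def mult.commute)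
 then show ?thesis using summable_acov(3) by (simp add: suminf_mult)
qed

text \<open>The variance of the sum weights lag \<open>k\<close> by \<open>m - k\<close>; compared
  with \<open>m\<close> times the full series each lag loses at most \<open>min k m\<close>, so the
  error stays bounded in \<open>m\<close> once lag times autocovariance is summable. That is where
  \<open>a > 2\<close> enters.\<close>

lemma square_psum_close:
 "\<bar>(\<E> x. (blinfun_apply v (psum {1..m} x))\<^sup>2) - real m * lrc v v\<bar>
  <= 2 * (\<Sum>k. real (Suc k) * \<bar>acov v (Suc k)\<bar>)"
proof -
 define g where "g k = (if k < m then real (Suc k) else real m) * acov v (Suc k)" for k
 have gb: "\<bar>g k\<bar> <= real (Suc k) * \<bar>acov v (Suc k)\<bar>" for k
  unfolding g_def abs_mult by (intro mult_right_mono) auto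
 have sg: "summable (\<lambda>k. \<bar>g k\<bar>)"
  by (rule summable_comparison_test'[OF summable_acov(1), of 0]) (use gb in auto)
 have "(\<Sum>k<m. (real m - real (Suc k)) * acov v (Suc k)) = (\<Sum>k. if k < m then (real m - real (Suc k)) * acov v (Suc k) else 0)"
  by (subst suminf_finite[of "{..<m}"]) auto
 moreover have "summable (\<lambda>k. if k < m then (real m - real (Suc k)) * acov v (Suc k) else 0)"
  by (rule summable_finite[of "{..<m}"]) auto
 ultimately have "real m * (\<Sum>k. acov v (Suc k)) - (\<Sum>k<m. (real m - real (Suc k)) * acov v (Suc k))
   = (\<Sum>k. real m * acov v (Suc k) - (if k < m then (real m - real (Suc k)) * acov v (Suc k) else 0))"
  using suminf_diff[OF summable_mult[OF summable_acov(3), of "real m" v],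
    of "\<lambda>k. if k < m then (real m - real (Suc k)) * acov v (Suc k) else 0"]
   suminf_mult[OF summable_acov(3), of "real m" v]
  by (simp only:)
 also have "(\<lambda>k. real m * acov v (Suc k) - (if k < m then (real m - real (Suc k)) * acov v (Suc k) else 0)) = g"
  by (auto simp: g_def algebra_simps)
 finally have "(\<E> x. (v (psum {1..m} x))\<^sup>2) - real m * lrc v v = - 2 * suminf g"
  unfolding square_psum_eq long_run_cov_eq by (simp add: algebra_simps)
 moreover have "\<bar>suminf g\<bar> <= (\<Sum>k. \<bar>g k\<bar>)" by (rule summable_rabs[OF sg])
 moreover have "(\<Sum>k. \<bar>g k\<bar>) <= (\<Sum>k. real (Suc k) * \<bar>acov v (Suc k)\<bar>)"
  by (intro suminf_le gb sg summable_acov(1))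
 ultimately show ?thesis by linarith
qed

text \<open>Summing over the family inside the series over lags keeps the total error free of the
  size of the family.\<close>

lemma sum_square_psum_close:
 assumes I: "finite I" and K: "K > 0" "\<And>x. (\<Sum>c\<in>I. \<bar>blinfun_apply (v c) x\<bar>) <= K * norm x"
 shows "(\<Sum>c\<in>I. \<bar>(\<E> z. ((v c) (psum {1..m} z))\<^sup>2) - real m * lrc (v c) (v c)\<bar>) <= K\<^sup>2 * Dc"
proof -
 have "(\<Sum>c\<in>I. \<bar>(\<E> z. ((v c) (psum {1..m} z))\<^sup>2) - real m * lrc (v c) (v c)\<bar>)
   <= (\<Sum>c\<in>I. 2 * (\<Sum>k. real (Suc k) * \<bar>acov (v c) (Suc k)\<bar>))"
  by (intro sum_mono square_psum_close)
 also have "... = 2 * (\<Sum>k. \<Sum>c\<in>I. real (Suc k) * \<bar>acov (v c) (Suc k)\<bar>)"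
  by (subst suminf_sum) (auto simp: summable_acov sum_distrib_left simp del: of_nat_Suc)
 also have "... <= 2 * (\<Sum>k. K\<^sup>2 * Cc * (real (Suc k) * real (Suc k) powr - a))"
 proof (intro mult_left_mono suminf_le)
  show "summable (\<lambda>k. \<Sum>c\<in>I. real (Suc k) * \<bar>acov (v c) (Suc k)\<bar>)" by (intro summable_sum summable_acov)
  show "summable (\<lambda>k. K\<^sup>2 * Cc * (real (Suc k) * real (Suc k) powr - a))" by (intro summable_mult summable_weights)
  fix k
  have "(\<Sum>c\<in>I. real (Suc k) * \<bar>acov (v c) (Suc k)\<bar>) = real (Suc k) * (\<Sum>c\<in>I. \<bar>acov (v c) (Suc k)\<bar>)"
   by (simp add: sum_distrib_left)
  also have "... <= real (Suc k) * (K\<^sup>2 * Cc * real (Suc k) powr - a)"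
   by (intro mult_left_mono sum_acov_le I K) auto
  finally show "(\<Sum>c\<in>I. real (Suc k) * \<bar>acov (v c) (Suc k)\<bar>) <= K\<^sup>2 * Cc * (real (Suc k) * real (Suc k) powr - a)"
   by (simp only: mult_ac)
 qed simp
 also have "... = K\<^sup>2 * Dc" using suminf_mult[OF summable_weights, of "K\<^sup>2 * Cc"] by (simp add: Dc_def)
 finally show ?thesis .
qed

text \<open>Long blocks, made independent, grow at least like \<open>sqrt J\<close>. Their sum is
  the full sum minus the gaps, and the gaps are made independent in turn, with the blocks as their
  separation. The family enters the errors only through \<open>K\<close> and its total standard
  deviation.\<close>

lemma block_step:
 assumes I: "finite I" and K: "K > 0" "\<And>x. (\<Sum>c\<in>I. \<bar>blinfun_apply (v c) x\<bar>) <= K * norm x"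
  and pq: "p >= 1" "q >= 1"
 shows "sqrt (real J) * (\<E> w. (\<Sum>c\<in>I. \<bar>(v c) (psum {1..p} w)\<bar>))
  <= 4 * ((\<E> w. (\<Sum>c\<in>I. \<bar>(v c) (psum {1..J * (p + q)} w)\<bar>))
   + sqrt (real J) * real q * (\<Sum>c\<in>I. sqrt (\<E> w. ((v c) (eps 1 w))\<^sup>2))
   + real J * (K * real p * Cd * real q powr - a') + real J * (K * real q * Cd * real p powr - a'))"
proof -
 define N where "N x = (\<Sum>c\<in>I. \<bar>(v c) x\<bar>)" for x
 have tri: "N (x + y) <= N x + N y" for x y
  unfolding N_def sum.distrib[symmetric] by (intro sum_mono) (simp add: blinfun.add_right abs_triangle_ineq)
 have neg: "N (- x) = N x" for x by (simp add: N_def blinfun.minus_right)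
 have Nlip: "\<bar>N x - N y\<bar> <= K * norm (x - y)" for x y
 proof -
  have "N x <= N y + N (x - y)" using tri[of y "x - y"] by simp
  moreover have "N y <= N x + N (x - y)" using tri[of x "y - x"] neg[of "x - y"] by simp
  moreover have "N (x - y) <= K * norm (x - y)" unfolding N_def by (rule K)
  ultimately show ?thesis by linarith
 qed
 have lip1: "\<exists>K. \<forall>x y. \<bar>\<bar>(v c) x\<bar> - \<bar>(v c) y\<bar>\<bar> <= K * norm (x - y)" for c
  using abs_functional_lipschitz by blast
 have AN: "(Aop r ^^ J) N 0 = (\<Sum>c\<in>I. (Aop r ^^ J) (\<lambda>z. \<bar>(v c) z\<bar>) 0)" for r
  unfolding N_def[abs_def] by (rule Aop_funpow_sum[OF lip1])
 have iN: "integrable M (\<lambda>w. N (V w))" if "integrable M V" for V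
  by (rule integrable_lipschitz_comp[OF that Nlip])
 let ?Z = "\<lambda>w. \<Sum>j<J. psum (blk 0 p q j) w" and ?B = "\<lambda>w. \<Sum>j<J. psum (blk p q p j) w"
 have iZ: "integrable M ?Z" and iB: "integrable M ?B"
  by (intro intg_sum integrable_psum; auto simp: blk_def)+
 have iS: "integrable M (psum {1..J * (p + q)})" by (rule integrable_psum) auto
 have iv: "integrable M (\<lambda>w. \<bar>(v c) (psum {1..p} w)\<bar>)" for c
  by (intro integrable_abs integrable_functional_psum) auto
 have "sqrt (real J) * (\<E> w. (\<Sum>c\<in>I. \<bar>(v c) (psum {1..p} w)\<bar>))
   = (\<Sum>c\<in>I. sqrt (real J) * (\<E> w. \<bar>(v c) (psum {1..p} w)\<bar>))"
  using iv by (simp add: sum_distrib_left)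
 also have "... <= (\<Sum>c\<in>I. 4 * (Aop p ^^ J) (\<lambda>z. \<bar>(v c) z\<bar>) 0)"
  by (intro sum_mono Aop_funpow_abs_ge)
 also have "... = 4 * (Aop p ^^ J) N 0" unfolding AN by (simp add: sum_distrib_left)
 finally have 1: "sqrt (real J) * (\<E> w. (\<Sum>c\<in>I. \<bar>(v c) (psum {1..p} w)\<bar>)) <= 4 * (Aop p ^^ J) N 0" .
 have 2: "(Aop p ^^ J) N 0 <= (\<E> w. N (?Z w)) + real J * (K * real p * Cd * real q powr - a')"
  using decouple_blocks[OF pq Nlip, of 0 0 J] by simp
 have 3: "(\<E> w. N (?Z w)) <= (\<E> w. N (psum {1..J * (p + q)} w)) + (\<E> w. N (?B w))"
 proof -
  have "N (?Z w) <= N (psum {1..J * (p + q)} w) + N (?B w)" for w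
   using tri[of "psum {1..J * (p + q)} w" "- ?B w"] neg[of "?B w"] unfolding psum_union_blocks by simp
  then have "(\<E> w. N (?Z w)) <= (\<E> w. N (psum {1..J * (p + q)} w) + N (?B w))"
   by (intro integral_mono iN iZ intg_add iS iB)
  then show ?thesis using iN[OF iS] iN[OF iB] by simp
 qed
 have 4: "(\<E> w. N (?B w)) <= (Aop q ^^ J) N 0 + real J * (K * real q * Cd * real p powr - a')"
  using decouple_blocks[OF pq(2,1) Nlip, of 0 p J] by simp
 have 5: "(Aop q ^^ J) N 0 <= sqrt (real J) * real q * (\<Sum>c\<in>I. sqrt (\<E> w. ((v c) (eps 1 w))\<^sup>2))"
 proof -
  have "(Aop q ^^ J) N 0 <= (\<Sum>c\<in>I. sqrt (real J) * real q * sqrt (\<E> w. ((v c) (eps 1 w))\<^sup>2))"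
   unfolding AN
  proof (rule sum_mono)
   fix c
   have "(Aop q ^^ J) (\<lambda>z. \<bar>(v c) z\<bar>) 0 <= sqrt (real J * (\<E> w. ((v c) (psum {1..q} w))\<^sup>2))"
    using Aop_funpow_abs_le[where p = q and J = J and v = "v c" and z = 0] by (simp add: blinfun.zero_right)
   also have "... <= sqrt (real J * ((real q)\<^sup>2 * (\<E> w. ((v c) (eps 1 w))\<^sup>2)))"
    using square_functional_psum(2)[of "{1..q}" "v c"] by (intro real_sqrt_le_mono mult_left_mono) auto
   finally show "(Aop q ^^ J) (\<lambda>z. \<bar>(v c) z\<bar>) 0 <= sqrt (real J) * real q * sqrt (\<E> w. ((v c) (eps 1 w))\<^sup>2)"
    by (simp add: real_sqrt_mult mult.assoc)
  qed
  then show ?thesis by (simp add: sum_distrib_left)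
 qed
 have "r1 <= 4 * (r4 + r7 + r8 + r9)" if "r1 <= 4 * r2" "r2 <= r3 + r8" "r3 <= r4 + r5" "r5 <= r6 + r9" "r6 <= r7"
  for r1 r2 r3 r4 r5 r6 r7 r8 r9 :: real using that by simp
 from this[OF 1 2 3 4 5] show ?thesis unfolding N_def .
qed

section \<open>Tightness of the partial sums\<close>

definition escale :: "nat set => (nat => L1_dual) => nat => real" where
 "escale I v n = (\<E> x. (\<Sum>c\<in>I. \<bar>blinfun_apply (v c) (psum {1..n} x)\<bar>)) / sqrt n"

text \<open>Data uniform over the families in use: 2 is the bound for \<open>x - proj m x\<close>,
  and \<open>W\<close> limits the total standard deviation of a single error, which pays for the
  gaps between blocks.\<close>

definition family :: "real => nat set => (nat => L1_dual) => bool" where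
 "family W I v \<longleftrightarrow> finite I \<and> (\<forall>x. (\<Sum>c\<in>I. \<bar>blinfun_apply (v c) x\<bar>) <= 2 * norm x) \<and>
   (\<Sum>c\<in>I. sqrt (\<E> z. ((v c) (eps 1 z))\<^sup>2)) <= W"

lemma a'_gt2: "a' > 2"
proof -
 have "a < a * ((1 + \<delta>) / \<delta>)" using a_gt2 delta by (simp add: field_simps)
 then show ?thesis using a_gt2 by (simp add: a'_def)
qed

lemma Cd_pos: "Cd > 0" using m_r_ge1 B_pos by (simp add: Cd_def)

lemma floor_half: "x >= 1 ==> x / 2 <= real (nat \<lfloor>x\<rfloor>) \<and> real (nat \<lfloor>x\<rfloor>) <= x \<and> nat \<lfloor>x\<rfloor> >= 1"
proof -
 assume x: "x >= 1"
 define k where "k = \<lfloor>x\<rfloor>"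
 have k: "k >= 1" using x by (simp add: le_floor_iff k_def)
 have 1: "real (nat k) = of_int k" using k by simp
 have 2: "of_int k >= (1::real)" using k by simp
 have 3: "of_int k <= x" "x < of_int k + 1" unfolding k_def by linarith+
 have "x / 2 <= of_int k" using 2 3(2) by simp
 moreover have "nat k >= 1" using k by simp
 ultimately show ?thesis using 3(1) unfolding k_def[symmetric] 1 by blast
qed

text \<open>Blocks of length \<open>n\<close>, gaps of about \<open>n powr 0.4\<close>, about
  \<open>n powr 0.2\<close> blocks. The gaps cost \<open>n powr (0.4 - 0.5)\<close>, the decoupling
  at most \<open>n powr (0.1 + 0.5 - 0.8)\<close> because \<open>a' > 2\<close>. The new length is
  near \<open>n powr 1.2\<close>; \<open>n >= 1024\<close>, that is \<open>n powr 0.1 >= 2\<close>,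
  absorbs the rounding and leaves \<open>n powr 1.1\<close>. The factor 6 is 4 times 1.5, where 1.5
  exceeds \<open>sqrt 2\<close>.\<close>

lemma escale_step:
 assumes n: "n >= 1024"
 obtains m where "real m >= real n powr 1.1"
  "\<And>W I v. family W I v ==> escale I v n <= 6 * escale I v m + (4 * W + 64 * Cd) * real n powr - 0.1"
proof -
 define q where "q = nat \<lfloor>real n powr 0.4\<rfloor>"
 define J where "J = nat \<lfloor>real n powr 0.2\<rfloor>"
 define m where "m = J * (n + q)"
 have n1: "real n >= 1" using n by simp
 have q: "real n powr 0.4 / 2 <= real q" "real q <= real n powr 0.4" "q >= 1"
  using floor_half[of "real n powr 0.4"] n1 by (simp_all add: q_def ge_one_powr_ge_zero)
 have J: "real n powr 0.2 / 2 <= real J" "real J <= real n powr 0.2" "J >= 1"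
  using floor_half[of "real n powr 0.2"] n1 by (simp_all add: J_def ge_one_powr_ge_zero)
 have qn: "real q <= real n"
 proof -
  have "real n powr 0.4 <= real n powr 1" using n1 by (intro powr_mono) auto
  then show ?thesis using q(2) n1 by simp
 qed
 have n01: "real n powr 0.1 >= 2"
 proof -
  have "(2::real) = 1024 powr 0.1"
   using powr_powr[of 2 10 "0.1::real"] by (simp add: powr_numeral)
  also have "... <= real n powr 0.1" using n by (intro powr_mono2) auto
  finally show ?thesis .
 qed
 have "real n powr 1.1 * 2 <= real n powr 1.1 * real n powr 0.1" using n01 by (intro mult_left_mono) auto
 also have "... = real n powr 0.2 * real n" using n1 by (simp add: powr_add[symmetric] powr_mult_base mult.commute)
 also have "... <= 2 * real J * real n" using J(1) by (intro mult_right_mono) auto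
 also have "... <= 2 * real m" by (simp add: m_def algebra_simps)
 finally have m1: "real m >= real n powr 1.1" by simp
 have bound: "escale I v n <= 6 * escale I v m + (4 * W + 64 * Cd) * real n powr - 0.1" if fam: "family W I v" for W I v
 proof -
  define En where "En = (\<E> x. (\<Sum>c\<in>I. \<bar>blinfun_apply (v c) (psum {1..n} x)\<bar>))"
  define Em where "Em = (\<E> x. (\<Sum>c\<in>I. \<bar>(v c) (psum {1..m} x)\<bar>))"
  define w where "w = (\<Sum>c\<in>I. sqrt (\<E> x. ((v c) (eps 1 x))\<^sup>2))"
  define X where "X = 2 * real n * Cd * real q powr - a'"
  define s where "s = sqrt (real J)"
  define t where "t = sqrt n"
  have s: "s > 0" "s * s = real J" using J(3) by (simp_all add: s_def)
  have t: "t > 0" "t * t = real n" using n1 by (simp_all add: t_def)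
  have Em0: "Em >= 0" unfolding Em_def by (intro Bochner_Integration.integral_nonneg sum_nonneg) auto
  have w: "w <= W" "w >= 0" using fam by (auto simp: family_def w_def intro!: sum_nonneg)
  have X0: "X >= 0" using Cd_pos by (simp add: X_def)
  have qX: "2 * real q * Cd * real n powr - a' <= X"
   unfolding X_def using qn Cd_pos q(3) a'_gt2 by (intro mult_mono powr_mono2') auto
  have "s * En <= 4 * (Em + s * real q * w + real J * X + real J * (2 * real q * Cd * real n powr - a'))"
   using block_step[of I 2 v n q J] fam n q(3)
   unfolding family_def En_def Em_def w_def X_def s_def m_def by simp
  also have "... <= 4 * (Em + s * real q * w + real J * X + real J * X)"
   by (intro mult_left_mono add_left_mono qX) auto
  also have "... = s * (4 * (Em / s + real q * w + 2 * s * X))"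
   using s by (simp add: field_simps)
  finally have "En <= 4 * (Em / s + real q * w + 2 * s * X)" using s(1) by simp
  then have "En / t <= 4 * (Em / s + real q * w + 2 * s * X) / t" using t(1) by (intro divide_right_mono) auto
  also have "... = 4 * (Em / (s * t)) + 4 * (real q * w / t) + 8 * (s * X / t)"
   using s t by (simp add: field_simps)
  finally have main: "En / t <= 4 * (Em / (s * t)) + 4 * (real q * w / t) + 8 * (s * X / t)" .
  have 1: "Em / (s * t) <= 1.5 * (Em / sqrt (real m))"
  proof -
   have "real m <= 2 * (real J * real n)" using mult_left_mono[OF qn, of "real J"] by (simp add: m_def algebra_simps)
   then have "sqrt (real m) <= sqrt (2 * (real J * real n))" by simp
   also have "... = sqrt 2 * (s * t)" by (simp add: s_def t_def real_sqrt_mult)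
   also have "... <= 1.5 * (s * t)"
   proof (rule mult_right_mono)
    show "sqrt 2 <= (1.5::real)" by (rule real_le_lsqrt) (auto simp: power2_eq_square)
   qed (use s t in auto)
   finally have sm: "sqrt (real m) <= 1.5 * (s * t)" .
   have mp: "sqrt (real m) > 0" using J(3) n by (simp add: m_def)
   have "Em * sqrt (real m) <= Em * (1.5 * (s * t))" by (intro mult_left_mono sm Em0)
   then show ?thesis using s t mp by (simp add: field_simps)
  qed
  have tp: "t = real n powr 0.5" by (simp add: t_def powr_half_sqrt)
  have 2: "real q * w / t <= W * real n powr - 0.1"
  proof -
   have "real q * w / t <= real n powr 0.4 * W / t"
    using q w t by (intro divide_right_mono mult_mono) auto
   also have "... = W * (real n powr 0.4 / real n powr 0.5)" by (simp add: tp)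
   also have "real n powr 0.4 / real n powr 0.5 = real n powr - 0.1" by (simp add: powr_diff[symmetric])
   finally show ?thesis .
  qed
  have 3: "s * X / t <= 8 * Cd * real n powr - 0.1"
  proof -
   have sp: "s <= real n powr 0.1"
   proof -
    have "s <= sqrt (real n powr 0.2)" unfolding s_def using J(2) by simp
    also have "... = real n powr 0.1" by (simp add: powr_half_sqrt[symmetric] powr_powr)
    finally show ?thesis .
   qed
   have "real q powr - a' <= real q powr - 2" using a'_gt2 q(3) by (intro powr_mono) auto
   also have "... <= (real n powr 0.4 / 2) powr - 2" using q n1 by (intro powr_mono2') auto
   also have "... = 4 * real n powr - 0.8"
    using n1 by (subst powr_divide) (auto simp: powr_powr powr_minus_divide powr_numeral)
   finally have qa: "real q powr - a' <= 4 * real n powr - 0.8" .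
   have "s * X / t = (s * 2 * Cd * real q powr - a') * (real n / t)" by (simp add: X_def)
   also have "real n / t = t" using t by (simp add: t(2)[symmetric])
   also have "(s * 2 * Cd * real q powr - a') * t <= (real n powr 0.1 * 2 * Cd * (4 * real n powr - 0.8)) * t"
    using sp qa Cd_pos s t by (intro mult_right_mono mult_mono) auto
   also have "... = 8 * Cd * (real n powr 0.1 * real n powr - 0.8 * real n powr 0.5)" by (simp add: tp)
   also have "real n powr 0.1 * real n powr - 0.8 * real n powr 0.5 = real n powr - 0.2" by (simp add: powr_add[symmetric])
   also have "8 * Cd * real n powr - 0.2 <= 8 * Cd * real n powr - 0.1"
    using Cd_pos n1 by (intro mult_left_mono powr_mono) auto
   finally show ?thesis .
  qed
  have "escale I v n <= 4 * (1.5 * escale I v m) + 4 * (W * real n powr - 0.1) + 8 * (8 * Cd * real n powr - 0.1)"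
   using main 1 2 3 unfolding escale_def En_def[symmetric] Em_def[symmetric] t_def[symmetric] by linarith
  then show ?thesis by (simp add: algebra_simps)
 qed
 show ?thesis by (rule that[OF m1 bound])
qed

text \<open>Later stages start from larger samples, so their error terms are at most the first one;
  each of the \<open>r\<close> terms carries a factor of at most \<open>6 ^ r\<close>.\<close>

lemma escale_iterate:
 "n >= 1024 ==> \<exists>m. real m >= real n powr (1.1 ^ r) \<and> (\<forall>W I v. family W I v \<longrightarrow>
  escale I v n <= 6 ^ r * escale I v m + real r * 6 ^ r * (4 * W + 64 * Cd) * real n powr - 0.1)"
proof (induction r arbitrary: n)
 case 0
 then show ?case by (intro exI[of _ n]) auto
next
 case (Suc r)
 obtain m1 where m1: "real m1 >= real n powr 1.1"
  "\<And>W I v. family W I v ==> escale I v n <= 6 * escale I v m1 + (4 * W + 64 * Cd) * real n powr - 0.1"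
  using escale_step[OF Suc.prems] by blast
 have n1: "real n >= 1" using Suc.prems by simp
 have "real n powr 1 <= real n powr 1.1" using n1 by (intro powr_mono) auto
 then have nm: "real n <= real m1" using m1(1) n1 by simp
 then have "m1 >= 1024" using Suc.prems by simp
 from Suc.IH[OF this] obtain m where m: "real m >= real m1 powr (1.1 ^ r)"
  "\<And>W I v. family W I v ==>
   escale I v m1 <= 6 ^ r * escale I v m + real r * 6 ^ r * (4 * W + 64 * Cd) * real m1 powr - 0.1" by blast
 show ?case
 proof (intro exI[of _ m] conjI allI impI)
  have "real n powr (1.1 ^ Suc r) = (real n powr 1.1) powr (1.1 ^ r)" by (simp add: powr_powr)
  also have "... <= real m1 powr (1.1 ^ r)" using m1(1) by (intro powr_mono2) auto
  finally show "real n powr (1.1 ^ Suc r) <= real m" using m(1) by linarith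
  fix W I v assume fam: "family W I v"
  have W0: "W >= 0" using fam unfolding family_def
   by (meson order_trans sum_nonneg real_sqrt_ge_zero Bochner_Integration.integral_nonneg zero_le_power2)
  let ?k = "4 * W + 64 * Cd"
  have k0: "?k >= 0" using W0 Cd_pos by simp
  have "real m1 powr - 0.1 <= real n powr - 0.1" using nm n1 by (intro powr_mono2') auto
  then have "real r * 6 ^ r * ?k * real m1 powr - 0.1 <= real r * 6 ^ r * ?k * real n powr - 0.1"
   using k0 by (intro mult_left_mono) auto
  then have "escale I v m1 <= 6 ^ r * escale I v m + real r * 6 ^ r * ?k * real n powr - 0.1"
   using m(2)[OF fam] by linarith
  then have "escale I v n <= 6 * (6 ^ r * escale I v m + real r * 6 ^ r * ?k * real n powr - 0.1) + ?k * real n powr - 0.1"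
   by (intro order_trans[OF m1(2)[OF fam]] add_right_mono mult_left_mono) auto
  also have "... <= 6 * (6 ^ r * escale I v m + real r * 6 ^ r * ?k * real n powr - 0.1) + 6 ^ Suc r * (?k * real n powr - 0.1)"
  proof -
   have "?k * real n powr - 0.1 * 1 <= ?k * real n powr - 0.1 * 6 ^ Suc r"
    using k0 by (intro mult_left_mono one_le_power) auto
   then show ?thesis by (simp add: mult.commute)
  qed
  also have "... = 6 ^ Suc r * escale I v m + real (Suc r) * 6 ^ Suc r * ?k * real n powr - 0.1"
   by (simp add: algebra_simps)
  finally show "escale I v n <= 6 ^ Suc r * escale I v m + real (Suc r) * 6 ^ Suc r * ?k * real n powr - 0.1" .
 qed
qed

text \<open>The deviations \<open>D c\<close> have a bounded total, and Cauchy-Schwarz turns the sum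
  of their roots into the root of \<open>card I\<close>. Divided by \<open>sqrt m\<close> this is
  small only once \<open>m\<close> is large against the number of functionals.\<close>

lemma escale_le_long_run:
 assumes fam: "family W I v" and m: "m >= 1" and nn: "\<And>c. c \<in> I ==> lrc (v c) (v c) >= 0"
 shows "escale I v m <= (\<Sum>c\<in>I. sqrt (lrc (v c) (v c))) + sqrt (real (card I) * (4 * Dc) / real m)"
proof -
 have fin: "finite I" and K: "\<And>x. (\<Sum>c\<in>I. \<bar>blinfun_apply (v c) x\<bar>) <= 2 * norm x"
  using fam by (auto simp: family_def)
 define L where "L c = lrc (v c) (v c)" for c
 define V where "V c = (\<E> z. ((v c) (psum {1..m} z))\<^sup>2)" for c
 define D where "D c = \<bar>V c - real m * L c\<bar>" for c
 have iv: "integrable M (\<lambda>z. \<bar>(v c) (psum {1..m} z)\<bar>)" for c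
  by (intro integrable_abs integrable_functional_psum) auto
 have "(\<E> z. (\<Sum>c\<in>I. \<bar>(v c) (psum {1..m} z)\<bar>)) = (\<Sum>c\<in>I. \<E> z. \<bar>(v c) (psum {1..m} z)\<bar>)"
  using iv by simp
 also have "... <= (\<Sum>c\<in>I. sqrt (real m) * sqrt (L c) + sqrt (D c))"
 proof (rule sum_mono)
  fix c assume c: "c \<in> I"
  have "(\<E> z. \<bar>(v c) (psum {1..m} z)\<bar>) <= sqrt (V c)"
   using expectation_le_sqrt(2)[of "\<lambda>z. \<bar>(v c) (psum {1..m} z)\<bar>"]
    square_functional_psum(1)[of "{1..m}" "v c"] borel_measurable_integrable[OF iv]
   unfolding V_def by (simp add: abs_le_iff)
  also have "... <= sqrt (real m * L c + D c)" unfolding D_def by (intro real_sqrt_le_mono) simp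
  also have "... <= sqrt (real m * L c) + sqrt (D c)"
   using nn[OF c] by (intro sqrt_add_le_add_sqrt) (auto simp: L_def D_def)
  finally show "(\<E> z. \<bar>(v c) (psum {1..m} z)\<bar>) <= sqrt (real m) * sqrt (L c) + sqrt (D c)"
   by (simp add: real_sqrt_mult)
 qed
 also have "... = sqrt (real m) * (\<Sum>c\<in>I. sqrt (L c)) + (\<Sum>c\<in>I. sqrt (D c))"
  by (simp add: sum.distrib sum_distrib_left)
 also have "(\<Sum>c\<in>I. sqrt (D c)) <= sqrt (real (card I) * (4 * Dc))"
 proof -
  have "(\<Sum>c\<in>I. sqrt (D c) * 1)\<^sup>2 <= (\<Sum>c\<in>I. (sqrt (D c))\<^sup>2) * (\<Sum>c\<in>I. 1\<^sup>2)" by (rule Cauchy_Schwarz_ineq_sum)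
  also have "... = (\<Sum>c\<in>I. D c) * real (card I)" by (simp add: D_def)
  also have "... <= (4 * Dc) * real (card I)"
   using sum_square_psum_close[OF fin _ K, of m] unfolding D_def V_def L_def by (intro mult_right_mono) auto
  finally show ?thesis by (intro real_le_rsqrt) (simp add: mult.commute)
 qed
 finally have "(\<E> z. (\<Sum>c\<in>I. \<bar>(v c) (psum {1..m} z)\<bar>))
   <= sqrt (real m) * (\<Sum>c\<in>I. sqrt (L c)) + sqrt (real (card I) * (4 * Dc))" by simp
 then have "escale I v m <= (sqrt (real m) * (\<Sum>c\<in>I. sqrt (L c)) + sqrt (real (card I) * (4 * Dc))) / sqrt (real m)"
  unfolding escale_def by (intro divide_right_mono) auto
 also have "... = (\<Sum>c\<in>I. sqrt (L c)) + sqrt (real (card I) * (4 * Dc) / real m)"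
  using m by (simp add: add_divide_distrib real_sqrt_divide)
 finally show ?thesis unfolding L_def .
qed

end

section \<open>Functionals of the residual on fine cells\<close>

definition resid :: "nat => nat => nat => L1_dual" where
 "resid m N c = cellf N c o\<^sub>L (id_blinfun - Blinfun (proj m))"

lemma resid_apply: "resid m N c x = cellf N c (x - proj m x)"
 by (simp add: resid_def blinfun.diff_left bounded_linear_Blinfun_apply[OF bounded_linear_proj])

lemma sum_resid_le:
 assumes "N > 0"
 shows "(\<Sum>c<N. \<bar>resid m N c x\<bar>) <= norm (x - proj m x)"
 unfolding resid_apply by (rule sum_abs_cellf_le[OF assms])

context mixing_seq begin

text \<open>The hypotheses concern different objects: \<open>H1\<close> the long run variances,
  which must be small uniformly in the refinement \<open>R\<close>; \<open>H2\<close> a single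
  error, at a polynomial rate; \<open>H3\<close> the standard deviations of a single error, whose
  total may be large but must be bounded in \<open>m\<close> and \<open>R\<close>.\<close>

lemma proj_tail_small:
 fixes g CA W :: real
 assumes nn: "\<And>v. lrc v v >= 0"
  and H1: "\<And>w. w > 0 ==> \<exists>m1. \<forall>m\<ge>m1. \<forall>R\<ge>1. m >= 1 \<longrightarrow> (\<Sum>c<m * R. sqrt (lrc (resid m (m * R) c) (resid m (m * R) c))) <= w"
  and H2: "g > 0" "\<And>N. N >= 1 ==> (\<E> z. norm (eps 1 z - proj N (eps 1 z))) <= CA * real N powr - g"
  and H3: "\<And>m R. m >= 1 ==> R >= 1 ==> (\<Sum>c<m * R. sqrt (\<E> z. (resid m (m * R) c (eps 1 z))\<^sup>2)) <= W"
  and w: "w > 0"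
 shows "\<exists>m1. \<forall>m\<ge>m1. EV n. (\<E> z. norm (psum {1..n} z - proj m (psum {1..n} z))) <= w * sqrt n"
proof -
 \<comment> \<open>Enough steps for a sample of size \<open>n powr (1.1 ^ r)\<close> to exceed the
   number of cells, of order \<open>n powr (1 / g)\<close>, by a factor \<open>n\<close>.\<close>
 obtain r :: nat where r: "1 / g + 1 <= (1.1::real) ^ r"
  using real_arch_pow[of "1.1::real" "1 / g + 1"] by (auto intro: less_imp_le)
 \<comment> \<open>Half of \<open>w\<close> is reserved for the long run part, divided by the factor
   \<open>6 ^ r\<close> that the iteration loses.\<close>
 obtain m1 where m1: "\<And>m R. m >= m1 ==> R >= 1 ==> m >= 1 ==>
   (\<Sum>c<m * R. sqrt (lrc (resid m (m * R) c) (resid m (m * R) c))) <= w / (2 * 6 ^ r)"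
  using H1[of "w / (2 * 6 ^ r)"] w by auto
 have "EV n. (\<E> z. norm (psum {1..n} z - proj m (psum {1..n} z))) <= w * sqrt n"
  if m: "m >= max 1 m1" for m
 proof -
  let ?k = "4 * W + 64 * Cd"
  define E where "E n = \<bar>CA\<bar> / sqrt n + 6 ^ r * sqrt (8 * real m * Dc / real n) + real r * 6 ^ r * ?k * real n powr - 0.1" for n
  have "E ----> 0"
  proof -
   have "(\<lambda>n. \<bar>CA\<bar> / sqrt n) ----> 0" by real_asymp
   moreover have "(\<lambda>n. 6 ^ r * sqrt (8 * real m * Dc / real n)) ----> 6 ^ r * sqrt 0"
    by (intro tendsto_intros lim_const_over_n)
   moreover have "(\<lambda>n. real r * 6 ^ r * ?k * real n powr - 0.1) ----> real r * 6 ^ r * ?k * 0"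
    by (intro tendsto_mult tendsto_const tendsto_neg_powr filterlim_real_sequentially) simp
   ultimately have "E ----> 0 + 6 ^ r * sqrt 0 + real r * 6 ^ r * ?k * 0" unfolding E_def by (intro tendsto_add)
   then show ?thesis by simp
  qed
  then have ev: "EV n. E n < w / 2" using w by (intro order_tendstoD) auto
  show ?thesis
   using ev eventually_ge_at_top[of 1024]
  proof eventually_elim
   case (elim n)
   have n1: "real n >= 1" using elim by simp
   define R where "R = nat \<lceil>real n powr (1 / g)\<rceil>"
   have p1: "real n powr (1 / g) >= 1" using n1 H2(1) by (simp add: ge_one_powr_ge_zero)
   have R: "real n powr (1 / g) <= real R" "real R <= 2 * real n powr (1 / g)" "R >= 1"
    unfolding R_def using p1 by linarith+
   define N where "N = m * R"
   have N: "N >= 1" "R <= N" using m R(3) by (simp_all add: N_def)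
   define v where "v = resid m N"
   have fam: "family W {..<N} v"
    unfolding family_def
   proof (intro conjI allI)
    fix x
    have "(\<Sum>c<N. \<bar>blinfun_apply (v c) x\<bar>) <= norm (x - proj m x)" unfolding v_def using N by (intro sum_resid_le) simp
    also have "... <= 2 * norm x" by (rule norm_diff_proj_le)
    finally show "(\<Sum>c<N. \<bar>(v c) x\<bar>) <= 2 * norm x" .
    show "(\<Sum>c<N. sqrt (\<E> z. ((v c) (eps 1 z))\<^sup>2)) <= W"
     unfolding v_def N_def using m R(3) by (intro H3) auto
   qed simp
   obtain k where k: "real k >= real n powr (1.1 ^ r)"
    "escale {..<N} v n <= 6 ^ r * escale {..<N} v k + real r * 6 ^ r * ?k * real n powr - 0.1"
    using escale_iterate[OF elim(2), of r] fam by blast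
   have "real n powr (1 / g + 1) <= real n powr (1.1 ^ r)" using n1 r by (intro powr_mono) auto
   then have kn: "real k >= real n powr (1 / g) * real n" using k(1) n1 by (simp add: powr_add)
   have k0: "real k > 0" by (rule less_le_trans[OF _ kn]) (use n1 in simp)
   have "real N / real k <= 2 * real m / real n"
   proof -
    have "real N * real n <= real m * (2 * real n powr (1 / g)) * real n"
     unfolding N_def using R(2) by (simp add: mult_left_mono mult_right_mono)
    also have "... <= 2 * real m * real k" using mult_left_mono[OF kn, of "2 * real m"] by (simp add: mult_ac)
    finally show ?thesis using k0 n1 by (simp add: field_simps)
   qed
   then have Nk: "real N * (4 * Dc) / real k <= 8 * real m * Dc / real n"
    using mult_right_mono[of "real N / real k" "2 * real m / real n" "4 * Dc"] Dc_nonneg by (simp add: mult_ac)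
   have "escale {..<N} v k <= (\<Sum>c<N. sqrt (lrc (v c) (v c))) + sqrt (real (card {..<N}) * (4 * Dc) / real k)"
    using k0 nn by (intro escale_le_long_run[OF fam]) auto
   also have "... <= w / (2 * 6 ^ r) + sqrt (8 * real m * Dc / real n)"
    using m1[of m R] m R(3) Nk by (intro add_mono real_sqrt_le_mono) (auto simp: v_def N_def)
   finally have "6 ^ r * escale {..<N} v k <= 6 ^ r * (w / (2 * 6 ^ r) + sqrt (8 * real m * Dc / real n))"
    by (intro mult_left_mono) auto
   also have "... = w / 2 + 6 ^ r * sqrt (8 * real m * Dc / real n)" by (simp add: distrib_left)
   finally have e1: "escale {..<N} v n <= w / 2 + 6 ^ r * sqrt (8 * real m * Dc / real n) + real r * 6 ^ r * ?k * real n powr - 0.1"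
    using k(2) by linarith
   let ?S = "psum {1..n}"
   have iS: "integrable M ?S" by (rule integrable_psum) auto
   have ip: "integrable M (\<lambda>z. norm (X z - proj h (X z)))" if "integrable M X" for X h
    using integrable_bounded_linear[OF bounded_linear_proj that] that by simp
   have iv: "integrable M (\<lambda>z. \<Sum>c<N. \<bar>(v c) (?S z)\<bar>)"
    by (intro intg_sum integrable_abs integrable_functional_psum) auto
   \<comment> \<open>The triangle inequality suffices here: \<open>N\<close> is so large that
     \<open>n\<close> times the error of a single variable stays bounded, hence is negligible
     against \<open>sqrt n\<close>.\<close>
   have e2: "(\<E> z. norm (?S z - proj N (?S z))) <= \<bar>CA\<bar>"
   proof -
    have i1: "integrable M (\<lambda>z. norm (eps i z - proj N (eps i z)))" if "i >= 1" for i
     by (rule ip[OF integrable_eps[OF that]])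
    have "(\<E> z. norm (?S z - proj N (?S z))) <= (\<E> z. (\<Sum>i=1..n. norm (eps i z - proj N (eps i z))))"
    proof (rule integral_mono[OF ip[OF iS]])
     show "integrable M (\<lambda>z. \<Sum>i=1..n. norm (eps i z - proj N (eps i z)))" using i1 by (intro intg_sum) auto
     fix z
     have "?S z - proj N (?S z) = (\<Sum>i=1..n. eps i z - proj N (eps i z))"
      by (simp add: psum_def proj_sum sum_subtractf)
     then show "norm (?S z - proj N (?S z)) <= (\<Sum>i=1..n. norm (eps i z - proj N (eps i z)))"
      by (simp add: norm_sum)
    qed
    also have "... = (\<Sum>i=1..n. \<E> z. norm (eps i z - proj N (eps i z)))"
     by (rule Bochner_Integration.integral_sum) (use i1 in auto)
    also have "... = (\<Sum>i=1..n. \<E> z. norm (eps 1 z - proj N (eps 1 z)))"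
    proof (rule sum.cong[OF refl])
     fix i assume "i \<in> {1..n}"
     have "continuous_on UNIV (\<lambda>x. norm (x - proj N x))"
      by (intro continuous_intros linear_continuous_on bounded_linear_proj)
     then show "(\<E> z. norm (eps i z - proj N (eps i z))) = (\<E> z. norm (eps 1 z - proj N (eps 1 z)))"
      using \<open>i \<in> {1..n}\<close> by (intro expectation_eps[where f = "\<lambda>x. norm (x - proj N x)"] borel_measurable_continuous_onI) auto
    qed
    also have "... = real n * (\<E> z. norm (eps 1 z - proj N (eps 1 z)))" by simp
    also have "... <= real n * (\<bar>CA\<bar> * real N powr - g)"
    proof (rule mult_left_mono)
     have "(\<E> z. norm (eps 1 z - proj N (eps 1 z))) <= CA * real N powr - g" by (rule H2(2)[OF N(1)])
     also have "... <= \<bar>CA\<bar> * real N powr - g" by (intro mult_right_mono) auto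
     finally show "(\<E> z. norm (eps 1 z - proj N (eps 1 z))) <= \<bar>CA\<bar> * real N powr - g" .
    qed simp
    also have "... <= real n * (\<bar>CA\<bar> * (real n powr (1 / g)) powr - g)"
     using N(2) R(1) p1 H2(1) n1 by (intro mult_left_mono powr_mono2') auto
    also have "... = \<bar>CA\<bar>" using H2(1) n1 by (simp add: powr_powr powr_minus)
    finally show ?thesis .
   qed
   have "(\<E> z. norm (?S z - proj m (?S z)))
     <= (\<E> z. norm (?S z - proj N (?S z)) + (\<Sum>c<N. \<bar>(v c) (?S z)\<bar>))"
   proof (rule integral_mono[OF ip[OF iS]])
    show "integrable M (\<lambda>z. norm (?S z - proj N (?S z)) + (\<Sum>c<N. \<bar>(v c) (?S z)\<bar>))"
     using ip[OF iS] iv by (rule intg_add)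
    fix z
    show "norm (?S z - proj m (?S z)) <= norm (?S z - proj N (?S z)) + (\<Sum>c<N. \<bar>(v c) (?S z)\<bar>)"
     unfolding v_def resid_apply N_def using m R(3) by (intro norm_diff_proj_refine_le) auto
   qed
   also have "... = (\<E> z. norm (?S z - proj N (?S z))) + escale {..<N} v n * sqrt n"
    using ip[OF iS] iv n1 by (subst Bochner_Integration.integral_add) (auto simp: escale_def)
   also have "... <= (\<bar>CA\<bar> / sqrt n) * sqrt n + (w / 2 + 6 ^ r * sqrt (8 * real m * Dc / real n) + real r * 6 ^ r * ?k * real n powr - 0.1) * sqrt n"
    using e1 e2 n1 by (intro add_mono mult_right_mono) auto
   also have "... = (w / 2 + E n) * sqrt n" by (simp add: E_def algebra_simps)
   also have "... <= w * sqrt n" using elim(1) by (intro mult_right_mono) auto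
   finally show ?case .
  qed
 qed
 then show ?thesis by blast
qed

end

section \<open>Central limit theorem for functionals\<close>

lemma cmod_iexp_diff_le: "cmod (iexp x - iexp y) <= \<bar>x - y\<bar>"
proof -
 have "iexp y * iexp (x - y) = iexp x"
  by (subst exp_add[symmetric]) (simp add: algebra_simps)
 then have "iexp x - iexp y = iexp y * (iexp (x - y) - 1)" by (simp add: right_diff_distrib)
 then have "cmod (iexp x - iexp y) = cmod (iexp (x - y) - 1)" by (simp add: norm_mult)
 also have "... <= \<bar>x - y\<bar>" using iexp_approx1[of "x - y" 0] by simp
 finally show ?thesis .
qed

text \<open>Interpolates between the cubic remainder for small and the quadratic one for large
  arguments, since moments are only available up to order 2 + \<delta>.\<close>

lemma cmod_iexp_taylor2:
 assumes "2 <= r" "r <= 3"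
 shows "cmod (iexp x - (1 + \<i> * of_real x - of_real (x\<^sup>2 / 2))) <= \<bar>x\<bar> powr r"
proof -
 have eq: "(\<Sum>k\<le>2. (\<i> * of_real x) ^ k / fact k) = 1 + \<i> * of_real x - of_real (x\<^sup>2 / 2)"
  by (simp add: numeral_2_eq_2 power2_eq_square algebra_simps)
 show ?thesis
 proof (cases "x = 0")
  case False
  show ?thesis
  proof (cases "\<bar>x\<bar> <= 1")
   case True
   have "cmod (iexp x - (1 + \<i> * of_real x - of_real (x\<^sup>2 / 2))) <= \<bar>x\<bar> ^ 3 / 6"
    using iexp_approx1[of x 2] unfolding eq by (simp add: numeral_3_eq_3 fact_numeral)
   also have "... <= \<bar>x\<bar> ^ 3" by simp
   also have "... = \<bar>x\<bar> powr 3" using False by (simp add: powr_numeral)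
   also have "... <= \<bar>x\<bar> powr r" using True False assms by (intro powr_mono') auto
   finally show ?thesis .
  next
   case out: False
   have "cmod (iexp x - (1 + \<i> * of_real x - of_real (x\<^sup>2 / 2))) <= \<bar>x\<bar> ^ 2"
    using iexp_approx2[of x 2] unfolding eq by simp
   also have "... = \<bar>x\<bar> powr 2" using False by (simp add: powr_numeral)
   also have "... <= \<bar>x\<bar> powr r" using out assms by (intro powr_mono) auto
   finally show ?thesis .
  qed
 qed simp
qed

text \<open>Rotating a difference to the positive real axis turns complex estimates into estimates
  for \<open>Re (z * iexp (u x))\<close>, a real Lipschitz function of \<open>x\<close>, to which
  the decoupling bounds apply.\<close>

lemma cmod_eq_Re_rotated: "\<exists>z. cmod z = 1 \<and> complex_of_real (cmod d) = z * d"
proof (cases "d = 0")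
 case True
 then show ?thesis by (intro exI[of _ 1]) simp
next
 case False
 have "d * cnj d = complex_of_real ((cmod d)\<^sup>2)" by (rule complex_norm_square[symmetric])
 then have "complex_of_real (cmod d) = cnj d / of_real (cmod d) * d"
  using False by (simp add: power2_eq_square mult.commute)
 moreover have "cmod (cnj d / of_real (cmod d)) = 1" using False by (simp add: norm_divide)
 ultimately show ?thesis by blast
qed

context mixing_seq begin

lemma Re_iexp_diff_le:
 fixes u :: L1_dual
 assumes "cmod z = 1"
 shows "\<bar>Re (z * iexp (blinfun_apply u x)) - Re (z * iexp (u y))\<bar> <= \<bar>u (x - y)\<bar>"
proof -
 have "\<bar>Re (z * iexp (u x)) - Re (z * iexp (u y))\<bar>
   = \<bar>Re (z * (iexp (u x) - iexp (u y)))\<bar>" by (simp add: algebra_simps)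
 also have "... <= cmod (z * (iexp (u x) - iexp (u y)))" by (rule abs_Re_le_cmod)
 also have "... <= \<bar>u (x - y)\<bar>" using assms cmod_iexp_diff_le by (simp add: norm_mult blinfun.diff_right)
 finally show ?thesis .
qed

lemma iexp_lipschitz:
 fixes u :: L1_dual
 assumes "cmod z = 1"
 shows "\<bar>Re (z * iexp (blinfun_apply u x)) - Re (z * iexp (u y))\<bar> <= norm u * norm (x - y)"
 using Re_iexp_diff_le[OF assms, of u x y] norm_blinfun[of u "x - y"] by simp

lemma integrable_iexp_functional:
 fixes u :: L1_dual
 assumes "X \<in> borel_measurable M"
 shows "integrable M (\<lambda>z. iexp (blinfun_apply u (X z)))"
proof (rule integrable_const_bound[of _ 1])
 have "continuous_on UNIV (\<lambda>x. iexp (u x))" by (intro continuous_intros)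
 from measurable_compose[OF assms borel_measurable_continuous_onI[OF this]]
 show "(\<lambda>z. iexp (u (X z))) \<in> borel_measurable M" .
qed simp

text \<open>Characters are eigenfunctions of the averaging: each application multiplies by the
  characteristic function of one block.\<close>

lemma Aop_funpow_iexp:
 fixes u :: L1_dual
 shows "(Aop p ^^ J) (\<lambda>x. Re (z * iexp (blinfun_apply u x))) x
  = Re (z * iexp (u x) * (\<E> w. iexp (u (psum {1..p} w))) ^ J)"
proof (induction J arbitrary: x)
 case (Suc J)
 let ?f = "\<E> w. iexp (u (psum {1..p} w))"
 note i = integrable_iexp_functional[OF borel_measurable_integrable[OF integrable_psum_atLeast1], of u p]
 define h where "h x = Re (z * iexp (u x))" for x
 have "(Aop p ^^ Suc J) h x = (\<E> w. (Aop p ^^ J) h (x + psum {1..p} w))"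
  by (simp add: Aop_def[of p "(Aop p ^^ J) _"])
 then have "(Aop p ^^ Suc J) (\<lambda>x. Re (z * iexp (u x))) x
   = (\<E> w. Re (z * iexp (u (x + psum {1..p} w)) * ?f ^ J))"
  unfolding h_def Suc .
 also have "... = (\<E> w. Re ((z * iexp (u x) * ?f ^ J) * iexp (u (psum {1..p} w))))"
  by (simp only: blinfun.add_right of_real_add distrib_left exp_add mult_ac)
 also have "... = Re (\<E> w. (z * iexp (u x) * ?f ^ J) * iexp (u (psum {1..p} w)))"
  using i by (intro integral_Re) auto
 also have "... = Re (z * iexp (u x) * ?f ^ Suc J)"
  using i by (simp add: mult_ac)
 finally show ?case .
qed simp

lemma integral_norm_psum_le:
 assumes "finite I" "I \<subseteq> {1..}"
 shows "(\<E> x. norm (psum I x)) <= real (card I) * m_r"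
proof -
 have i: "integrable M (\<lambda>x. norm (eps i x))" "(\<E> x. norm (eps i x)) <= m_r" if "i \<in> I" for i
  using integrable_norm_power[of i 1] that assms by auto
 have "(\<E> x. norm (psum I x)) <= (\<E> x. (\<Sum>i\<in>I. norm (eps i x)))"
  using i norm_psum_le
  by (intro integral_mono integrable_norm[OF integrable_psum[OF assms(2)]] intg_sum) auto
 also have "... = (\<Sum>i\<in>I. \<E> x. norm (eps i x))" using i by simp
 also have "... <= (\<Sum>i\<in>I. m_r)" using i by (intro sum_mono) auto
 finally show ?thesis by simp
qed

lemma integral_abs_functional_psum_le:
 assumes "finite I" "I \<subseteq> {1..}"
 shows "(\<E> x. \<bar>blinfun_apply u (psum I x)\<bar>) <= norm u * (real (card I) * m_r)"
proof -
 have "(\<E> x. \<bar>u (psum I x)\<bar>) <= (\<E> x. norm u * norm (psum I x))"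
  using norm_blinfun[of u] integrable_psum[OF assms(2)]
  by (intro integral_mono integrable_abs integrable_functional_psum assms) auto
 also have "... = norm u * (\<E> x. norm (psum I x))" by simp
 also have "... <= norm u * (real (card I) * m_r)" by (intro mult_left_mono integral_norm_psum_le assms) auto
 finally show ?thesis .
qed

lemma integral_lipschitz_diff_le:
 fixes u :: L1_dual
 assumes X: "integrable M X" and Y: "integrable M Y" and z: "cmod z = 1"
 shows "\<bar>(\<E> x. Re (z * iexp (blinfun_apply u (X x)))) - (\<E> x. Re (z * iexp (u (Y x))))\<bar>
  <= (\<E> x. \<bar>u (X x - Y x)\<bar>)"
proof -
 note i = integrable_lipschitz_comp[OF _ iexp_lipschitz[OF z]]
 have id: "integrable M (\<lambda>x. \<bar>u (X x - Y x)\<bar>)"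
  using X Y by (intro integrable_abs integrable_bounded_linear[OF blinfun.bounded_linear_right]) auto
 show ?thesis by (rule integral_abs_diff_le[OF i[OF X] i[OF Y] id Re_iexp_diff_le[OF z]])
qed

lemma psum_split_at:
 assumes "k <= n"
 shows "psum {1..n} x = psum {1..k} x + psum {k + 1..n} x"
proof -
 have "{1..n} = {1..k} \<union> {k + 1..n}" using assms by auto
 then show ?thesis unfolding psum_def by (simp add: sum.union_disjoint)
qed

text \<open>The first term pays for the incomplete last stretch, shorter than \<open>p + q\<close>,
  the second for the gaps, the third for two decouplings, of the blocks and of the gaps.\<close>

lemma char_block_bound:
 fixes u :: L1_dual and p q n :: nat
 assumes pq: "p >= 1" "q >= 1" "q <= p"
 defines "J \<equiv> n div (p + q)"
 shows "cmod ((\<E> w. iexp (blinfun_apply u (psum {1..n} w))) - (\<E> w. iexp (u (psum {1..p} w))) ^ J)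
  <= norm u * (2 * real p * m_r) + sqrt (real J * (\<E> w. (u (psum {1..q} w))\<^sup>2))
   + 2 * (real J * (norm u * real p * Cd * real q powr - a'))"
proof -
 let ?f = "\<E> w. iexp (u (psum {1..p} w))"
 let ?D = "(\<E> w. iexp (u (psum {1..n} w))) - ?f ^ J"
 define e where "e = real J * (norm u * real p * Cd * real q powr - a')"
 obtain z where z: "cmod z = 1" "complex_of_real (cmod ?D) = z * ?D" using cmod_eq_Re_rotated by blast
 define g where "g x = Re (z * iexp (u x))" for x
 note gl = iexp_lipschitz[OF z(1), of u, folded g_def]
 define h where "h = J * (p + q)"
 have hn: "h <= n" "n - h < p + q" unfolding h_def J_def using pq by (auto simp: minus_div_mult_eq_mod)
 let ?Z = "\<lambda>w. \<Sum>j<J. psum (blk 0 p q j) w" and ?B = "\<lambda>w. \<Sum>j<J. psum (blk p q p j) w"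
 have iZ: "integrable M ?Z" and iB: "integrable M ?B"
  by (intro intg_sum integrable_psum; auto simp: blk_def)+
 have iS: "integrable M (psum {1..n})" by (rule integrable_psum_atLeast1)
 have iR: "integrable M (psum {h + 1..n})" by (rule integrable_psum) auto
 have dec: "psum {1..n} w - ?Z w = ?B w + psum {h + 1..n} w" for w
  unfolding psum_split_at[OF hn(1)] h_def psum_union_blocks by simp
 have ub: "integrable M (\<lambda>w. \<bar>u (X w)\<bar>)" if "integrable M X" for X
  by (intro integrable_abs integrable_bounded_linear[OF blinfun.bounded_linear_right] that)
 have "(\<E> w. \<bar>u (psum {1..n} w - ?Z w)\<bar>)
   <= (\<E> w. \<bar>u (?B w)\<bar> + \<bar>u (psum {h + 1..n} w)\<bar>)"
  unfolding dec using iB iR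
  by (intro integral_mono ub intg_add) (auto simp: blinfun.add_right)
 also have "... = (\<E> w. \<bar>u (?B w)\<bar>) + (\<E> w. \<bar>u (psum {h + 1..n} w)\<bar>)"
  using ub[OF iB] ub[OF iR] by simp
 also have "(\<E> w. \<bar>u (psum {h + 1..n} w)\<bar>) <= norm u * (real (card {h + 1..n}) * m_r)"
  by (rule integral_abs_functional_psum_le) auto
 also have "... <= norm u * (2 * real p * m_r)"
  using hn pq m_r_ge1 by (intro mult_left_mono mult_right_mono) auto
 finally have 1: "(\<E> w. \<bar>u (psum {1..n} w - ?Z w)\<bar>)
   <= (\<E> w. \<bar>u (?B w)\<bar>) + norm u * (2 * real p * m_r)" by simp
 have 2: "(\<E> w. \<bar>u (?B w)\<bar>) <= (Aop q ^^ J) (\<lambda>x. \<bar>u x\<bar>) 0 + real J * (norm u * real q * Cd * real p powr - a')"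
  using decouple_blocks[OF pq(2,1) abs_functional_lipschitz, of u 0 p J] by simp
 have 3: "(Aop q ^^ J) (\<lambda>x. \<bar>u x\<bar>) 0 <= sqrt (real J * (\<E> w. (u (psum {1..q} w))\<^sup>2))"
  using Aop_funpow_abs_le[where p = q and J = J and v = u and z = 0] by (simp add: blinfun.zero_right)
 have 4: "real J * (norm u * real q * Cd * real p powr - a') <= e"
  unfolding e_def using pq Cd_pos a'_gt2 by (intro mult_left_mono mult_mono powr_mono2') auto
 have 5: "\<bar>(\<E> w. g (?Z w)) - (Aop p ^^ J) g 0\<bar> <= e"
  using decouple_blocks[OF pq(1,2) gl, of 0 0 J] by (simp add: e_def)
 have 6: "\<bar>(\<E> w. g (psum {1..n} w)) - (\<E> w. g (?Z w))\<bar> <= (\<E> w. \<bar>u (psum {1..n} w - ?Z w)\<bar>)"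
  unfolding g_def by (rule integral_lipschitz_diff_le[OF iS iZ z(1)])
 have "(\<E> w. g (psum {1..n} w)) = Re (z * (\<E> w. iexp (u (psum {1..n} w))))"
  unfolding g_def using integrable_iexp_functional[OF borel_measurable_integrable[OF iS], of u]
  by (subst integral_Re) auto
 moreover have "(Aop p ^^ J) g 0 = Re (z * ?f ^ J)"
  unfolding g_def by (subst Aop_funpow_iexp) (simp add: blinfun.zero_right)
 ultimately have eq: "cmod ?D = (\<E> w. g (psum {1..n} w)) - (Aop p ^^ J) g 0"
  using arg_cong[OF z(2), of Re] by (simp add: right_diff_distrib)
 have ar: "r1 - r2 <= k + s + 2 * t" if "\<bar>r3 - r2\<bar> <= t" "\<bar>r1 - r3\<bar> <= r4" "r4 <= r5 + k" "r5 <= r6 + r7" "r6 <= s" "r7 <= t"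
  for r1 r2 r3 r4 r5 r6 r7 k s t :: real
  using that by simp
 show ?thesis unfolding eq using ar[OF 5 6 1 2 3 4] unfolding e_def .
qed

lemma long_run_cov_nonneg: "lrc v v >= 0"
proof -
 define D where "D = 2 * (\<Sum>k. real (Suc k) * \<bar>acov v (Suc k)\<bar>)"
 have "- D * inverse (real (Suc m)) <= lrc v v" for m
 proof -
  have "0 <= (\<E> z. (blinfun_apply v (psum {1..Suc m} z))\<^sup>2)" by simp
  then have "- D <= real (Suc m) * lrc v v"
   using square_psum_close[of v "Suc m"] unfolding D_def by linarith
  then show ?thesis by (simp add: field_simps)
 qed
 moreover have "(\<lambda>m. - D * inverse (real (Suc m))) ----> - D * 0"
  by (intro tendsto_mult tendsto_const LIMSEQ_inverse_real_of_nat)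
 ultimately show ?thesis by (intro LIMSEQ_le_const2[where X = "\<lambda>m. - D * inverse (real (Suc m))" and x = 0]) auto
qed

lemma functional_moment_le:
 fixes l :: L1_dual
 assumes p: "p >= 1" and r: "2 <= r" "r <= 2 + \<delta>"
 shows "integrable M (\<lambda>x. \<bar>blinfun_apply l (psum {1..p} x)\<bar> powr r)"
  and "(\<E> x. \<bar>l (psum {1..p} x)\<bar> powr r) <= (norm l * real p) powr r * m_r"
proof -
 let ?s = "\<lambda>x. (norm l * real p) powr r * (norm (psum {1..p} x) / real p) powr r"
 have le: "\<bar>l (psum {1..p} x)\<bar> powr r <= ?s x" for x
 proof -
  have "\<bar>l (psum {1..p} x)\<bar> <= norm l * norm (psum {1..p} x)" using norm_blinfun[of l] by simp
  then have "\<bar>l (psum {1..p} x)\<bar> powr r <= (norm l * norm (psum {1..p} x)) powr r"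
   using r by (intro powr_mono2) auto
  also have "... = ?s x" using p by (simp add: powr_mult[symmetric])
  finally show ?thesis .
 qed
 have m: "integrable M (\<lambda>x. (norm (psum {1..p} x) / real p) powr r)" "(\<E> x. (norm (psum {1..p} x) / real p) powr r) <= m_r"
  using psum_moment[of "{1..p}" r] p r by auto
 have "(\<lambda>x. l (psum {1..p} x)) \<in> borel_measurable M"
  by (intro borel_measurable_integrable integrable_functional_psum) auto
 then have "(\<lambda>x. \<bar>l (psum {1..p} x)\<bar> powr r) \<in> borel_measurable M" by measurable
 from integrable_dominated[OF integrable_mult_right[OF m(1), of "(norm l * real p) powr r"] this] le
 show i: "integrable M (\<lambda>x. \<bar>l (psum {1..p} x)\<bar> powr r)" by simp
 have "(\<E> x. \<bar>l (psum {1..p} x)\<bar> powr r) <= (\<E> x. ?s x)"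
  using m(1) by (intro integral_mono i le) simp
 also have "... <= (norm l * real p) powr r * m_r" using m by (simp add: mult_left_mono)
 finally show "(\<E> x. \<bar>l (psum {1..p} x)\<bar> powr r) <= (norm l * real p) powr r * m_r" .
qed

lemma char_taylor_bound:
 fixes l :: L1_dual
 assumes p: "p >= 1" and r: "2 <= r" "r <= 3" "r <= 2 + \<delta>"
 shows "cmod ((\<E> x. iexp (blinfun_apply l (psum {1..p} x)))
   - of_real (1 - (\<E> x. (l (psum {1..p} x))\<^sup>2) / 2)) <= (norm l * real p) powr r * m_r"
proof -
 define X where "X x = l (psum {1..p} x)" for x
 have iX: "integrable M X" unfolding X_def by (rule integrable_functional_psum) auto
 have EX: "(\<E> x. X x) = 0" unfolding X_def by (rule integral_functional_psum) auto
 have iX2: "integrable M (\<lambda>x. (X x)\<^sup>2)" unfolding X_def by (rule square_functional_psum) auto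
 have ie: "integrable M (\<lambda>x. iexp (X x))" unfolding X_def
  by (rule integrable_iexp_functional[OF borel_measurable_integrable[OF integrable_psum_atLeast1]])
 have i1: "integrable M (\<lambda>x. \<i> * complex_of_real (X x))" and i2: "integrable M (\<lambda>x. complex_of_real ((X x)\<^sup>2 / 2))"
  using iX iX2 by (auto intro!: integrable_of_real integrable_mult_right simp del: of_real_power of_real_divide)
 let ?T = "\<lambda>x. 1 + \<i> * complex_of_real (X x) - complex_of_real ((X x)\<^sup>2 / 2)"
 have iT: "integrable M ?T" using i1 i2 by (intro intg_add intg_diff) auto
 have "(\<E> x. ?T x) = (\<E> x. 1 + \<i> * complex_of_real (X x)) - (\<E> x. complex_of_real ((X x)\<^sup>2 / 2))"
  using i1 i2 by (intro intl_diff) auto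
 also have "(\<E> x. 1 + \<i> * complex_of_real (X x)) = 1 + \<i> * complex_of_real (\<E> x. X x)"
  using i1 iX by (subst Bochner_Integration.integral_add) (auto simp: prob_space)
 also have "(\<E> x. complex_of_real ((X x)\<^sup>2 / 2)) = complex_of_real ((\<E> x. (X x)\<^sup>2) / 2)"
  by (subst integral_complex_of_real) simp
 finally have ET: "(\<E> x. ?T x) = of_real (1 - (\<E> x. (X x)\<^sup>2) / 2)" unfolding EX by simp
 have "integrable M (\<lambda>x. \<bar>X x\<bar> powr r)" unfolding X_def by (rule functional_moment_le(1)[OF p r(1,3)])
 from integral_norm_diff_le[OF ie iT this cmod_iexp_taylor2[OF r(1,2)]]
 have "cmod ((\<E> x. iexp (X x)) - (\<E> x. ?T x)) <= (\<E> x. \<bar>X x\<bar> powr r)" .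
 also have "... <= (norm l * real p) powr r * m_r" unfolding X_def by (rule functional_moment_le(2)[OF p r(1,3)])
 finally show ?thesis unfolding ET unfolding X_def .
qed

lemma square_psum_le:
 fixes v :: L1_dual
 assumes "q >= 1"
 shows "(\<E> x. (blinfun_apply v (psum {1..q} x))\<^sup>2)
  <= real q * (lrc v v + 2 * (\<Sum>k. real (Suc k) * \<bar>acov v (Suc k)\<bar>))"
proof -
 let ?D = "2 * (\<Sum>k. real (Suc k) * \<bar>acov v (Suc k)\<bar>)"
 have "?D >= 0" by (intro mult_nonneg_nonneg suminf_nonneg summable_acov) auto
 then have "1 * ?D <= real q * ?D" using assms by (intro mult_right_mono) auto
 then show ?thesis using square_psum_close[of v q] by (simp add: distrib_left)
qed

lemma exp_limit_real: "((\<lambda>x::real. x * (1 - exp (- c / x))) \<longlongrightarrow> c) at_top"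
 by real_asymp

text \<open>\<open>h1\<close> makes the gaps negligible, \<open>h2\<close> the incomplete stretch,
  \<open>h3\<close> the decoupling, and \<open>h4\<close> is Lyapunov's condition. The moment of a
  block is bounded crudely by the power \<open>r\<close> of its length, so \<open>h4\<close> forces
  short blocks while \<open>h3\<close> forces long gaps.\<close>

lemma char_psum_tendsto_blocks:
 fixes l :: L1_dual and p q :: "nat => nat"
 assumes r: "2 <= r" "r <= 3" "r <= 2 + \<delta>"
  and pq: "EV n. 1 <= q n \<and> q n <= p n"
  and plim: "filterlim p at_top sequentially"
  and h1: "(\<lambda>n. real (q n) / real (p n)) ----> 0"
  and h2: "(\<lambda>n. real (p n) / sqrt n) ----> 0"
  and h3: "(\<lambda>n. sqrt n * real (q n) powr - a') ----> 0"
  and h4: "(\<lambda>n. real n / real (p n) * (real (p n) / sqrt n) powr r) ----> 0"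
 shows "(\<lambda>n. \<E> x. iexp (blinfun_apply l (psum {1..n} x) / sqrt n)) ----> exp (- lrc l l / 2)"
proof -
 define LR where "LR = lrc l l"
 define D where "D = 2 * (\<Sum>k. real (Suc k) * \<bar>acov l (Suc k)\<bar>)"
 define c where "c = LR / 2"
 have D0: "D >= 0" unfolding D_def by (intro mult_nonneg_nonneg suminf_nonneg summable_acov) auto
 have LR0: "LR >= 0" unfolding LR_def by (rule long_run_cov_nonneg)
 define J where "J n = n div (p n + q n)" for n
 define u where "u n = (1 / sqrt n) *\<^sub>R l" for n :: nat
 define f where "f n = (\<E> x. iexp (blinfun_apply (u n) (psum {1..p n} x)))" for n
 define v where "v n = (\<E> x. ((u n) (psum {1..p n} x))\<^sup>2)" for n
 define g where "g n = (\<E> x. iexp ((u n) (psum {1..n} x)))" for n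
 have nu: "norm (u n) = norm l / sqrt n" for n by (simp add: u_def)
 have sq: "(\<E> x. ((u n) (psum {1..k} x))\<^sup>2) = (\<E> x. (l (psum {1..k} x))\<^sup>2) / real n" for n k
  by (simp add: u_def blinfun.scaleR_left power_divide)
 have ev2p: "EV n. 2 * p n <= n \<and> 0 < n"
 proof -
  have "EV n. real (p n) / sqrt n < 1 / 2" using h2 by (rule order_tendstoD) simp
  then show ?thesis using eventually_gt_at_top[of 0]
  proof eventually_elim
   case (elim n)
   then have n1: "1 <= sqrt n" by simp
   have "2 * real (p n) <= sqrt n" using elim by (simp add: field_simps)
   also have "... <= sqrt n * sqrt n" using mult_right_mono[OF n1, of "sqrt n"] by simp
   also have "... = real n" by simp
   finally show ?case using elim by linarith
  qed
 qed
 have basic: "EV n. 1 <= q n \<and> q n <= p n \<and> 0 < n \<and> 1 <= J n \<and> real (J n) * real (p n) <= real n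
   \<and> real n <= (real (J n) + 1) * (real (p n) + real (q n))"
  using pq ev2p
 proof eventually_elim
  case (elim n)
  have "J n * (p n + q n) <= n" by (simp add: J_def)
  moreover have "J n * p n <= J n * (p n + q n)" by simp
  ultimately have "J n * p n <= n" by (rule le_trans[rotated])
  then have 1: "real (J n) * real (p n) <= real n" by (metis of_nat_le_iff of_nat_mult)
  have "n < Suc (J n) * (p n + q n)" using elim unfolding J_def by (simp add: dividend_less_div_times add.commute)
  then have "real n <= real (Suc (J n) * (p n + q n))" by linarith
  also have "... = (real (J n) + 1) * (real (p n) + real (q n))" by (simp add: algebra_simps)
  finally have 2: "real n <= (real (J n) + 1) * (real (p n) + real (q n))" .
  have "0 < J n" unfolding J_def div_greater_zero_iff using elim by linarith
  then show ?case using elim 1 2 by simp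
 qed
 have err: "(\<lambda>n. g n - f n ^ J n) ----> 0"
 proof (rule Lim_null_comparison)
  let ?e = "\<lambda>n. 2 * norm l * m_r * (real (p n) / sqrt n) + sqrt ((LR + D) * (real (q n) / real (p n)))
    + 2 * norm l * Cd * (sqrt n * real (q n) powr - a')"
  show "EV n. cmod (g n - f n ^ J n) <= ?e n"
   using basic
  proof eventually_elim
   case (elim n)
   then have p1: "1 <= p n" by linarith
   have "cmod (g n - f n ^ J n) <= norm (u n) * (2 * real (p n) * m_r)
     + sqrt (real (J n) * (\<E> x. ((u n) (psum {1..q n} x))\<^sup>2))
     + 2 * (real (J n) * (norm (u n) * real (p n) * Cd * real (q n) powr - a'))"
    unfolding g_def f_def J_def using elim p1 by (intro char_block_bound) auto
   moreover have "norm (u n) * (2 * real (p n) * m_r) = 2 * norm l * m_r * (real (p n) / sqrt n)"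
    by (simp add: nu)
   moreover have "sqrt (real (J n) * (\<E> x. ((u n) (psum {1..q n} x))\<^sup>2)) <= sqrt ((LR + D) * (real (q n) / real (p n)))"
   proof (rule real_sqrt_le_mono)
    have "real (J n) * (\<E> x. ((u n) (psum {1..q n} x))\<^sup>2) <= real (J n) * (real (q n) * (LR + D) / real n)"
     unfolding sq LR_def D_def using elim by (intro mult_left_mono divide_right_mono square_psum_le) auto
    also have "... = (real (J n) / real n) * (real (q n) * (LR + D))" by simp
    also have "... <= (1 / real (p n)) * (real (q n) * (LR + D))"
     using elim p1 LR0 D0 by (intro mult_right_mono) (auto simp: field_simps)
    finally show "real (J n) * (\<E> x. ((u n) (psum {1..q n} x))\<^sup>2) <= (LR + D) * (real (q n) / real (p n))"
     by (simp add: mult_ac)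
   qed
   moreover have "2 * (real (J n) * (norm (u n) * real (p n) * Cd * real (q n) powr - a')) <= 2 * norm l * Cd * (sqrt n * real (q n) powr - a')"
   proof -
    have "real (J n) * real (p n) / sqrt n <= real n / sqrt n" using elim by (intro divide_right_mono) auto
    also have "... = sqrt n" by (simp add: real_div_sqrt)
    finally have "2 * norm l * Cd * real (q n) powr - a' * (real (J n) * real (p n) / sqrt n) <= 2 * norm l * Cd * real (q n) powr - a' * sqrt n"
     using Cd_pos by (intro mult_left_mono) auto
    then show ?thesis by (simp add: nu mult_ac)
   qed
   ultimately show ?case by linarith
  qed
  have "?e ----> 2 * norm l * m_r * 0 + sqrt ((LR + D) * 0) + 2 * norm l * Cd * 0"
   by (intro tendsto_intros h1 h2 h3)
  then show "?e ----> 0" by simp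
 qed
 have Jp: "(\<lambda>n. real (J n) * real (p n) / real n) ----> 1"
 proof (rule tendsto_sandwich)
  \<comment> \<open>From \<open>n <= (J + 1) * (p + q)\<close>: the first term is
    \<open>p / (p + q)\<close>, the second, \<open>p / n\<close>, is the share of the incomplete
    block.\<close>
  let ?lo = "\<lambda>n. 1 / (1 + real (q n) / real (p n)) - (real (p n) / sqrt n) * (1 / sqrt n)"
  show "EV n. real (J n) * real (p n) / real n <= 1"
   using basic by eventually_elim (auto simp: field_simps)
  show "EV n. ?lo n <= real (J n) * real (p n) / real n"
   using basic
  proof eventually_elim
   case (elim n)
   then have p: "real (p n) > 0" and n: "real n > 0" by auto
   have "real n / (real (p n) + real (q n)) <= real (J n) + 1"
    using elim p by (simp add: field_simps add_pos_nonneg)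
   then have "real (p n) / real n * (real n / (real (p n) + real (q n))) <= real (p n) / real n * (real (J n) + 1)"
    by (intro mult_left_mono) auto
   moreover have "real (p n) / real n * (real n / (real (p n) + real (q n))) = 1 / (1 + real (q n) / real (p n))"
    using p n by (simp add: field_simps)
   moreover have "(real (p n) / sqrt n) * (1 / sqrt n) = real (p n) / real n" using n by simp
   moreover have "real (p n) / real n * (real (J n) + 1) = real (J n) * real (p n) / real n + real (p n) / real n"
    by (simp add: algebra_simps add_divide_distrib)
   ultimately show ?case by linarith
  qed
  have "(\<lambda>n. 1 / sqrt n) ----> 0" by real_asymp
  then have "?lo ----> 1 / (1 + 0) - 0 * 0" by (intro tendsto_intros h1 h2) auto
  then show "?lo ----> 1" by simp
 qed simp
 have Jinf: "filterlim (\<lambda>n. real (J n)) at_top sequentially"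
 proof (rule filterlim_at_top_mono)
  show "filterlim (\<lambda>n. sqrt n / 2 - 1) at_top sequentially" by real_asymp
  have "EV n. real (p n) / sqrt n < 1" using h2 by (rule order_tendstoD) simp
  then show "EV n. sqrt n / 2 - 1 <= real (J n)"
   using basic
  proof eventually_elim
   case (elim n)
   then have s: "sqrt n > 0" and ps: "real (p n) <= sqrt n" by (auto simp: field_simps)
   have "sqrt n * sqrt n <= (real (J n) + 1) * (real (p n) + real (q n))" using elim by simp
   also have "... <= (real (J n) + 1) * (2 * sqrt n)" using elim ps by (intro mult_left_mono) auto
   finally have "sqrt n * sqrt n <= ((real (J n) + 1) * 2) * sqrt n"
    by (simp only: mult.assoc)
   then have "sqrt n <= (real (J n) + 1) * 2" by (rule mult_right_le_imp_le) (rule s)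
   then show ?case by simp
  qed
 qed
 have Jv: "(\<lambda>n. real (J n) * v n) ----> LR"
 proof -
  define w where "w k = (\<E> x. (l (psum {1..k} x))\<^sup>2) / real k" for k :: nat
  have "w ----> LR"
  proof (rule LIM_zero_cancel, rule Lim_null_comparison)
   show "EV k. norm (w k - LR) <= D / real k"
    using eventually_gt_at_top[of 0]
   proof eventually_elim
    case (elim k)
    have "w k - LR = ((\<E> x. (l (psum {1..k} x))\<^sup>2) - real k * LR) / real k"
     using elim by (simp add: w_def field_simps)
    then have "norm (w k - LR) = \<bar>(\<E> x. (l (psum {1..k} x))\<^sup>2) - real k * LR\<bar> / real k" by simp
    also have "... <= D / real k" unfolding D_def LR_def by (intro divide_right_mono square_psum_close) simp
    finally show ?case .
   qed
   show "(\<lambda>k. D / real k) ----> 0" by (rule lim_const_over_n)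
  qed
  then have "(\<lambda>n. w (p n)) ----> LR" using plim by (rule filterlim_compose)
  then have "(\<lambda>n. real (J n) * real (p n) / real n * w (p n)) ----> 1 * LR" by (intro tendsto_mult Jp)
  moreover have "EV n. real (J n) * real (p n) / real n * w (p n) = real (J n) * v n"
   using basic
  proof eventually_elim
   case (elim n)
   then show ?case unfolding v_def sq w_def by simp
  qed
  ultimately have "(\<lambda>n. real (J n) * v n) ----> 1 * LR" by (rule Lim_transform_eventually)
  then show ?thesis by simp
 qed
 have main: "(\<lambda>n. f n ^ J n - of_real (exp (- c))) ----> 0"
 proof (rule Lim_null_comparison)
  let ?e = "\<lambda>n. (norm l) powr r * m_r * (real n / real (p n) * (real (p n) / sqrt n) powr r)
    + \<bar>real (J n) * (1 - exp (- c / real (J n))) - real (J n) * v n / 2\<bar>"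
  show "EV n. cmod (f n ^ J n - of_real (exp (- c))) <= ?e n"
   using basic
  proof eventually_elim
   case (elim n)
   then have p1: "1 <= p n" and J0: "real (J n) > 0" by auto
   \<comment> \<open>The limit is written as a \<open>J\<close>-th power, so that the difference of
     powers is at most \<open>J\<close> times the difference of the bases, both of modulus at most
     1.\<close>
   have "exp (- c) = exp (- c / real (J n)) ^ J n" using J0 by (simp add: exp_of_nat_mult[symmetric])
   then have "f n ^ J n - of_real (exp (- c)) = f n ^ J n - (of_real (exp (- c / real (J n)))) ^ J n" by simp
   also have "cmod ... <= real (J n) * cmod (f n - of_real (exp (- c / real (J n))))"
   proof (rule norm_power_diff)
    have "cmod (f n) <= (\<E> x. cmod (iexp ((u n) (psum {1..p n} x))))"
     unfolding f_def by (rule integral_norm_bound)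
    then show "cmod (f n) <= 1" by (simp add: prob_space)
    have "- c / real (J n) <= 0" using LR0 by (simp add: c_def)
    then show "cmod (of_real (exp (- c / real (J n)))) <= 1" by (simp only: norm_of_real) simp
   qed
   also have "... <= real (J n) * (cmod (f n - of_real (1 - v n / 2)) + \<bar>1 - v n / 2 - exp (- c / real (J n))\<bar>)"
   proof (rule mult_left_mono)
    have "cmod (f n - of_real (exp (- c / real (J n))))
      <= cmod (f n - of_real (1 - v n / 2)) + cmod (of_real (1 - v n / 2) - of_real (exp (- c / real (J n))))"
     using norm_triangle_ineq[of "f n - of_real (1 - v n / 2)" "of_real (1 - v n / 2) - of_real (exp (- c / real (J n)))"] by simp
    also have "cmod (of_real (1 - v n / 2) - of_real (exp (- c / real (J n)))) = \<bar>1 - v n / 2 - exp (- c / real (J n))\<bar>"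
     by (simp only: of_real_diff[symmetric] norm_of_real)
    finally show "cmod (f n - of_real (exp (- c / real (J n)))) <= cmod (f n - of_real (1 - v n / 2)) + \<bar>1 - v n / 2 - exp (- c / real (J n))\<bar>" .
   qed simp
   also have "... <= real (J n) * ((norm (u n) * real (p n)) powr r * m_r + \<bar>1 - v n / 2 - exp (- c / real (J n))\<bar>)"
    unfolding f_def v_def using p1 r by (intro mult_left_mono add_right_mono char_taylor_bound) auto
   also have "... = real (J n) * (norm (u n) * real (p n)) powr r * m_r + \<bar>real (J n) * (1 - v n / 2 - exp (- c / real (J n)))\<bar>"
    using J0 by (simp add: distrib_left abs_mult)
   also have "real (J n) * (1 - v n / 2 - exp (- c / real (J n))) = real (J n) * (1 - exp (- c / real (J n))) - real (J n) * v n / 2"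
    by (simp add: algebra_simps)
   also have "real (J n) * (norm (u n) * real (p n)) powr r * m_r <= (norm l) powr r * m_r * (real n / real (p n) * (real (p n) / sqrt n) powr r)"
   proof -
    have "(norm (u n) * real (p n)) powr r = (norm l) powr r * (real (p n) / sqrt n) powr r"
     by (simp add: nu powr_mult[symmetric])
    moreover have "real (J n) <= real n / real (p n)" using elim p1 by (simp add: field_simps)
    ultimately have "real (J n) * ((norm (u n) * real (p n)) powr r * m_r) <= real n / real (p n) * ((norm l) powr r * (real (p n) / sqrt n) powr r * m_r)"
     using m_r_ge1 by (intro mult_mono) auto
    then show ?thesis by (simp add: mult_ac)
   qed
   finally show ?case by simp
  qed
  have "(\<lambda>n. real (J n) * (1 - exp (- c / real (J n)))) ----> c"
   by (rule filterlim_compose[OF exp_limit_real Jinf])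
  then have "?e ----> (norm l) powr r * m_r * 0 + \<bar>c - LR / 2\<bar>"
   by (intro tendsto_intros h4 Jv) auto
  then show "?e ----> 0" by (simp add: c_def)
 qed
 have "(\<lambda>n. (g n - f n ^ J n) + (f n ^ J n - of_real (exp (- c))) + of_real (exp (- c))) ----> 0 + 0 + of_real (exp (- c))"
  by (intro tendsto_add err main tendsto_const)
 then have 1: "g ----> of_real (exp (- c))" by simp
 have 2: "g = (\<lambda>n. \<E> x. iexp (l (psum {1..n} x) / sqrt n))"
  by (simp add: g_def[abs_def] u_def blinfun.scaleR_left)
 have 3: "- c = - lrc l l / 2" by (simp add: c_def LR_def)
 show ?thesis using 1 unfolding 2 3 .
qed

lemma powr_seq_tendsto_0: "e < 0 ==> (\<lambda>n. C * real n powr e) ----> 0"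
 using tendsto_mult[OF tendsto_const tendsto_neg_powr[OF _ filterlim_real_sequentially]] by fastforce

text \<open>Gap and block lengths are powers of \<open>n\<close> with exponents
  \<open>hq < hp\<close> in between \<open>L\<close>, above which
  \<open>sqrt n * q powr - a'\<close> vanishes, and \<open>U\<close>, below which Lyapunov's
  condition holds. There is room because \<open>a > 2 + 2 / \<delta>\<close> yields
  \<open>L < U\<close>. Capping \<delta> at 1 serves the Taylor bound, which needs
  \<open>r <= 3\<close>.\<close>

theorem char_psum_tendsto:
 fixes l :: L1_dual
 shows "(\<lambda>n. \<E> z. iexp (blinfun_apply l (psum {1..n} z) / sqrt n)) ----> exp (- lrc l l / 2)"
proof -
 define \<delta>' where "\<delta>' = min \<delta> 1"
 define r where "r = 2 + \<delta>'"
 define L where "L = 1 / (2 * a')"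
 define U where "U = \<delta>' / (2 * (1 + \<delta>'))"
 define hq where "hq = (2 * L + U) / 3"
 define hp where "hp = (L + 2 * U) / 3"
 have d': "\<delta>' > 0" "\<delta>' <= 1" "\<delta>' <= \<delta>" using delta by (auto simp: \<delta>'_def)
 have LU: "L < U"
 proof -
  \<comment> \<open>With this \<open>e\<close> the hypothesis on \<open>a\<close> reads
    \<open>a > 2 * e\<close>, so \<open>a' = a * e\<close> exceeds \<open>2 * e * e\<close>; for
    \<delta> at most 1 the bound \<open>U\<close> is \<open>1 / (2 * e)\<close>.\<close>
  define e where "e = (1 + \<delta>) / \<delta>"
  have k1: "e > 1" using delta by (simp add: e_def)
  have "2 * e * e < a * e"
   using a_gt k1 delta by (intro mult_strict_right_mono) (auto simp: e_def field_simps)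
  then have a'k: "a' > 2 * e * e" by (simp add: a'_def e_def)
  have "2 * (2 * e * e) > 0" using k1 by simp
  then have "L < 1 / (2 * (2 * e * e))" unfolding L_def using a'k a'_gt2 by (intro divide_strict_left_mono) auto
  also have "... <= U"
  proof (cases "\<delta> <= 1")
   case True
   then have U: "U = 1 / (2 * e)" using delta by (simp add: U_def \<delta>'_def e_def)
   have "2 * e <= 2 * (2 * e * e)" using k1 by simp
   then show ?thesis unfolding U using k1 by (intro divide_left_mono) auto
  next
   case False
   then have U: "U = 1 / 4" by (simp add: U_def \<delta>'_def)
   have "1 <= e * e" using k1 by (metis less_imp_le mult_mono mult_1 zero_le_one order_trans)
   then have "(4::real) <= 2 * (2 * e * e)" by simp
   then show ?thesis unfolding U by (intro divide_left_mono) auto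
  qed
  finally show ?thesis .
 qed
 have L0: "L > 0" using a'_gt2 by (simp add: L_def)
 have U4: "U <= 1 / 4" using d' by (simp add: U_def field_simps)
 have ord: "L < hq" "hq < hp" "hp < U" using LU by (auto simp: hq_def hp_def)
 define p where "p n = nat \<lfloor>real n powr hp\<rfloor>" for n
 define q where "q n = nat \<lfloor>real n powr hq\<rfloor>" for n
 have bp: "real n powr hp / 2 <= real (p n)" "real (p n) <= real n powr hp" "1 <= p n" if "n >= 1" for n
  using floor_half[of "real n powr hp"] that ord L0 by (auto simp: p_def ge_one_powr_ge_zero)
 have bq: "real n powr hq / 2 <= real (q n)" "real (q n) <= real n powr hq" "1 <= q n" if "n >= 1" for n
  using floor_half[of "real n powr hq"] that ord L0 by (auto simp: q_def ge_one_powr_ge_zero)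
 show ?thesis
 proof (rule char_psum_tendsto_blocks[where r = r and p = p and q = q])
  show "2 <= r" "r <= 3" "r <= 2 + \<delta>" using d' by (auto simp: r_def)
  show "EV n. 1 <= q n \<and> q n <= p n"
   using eventually_ge_at_top[of 1]
  proof eventually_elim
   case (elim n)
   have "real n powr hq <= real n powr hp" using elim ord by (intro powr_mono) auto
   then show ?case using bq(3)[OF elim] unfolding p_def q_def by (auto intro!: nat_mono floor_mono)
  qed
  have "filterlim (\<lambda>n. real n powr hp / 2) at_top sequentially"
   using ord L0 by real_asymp
  then have "filterlim (\<lambda>n. real (p n)) at_top sequentially"
   by (rule filterlim_at_top_mono) (rule eventually_mono[OF eventually_ge_at_top[of 1] bp(1)])
  then show "filterlim p at_top sequentially" by (simp add: filterlim_sequentially_iff_filterlim_real)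
  show "(\<lambda>n. real (q n) / real (p n)) ----> 0"
  proof (rule Lim_null_comparison)
   show "EV n. norm (real (q n) / real (p n)) <= 2 * real n powr (hq - hp)"
    using eventually_ge_at_top[of 1]
   proof eventually_elim
    case (elim n)
    have "real (q n) / real (p n) <= real n powr hq / (real n powr hp / 2)"
     using bp[OF elim] bq[OF elim] elim by (intro frac_le) auto
    then show ?case by (simp add: powr_diff mult.commute)
   qed
   show "(\<lambda>n. 2 * real n powr (hq - hp)) ----> 0" using ord by (intro powr_seq_tendsto_0) simp
  qed
  have psq: "real (p n) / sqrt n <= real n powr (hp - 1 / 2)" if "n >= 1" for n
  proof -
   have "real (p n) / sqrt n <= real n powr hp / real n powr (1 / 2)"
    using bp[OF that] that by (simp add: powr_half_sqrt divide_right_mono)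
   then show ?thesis by (simp add: powr_diff)
  qed
  show "(\<lambda>n. real (p n) / sqrt n) ----> 0"
  proof (rule Lim_null_comparison)
   show "EV n. norm (real (p n) / sqrt n) <= 1 * real n powr (hp - 1 / 2)"
    using eventually_ge_at_top[of 1] by eventually_elim (use psq in auto)
   show "(\<lambda>n. 1 * real n powr (hp - 1 / 2)) ----> 0" using ord U4 by (intro powr_seq_tendsto_0) simp
  qed
  show "(\<lambda>n. sqrt n * real (q n) powr - a') ----> 0"
  proof (rule Lim_null_comparison)
   show "EV n. norm (sqrt n * real (q n) powr - a') <= 2 powr a' * real n powr (1 / 2 - hq * a')"
    using eventually_ge_at_top[of 1]
   proof eventually_elim
    case (elim n)
    have "real (q n) powr - a' <= (real n powr hq / 2) powr - a'"
     using bq[OF elim] elim a'_gt2 by (intro powr_mono2') auto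
    also have "... = 2 powr a' * real n powr - (hq * a')"
     by (simp add: powr_divide powr_powr powr_minus_divide)
    finally have "sqrt n * real (q n) powr - a' <= real n powr (1 / 2) * (2 powr a' * real n powr - (hq * a'))"
     by (simp add: powr_half_sqrt mult_left_mono)
    also have "... = 2 powr a' * real n powr (1 / 2 - hq * a')"
     by (simp add: powr_diff powr_minus_divide)
    finally show ?case by simp
   qed
   have "hq * a' > L * a'" using ord a'_gt2 by (intro mult_strict_right_mono) auto
   moreover have "L * a' = 1 / 2" using a'_gt2 by (simp add: L_def)
   ultimately show "(\<lambda>n. 2 powr a' * real n powr (1 / 2 - hq * a')) ----> 0" by (intro powr_seq_tendsto_0) simp
  qed
  show "(\<lambda>n. real n / real (p n) * (real (p n) / sqrt n) powr r) ----> 0"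
  proof (rule Lim_null_comparison)
   have ex: "1 - hp + (hp - 1 / 2) * r = hp * (1 + \<delta>') - \<delta>' / 2" by (simp add: r_def algebra_simps)
   show "EV n. norm (real n / real (p n) * (real (p n) / sqrt n) powr r) <= 2 * real n powr (hp * (1 + \<delta>') - \<delta>' / 2)"
    using eventually_ge_at_top[of 1]
   proof eventually_elim
    case (elim n)
    have "real n / real (p n) <= real n / (real n powr hp / 2)" using bp[OF elim] elim by (intro divide_left_mono) auto
    also have "... = 2 * real n powr (1 - hp)" using elim by (simp add: powr_diff)
    finally have 1: "real n / real (p n) <= 2 * real n powr (1 - hp)" .
    have 2: "(real (p n) / sqrt n) powr r <= (real n powr (hp - 1 / 2)) powr r"
     using psq[OF elim] d' by (intro powr_mono2) (auto simp: r_def)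
    have "real n / real (p n) * (real (p n) / sqrt n) powr r <= 2 * real n powr (1 - hp) * (real n powr (hp - 1 / 2)) powr r"
     using 1 2 by (intro mult_mono) auto
    also have "... = 2 * real n powr (1 - hp + (hp - 1 / 2) * r)" by (simp add: powr_powr powr_add)
    finally show ?case unfolding ex by simp
   qed
   have "hp * (1 + \<delta>') < U * (1 + \<delta>')" using ord d' by (intro mult_strict_right_mono) auto
   also have "... = \<delta>' / 2"
   proof -
    define x where "x = 1 + \<delta>'"
    have "x \<noteq> 0" using d' by (simp add: x_def)
    then show ?thesis unfolding U_def x_def[symmetric] by simp
   qed
   finally show "(\<lambda>n. 2 * real n powr (hp * (1 + \<delta>') - \<delta>' / 2)) ----> 0" by (intro powr_seq_tendsto_0) simp
  qed
 qed
qed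

lemma long_run_cov_scaleR: "lrc (t *\<^sub>R l) (t *\<^sub>R l) = t\<^sup>2 * lrc l l"
proof -
 have ac: "acov (t *\<^sub>R l) k = t\<^sup>2 * acov l k" for k
  unfolding acov_def integral_mult_right_zero[symmetric]
  by (simp add: blinfun.scaleR_left power2_eq_square mult_ac)
 show ?thesis unfolding long_run_cov_eq ac using suminf_mult[OF summable_acov(3), of "t\<^sup>2" l] by (simp add: algebra_simps)
qed

lemma integral_abs_functional_psum_sqrt:
 fixes l :: L1_dual
 shows "\<exists>c\<ge>0. \<forall>n m. m <= n \<longrightarrow> (\<E> x. \<bar>l (psum {1..m} x)\<bar>) <= c * sqrt n"
proof -
 define D where "D = 2 * (\<Sum>k. real (Suc k) * \<bar>acov l (Suc k)\<bar>)"
 define C where "C = lrc l l"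
 have C: "C >= 0" unfolding C_def by (rule long_run_cov_nonneg)
 have "0 <= D" using square_psum_close[of l 0] unfolding D_def by linarith
 have "(\<E> x. \<bar>l (psum {1..m} x)\<bar>) <= sqrt (C + D) * sqrt n" if "m <= n" for m n
 proof (cases "n = 0")
  case True
  then show ?thesis using that by (simp add: psum_def blinfun.zero_right)
 next
  case False
  have sq: "integrable M (\<lambda>x. (l (psum {1..m} x))\<^sup>2)" by (rule square_functional_psum(1)) auto
  have "(\<E> x. (l (psum {1..m} x))\<^sup>2) <= real m * C + D"
   using square_psum_close[of l m] unfolding C_def D_def by linarith
  also have "... <= real n * C + real n * D"
   using that False C \<open>0 <= D\<close> by (intro add_mono mult_right_mono) (auto simp: mult_le_cancel_right1)
  also have "... = (C + D) * real n" by (simp add: distrib_left mult.commute)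
  finally have le: "sqrt (\<E> x. (l (psum {1..m} x))\<^sup>2) <= sqrt (C + D) * sqrt n"
   unfolding real_sqrt_mult[symmetric] by (rule real_sqrt_le_mono)
  have "(\<lambda>x. l (psum {1..m} x)) \<in> borel_measurable M"
   by (intro borel_measurable_integrable integrable_functional_psum) auto
  then have "(\<E> x. \<bar>l (psum {1..m} x)\<bar>) <= sqrt (\<E> x. (l (psum {1..m} x))\<^sup>2)"
   using expectation_le_sqrt(2)[of "\<lambda>x. \<bar>l (psum {1..m} x)\<bar>"] sq by simp
  then show ?thesis using le by linarith
 qed
 moreover have "sqrt (C + D) >= 0" using C \<open>0 <= D\<close> by simp
 ultimately show ?thesis by blast
qed

text \<open>Mean absolute values of order \<open>sqrt k\<close> make the characteristic functions of
  the normalized sums uniformly Lipschitz, so the argument may vary with \<open>n\<close>.\<close>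

lemma char_scaled_tendsto:
 fixes l :: L1_dual
 assumes r: "filterlim r at_top sequentially" and t: "t ----> e"
 shows "(\<lambda>n. \<E> z. iexp (t n * (blinfun_apply l (psum {1..r n} z) / sqrt (real (r n))))) ----> exp (- (e\<^sup>2 * lrc l l) / 2)"
proof -
 obtain K where K: "K >= 0" "\<And>n m. m <= n ==> (\<E> z. \<bar>l (psum {1..m} z)\<bar>) <= K * sqrt n"
  using integral_abs_functional_psum_sqrt[of l] by auto
 let ?y = "\<lambda>k z. l (psum {1..k} z) / sqrt (real k)"
 have iy: "integrable M (?y k)" for k by (intro integrable_divide integrable_functional_psum) auto
 have Ey: "(\<E> z. \<bar>?y k z\<bar>) <= K" if "k >= 1" for k
  using K(2)[of k k] that by (simp add: pos_divide_le_eq)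
 have ie: "integrable M (\<lambda>z. iexp (c * ?y k z))" for c k
 proof (rule integrable_const_bound[of _ 1])
  have "continuous_on UNIV (\<lambda>x. iexp (c * x))" by (intro continuous_intros)
  from measurable_compose[OF borel_measurable_integrable[OF iy[of k]] borel_measurable_continuous_onI[OF this]]
  show "(\<lambda>z. iexp (c * ?y k z)) \<in> borel_measurable M" .
 qed simp
 have diff: "cmod ((\<E> z. iexp (t n * ?y k z)) - (\<E> z. iexp (e * ?y k z))) <= \<bar>t n - e\<bar> * K" if "k >= 1" for n k
 proof -
  have "integrable M (\<lambda>z. \<bar>t n - e\<bar> * \<bar>?y k z\<bar>)" by (intro integrable_mult_right integrable_abs iy)
  moreover have "cmod (iexp (t n * ?y k z) - iexp (e * ?y k z)) <= \<bar>t n - e\<bar> * \<bar>?y k z\<bar>" for z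
   using cmod_iexp_diff_le[of "t n * ?y k z" "e * ?y k z"] unfolding left_diff_distrib[symmetric] abs_mult .
  ultimately have "cmod ((\<E> z. iexp (t n * ?y k z)) - (\<E> z. iexp (e * ?y k z))) <= (\<E> z. \<bar>t n - e\<bar> * \<bar>?y k z\<bar>)"
   by (intro integral_norm_diff_le ie)
  also have "... = \<bar>t n - e\<bar> * (\<E> z. \<bar>?y k z\<bar>)" by simp
  also have "... <= \<bar>t n - e\<bar> * K" by (intro mult_left_mono Ey that) simp
  finally show ?thesis .
 qed
 have 1: "(\<lambda>n. (\<E> z. iexp (t n * ?y (r n) z)) - (\<E> z. iexp (e * ?y (r n) z))) ----> 0"
 proof (rule Lim_null_comparison)
  have "EV n. r n >= 1" using r by (simp add: filterlim_at_top)
  then show "EV n. cmod ((\<E> z. iexp (t n * ?y (r n) z)) - (\<E> z. iexp (e * ?y (r n) z))) <= \<bar>t n - e\<bar> * K"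
   by eventually_elim (rule diff)
  have "(\<lambda>n. \<bar>t n - e\<bar> * K) ----> \<bar>e - e\<bar> * K" by (intro tendsto_intros t)
  then show "(\<lambda>n. \<bar>t n - e\<bar> * K) ----> 0" by simp
 qed
 have eq: "iexp (blinfun_apply (e *\<^sub>R l) (psum {1..k} z) / sqrt (real k)) = iexp (e * ?y k z)" for k z
  by (simp add: blinfun.scaleR_left)
 have 2: "(\<lambda>n. \<E> z. iexp (e * ?y (r n) z)) ----> exp (- (e\<^sup>2 * lrc l l) / 2)"
  using filterlim_compose[OF char_psum_tendsto[of "e *\<^sub>R l"] r] unfolding eq long_run_cov_scaleR .
 show ?thesis using tendsto_add[OF 1 2] by simp
qed

lemma psum_shift_eq_image: "psum {h + 1..h + r} = psum ((\<lambda>i. i + h) ` {1..r})"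
 by (simp add: image_add_atLeastAtMost' add.commute)

text \<open>After the index \<open>k n\<close> a stretch of length \<open>q n\<close> is dropped, so
  that what precedes and what follows it can be decoupled. The coefficients \<open>1 - v\<close> and
  \<open>- v\<close> of the two stretches produce the variance
  \<open>(1 - s)\<^sup>2 * s + s\<^sup>2 * (1 - s)\<close>, which is
  \<open>s * (1 - s)\<close>.\<close>

theorem char_bridge_tendsto:
 fixes l :: L1_dual and k :: "nat => nat"
 assumes s: "0 < s" "s < 1" and kn: "\<And>n. k n <= n" and lim: "(\<lambda>n. real (k n) / real n) ----> s"
 shows "(\<lambda>n. \<E> t. iexp (blinfun_apply l (psum {1..k n} t - (real (k n) / real n) *\<^sub>R psum {1..n} t) / sqrt n))
  ----> exp (- (s * (1 - s) * lrc l l) / 2)"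
proof -
 define v where "v n = real (k n) / real n" for n
 \<comment> \<open>With exponent 1/4 both \<open>q / sqrt n\<close> and, as \<open>a' > 2\<close>,
   \<open>sqrt n * q powr - a'\<close> tend to 0.\<close>
 define q where "q n = nat \<lfloor>real n powr (1 / 4)\<rfloor>" for n
 have bq: "real n powr (1 / 4) / 2 <= real (q n)" "real (q n) <= real n powr (1 / 4)" "1 <= q n" if "n >= 1" for n
  using floor_half[of "real n powr (1 / 4)"] that by (auto simp: q_def ge_one_powr_ge_zero)
 have klim: "v ----> s" using lim by (simp add: v_def[abs_def])
 have qn0: "(\<lambda>n. real (q n) / real n) ----> 0"
 proof (rule Lim_null_comparison)
  show "EV n. norm (real (q n) / real n) <= 1 * real n powr (- (3 / 4))"
   using eventually_ge_at_top[of 1]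
  proof eventually_elim
   case (elim n)
   have "real (q n) / real n <= real n powr (1 / 4) / real n" using bq[OF elim] by (intro divide_right_mono) auto
   also have "... = real n powr (1 / 4 - 1)" using elim powr_diff[of "real n" "1 / 4" 1] by simp
   finally show ?case by simp
  qed
  show "(\<lambda>n. 1 * real n powr (- (3 / 4))) ----> 0" by (rule powr_seq_tendsto_0) simp
 qed
 define r where "r n = n - (k n + q n)" for n
 have "(\<lambda>n. v n + real (q n) / real n) ----> s + 0" by (intro tendsto_add klim qn0)
 then have "EV n. v n + real (q n) / real n < 1" using s by (intro order_tendstoD) auto
 moreover have "EV n. v n > s / 2" using klim s by (intro order_tendstoD) auto
 ultimately have ev: "EV n. n >= 1 \<and> k n + q n <= n \<and> k n >= 1 \<and> v n > s / 2"
  using eventually_ge_at_top[of 1]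
 proof eventually_elim
  case (elim n)
  then have "real (k n) + real (q n) < real n" by (simp add: v_def add_divide_distrib[symmetric])
  moreover have "v n > 0" using elim s by linarith
  then have "k n > 0" by (simp add: v_def zero_less_divide_iff)
  ultimately show ?case using elim by auto
 qed
 have rn: "(\<lambda>n. real (r n) / real n) ----> 1 - s"
 proof -
  have "(\<lambda>n. 1 - (v n + real (q n) / real n)) ----> 1 - (s + 0)" by (intro tendsto_intros klim qn0)
  moreover have "EV n. 1 - (v n + real (q n) / real n) = real (r n) / real n"
   using ev
  proof eventually_elim
   case (elim n)
   then have "real (r n) = real n - (real (k n) + real (q n))" by (simp add: r_def of_nat_diff)
   then show ?case using elim by (simp add: v_def field_simps)
  qed
  ultimately have "(\<lambda>n. real (r n) / real n) ----> 1 - (s + 0)" by (rule Lim_transform_eventually)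
  then show ?thesis by simp
 qed
 have inf: "filterlim f at_top sequentially" if "(\<lambda>n. real (f n) / real n) ----> c" "c > 0" for f :: "nat => nat" and c
 proof -
  have "filterlim (\<lambda>n. real (f n) / real n * real n) at_top sequentially"
   by (rule filterlim_tendsto_pos_mult_at_top[OF that filterlim_real_sequentially])
  moreover have "EV n. real (f n) / real n * real n = real (f n)"
   using eventually_ge_at_top[of 1] by eventually_elim simp
  ultimately have "filterlim (\<lambda>n. real (f n)) at_top sequentially" using filterlim_cong by fastforce
  then show ?thesis by (simp add: filterlim_sequentially_iff_filterlim_real)
 qed
 have kinf: "filterlim k at_top sequentially" using inf[OF lim s(1)] .
 have rinf: "filterlim r at_top sequentially" using inf[OF rn] s by simp
 define u where "u n = (1 / sqrt n) *\<^sub>R l" for n :: nat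
 have nu: "norm (u n) = norm l / sqrt n" for n by (simp add: u_def)
 define b1 where "b1 n = (1 - v n) * sqrt (real (k n) / real n)" for n
 define b2 where "b2 n = - v n * sqrt (real (r n) / real n)" for n
 define g1 where "g1 n = (\<E> t. iexp (b1 n * (l (psum {1..k n} t) / sqrt (real (k n)))))" for n
 define g2 where "g2 n = (\<E> t. iexp (b2 n * (l (psum {1..r n} t) / sqrt (real (r n)))))" for n
 have b1: "b1 ----> (1 - s) * sqrt s" unfolding b1_def by (intro tendsto_intros klim lim)
 have b2: "b2 ----> - s * sqrt (1 - s)" unfolding b2_def by (intro tendsto_intros klim rn)
 have l1: "g1 ----> exp (- (((1 - s) * sqrt s)\<^sup>2 * lrc l l) / 2)"
  unfolding g1_def by (rule char_scaled_tendsto[OF kinf b1])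
 have l2: "g2 ----> exp (- ((- s * sqrt (1 - s))\<^sup>2 * lrc l l) / 2)"
  unfolding g2_def by (rule char_scaled_tendsto[OF rinf b2])
 have l12: "(\<lambda>n. g1 n * g2 n) ----> of_real (exp (- (s * (1 - s) * lrc l l) / 2))"
 proof -
  have "- (((1 - s) * sqrt s)\<^sup>2 * lrc l l) / 2 + - ((- s * sqrt (1 - s))\<^sup>2 * lrc l l) / 2
    = - (s * (1 - s) * lrc l l) / 2"
  proof -
   have e: "((1 - s) * sqrt s)\<^sup>2 = (1 - s)\<^sup>2 * s" "(- s * sqrt (1 - s))\<^sup>2 = s\<^sup>2 * (1 - s)"
    using s by (simp_all add: power_mult_distrib)
   show ?thesis unfolding e by (simp add: power2_eq_square field_simps)
  qed
  then show ?thesis using tendsto_mult[OF l1 l2] by (simp only: of_real_mult[symmetric] exp_add[symmetric])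
 qed
 define V where "V n t = psum {1..k n} t - v n *\<^sub>R psum {1..n} t" for n t
 define h where "h n = (\<E> t. iexp (blinfun_apply (u n) (V n t)))" for n
 have err: "(\<lambda>n. h n - g1 n * g2 n) ----> 0"
 proof (rule Lim_null_comparison)
  let ?e = "\<lambda>n. norm l * m_r * real n powr (- (1 / 4)) + norm l * Cd * 2 powr a' * real n powr (1 / 2 - a' / 4)"
  show "EV n. cmod (h n - g1 n * g2 n) <= ?e n"
   using ev
  proof eventually_elim
   case (elim n)
   then have n: "n >= 1" "k n + q n <= n" "k n >= 1" and k0: "v n > 0" using s by auto
   have k1: "v n <= 1" using kn[of n] n by (simp add: v_def)
   obtain z where z: "cmod z = 1" "complex_of_real (cmod (h n - g1 n * g2 n)) = z * (h n - g1 n * g2 n)"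
    using cmod_eq_Re_rotated by blast
   define A where "A = psum {1..k n}"
   define G where "G = psum {k n + 1..k n + q n}"
   define I where "I = {(k n + q n) + 1..(k n + q n) + r n}"
   define B where "B = psum I"
   have nr: "(k n + q n) + r n = n" using n by (simp add: r_def)
   have iA: "integrable M A" and iG: "integrable M G" and iB: "integrable M B"
    unfolding A_def G_def B_def I_def by (auto intro!: integrable_psum)
   have dec: "psum {1..n} t = A t + (G t + B t)" for t
   proof -
    have "psum {k n + 1..n} t = G t + B t"
    proof -
     have "{k n + 1..n} = {k n + 1..k n + q n} \<union> I" using n nr by (auto simp: I_def)
     then show ?thesis unfolding G_def B_def I_def psum_def by (simp add: sum.union_disjoint)
    qed
    then show ?thesis using psum_split_at[OF kn[of n]] by (simp add: A_def)
   qed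
   define V' where "V' t = (1 - v n) *\<^sub>R A t - v n *\<^sub>R B t" for t
   have iV': "integrable M V'" unfolding V'_def using iA iB by auto
   have VV: "V n t = V' t - v n *\<^sub>R G t" for t
    unfolding V_def V'_def dec A_def[symmetric] by (simp add: algebra_simps)
   have iV: "integrable M (V n)" unfolding VV[abs_def] using iV' iG by auto
   have VV': "V n t - V' t = (- v n) *\<^sub>R G t" for t unfolding VV by simp
   have 1: "\<bar>(\<E> t. Re (z * iexp ((u n) (V n t)))) - (\<E> t. Re (z * iexp ((u n) (V' t))))\<bar>
     <= norm l * m_r * real n powr (- (1 / 4))"
   proof -
    have "\<bar>(\<E> t. Re (z * iexp ((u n) (V n t)))) - (\<E> t. Re (z * iexp ((u n) (V' t))))\<bar>
     <= (\<E> t. \<bar>(u n) (V n t - V' t)\<bar>)"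
     by (rule integral_lipschitz_diff_le[OF iV iV' z(1)])
    also have "... = v n * (\<E> t. \<bar>(u n) (G t)\<bar>)"
     unfolding VV' using k0 by (simp add: blinfun.scaleR_right blinfun.minus_right abs_mult)
    also have "... <= 1 * (norm (u n) * (real (card {k n + 1..k n + q n}) * m_r))"
     unfolding G_def using k1 k0 by (intro mult_mono integral_abs_functional_psum_le) auto
    also have "... = norm l * m_r * (real (q n) / sqrt n)" by (simp add: nu)
    also have "... <= norm l * m_r * (real n powr (1 / 4) / real n powr (1 / 2))"
     using bq[OF n(1)] m_r_ge1 by (intro mult_left_mono) (auto simp: powr_half_sqrt divide_right_mono)
    also have "real n powr (1 / 4) / real n powr (1 / 2) = real n powr (- (1 / 4))" by (simp add: powr_diff[symmetric])
    finally show ?thesis .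
   qed
   \<comment> \<open>Dividing by \<open>- v n\<close> puts the second stretch into the argument with
     coefficient 1, the form that \<open>decouple_step\<close> requires.\<close>
   define w where "w = (- v n) *\<^sub>R u n"
   define W where "W t = (- ((1 - v n) / v n)) *\<^sub>R A t" for t
   have WB: "blinfun_apply w (W t + y) = (u n) ((1 - v n) *\<^sub>R A t - v n *\<^sub>R y)" for t y
    using k0 by (simp add: w_def W_def blinfun.minus_left blinfun.minus_right blinfun.scaleR_left blinfun.scaleR_right blinfun.add_right blinfun.diff_right field_simps)
   have Wm: "W \<in> borel_measurable (sigma_field M eps {1..k n})"
    unfolding W_def A_def by (intro borel_measurable_scaleR borel_measurable_const psum_meas_sigma) auto
   have iW: "integrable M W" unfolding W_def using iA by auto
   have I: "finite I" "I \<subseteq> {k n + q n..}" "card I = r n" by (auto simp: I_def)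
   have 2: "\<bar>(\<E> t. Re (z * iexp (w (W t + B t)))) - (\<E> t. \<E> t'. Re (z * iexp (w (W t + B t'))))\<bar>
     <= norm l * Cd * 2 powr a' * real n powr (1 / 2 - a' / 4)"
   proof -
    have "\<bar>(\<E> t. Re (z * iexp (w (W t + B t)))) - (\<E> t. \<E> t'. Re (z * iexp (w (W t + B t'))))\<bar>
      <= norm w * real (card I) * Cd * real (q n) powr - a'"
     unfolding B_def by (rule decouple_step[OF n(3) bq(3)[OF n(1)] I(1,2) Wm iW iexp_lipschitz[OF z(1)]])
    also have "... <= (norm l / sqrt n) * real n * Cd * (real n powr (1 / 4) / 2) powr - a'"
    proof -
     have "norm w <= norm l / sqrt n" using k0 k1 by (simp add: w_def nu mult_left_le_one_le divide_right_mono)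
     moreover have "real (q n) powr - a' <= (real n powr (1 / 4) / 2) powr - a'"
      using bq[OF n(1)] n a'_gt2 by (intro powr_mono2') auto
     moreover have "r n <= n" by (simp add: r_def)
     ultimately show ?thesis unfolding I(3) using Cd_pos by (intro mult_mono) auto
    qed
    also have "(real n powr (1 / 4) / 2) powr - a' = 2 powr a' * real n powr - (a' / 4)"
     by (simp add: powr_divide powr_powr powr_minus_divide)
    also have "(norm l / sqrt n) * real n * Cd * (2 powr a' * real n powr - (a' / 4))
      = norm l * Cd * 2 powr a' * ((real n / sqrt n) * real n powr - (a' / 4))" by simp
    also have "(real n / sqrt n) * real n powr - (a' / 4) = real n powr (1 / 2 - a' / 4)"
    proof -
     have "real n / sqrt n = real n powr (1 / 2)" by (simp add: real_div_sqrt powr_half_sqrt)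
     then show ?thesis by (simp only: powr_add[symmetric]) simp
    qed
    finally show ?thesis .
   qed
   have eB: "(\<E> t. iexp (w (B t))) = g2 n"
   proof -
    have "continuous_on UNIV (\<lambda>x. iexp (w x))" by (intro continuous_intros)
    then have "(\<E> t. iexp (w (B t))) = (\<E> t. iexp (w (psum {1..r n} t)))"
     unfolding B_def I_def psum_shift_eq_image
     by (intro expectation_eq_of_distr(1)[where f = "\<lambda>x. iexp (w x)", OF distr_psum_shift] psum_meas borel_measurable_continuous_onI) auto
    also have "... = g2 n"
    proof (cases "r n = 0")
     case True
     then show ?thesis by (simp add: g2_def b2_def psum_def blinfun.zero_right)
    next
     case False
     then have "b2 n * (y / sqrt (real (r n))) = - v n * (1 / sqrt n) * y" for y
      by (simp add: b2_def real_sqrt_divide)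
     then show ?thesis unfolding g2_def w_def u_def by (simp add: blinfun.scaleR_left blinfun.minus_left)
    qed
    finally show ?thesis .
   qed
   have eA: "(\<E> t. iexp (w (W t))) = g1 n"
   proof -
    have "b1 n * (y / sqrt (real (k n))) = (1 - v n) * (1 / sqrt n) * y" for y
     using n(3) by (simp add: b1_def real_sqrt_divide)
    moreover have "w (W t) = (1 - v n) * (1 / sqrt n) * l (psum {1..k n} t)" for t
     using WB[of t 0] by (simp add: u_def A_def blinfun.scaleR_left blinfun.scaleR_right)
    ultimately show ?thesis unfolding g1_def by simp
   qed
   note ieB = integrable_iexp_functional[OF borel_measurable_integrable[OF iB], of w]
    and ieA = integrable_iexp_functional[OF borel_measurable_integrable[OF iW], of w]
   have 3: "(\<E> t. \<E> t'. Re (z * iexp (w (W t + B t')))) = Re (z * (g1 n * g2 n))"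
   proof -
    have "(\<E> t'. Re (z * iexp (w (W t + B t')))) = Re ((z * g2 n) * iexp (w (W t)))" for t
    proof -
     have "(\<E> t'. Re (z * iexp (w (W t + B t'))))
       = (\<E> t'. Re ((z * iexp (w (W t))) * iexp (w (B t'))))"
      by (simp only: blinfun.add_right of_real_add distrib_left exp_add mult_ac)
     also have "... = Re (\<E> t'. (z * iexp (w (W t))) * iexp (w (B t')))"
      using ieB by (intro integral_Re integrable_mult_right)
     also have "... = Re ((z * iexp (w (W t))) * g2 n)"
      using ieB eB by (subst integral_mult_right_zero) auto
     finally show ?thesis by (simp only: mult_ac)
    qed
    then have "(\<E> t. \<E> t'. Re (z * iexp (w (W t + B t'))))
      = (\<E> t. Re ((z * g2 n) * iexp (w (W t))))" by (simp only:)
    also have "... = Re (\<E> t. (z * g2 n) * iexp (w (W t)))"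
     using ieA by (intro integral_Re integrable_mult_right)
    also have "... = Re ((z * g2 n) * g1 n)" using ieA eA by (subst integral_mult_right_zero) auto
    finally show ?thesis by (simp only: mult_ac)
   qed
   have 4: "(\<E> t. Re (z * iexp ((u n) (V n t)))) = Re (z * h n)"
   proof -
    note ie = integrable_iexp_functional[OF borel_measurable_integrable[OF iV], of "u n"]
    have "(\<E> t. Re (z * iexp ((u n) (V n t)))) = Re (\<E> t. z * iexp ((u n) (V n t)))"
     using ie by (intro integral_Re integrable_mult_right)
    then show ?thesis using ie by (simp only: h_def integral_mult_right_zero)
   qed
   have 5: "w (W t + B t) = (u n) (V' t)" for t unfolding WB V'_def ..
   have "cmod (h n - g1 n * g2 n) = Re (z * h n) - Re (z * (g1 n * g2 n))"
    using arg_cong[OF z(2), of Re] by (simp only: Re_complex_of_real right_diff_distrib minus_complex.sel)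
   then show ?case using 1 2 unfolding 3 4 5 by linarith
  qed
  have "a' / 4 > 1 / 2" using a'_gt2 by simp
  then have "?e ----> 0 + 0" by (intro tendsto_add powr_seq_tendsto_0) auto
  then show "?e ----> 0" by simp
 qed
 have "h ----> of_real (exp (- (s * (1 - s) * lrc l l) / 2))"
  using tendsto_add[OF err l12] by simp
 moreover have "h = (\<lambda>n. \<E> t. iexp (l (psum {1..k n} t - (real (k n) / real n) *\<^sub>R psum {1..n} t) / sqrt n))"
  by (simp add: h_def[abs_def] u_def V_def v_def blinfun.scaleR_left)
 ultimately show ?thesis by (simp only:)
qed

section \<open>Law of large numbers over windows\<close>

lemma functional_sq_integrable:
 fixes f :: "L1 => real"
 assumes fc: "continuous_on UNIV f" and fb: "\<And>x. \<bar>f x\<bar> <= c * norm x" and i: "i >= 1"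
 shows "integrable M (\<lambda>z. f (eps i z))" "integrable M (\<lambda>z. (f (eps i z))\<^sup>2)"
  "(\<E> z. (f (eps i z))\<^sup>2) <= c\<^sup>2 * m_r" "(\<E> z. f (eps i z)) = (\<E> z. f (eps 1 z))"
proof -
 have m: "(\<lambda>z. f (eps i z)) \<in> borel_measurable M"
  by (rule measurable_compose[OF eps_meas[OF i] borel_measurable_continuous_onI[OF fc]])
 have sq: "(f x)\<^sup>2 <= c\<^sup>2 * (norm x)\<^sup>2" for x
  using power_mono[OF fb[of x] abs_ge_zero, of 2] by (simp add: power_mult_distrib)
 have in2: "integrable M (\<lambda>z. c\<^sup>2 * (norm (eps i z))\<^sup>2)"
  using integrable_norm_power(1)[OF i, of 2] by simp
 show i2: "integrable M (\<lambda>z. (f (eps i z))\<^sup>2)"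
  using m sq by (intro intg_bound[OF in2]) auto
 then show "integrable M (\<lambda>z. f (eps i z))" by (rule expectation_le_sqrt(1)) (rule m)
 have "(\<E> z. (f (eps i z))\<^sup>2) <= (\<E> z. c\<^sup>2 * (norm (eps i z))\<^sup>2)" by (intro integral_mono i2 in2 sq)
 also have "... = c\<^sup>2 * (\<E> z. (norm (eps i z))\<^sup>2)" by simp
 also have "... <= c\<^sup>2 * m_r" using integrable_norm_power(2)[OF i, of 2] by (intro mult_left_mono) auto
 finally show "(\<E> z. (f (eps i z))\<^sup>2) <= c\<^sup>2 * m_r" .
 show "(\<E> z. f (eps i z)) = (\<E> z. f (eps 1 z))"
  by (rule expectation_eps[OF i borel_measurable_continuous_onI[OF fc]])
qed

lemma summable_powr_a: "summable (\<lambda>k. real (Suc k) powr - a)"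
proof (rule summable_comparison_test'[OF summable_weights, of 0])
 fix n :: nat
 show "norm (real (Suc n) powr - a) <= real (Suc n) * real (Suc n) powr - a"
  by (simp add: mult_le_cancel_right1)
qed

text \<open>\<open>covariance_bound\<close> is applied to the kernel
  \<open>w x * w y / c\<^sup>2\<close>, and the off-diagonal terms are summed by lag.
  \<open>w\<close> is allowed to be nonlinear because it will also be the norm of
  \<open>x - proj L x\<close>.\<close>

lemma variance_sum_functional:
 fixes w :: "L1 => real"
 assumes wc: "continuous_on UNIV w" and wb: "\<And>x. \<bar>w x\<bar> <= c * norm x" and c: "c > 0"
 defines "r \<equiv> (\<E> z. w (eps 1 z))"
 assumes I: "finite I" "I \<subseteq> {1..}"
 shows "integrable M (\<lambda>z. (\<Sum>i\<in>I. w (eps i z) - r)\<^sup>2)"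
  and "(\<E> z. (\<Sum>i\<in>I. w (eps i z) - r)\<^sup>2) <= c\<^sup>2 * (m_r + 2 * Cc * (\<Sum>k. real (Suc k) powr - a)) * real (card I)"
proof -
 note f = functional_sq_integrable[OF wc wb]
 define g where "g i z = w (eps i z) - r" for i z
 have ig: "integrable M (g i)" if "i >= 1" for i unfolding g_def[abs_def] using f(1)[OF that] by simp
 have ig2: "integrable M (\<lambda>z. (g i z)\<^sup>2)" if "i >= 1" for i
  unfolding g_def[abs_def] power2_diff using f(1,2)[OF that] by simp
 have prod: "integrable M (\<lambda>z. g i z * g j z)" if "i >= 1" "j >= 1" for i j
 proof (rule intg_bound)
  show "integrable M (\<lambda>z. (g i z)\<^sup>2 + (g j z)\<^sup>2)" using ig2 that by simp
  show "(\<lambda>z. g i z * g j z) \<in> borel_measurable M"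
   using ig that by (intro borel_measurable_times borel_measurable_integrable) auto
  have "\<bar>x * y\<bar> <= x\<^sup>2 + y\<^sup>2" for x y :: real
  proof -
   have "2 * (\<bar>x\<bar> * \<bar>y\<bar>) <= x\<^sup>2 + y\<^sup>2" using sum_squares_bound[of "\<bar>x\<bar>" "\<bar>y\<bar>"] by simp
   moreover have "0 <= \<bar>x\<bar> * \<bar>y\<bar>" by simp
   ultimately show ?thesis unfolding abs_mult by linarith
  qed
  then show "AE z in M. norm (g i z * g j z) <= norm ((g i z)\<^sup>2 + (g j z)\<^sup>2)" by (intro AE_I2) simp
 qed
 have sqeq: "(\<Sum>i\<in>I. g i z)\<^sup>2 = (\<Sum>i\<in>I. \<Sum>j\<in>I. g i z * g j z)" for z
  by (simp add: power2_eq_square sum_product)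
 have I1: "i >= 1" if "i \<in> I" for i using I that by auto
 show "integrable M (\<lambda>z. (\<Sum>i\<in>I. w (eps i z) - r)\<^sup>2)"
  unfolding g_def[symmetric] sqeq using prod I1 by (intro intg_sum) auto
 have diag: "(\<E> z. g i z * g i z) <= c\<^sup>2 * m_r" if "i >= 1" for i
 proof -
  have "(\<E> z. g i z * g i z) = (\<E> z. (w (eps i z))\<^sup>2 + r\<^sup>2 - 2 * w (eps i z) * r)"
   by (simp add: g_def power2_diff flip: power2_eq_square)
  also have "... = (\<E> z. (w (eps i z))\<^sup>2) - r\<^sup>2"
   using f(1,2)[OF that] f(4)[OF that] by (simp add: prob_space power2_eq_square r_def)
  finally show ?thesis using f(3)[OF that] zero_le_power2[of r] by linarith
 qed
 have off: "\<bar>\<E> z. g i z * g (i + k) z\<bar> <= c\<^sup>2 * Cc * real k powr - a" if i: "i >= 1" and k: "k >= 1" for i k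
 proof -
  have ik: "i + k >= 1" using i by simp
  define h where "h x y = w x * w y / c\<^sup>2" for x y
  have hm: "case_prod h \<in> borel_measurable (borel \<Otimes>\<^sub>M borel)"
   unfolding borel_prod h_def case_prod_beta' using c
   by (intro borel_measurable_continuous_onI continuous_intros continuous_on_compose2[OF wc]) auto
  have hc: "continuous_on UNIV (\<lambda>x. h x y)" for y
   unfolding h_def using c by (intro continuous_intros wc) auto
  have hb: "\<bar>h x y\<bar> <= norm x * norm y" for x y
  proof -
   have "\<bar>w x\<bar> * \<bar>w y\<bar> <= (c * norm x) * (c * norm y)" using wb c by (intro mult_mono) auto
   then show ?thesis using c by (simp add: h_def abs_mult power2_eq_square field_simps)
  qed
  have ih: "integrable M (\<lambda>z. w (eps i z) * w (eps (i + k) z))"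
   using integrable_mult_right[OF covariance_bound(1)[OF i k hm hc hb], of "c\<^sup>2"] c by (simp add: h_def)
  have inner: "(\<E> z'. h x (eps (i + k) z')) = w x * r / c\<^sup>2" for x
   unfolding h_def using f(4)[OF ik] by (simp add: r_def)
  have "(\<E> z. \<E> z'. h (eps i z) (eps (i + k) z')) = r * r / c\<^sup>2"
   unfolding inner using f(4)[OF i] by (simp add: r_def)
  moreover have "(\<E> z. h (eps i z) (eps (i + k) z)) = (\<E> z. w (eps i z) * w (eps (i + k) z)) / c\<^sup>2"
   unfolding h_def by simp
  ultimately have "\<bar>(\<E> z. w (eps i z) * w (eps (i + k) z)) / c\<^sup>2 - r * r / c\<^sup>2\<bar> <= Cc * real k powr - a"
   using covariance_bound(2)[OF i k hm hc hb] by simp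
  then have "\<bar>(\<E> z. w (eps i z) * w (eps (i + k) z)) - r * r\<bar> / c\<^sup>2 <= Cc * real k powr - a"
   by (simp add: diff_divide_distrib[symmetric] abs_divide)
  then have "\<bar>(\<E> z. w (eps i z) * w (eps (i + k) z)) - r * r\<bar> <= c\<^sup>2 * Cc * real k powr - a"
   using c by (simp add: field_simps)
  moreover have "(\<E> z. g i z * g (i + k) z) = (\<E> z. w (eps i z) * w (eps (i + k) z)) - r * r"
  proof -
   have "(\<E> z. g i z * g (i + k) z) = (\<E> z. w (eps i z) * w (eps (i + k) z) - r * w (eps i z) - r * w (eps (i + k) z) + r * r)"
    by (simp add: g_def algebra_simps)
   also have "... = (\<E> z. w (eps i z) * w (eps (i + k) z)) - r * r"
    using ih f(1,4)[OF i] f(1,4)[OF ik] by (simp add: prob_space r_def)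
   finally show ?thesis .
  qed
  ultimately show ?thesis by simp
 qed
 let ?s = "\<Sum>k. real (Suc k) powr - a"
 have tail: "(\<Sum>j\<in>{j\<in>I. i < j}. real (j - i) powr - a) <= ?s" "(\<Sum>j\<in>{j\<in>I. j < i}. real (i - j) powr - a) <= ?s" for i
 proof -
  have "(\<Sum>j\<in>{j\<in>I. i < j}. real (j - i) powr - a) = (\<Sum>k\<in>(\<lambda>j. j - i - 1) ` {j\<in>I. i < j}. real (Suc k) powr - a)"
   by (subst sum.reindex) (auto simp: inj_on_def intro!: sum.cong)
  also have "... <= ?s" using I by (intro sum_le_suminf summable_powr_a) auto
  finally show "(\<Sum>j\<in>{j\<in>I. i < j}. real (j - i) powr - a) <= ?s" .
  have "(\<Sum>j\<in>{j\<in>I. j < i}. real (i - j) powr - a) = (\<Sum>k\<in>(\<lambda>j. i - j - 1) ` {j\<in>I. j < i}. real (Suc k) powr - a)"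
   by (subst sum.reindex) (auto simp: inj_on_def intro!: sum.cong)
  also have "... <= ?s" using I by (intro sum_le_suminf summable_powr_a) auto
  finally show "(\<Sum>j\<in>{j\<in>I. j < i}. real (i - j) powr - a) <= ?s" .
 qed
 have row: "(\<Sum>j\<in>I. \<E> z. g i z * g j z) <= c\<^sup>2 * (m_r + 2 * Cc * ?s)" if i: "i \<in> I" for i
 proof -
  have Ieq: "I = {i} \<union> ({j\<in>I. i < j} \<union> {j\<in>I. j < i})" using i by auto
  have "(\<Sum>j\<in>I. \<E> z. g i z * g j z) = (\<E> z. g i z * g i z)
    + ((\<Sum>j\<in>{j\<in>I. i < j}. \<E> z. g i z * g j z) + (\<Sum>j\<in>{j\<in>I. j < i}. \<E> z. g i z * g j z))"
   using I(1) by (subst Ieq, subst sum.union_disjoint) (auto intro: sum.union_disjoint)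
  moreover have "(\<Sum>j\<in>{j\<in>I. i < j}. \<E> z. g i z * g j z) <= (\<Sum>j\<in>{j\<in>I. i < j}. c\<^sup>2 * Cc * real (j - i) powr - a)"
  proof (rule sum_mono)
   fix j assume j: "j \<in> {j\<in>I. i < j}"
   then have e: "j - i >= 1" "i + (j - i) = j" by auto
   show "(\<E> z. g i z * g j z) <= c\<^sup>2 * Cc * real (j - i) powr - a"
    using off[OF I1[OF i] e(1)] unfolding e(2) by (rule order_trans[OF abs_ge_self])
  qed
  moreover have "... <= c\<^sup>2 * Cc * ?s"
   unfolding sum_distrib_left[symmetric] using Cc_pos by (intro mult_left_mono tail) auto
  moreover have "(\<Sum>j\<in>{j\<in>I. j < i}. \<E> z. g i z * g j z) <= (\<Sum>j\<in>{j\<in>I. j < i}. c\<^sup>2 * Cc * real (i - j) powr - a)"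
  proof (rule sum_mono)
   fix j assume j: "j \<in> {j\<in>I. j < i}"
   then have e: "i - j >= 1" "j + (i - j) = i" "j \<in> I" by auto
   show "(\<E> z. g i z * g j z) <= c\<^sup>2 * Cc * real (i - j) powr - a"
    using off[OF I1[OF e(3)] e(1)] unfolding e(2) mult.commute[of "g i _"] by (rule order_trans[OF abs_ge_self])
  qed
  moreover have "... <= c\<^sup>2 * Cc * ?s"
   unfolding sum_distrib_left[symmetric] using Cc_pos by (intro mult_left_mono tail) auto
  ultimately show ?thesis using diag[OF I1[OF i]] by (simp add: algebra_simps)
 qed
 have "(\<E> z. (\<Sum>i\<in>I. w (eps i z) - r)\<^sup>2) = (\<E> z. (\<Sum>i\<in>I. \<Sum>j\<in>I. g i z * g j z))"
  by (simp only: g_def[symmetric] sqeq)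
 also have "... = (\<Sum>i\<in>I. \<Sum>j\<in>I. \<E> z. g i z * g j z)"
  using prod I1 by (subst Bochner_Integration.integral_sum, auto intro!: Bochner_Integration.integral_sum sum.cong)
 also have "... <= (\<Sum>i\<in>I. c\<^sup>2 * (m_r + 2 * Cc * ?s))" by (rule sum_mono) (rule row)
 finally show "(\<E> z. (\<Sum>i\<in>I. w (eps i z) - r)\<^sup>2) <= c\<^sup>2 * (m_r + 2 * Cc * ?s) * real (card I)"
  by (simp add: mult.commute)
qed

text \<open>Nested sets of \<open>m\<close> positive indices model windows that grow to the right or
  to the left of any index. Quantifying over all of them makes the laws of large numbers below
  uniform in the position.\<close>

definition window :: "nat => (nat => nat set) => bool" where
 "window N I \<longleftrightarrow> (\<forall>m\<le>N. finite (I m) \<and> card (I m) = m \<and> I m \<subseteq> {1..}) \<and> (\<forall>m m'. m <= m' \<longrightarrow> m' <= N \<longrightarrow> I m \<subseteq> I m')"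

lemma (in prob_space) prob_abs_gt_le:
 assumes "integrable M (\<lambda>x. (Y x)\<^sup>2)" "Y \<in> borel_measurable M" "t > 0"
 shows "prob {x \<in> space M. t < \<bar>Y x\<bar>} <= expectation (\<lambda>x. (Y x)\<^sup>2) / t\<^sup>2"
proof -
 have "prob {x \<in> space M. t < \<bar>Y x\<bar>} <= prob {x \<in> space M. t\<^sup>2 <= (Y x)\<^sup>2}"
 proof (rule finite_measure_mono)
  show "{x \<in> space M. t\<^sup>2 <= (Y x)\<^sup>2} \<in> events" using assms(2) by measurable
  show "{x \<in> space M. t < \<bar>Y x\<bar>} \<subseteq> {x \<in> space M. t\<^sup>2 <= (Y x)\<^sup>2}"
   using assms(3) by (auto simp: abs_le_square_iff[symmetric])
 qed
 also have "... <= expectation (\<lambda>x. (Y x)\<^sup>2) / t\<^sup>2"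
  using assms by (intro integral_Markov_inequality_measure[where A = "space M" and u = "\<lambda>x. (Y x)\<^sup>2", simplified]) auto
 finally show ?thesis .
qed

text \<open>Chebyshev's inequality along the squares \<open>k\<^sup>2\<close>, and a bound for the
  sum of absolute values over the at most \<open>3 * k\<close> indices between consecutive squares.
  Both events have probability of order \<open>1 / k\<^sup>2\<close>; the 4 comes from halving the
  level, 36 is 4 times the square of 3.\<close>

lemma slln_scalar:
 fixes w :: "L1 => real"
 assumes wc: "continuous_on UNIV w" and wb: "\<And>x. \<bar>w x\<bar> <= c * norm x" and c: "c > 0"
  and e: "e > 0" and h: "h > 0"
 defines "r \<equiv> (\<E> z. w (eps 1 z))"
 shows "\<exists>K. \<forall>K'\<ge>K. \<forall>N I. window N I \<longrightarrow>
  prob {z \<in> space M. \<exists>m. K' <= m \<and> m <= N \<and> e * real m < \<bar>\<Sum>i\<in>I m. w (eps i z) - r\<bar>} <= h"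
proof -
 note f = functional_sq_integrable[OF wc wb]
 define g where "g i z = w (eps i z) - r" for i z
 define D where "D = c\<^sup>2 * (m_r + 2 * Cc * (\<Sum>k. real (Suc k) powr - a))"
 have vs: "integrable M (\<lambda>z. (\<Sum>i\<in>I. g i z)\<^sup>2)" "(\<E> z. (\<Sum>i\<in>I. g i z)\<^sup>2) <= D * real (card I)"
  if "finite I" "I \<subseteq> {1..}" for I
  unfolding g_def D_def r_def using variance_sum_functional[OF wc wb c that] by auto
 have D0: "D >= 0" unfolding D_def using m_r_ge1 Cc_pos
  by (intro mult_nonneg_nonneg add_nonneg_nonneg suminf_nonneg summable_powr_a) auto
 have mg: "g i \<in> borel_measurable M" if "i >= 1" for i
  unfolding g_def[abs_def] using f(1)[OF that] by (intro borel_measurable_diff borel_measurable_integrable) auto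
 \<comment> \<open>Absolute values inside the sum, since it has to dominate all windows between two
   squares at once; the square of the number of summands is affordable because these stretches are
   short.\<close>
 have absq: "integrable M (\<lambda>z. (\<Sum>i\<in>I. \<bar>g i z\<bar>)\<^sup>2)" "(\<E> z. (\<Sum>i\<in>I. \<bar>g i z\<bar>)\<^sup>2) <= D * (real (card I))\<^sup>2"
  if I: "finite I" "I \<subseteq> {1..}" for I
 proof -
  have le: "(\<Sum>i\<in>I. \<bar>g i z\<bar>)\<^sup>2 <= real (card I) * (\<Sum>i\<in>I. (g i z)\<^sup>2)" for z
   using Cauchy_Schwarz_ineq_sum[of "\<lambda>i. \<bar>g i z\<bar>" "\<lambda>_. 1" I] by (simp add: mult.commute)
  have one: "integrable M (\<lambda>z. (g i z)\<^sup>2)" "(\<E> z. (g i z)\<^sup>2) <= D" if "i \<in> I" for i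
   using vs[of "{i}"] that I by auto
  have isum: "integrable M (\<lambda>z. real (card I) * (\<Sum>i\<in>I. (g i z)\<^sup>2))"
   using one by (intro integrable_mult_right intg_sum) auto
  show i: "integrable M (\<lambda>z. (\<Sum>i\<in>I. \<bar>g i z\<bar>)\<^sup>2)"
  proof (rule intg_bound[OF isum])
   show "(\<lambda>z. (\<Sum>i\<in>I. \<bar>g i z\<bar>)\<^sup>2) \<in> borel_measurable M" using mg I by (intro borel_measurable_power borel_measurable_sum borel_measurable_abs) auto
   show "AE z in M. norm ((\<Sum>i\<in>I. \<bar>g i z\<bar>)\<^sup>2) <= norm (real (card I) * (\<Sum>i\<in>I. (g i z)\<^sup>2))"
    using le by (intro AE_I2) (auto intro: order_trans[OF _ abs_ge_self])
  qed
  have "(\<E> z. (\<Sum>i\<in>I. \<bar>g i z\<bar>)\<^sup>2) <= (\<E> z. real (card I) * (\<Sum>i\<in>I. (g i z)\<^sup>2))" by (rule integral_mono[OF i isum le])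
  also have "... = real (card I) * (\<Sum>i\<in>I. \<E> z. (g i z)\<^sup>2)" using one by simp
  also have "... <= real (card I) * (\<Sum>i\<in>I. D)" using one by (intro mult_left_mono sum_mono) auto
  finally show "(\<E> z. (\<Sum>i\<in>I. \<bar>g i z\<bar>)\<^sup>2) <= D * (real (card I))\<^sup>2" by (simp add: power2_eq_square mult_ac)
 qed
 define C where "C = 4 * D / e\<^sup>2 + 36 * D / e\<^sup>2"
 have C0: "C >= 0" using D0 by (simp add: C_def)
 have sm: "summable (\<lambda>k. 1 / (real k)\<^sup>2)" using inverse_power_summable[of 2, where 'a = real] by (simp add: inverse_eq_divide power_one_over)
 have "\<exists>k0. \<forall>n\<ge>k0. norm (\<Sum>i. 1 / (real (i + n))\<^sup>2) < h / (C + 1)"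
  using suminf_exist_split[OF _ sm, of "h / (C + 1)"] h C0 by (auto simp: divide_pos_pos)
 then obtain k1 where k1: "norm (\<Sum>i. 1 / (real (i + n))\<^sup>2) < h / (C + 1)" if "n >= k1" for n by blast
 define k0 where "k0 = max 1 k1"
 have k0: "k0 >= 1" "(\<Sum>i. 1 / (real (i + k0))\<^sup>2) < h / (C + 1)" using k1[of k0] by (auto simp: k0_def)
 have "prob {z \<in> space M. \<exists>m. K' <= m \<and> m <= N \<and> e * real m < \<bar>\<Sum>i\<in>I m. w (eps i z) - r\<bar>} <= h"
  if K': "K' >= k0\<^sup>2" and W: "window N I" for K' N I
 proof -
  define T where "T m z = (\<Sum>i\<in>I m. g i z)" for m z
  have Im: "finite (I m)" "card (I m) = m" "I m \<subseteq> {1..}" if "m <= N" for m using W that by (auto simp: window_def)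
  have Imono: "I m \<subseteq> I m'" if "m <= m'" "m' <= N" for m m' using W that by (auto simp: window_def)
  \<comment> \<open>Cut off at \<open>N\<close>, beyond which nothing is assumed about
    \<open>I\<close>.\<close>
  define up where "up k = min N ((k + 1)\<^sup>2)" for k :: nat
  define A where "A k = {z \<in> space M. e * (real k)\<^sup>2 / 2 < \<bar>T (k\<^sup>2) z\<bar>}" for k
  define E where "E k = {z \<in> space M. e * (real k)\<^sup>2 / 2 < \<bar>\<Sum>i\<in>I (up k) - I (k\<^sup>2). \<bar>g i z\<bar>\<bar>}" for k
  define S where "S = {k. k0 <= k \<and> k\<^sup>2 <= N}"
  have finS: "finite S"
  proof (rule finite_subset[of _ "{..N}"])
   show "S \<subseteq> {..N}" unfolding S_def using power2_nat_le_imp_le by auto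
  qed simp
  have Tm: "T m \<in> borel_measurable M" if "m <= N" for m
   unfolding T_def[abs_def] using mg Im[OF that] by (intro borel_measurable_sum) auto
  have upk: "k\<^sup>2 <= up k" "up k <= N" if "k \<in> S" for k
   using that by (auto simp: up_def S_def intro!: power_mono)
  have Jk: "finite (I (up k) - I (k\<^sup>2))" "I (up k) - I (k\<^sup>2) \<subseteq> {1..}" "card (I (up k) - I (k\<^sup>2)) <= 3 * k" if k: "k \<in> S" for k
  proof -
   show "finite (I (up k) - I (k\<^sup>2))" "I (up k) - I (k\<^sup>2) \<subseteq> {1..}" using Im[OF upk(2)[OF k]] by auto
   have "k\<^sup>2 <= N" using k by (simp add: S_def)
   then have "card (I (up k) - I (k\<^sup>2)) = up k - k\<^sup>2"
    using Im[of "k\<^sup>2"] Im[OF upk(2)[OF k]] Imono[OF upk[OF k]] by (subst card_Diff_subset) auto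
   also have "... <= (k + 1)\<^sup>2 - k\<^sup>2" unfolding up_def by (intro diff_le_mono) simp
   also have "... = 2 * k + 1" by (simp add: power2_eq_square)
   also have "... <= 3 * k" using k k0 by (simp add: S_def)
   finally show "card (I (up k) - I (k\<^sup>2)) <= 3 * k" .
  qed
  have AM: "A k \<in> events" if "k \<in> S" for k unfolding A_def using Tm[of "k\<^sup>2"] that by (auto simp: S_def)
  have EM: "E k \<in> events" if "k \<in> S" for k
  proof -
   have "(\<lambda>z. \<Sum>i\<in>I (up k) - I (k\<^sup>2). \<bar>g i z\<bar>) \<in> borel_measurable M"
    using mg Jk[OF that] by (intro borel_measurable_sum borel_measurable_abs) auto
   then show ?thesis unfolding E_def by measurable
  qed
  have pA: "prob (A k) <= 4 * D / e\<^sup>2 * (1 / (real k)\<^sup>2)" if k: "k \<in> S" for k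
  proof -
   have kN: "k\<^sup>2 <= N" and kp: "real k > 0" using k k0 by (auto simp: S_def)
   have "prob (A k) <= (\<E> z. (T (k\<^sup>2) z)\<^sup>2) / (e * (real k)\<^sup>2 / 2)\<^sup>2"
    unfolding A_def
   proof (rule prob_abs_gt_le[OF _ Tm[OF kN]])
    show "integrable M (\<lambda>z. (T (k\<^sup>2) z)\<^sup>2)" unfolding T_def by (rule vs(1)[OF Im(1,3)[OF kN]])
   qed (use e kp in simp)
   also have "... <= (D * real (k\<^sup>2)) / (e * (real k)\<^sup>2 / 2)\<^sup>2"
    using vs(2)[OF Im(1,3)[OF kN]] Im(2)[OF kN] by (intro divide_right_mono) (auto simp: T_def)
   also have "... = 4 * D / e\<^sup>2 * (1 / (real k)\<^sup>2)" using kp e by (simp add: power2_eq_square field_simps)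
   finally show ?thesis .
  qed
  have pE: "prob (E k) <= 36 * D / e\<^sup>2 * (1 / (real k)\<^sup>2)" if k: "k \<in> S" for k
  proof -
   have kp: "real k > 0" using k k0 by (auto simp: S_def)
   have "(\<lambda>z. \<Sum>i\<in>I (up k) - I (k\<^sup>2). \<bar>g i z\<bar>) \<in> borel_measurable M"
    using mg Jk[OF k] by (intro borel_measurable_sum borel_measurable_abs) auto
   then have "prob (E k) <= (\<E> z. (\<Sum>i\<in>I (up k) - I (k\<^sup>2). \<bar>g i z\<bar>)\<^sup>2) / (e * (real k)\<^sup>2 / 2)\<^sup>2"
    unfolding E_def using absq(1)[OF Jk(1,2)[OF k]] e kp by (intro prob_abs_gt_le) auto
   also have "... <= (D * (real (card (I (up k) - I (k\<^sup>2))))\<^sup>2) / (e * (real k)\<^sup>2 / 2)\<^sup>2"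
    by (intro divide_right_mono absq(2) Jk[OF k]) auto
   also have "... <= (D * (real (3 * k))\<^sup>2) / (e * (real k)\<^sup>2 / 2)\<^sup>2"
    using D0 Jk(3)[OF k] by (intro divide_right_mono mult_left_mono power_mono) auto
   also have "... = 36 * D / e\<^sup>2 * (1 / (real k)\<^sup>2)" using kp e by (simp add: power2_eq_square field_simps)
   finally show ?thesis .
  qed
  have sub: "{z \<in> space M. \<exists>m. K' <= m \<and> m <= N \<and> e * real m < \<bar>\<Sum>i\<in>I m. w (eps i z) - r\<bar>} \<subseteq> (\<Union>k\<in>S. A k \<union> E k)"
  proof
   fix z assume "z \<in> {z \<in> space M. \<exists>m. K' <= m \<and> m <= N \<and> e * real m < \<bar>\<Sum>i\<in>I m. w (eps i z) - r\<bar>}"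
   then obtain m where z: "z \<in> space M" and m: "K' <= m" "m <= N" "e * real m < \<bar>T m z\<bar>"
    by (auto simp: T_def g_def)
   define k where "k = floor_sqrt m"
   have k: "k\<^sup>2 <= m" "m < (k + 1)\<^sup>2"
    using floor_sqrt_power2_le[of m] Suc_floor_sqrt_power2_gt[of m] by (simp_all add: k_def)
   have "k0 <= k"
   proof (rule ccontr)
    assume "\<not> k0 <= k"
    then have "(k + 1)\<^sup>2 <= k0\<^sup>2" by (intro power_mono) auto
    then show False using k(2) K' m(1) by linarith
   qed
   then have kS: "k \<in> S" using k(1) m(2) by (simp add: S_def)
   have mup: "m <= up k" using k(2) m(2) by (simp add: up_def)
   have sub1: "I (k\<^sup>2) \<subseteq> I m" "I m \<subseteq> I (up k)" using Imono[OF k(1) m(2)] Imono[OF mup upk(2)[OF kS]] by auto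
   have "T m z = T (k\<^sup>2) z + (\<Sum>i\<in>I m - I (k\<^sup>2). g i z)"
    unfolding T_def using sub1(1) Im(1)[OF m(2)] by (simp add: sum.subset_diff add.commute)
   moreover have "\<bar>\<Sum>i\<in>I m - I (k\<^sup>2). g i z\<bar> <= (\<Sum>i\<in>I m - I (k\<^sup>2). \<bar>g i z\<bar>)" by (rule sum_abs)
   moreover have "... <= (\<Sum>i\<in>I (up k) - I (k\<^sup>2). \<bar>g i z\<bar>)"
    using sub1 Jk(1)[OF kS] by (intro sum_mono2) auto
   moreover have "e * (real k)\<^sup>2 <= e * real m" using k(1) e by (intro mult_left_mono) (auto simp flip: of_nat_power)
   ultimately have "e * (real k)\<^sup>2 / 2 < \<bar>T (k\<^sup>2) z\<bar> \<or> e * (real k)\<^sup>2 / 2 < \<bar>\<Sum>i\<in>I (up k) - I (k\<^sup>2). \<bar>g i z\<bar>\<bar>"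
    using m(3) by linarith
   then show "z \<in> (\<Union>k\<in>S. A k \<union> E k)" using kS z by (auto simp: A_def E_def)
  qed
  have "prob {z \<in> space M. \<exists>m. K' <= m \<and> m <= N \<and> e * real m < \<bar>\<Sum>i\<in>I m. w (eps i z) - r\<bar>} <= prob (\<Union>k\<in>S. A k \<union> E k)"
   using sub AM EM finS by (intro finite_measure_mono) auto
  also have "... <= (\<Sum>k\<in>S. prob (A k \<union> E k))"
   using AM EM finS by (intro finite_measure_subadditive_finite) auto
  also have "... <= (\<Sum>k\<in>S. C * (1 / (real k)\<^sup>2))"
  proof (rule sum_mono)
   fix k assume k: "k \<in> S"
   have "prob (A k \<union> E k) <= prob (A k) + prob (E k)" using AM[OF k] EM[OF k] by (rule measure_Un_le)
   also have "... <= 4 * D / e\<^sup>2 * (1 / (real k)\<^sup>2) + 36 * D / e\<^sup>2 * (1 / (real k)\<^sup>2)" using pA[OF k] pE[OF k] by (rule add_mono)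
   also have "... = C * (1 / (real k)\<^sup>2)" by (simp add: C_def distrib_right)
   finally show "prob (A k \<union> E k) <= C * (1 / (real k)\<^sup>2)" .
  qed
  also have "... = C * (\<Sum>k\<in>S. 1 / (real k)\<^sup>2)" by (rule sum_distrib_left[symmetric])
  also have "... <= C * (\<Sum>i. 1 / (real (i + k0))\<^sup>2)"
  proof (rule mult_left_mono[OF _ C0])
   have "(\<Sum>k\<in>S. 1 / (real k)\<^sup>2) = (\<Sum>i\<in>(\<lambda>k. k - k0) ` S. 1 / (real (i + k0))\<^sup>2)"
    by (subst sum.reindex) (auto simp: inj_on_def S_def intro!: sum.cong)
   also have "... <= (\<Sum>i. 1 / (real (i + k0))\<^sup>2)"
    using finS summable_ignore_initial_segment[OF sm, of k0] by (intro sum_le_suminf) auto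
   finally show "(\<Sum>k\<in>S. 1 / (real k)\<^sup>2) <= (\<Sum>i. 1 / (real (i + k0))\<^sup>2)" .
  qed
  also have "... <= C * (h / (C + 1))" using k0(2) C0 by (intro mult_left_mono) auto
  also have "... <= h" using C0 h by (simp add: field_simps)
  finally show ?thesis .
 qed
 then show ?thesis by blast
qed

text \<open>The norm is reduced to finitely many scalar laws: the \<open>L\<close> cell integrals,
  of mean 0, and the nonlinear residual \<open>g\<close>, whose mean is below \<open>e / 4\<close>.
  Mean and fluctuation of the residual take \<open>e / 4\<close> each, the cells together
  \<open>e / 2\<close>.\<close>

theorem slln_window:
 assumes e: "e > 0" and h: "h > 0"
 shows "\<exists>K. \<forall>N I. window N I \<longrightarrow>
  prob {w \<in> space M. \<exists>m. K <= m \<and> m <= N \<and> e * real m < norm (psum (I m) w)} <= h"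
proof -
 have "EV L. L > 0 \<and> (\<E> w. norm (eps 1 w - proj L (eps 1 w))) < e / 4"
  using order_tendstoD(2)[OF proj_error_tendsto[OF integrable_eps[OF order_refl]], of "e / 4"] e
  by (intro eventually_conj eventually_gt_at_top) simp
 then obtain L where L: "L > 0" "(\<E> w. norm (eps 1 w - proj L (eps 1 w))) < e / 4"
  by (auto simp: eventually_sequentially)
 define g where "g x = norm (x - proj L x)" for x
 define r where "r = (\<E> w. g (eps 1 w))"
 define h' where "h' = h / (real L + 1)"
 have h': "h' > 0" using h by (simp add: h'_def add_nonneg_pos)
 have gc: "continuous_on UNIV g"
  unfolding g_def[abs_def] by (intro continuous_intros linear_continuous_on bounded_linear_proj)
 have gb: "\<bar>g x\<bar> <= 2 * norm x" for x using norm_diff_proj_le[of x L] by (simp add: g_def)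
 obtain K0 where K0: "\<And>K' N I. K' >= K0 ==> window N I ==>
   prob {w \<in> space M. \<exists>m. K' <= m \<and> m <= N \<and> e / 4 * real m < \<bar>\<Sum>i\<in>I m. g (eps i w) - r\<bar>} <= h'"
  using slln_scalar[OF gc gb, of "e / 4" h'] e h' unfolding r_def[symmetric] by auto
 have u: "\<exists>K. \<forall>K'\<ge>K. \<forall>N I. window N I \<longrightarrow>
   prob {w \<in> space M. \<exists>m. K' <= m \<and> m <= N \<and> e / (2 * real L) * real m < \<bar>\<Sum>i\<in>I m. cellf L j (eps i w)\<bar>} <= h'" for j
 proof -
  have c: "continuous_on UNIV (\<lambda>x. cellf L j x)" by (intro continuous_intros)
  have b: "\<bar>cellf L j x\<bar> <= (norm (cellf L j) + 1) * norm x" for x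
   using norm_blinfun[of "cellf L j" x] by (simp add: distrib_right add_increasing2)
  have z: "(\<E> w. cellf L j (eps 1 w)) = 0" by (rule integral_functional_eps) simp
  show ?thesis using slln_scalar[OF c b, of "e / (2 * real L)" h'] e h' L(1) unfolding z
   by (simp add: add_nonneg_pos)
 qed
 define Kj where "Kj j = (SOME K. \<forall>K'\<ge>K. \<forall>N I. window N I \<longrightarrow>
   prob {w \<in> space M. \<exists>m. K' <= m \<and> m <= N \<and> e / (2 * real L) * real m < \<bar>\<Sum>i\<in>I m. cellf L j (eps i w)\<bar>} <= h')" for j
 have Kj: "K' >= Kj j ==> window N I ==>
   prob {w \<in> space M. \<exists>m. K' <= m \<and> m <= N \<and> e / (2 * real L) * real m < \<bar>\<Sum>i\<in>I m. cellf L j (eps i w)\<bar>} <= h'" for j K' N I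
  using someI_ex[OF u[of j]] unfolding Kj_def[symmetric] by (elim allE impE) assumption+
 define K where "K = K0 + (\<Sum>j<L. Kj j)"
 have KK: "K >= K0" "j < L ==> K >= Kj j" for j
  using member_le_sum[of j "{..<L}" Kj] by (auto simp: K_def)
 have "prob {w \<in> space M. \<exists>m. K <= m \<and> m <= N \<and> e * real m < norm (psum (I m) w)} <= h"
  if W: "window N I" for N I
 proof -
  have Im: "finite (I m)" "card (I m) = m" "I m \<subseteq> {1..}" if "m <= N" for m using W that by (auto simp: window_def)
  define A where "A = {w \<in> space M. \<exists>m. K <= m \<and> m <= N \<and> e / 4 * real m < \<bar>\<Sum>i\<in>I m. g (eps i w) - r\<bar>}"
  define E where "E j = {w \<in> space M. \<exists>m. K <= m \<and> m <= N \<and> e / (2 * real L) * real m < \<bar>\<Sum>i\<in>I m. cellf L j (eps i w)\<bar>}" for j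
  have mf: "(\<lambda>w. f (eps i w)) \<in> borel_measurable M" if "i >= 1" "continuous_on UNIV f" for f :: "L1 => real" and i
   by (rule measurable_compose[OF eps_meas[OF that(1)] borel_measurable_continuous_onI[OF that(2)]])
  have ms: "(\<lambda>w. \<bar>\<Sum>i\<in>I m. f (eps i w) - c\<bar>) \<in> borel_measurable M" if "m <= N" "continuous_on UNIV f" for f :: "L1 => real" and m c
   using Im[OF that(1)] by (intro borel_measurable_abs borel_measurable_sum borel_measurable_diff borel_measurable_const mf that(2)) auto
  have AM: "A \<in> events"
  proof -
   have "A = (\<Union>m\<in>{K..N}. {w \<in> space M. e / 4 * real m < \<bar>\<Sum>i\<in>I m. g (eps i w) - r\<bar>})" by (auto simp: A_def)
   moreover have "{w \<in> space M. e / 4 * real m < \<bar>\<Sum>i\<in>I m. g (eps i w) - r\<bar>} \<in> events" if "m \<in> {K..N}" for m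
    using ms[OF _ gc, of m r] that by (intro borel_measurable_less) auto
   ultimately show ?thesis by (simp add: sets.finite_UN)
  qed
  have EM: "E j \<in> events" for j
  proof -
   have "E j = (\<Union>m\<in>{K..N}. {w \<in> space M. e / (2 * real L) * real m < \<bar>\<Sum>i\<in>I m. cellf L j (eps i w)\<bar>})" by (auto simp: E_def)
   moreover have "{w \<in> space M. e / (2 * real L) * real m < \<bar>\<Sum>i\<in>I m. cellf L j (eps i w)\<bar>} \<in> events" if "m \<in> {K..N}" for m
   proof (intro borel_measurable_less borel_measurable_const)
    show "(\<lambda>w. \<bar>\<Sum>i\<in>I m. cellf L j (eps i w)\<bar>) \<in> borel_measurable M"
     using ms[of m "\<lambda>x. cellf L j x" 0] that by (simp add: continuous_intros)
   qed
   ultimately show ?thesis by (simp add: sets.finite_UN)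
  qed
  have sub: "{w \<in> space M. \<exists>m. K <= m \<and> m <= N \<and> e * real m < norm (psum (I m) w)} \<subseteq> A \<union> (\<Union>j<L. E j)"
  proof (rule subsetI, rule ccontr)
   fix w assume "w \<in> {w \<in> space M. \<exists>m. K <= m \<and> m <= N \<and> e * real m < norm (psum (I m) w)}"
    and no: "w \<notin> A \<union> (\<Union>j<L. E j)"
   then obtain m where w: "w \<in> space M" and m: "K <= m" "m <= N" "e * real m < norm (psum (I m) w)" by auto
   have 1: "\<bar>\<Sum>i\<in>I m. g (eps i w) - r\<bar> <= e / 4 * real m" using no w m by (auto simp: A_def not_less)
   have 2: "\<bar>cellf L j (psum (I m) w)\<bar> <= e / (2 * real L) * real m" if "j < L" for j
    using no w m that by (auto simp: E_def not_less psum_def blinfun.sum_right)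
   have "norm (psum (I m) w) <= norm (psum (I m) w - proj L (psum (I m) w)) + norm (proj L (psum (I m) w))"
    using norm_triangle_ineq[of "psum (I m) w - proj L (psum (I m) w)" "proj L (psum (I m) w)"] by simp
   moreover have "norm (proj L (psum (I m) w)) <= e / 2 * real m"
   proof -
    have "norm (proj L (psum (I m) w)) <= (\<Sum>j<L. \<bar>cellf L j (psum (I m) w)\<bar>)" by (rule norm_proj_le_sum)
    also have "... <= (\<Sum>j<L. e / (2 * real L) * real m)" using 2 by (intro sum_mono) auto
    also have "... = e / 2 * real m" using L(1) by simp
    finally show ?thesis .
   qed
   moreover have "norm (psum (I m) w - proj L (psum (I m) w)) <= (\<Sum>i\<in>I m. g (eps i w))"
   proof -
    have "psum (I m) w - proj L (psum (I m) w) = (\<Sum>i\<in>I m. eps i w - proj L (eps i w))"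
     by (simp add: psum_def proj_sum sum_subtractf)
    then show ?thesis unfolding g_def by (simp add: norm_sum)
   qed
   moreover have "(\<Sum>i\<in>I m. g (eps i w)) = (\<Sum>i\<in>I m. g (eps i w) - r) + real m * r"
    using Im(2)[OF m(2)] by (simp add: sum_subtractf)
   moreover have "real m * r <= real m * (e / 4)" using L(2) by (intro mult_left_mono) (auto simp: r_def g_def)
   moreover have "real m * (e / 4) = e * real m / 4" "e / 4 * real m = e * real m / 4" "e / 2 * real m = e * real m / 2" by simp_all
   ultimately show False using 1 m(3) by linarith
  qed
  have "prob {w \<in> space M. \<exists>m. K <= m \<and> m <= N \<and> e * real m < norm (psum (I m) w)} <= prob (A \<union> (\<Union>j<L. E j))"
   using sub AM EM by (intro finite_measure_mono) auto
  also have "... <= prob A + prob (\<Union>j<L. E j)" using AM EM by (intro measure_Un_le) auto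
  also have "... <= h' + (\<Sum>j<L. prob (E j))"
  proof (rule add_mono)
   show "prob A <= h'" unfolding A_def by (rule K0[OF KK(1) W])
   show "prob (\<Union>j<L. E j) <= (\<Sum>j<L. prob (E j))" using EM by (intro finite_measure_subadditive_finite) auto
  qed
  also have "... <= h' + (\<Sum>j<L. h')"
   unfolding E_def using KK(2) W by (intro add_left_mono sum_mono Kj) auto
  also have "... = (real L + 1) * h'" by (simp add: distrib_right)
  also have "... = h" using L(1) by (simp add: h'_def add_nonneg_pos)
  finally show ?thesis .
 qed
 then show ?thesis by blast
qed

end

section \<open>Gaussian variables and Brownian motion\<close>

lemma gaussian_L1_distr:
 assumes "gaussian_L1 M X"
 shows "distr M borel (\<lambda>x. blinfun_apply l (X x)) = centered_normal (\<integral>x. (l (X x))\<^sup>2 \<partial>M)"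
  and "(\<lambda>x. l (X x)) \<in> borel_measurable M"
proof -
 have g: "centered_mvn M 1 (\<lambda>i x. l (X x)) (\<lambda>i j. \<integral>x. l (X x) * l (X x) \<partial>M)"
  using assms unfolding gaussian_L1_def by (elim conjE allE[of _ 1] allE[of _ "\<lambda>_. l"])
 then have u: "distr M borel (\<lambda>x. \<Sum>i<1. u i * l (X x)) =
   centered_normal (\<Sum>i<1. \<Sum>j<1. u i * u j * (\<integral>x. l (X x) * l (X x) \<partial>M))" for u :: "nat => real"
  unfolding centered_mvn_def by blast
 show "distr M borel (\<lambda>x. l (X x)) = centered_normal (\<integral>x. (l (X x))\<^sup>2 \<partial>M)"
  using u[of "\<lambda>_. 1"] by (simp add: power2_eq_square)
 show "(\<lambda>x. l (X x)) \<in> borel_measurable M" using g unfolding centered_mvn_def by auto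
qed

section \<open>Moments and characteristic functions of Gaussian functionals\<close>

context prob_space begin

lemma gaussian_std:
 assumes g: "gaussian_L1 M X" and nz: "expectation (\<lambda>x. (blinfun_apply l (X x))\<^sup>2) \<noteq> 0"
 defines "s \<equiv> sqrt (expectation (\<lambda>x. (l (X x))\<^sup>2))"
 shows "s > 0" "distributed M lborel (\<lambda>x. l (X x)) (normal_density 0 s)"
proof -
 have "expectation (\<lambda>x. (l (X x))\<^sup>2) >= 0" by simp
 then show "s > 0" unfolding s_def using nz by (simp add: order_less_le)
 have "distr M lborel (\<lambda>x. l (X x)) = distr M borel (\<lambda>x. l (X x))"
  by (rule distr_cong) auto
 then show "distributed M lborel (\<lambda>x. l (X x)) (normal_density 0 s)"
  using gaussian_L1_distr[OF g, of l] nz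
  unfolding distributed_def by (simp add: centered_normal_def s_def)
qed

lemma gaussian_abs_moment:
 assumes g: "gaussian_L1 M X"
 shows "expectation (\<lambda>z. \<bar>blinfun_apply l (X z)\<bar>) = sqrt (2 / pi) * sqrt (expectation (\<lambda>z. (l (X z))\<^sup>2))"
proof (cases "expectation (\<lambda>z. (l (X z))\<^sup>2) = 0")
 case True
 have "expectation (\<lambda>z. \<bar>l (X z)\<bar>) = (\<integral>x. \<bar>x\<bar> \<partial>distr M borel (\<lambda>z. l (X z)))"
  by (rule integral_distr[symmetric]) (use gaussian_L1_distr(2)[OF g] in auto)
 also have "... = 0" unfolding gaussian_L1_distr(1)[OF g] by (simp add: True centered_normal_def integral_return)
 finally show ?thesis using True by simp
next
 case False
 note s = gaussian_std[OF g False]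
 let ?e = "sqrt (expectation (\<lambda>z. (l (X z))\<^sup>2))"
 have "expectation (\<lambda>z. \<bar>l (X z)\<bar>) = (\<integral>x. normal_density 0 ?e x * \<bar>x\<bar> \<partial>lborel)"
  by (rule distributed_integral[OF s(2), symmetric]) auto
 also have "... = ?e * sqrt (2 / pi)"
  using has_bochner_integral_integral_eq[OF normal_moment_abs_odd[OF s(1), of 0 0]] by simp
 finally show ?thesis by simp
qed

lemma gaussian_char:
 assumes g: "gaussian_L1 M X"
 shows "expectation (\<lambda>z. iexp (blinfun_apply l (X z))) = exp (- expectation (\<lambda>z. (l (X z))\<^sup>2) / 2)"
proof (cases "expectation (\<lambda>z. (l (X z))\<^sup>2) = 0")
 case True
 have "expectation (\<lambda>z. iexp (l (X z))) = (\<integral>x. iexp x \<partial>distr M borel (\<lambda>z. l (X z)))"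
  by (rule integral_distr[symmetric]) (use gaussian_L1_distr(2)[OF g] in auto)
 also have "... = 1" unfolding gaussian_L1_distr(1)[OF g] by (simp add: True centered_normal_def integral_return)
 finally show ?thesis using True by simp
next
 case False
 note s = gaussian_std[OF g False]
 let ?e = "sqrt (expectation (\<lambda>z. (l (X z))\<^sup>2))"
 let ?Y = "\<lambda>z. l (X z) / ?e"
 have d: "distributed M lborel ?Y std_normal_density"
  using s normal_standard_normal_convert[OF s(1), of "\<lambda>z. l (X z)" 0] by simp
 have "distr M borel ?Y = distr M lborel ?Y" by (rule distr_cong) auto
 then have eq: "distr M borel ?Y = std_normal_distribution" using distributed_distr_eq_density[OF d] by simp
 have Ym: "?Y \<in> borel_measurable M" using gaussian_L1_distr(2)[OF g, of l] by simp
 have "expectation (\<lambda>z. iexp (l (X z))) = expectation (\<lambda>z. iexp (?e * ?Y z))"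
  using s(1) by (intro Bochner_Integration.integral_cong) auto
 also have "... = (\<integral>x. iexp (?e * x) \<partial>distr M borel ?Y)"
  by (rule integral_distr[OF Ym, symmetric]) auto
 also have "... = char std_normal_distribution ?e" unfolding eq char_def ..
 also have "... = exp (- (?e\<^sup>2) / 2)" by (simp add: char_std_normal_distribution)
 finally show ?thesis by simp
qed

text \<open>For Gaussian functionals standard deviation and mean absolute value are proportional. So
  a sum of standard deviations becomes the expectation of a sum of absolute values, which for cell
  functionals is bounded by a norm, independently of \<open>N\<close>. This is how the existence of
  the Gaussian variables enters.\<close>

lemma gaussian_sum_sd_le:
 assumes g: "gaussian_L1 M X"
 shows "(\<Sum>c<N. sqrt (expectation (\<lambda>x. (blinfun_apply (v c) (X x))\<^sup>2))) =
  sqrt (pi / 2) * expectation (\<lambda>x. \<Sum>c<N. \<bar>(v c) (X x)\<bar>)"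
proof -
 have X: "integrable M X" using g by (simp add: gaussian_L1_def)
 have i: "integrable M (\<lambda>x. \<bar>(v c) (X x)\<bar>)" for c
  by (intro integrable_abs integrable_bounded_linear[OF blinfun.bounded_linear_right X])
 have "sqrt (pi / 2) * sqrt (2 / pi) = 1" by (simp add: real_sqrt_mult[symmetric])
 then have "sqrt (expectation (\<lambda>x. ((v c) (X x))\<^sup>2)) = sqrt (pi / 2) * expectation (\<lambda>x. \<bar>(v c) (X x)\<bar>)" for c
  by (simp add: gaussian_abs_moment[OF g] mult.assoc[symmetric])
 then show ?thesis using i by (simp add: sum_distrib_left)
qed

lemma gaussian_sum_resid_le:
 assumes g: "gaussian_L1 M X" and "N > 0"
 shows "(\<Sum>c<N. sqrt (expectation (\<lambda>x. (blinfun_apply (resid m N c) (X x))\<^sup>2)))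
  <= sqrt (pi / 2) * expectation (\<lambda>x. norm (X x - proj m (X x)))"
 unfolding gaussian_sum_sd_le[OF g]
proof (intro mult_left_mono integral_mono sum_resid_le[OF assms(2)])
 have X: "integrable M X" using g by (simp add: gaussian_L1_def)
 show "integrable M (\<lambda>x. \<Sum>c<N. \<bar>(resid m N c) (X x)\<bar>)"
  by (intro intg_sum integrable_abs integrable_bounded_linear[OF blinfun.bounded_linear_right X])
 show "integrable M (\<lambda>x. norm (X x - proj m (X x)))"
  by (intro integrable_norm intg_diff X integrable_bounded_linear[OF bounded_linear_proj X])
qed simp

text \<open>A4 bounds the residual functionals of \<open>G\<close> uniformly in the refinement
  \<open>R\<close>, because the translations that occur are shorter than
  \<open>1 / m\<close>.\<close>

lemma gaussian_shift_sd_le: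
 assumes g: "gaussian_L1 M G" and pos: "m > 0" "R > 0" and w: "w > 0" and C1: "C1 > 0"
  and A4: "\<And>y. y >= 0 ==> integrable M (\<lambda>x. (norm (G x - shift_L1 y (G x)))\<^sup>2) \<and>
      sqrt (\<integral>x. (norm (G x - shift_L1 y (G x)))\<^sup>2 \<partial>M) <= C1 * y powr w"
 shows "(\<Sum>c<m * R. sqrt (expectation (\<lambda>x. (blinfun_apply (resid m (m * R) c) (G x))\<^sup>2)))
  <= sqrt (pi / 2) * (2 * C1 * real m powr - w)"
proof -
 have X: "integrable M G" using g by (simp add: gaussian_L1_def)
 let ?h = "\<lambda>r x. norm (G x - shift_L1 (real r / real (m * R)) (G x))"
 have h: "integrable M (?h r)" "expectation (?h r) <= C1 * real m powr - w" if "r < R" for r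
 proof -
  let ?y = "real r / real (m * R)"
  have A: "integrable M (\<lambda>x. (?h r x)\<^sup>2)" "sqrt (\<integral>x. (?h r x)\<^sup>2 \<partial>M) <= C1 * ?y powr w" using A4[of ?y] by auto
  have "(\<lambda>x. sqrt ((?h r x)\<^sup>2)) \<in> borel_measurable M" using borel_measurable_integrable[OF A(1)] by measurable
  then have mb: "?h r \<in> borel_measurable M" by simp
  note e = expectation_le_sqrt[OF A(1) mb]
  show "integrable M (?h r)" by (rule e(1))
  have "real r / real (m * R) <= 1 / real m" using that pos by (simp add: field_simps)
  then have "?y powr w <= (1 / real m) powr w" using w by (intro powr_mono2) auto
  then have "C1 * ?y powr w <= C1 * (1 / real m) powr w" using C1 by (intro mult_left_mono) auto
  then have "C1 * ?y powr w <= C1 * real m powr - w" using pos by (simp add: powr_divide powr_minus_divide del: of_nat_mult)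
  then show "expectation (?h r) <= C1 * real m powr - w" using A(2) e(2) by linarith
 qed
 have "expectation (\<lambda>x. \<Sum>c<m * R. \<bar>(resid m (m * R) c) (G x)\<bar>)
   <= expectation (\<lambda>x. (2 / real R) * (\<Sum>r<R. ?h r x))"
  unfolding resid_apply
 proof (intro integral_mono sum_cellf_diff_proj_le_shift pos)
  show "integrable M (\<lambda>x. \<Sum>c<m * R. \<bar>blinfun_apply (cellf (m * R) c) (G x - proj m (G x))\<bar>)"
   by (intro intg_sum integrable_abs integrable_bounded_linear[OF blinfun.bounded_linear_right]
     intg_diff X integrable_bounded_linear[OF bounded_linear_proj X])
  show "integrable M (\<lambda>x. (2 / real R) * (\<Sum>r<R. ?h r x))"
   using h by (intro integrable_mult_right intg_sum) auto
 qed
 also have "... = (2 / real R) * (\<Sum>r<R. expectation (?h r))" using h by simp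
 also have "... <= (2 / real R) * (\<Sum>r<R. C1 * real m powr - w)" using h by (intro mult_left_mono sum_mono) auto
 also have "... = 2 * C1 * real m powr - w" using pos by simp
 finally show ?thesis unfolding gaussian_sum_sd_le[OF g] by (intro mult_left_mono) auto
qed

end

section \<open>Transfer from the Gaussian variables to the errors\<close>

context mixing_seq begin

text \<open>A mean absolute value is at most the standard deviation, which \<open>eps 1\<close>
  shares with \<open>G\<close>; so the rate of \<open>G\<close> passes to the error although only
  the covariances agree. Letting \<open>R\<close> tend to infinity removes the part that the fine
  cells do not resolve.\<close>

lemma proj_error_eps_le:
 assumes P: "prob_space P" and G: "is_N0 P G (cov_op M (eps 1))" and e: "e > 0" and C1: "C1 > 0"
  and A4: "\<And>y. y >= 0 ==> integrable P (\<lambda>x. (norm (G x - shift_L1 y (G x)))\<^sup>2) \<and>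
      sqrt (\<integral>x. (norm (G x - shift_L1 y (G x)))\<^sup>2 \<partial>P) <= C1 * y powr e"
  and m: "m >= 1"
 shows "(\<E> x. norm (eps 1 x - proj m (eps 1 x))) <= sqrt (pi / 2) * (2 * C1) * real m powr - e"
proof -
 interpret P: prob_space P by fact
 have g: "gaussian_L1 P G" and c: "cov_op P G = cov_op M (eps 1)" using G by (simp_all add: is_N0_def)
 have sd: "(\<integral>x. (blinfun_apply l (G x))\<^sup>2 \<partial>P) = (\<E> x. (l (eps 1 x))\<^sup>2)" for l :: L1_dual
  using fun_cong[OF fun_cong[OF c, of l], of l] by (simp add: cov_op_def power2_eq_square)
 have ie: "integrable M (eps 1)" by (rule integrable_eps) simp
 have iD: "integrable M (\<lambda>x. norm (eps 1 x - proj m (eps 1 x)))" for m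
  by (intro integrable_norm intg_diff ie integrable_bounded_linear[OF bounded_linear_proj ie])
 have il: "integrable M (\<lambda>x. \<bar>l (eps 1 x)\<bar>)" for l :: L1_dual
  by (intro integrable_abs integrable_bounded_linear[OF blinfun.bounded_linear_right ie])
 have le: "(\<E> x. norm (eps 1 x - proj m (eps 1 x))) <= (\<E> x. norm (eps 1 x - proj (m * R) (eps 1 x))) + sqrt (pi / 2) * (2 * C1) * real m powr - e"
  if R: "R >= 1" for R
 proof -
  have "(\<E> x. norm (eps 1 x - proj m (eps 1 x)))
    <= (\<E> x. norm (eps 1 x - proj (m * R) (eps 1 x)) + (\<Sum>j<m * R. \<bar>blinfun_apply (resid m (m * R) j) (eps 1 x)\<bar>))"
   unfolding resid_apply
   using norm_diff_proj_refine_le[of m R] m R il[of "resid _ _ _", unfolded resid_apply]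
   by (intro integral_mono iD intg_add intg_sum) auto
  also have "... = (\<E> x. norm (eps 1 x - proj (m * R) (eps 1 x))) + (\<Sum>j<m * R. \<E> x. \<bar>(resid m (m * R) j) (eps 1 x)\<bar>)"
   using iD il by simp
  also have "(\<Sum>j<m * R. \<E> x. \<bar>(resid m (m * R) j) (eps 1 x)\<bar>) <= (\<Sum>j<m * R. sqrt (\<integral>x. ((resid m (m * R) j) (G x))\<^sup>2 \<partial>P))"
  proof (rule sum_mono)
   fix j
   let ?l = "resid m (m * R) j"
   have "(\<E> x. (\<bar>blinfun_apply ?l (eps 1 x)\<bar>)\<^sup>2) = (\<E> x. (blinfun_apply ?l (eps 1 x))\<^sup>2)" by simp
   moreover have "integrable M (\<lambda>x. (blinfun_apply ?l (eps 1 x))\<^sup>2)"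
    using square_functional_psum(1)[of "{1}" ?l] by (simp add: psum_def)
   ultimately show "(\<E> x. \<bar>blinfun_apply ?l (eps 1 x)\<bar>) <= sqrt (\<integral>x. (blinfun_apply ?l (G x))\<^sup>2 \<partial>P)"
    unfolding sd using expectation_le_sqrt(2)[of "\<lambda>x. \<bar>blinfun_apply ?l (eps 1 x)\<bar>"] borel_measurable_integrable[OF il[of ?l]]
    by simp
  qed
  also have "... <= sqrt (pi / 2) * (2 * C1 * real m powr - e)"
   using P.gaussian_shift_sd_le[OF g _ _ e C1 A4, of m R] m R by auto
  finally show ?thesis by (simp add: mult.assoc)
 qed
 have "filterlim (\<lambda>R. m * R) sequentially sequentially"
  using m by (intro filterlim_subseq) (simp add: strict_mono_def)
 from filterlim_compose[OF proj_error_tendsto[OF ie] this]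
 have "(\<lambda>R. (\<E> x. norm (eps 1 x - proj (m * R) (eps 1 x))) + sqrt (pi / 2) * (2 * C1) * real m powr - e)
   ----> 0 + sqrt (pi / 2) * (2 * C1) * real m powr - e"
  by (intro tendsto_intros)
 from tendsto_lowerbound[OF this, of "\<E> x. norm (eps 1 x - proj m (eps 1 x))"]
 show ?thesis using le by (auto simp: eventually_sequentially)
qed

text \<open>\<open>W\<close> measures the long run variances and its projection error tends to 0;
  \<open>G\<close> measures a single error, with the rate of A4 and with
  \<open>2 * norm (G x)\<close> as bound for the residual uniformly in \<open>m\<close>.\<close>

lemma psum_tail_small:
 assumes P: "prob_space P" and G: "is_N0 P G (cov_op M (eps 1))" and w: "w > 0" and C1: "C1 > 0"
  and A4: "\<And>y. y >= 0 ==> integrable P (\<lambda>x. (norm (G x - shift_L1 y (G x)))\<^sup>2) \<and>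
      sqrt (\<integral>x. (norm (G x - shift_L1 y (G x)))\<^sup>2 \<partial>P) <= C1 * y powr w"
  and Q: "prob_space Q" and W: "is_N0 Q W (lrc)" and e: "e > 0"
 shows "\<exists>m1. \<forall>m\<ge>m1. EV n. (\<E> x. norm (psum {1..n} x - proj m (psum {1..n} x))) <= e * sqrt n"
proof -
 interpret P: prob_space P by fact
 interpret Q: prob_space Q by fact
 have g: "gaussian_L1 P G" and c: "cov_op P G = cov_op M (eps 1)" using G by (simp_all add: is_N0_def)
 have gW: "gaussian_L1 Q W" and cW: "cov_op Q W = lrc" using W by (simp_all add: is_N0_def)
 have sd: "(\<E> x. (blinfun_apply l (eps 1 x))\<^sup>2) = (\<integral>x. (l (G x))\<^sup>2 \<partial>P)" for l :: L1_dual
  using fun_cong[OF fun_cong[OF c, of l], of l] by (simp add: cov_op_def power2_eq_square)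
 have sdW: "lrc l l = (\<integral>x. (l (W x))\<^sup>2 \<partial>Q)" for l
  using fun_cong[OF fun_cong[OF cW, of l], of l] by (simp add: cov_op_def power2_eq_square)
 have iG: "integrable P G" and iW: "integrable Q W" using g gW by (simp_all add: gaussian_L1_def)
 show ?thesis
 proof (rule proj_tail_small[where W = "sqrt (pi / 2) * (\<integral>x. 2 * norm (G x) \<partial>P)", OF long_run_cov_nonneg _ w proj_error_eps_le[OF P G w C1 A4] _ e])
  fix e :: real assume "e > 0"
  moreover have "(\<lambda>m. sqrt (pi / 2) * (\<integral>x. norm (W x - proj m (W x)) \<partial>Q)) ----> sqrt (pi / 2) * 0"
   by (intro tendsto_intros proj_error_tendsto iW)
  ultimately have "EV m. sqrt (pi / 2) * (\<integral>x. norm (W x - proj m (W x)) \<partial>Q) < e"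
   by (intro order_tendstoD) auto
  then obtain m1 where m1: "\<And>m. m >= m1 ==> sqrt (pi / 2) * (\<integral>x. norm (W x - proj m (W x)) \<partial>Q) < e"
   by (auto simp: eventually_sequentially)
  show "\<exists>m1. \<forall>m\<ge>m1. \<forall>R\<ge>1. m >= 1 \<longrightarrow> (\<Sum>c<m * R. sqrt (lrc (resid m (m * R) c) (resid m (m * R) c))) <= e"
  proof (intro exI[of _ m1] allI impI)
   fix m R :: nat assume "m >= m1" "R >= 1" "m >= 1"
   then show "(\<Sum>c<m * R. sqrt (lrc (resid m (m * R) c) (resid m (m * R) c))) <= e"
    unfolding sdW using Q.gaussian_sum_resid_le[OF gW, of "m * R" m] m1[of m] by simp
  qed
 next
  fix m R :: nat assume mR: "m >= 1" "R >= 1"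
  have "(\<Sum>c<m * R. sqrt (\<E> x. (resid m (m * R) c (eps 1 x))\<^sup>2)) <= sqrt (pi / 2) * (\<integral>x. norm (G x - proj m (G x)) \<partial>P)"
   unfolding sd using P.gaussian_sum_resid_le[OF g, of "m * R" m] mR by simp
  also have "... <= sqrt (pi / 2) * (\<integral>x. 2 * norm (G x) \<partial>P)"
   by (intro mult_left_mono integral_mono norm_diff_proj_le integrable_norm intg_diff iG
     integrable_bounded_linear[OF bounded_linear_proj iG] integrable_mult_right) auto
  finally show "(\<Sum>c<m * R. sqrt (\<E> x. (resid m (m * R) c (eps 1 x))\<^sup>2)) <= sqrt (pi / 2) * (\<integral>x. 2 * norm (G x) \<partial>P)" .
 qed
qed

end

section \<open>Variance of Brownian motion and its bridge\<close>

lemma nonneg_additive_linear: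
 fixes v :: "real => real"
 assumes add: "\<And>x y. 0 <= x ==> 0 <= y ==> v (x + y) = v x + v y" and nn: "\<And>x. 0 <= x ==> 0 <= v x"
  and s: "0 <= s"
 shows "v s = s * v 1"
proof -
 have m: "v (real k * x) = real k * v x" if "0 <= x" for k x
 proof (induction k)
  case 0
  show ?case using add[of 0 0] by simp
 next
  case (Suc k)
  then show ?case using add[of x "real k * x"] that by (simp add: distrib_right)
 qed
 have mono: "v x <= v y" if "0 <= x" "x <= y" for x y
  using add[of x "y - x"] nn[of "y - x"] that by simp
 have "\<bar>v s - s * v 1\<bar> <= v 1 * inverse (real (Suc n))" for n
 proof -
  define k where "k = nat \<lfloor>real (Suc n) * s\<rfloor>"
  have k: "real k <= real (Suc n) * s" "real (Suc n) * s <= real (Suc k)" using s unfolding k_def by simp_all linarith+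
  have "real k * v 1 <= real (Suc n) * v s" "real (Suc n) * v s <= real (Suc k) * v 1"
   using mono[OF _ k(1)] mono[OF _ k(2)] s m[of 1 k] m[of 1 "Suc k"] m[OF s, of "Suc n"] by (auto simp del: of_nat_Suc)
  moreover have "real k * v 1 <= real (Suc n) * s * v 1" "real (Suc n) * s * v 1 <= real (Suc k) * v 1"
   using k nn[of 1] by (auto intro!: mult_right_mono)
  ultimately have "\<bar>real (Suc n) * v s - real (Suc n) * s * v 1\<bar> <= v 1" by (simp add: distrib_right)
  then have "\<bar>real (Suc n) * (v s - s * v 1)\<bar> <= v 1" by (simp add: right_diff_distrib mult.assoc)
  then show ?thesis unfolding abs_mult by (simp add: field_simps)
 qed
 moreover have "(\<lambda>n. v 1 * inverse (real (Suc n))) ----> v 1 * 0" by (intro tendsto_intros LIMSEQ_inverse_real_of_nat)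
 ultimately have "\<bar>v s - s * v 1\<bar> <= v 1 * 0" by (intro LIMSEQ_le_const) auto
 then show ?thesis by simp
qed

context
 fixes Q :: "'c measure" and W :: "real => 'c => L1" and S
 assumes bm: "brownian_motion_L1 Q W S"
begin

lemma bm_prob: "prob_space Q" using bm by (simp add: brownian_motion_L1_def)

interpretation Q: prob_space Q by (rule bm_prob)

lemma bm_meas: "t >= 0 ==> W t \<in> borel_measurable Q" using bm by (simp add: brownian_motion_L1_def)

lemma bm_start: "AE x in Q. W 0 x = 0" using bm by (auto simp: brownian_motion_L1_def)

lemma bm_gauss: "0 <= u ==> u <= t ==> gaussian_L1 Q (\<lambda>x. W t x - W u x)"
 using bm unfolding brownian_motion_L1_def by blast

lemma bm_N0: "is_N0 Q (W 1) S" using bm by (simp add: brownian_motion_L1_def)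

lemma bm_char_prod:
 assumes ut: "0 <= u" "u <= t"
 shows "Q.expectation (\<lambda>z. iexp (blinfun_apply l (W u z - W 0 z) + blinfun_apply l' (W t z - W u z)))
  = exp (- Q.expectation (\<lambda>z. (l (W u z - W 0 z))\<^sup>2) / 2)
  * exp (- Q.expectation (\<lambda>z. (l' (W t z - W u z))\<^sup>2) / 2)"
proof -
 \<comment> \<open>The grid 0, \<open>u\<close>, \<open>t\<close> as a function on all of
   \<open>nat\<close>, since the definition of independent increments quantifies over such
   functions.\<close>
 define tt where "tt i = (if i = 0 then 0 else if i = 1 then u else t)" for i :: nat
 define L where "L i = (if i = 0 then l else l')" for i :: nat
 have "\<forall>(t :: nat => real) k. 0 <= t 0 \<and> (\<forall>i<k. t i <= t (Suc i)) \<longrightarrow>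
    Q.indep_vars (\<lambda>_. borel) (\<lambda>i z. W (t (Suc i)) z - W (t i) z) {..<k}"
  using bm unfolding brownian_motion_L1_def by blast
 then have "0 <= tt 0 \<and> (\<forall>i<2. tt i <= tt (Suc i)) \<longrightarrow>
    Q.indep_vars (\<lambda>_. borel) (\<lambda>i z. W (tt (Suc i)) z - W (tt i) z) {..<2}" by (elim allE)
 moreover have "0 <= tt 0 \<and> (\<forall>i<2. tt i <= tt (Suc i))" using ut by (auto simp: tt_def less_2_cases_iff)
 ultimately have iv: "Q.indep_vars (\<lambda>_. borel) (\<lambda>i z. W (tt (Suc i)) z - W (tt i) z) {..<2}" by (rule mp)
 have mi: "(\<lambda>x. iexp (blinfun_apply (L i) x)) \<in> borel_measurable borel" for i
  by (intro borel_measurable_continuous_onI continuous_intros)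
 have iv2: "Q.indep_vars (\<lambda>_. borel) (\<lambda>i z. iexp ((L i) (W (tt (Suc i)) z - W (tt i) z))) {..<2}"
  by (rule Q.indep_vars_compose2[OF iv mi])
 have m: "(\<lambda>z. W (tt (Suc i)) z - W (tt i) z) \<in> borel_measurable Q" for i
  using ut by (intro borel_measurable_diff bm_meas) (auto simp: tt_def)
 have g: "gaussian_L1 Q (\<lambda>z. W (tt (Suc i)) z - W (tt i) z)" for i
  using ut by (intro bm_gauss) (auto simp: tt_def)
 have "Q.expectation (\<lambda>z. \<Prod>i<2. iexp ((L i) (W (tt (Suc i)) z - W (tt i) z)))
   = (\<Prod>i<2. Q.expectation (\<lambda>z. iexp ((L i) (W (tt (Suc i)) z - W (tt i) z))))"
  by (rule Q.indep_vars_lebesgue_integral[OF _ iv2]) (auto intro: Q.integrable_const_bound[of _ 1] measurable_compose[OF m mi])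
 moreover have two: "{..<2} = {0, 1::nat}" by auto
 ultimately show ?thesis
  unfolding Q.gaussian_char[OF g] two by (simp add: tt_def L_def exp_add distrib_left)
qed

text \<open>Additivity of the variance in time is read off from the product of characteristic
  functions and the stationarity of increments; being nonnegative as well, it is linear.\<close>

lemma bm_variance:
 assumes "0 <= u" "u <= t"
 shows "Q.expectation (\<lambda>z. (blinfun_apply l (W t z - W u z))\<^sup>2) = (t - u) * S l l"
proof -
 define v where "v s = Q.expectation (\<lambda>z. (blinfun_apply l (W s z - W 0 z))\<^sup>2)" for s
 have inc: "Q.expectation (\<lambda>z. (blinfun_apply l (W t z - W u z))\<^sup>2) = v (t - u)" if ut: "0 <= u" "u <= t" for u t
 proof -
  have "\<forall>s t h. 0 <= s \<and> s <= t \<and> 0 <= h \<longrightarrow>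
    distr Q borel (\<lambda>z. W (t + h) z - W (s + h) z) = distr Q borel (\<lambda>z. W t z - W s z)"
   using bm unfolding brownian_motion_L1_def by blast
  then have "distr Q borel (\<lambda>z. W (t - u + u) z - W (0 + u) z) = distr Q borel (\<lambda>z. W (t - u) z - W 0 z)"
   using ut by (elim allE[of _ 0] allE[of _ "t - u"] allE[of _ u]) simp
  then have d: "distr Q borel (\<lambda>z. W t z - W u z) = distr Q borel (\<lambda>z. W (t - u) z - W 0 z)" by simp
  have f: "(\<lambda>x. (blinfun_apply l x)\<^sup>2) \<in> borel_measurable borel"
   by (intro borel_measurable_continuous_onI continuous_intros)
  have "Q.expectation (\<lambda>z. (blinfun_apply l (W t z - W u z))\<^sup>2) = (\<integral>x. (blinfun_apply l x)\<^sup>2 \<partial>distr Q borel (\<lambda>z. W t z - W u z))"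
   using ut f by (intro integral_distr[symmetric] borel_measurable_diff bm_meas) auto
  also have "... = v (t - u)"
   unfolding d v_def using ut f by (intro integral_distr borel_measurable_diff bm_meas) auto
  finally show ?thesis .
 qed
 have add: "v (x + y) = v x + v y" if "0 <= x" "0 <= y" for x y
 proof -
  have "exp (- v (x + y) / 2) = Q.expectation (\<lambda>z. iexp (blinfun_apply l (W (x + y) z - W 0 z)))"
   unfolding v_def using that by (intro Q.gaussian_char[OF bm_gauss, symmetric]) auto
  also have "... = Q.expectation (\<lambda>z. iexp (blinfun_apply l (W x z - W 0 z) + blinfun_apply l (W (x + y) z - W x z)))"
   by (simp add: blinfun.diff_right)
  also have "... = exp (- v x / 2) * exp (- v y / 2)"
   using bm_char_prod[of x "x + y" l l] inc[of x "x + y"] that by (simp add: v_def)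
  finally have "exp (- v (x + y) / 2) = exp (- v x / 2 + - v y / 2)" unfolding exp_add of_real_mult[symmetric] of_real_eq_iff .
  then show ?thesis by simp
 qed
 have "S l l = Q.expectation (\<lambda>z. (blinfun_apply l (W 1 z))\<^sup>2)"
  using bm_N0 by (auto simp: is_N0_def cov_op_def power2_eq_square)
 also have "... = v 1"
  unfolding v_def
 proof (rule integral_cong_AE)
  show "(\<lambda>z. (blinfun_apply l (W 1 z))\<^sup>2) \<in> borel_measurable Q" "(\<lambda>z. (blinfun_apply l (W 1 z - W 0 z))\<^sup>2) \<in> borel_measurable Q"
   by (intro measurable_compose[OF _ borel_measurable_continuous_onI[of "\<lambda>x. (blinfun_apply l x)\<^sup>2"]] borel_measurable_diff bm_meas continuous_intros; simp)+
  show "AE z in Q. (blinfun_apply l (W 1 z))\<^sup>2 = (blinfun_apply l (W 1 z - W 0 z))\<^sup>2"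
   using bm_start by eventually_elim simp
 qed
 finally have "v s = s * S l l" if "0 <= s" for s
  using nonneg_additive_linear[of v, OF add _ that] by (simp add: v_def)
 then show ?thesis using inc[OF assms] assms by simp
qed

text \<open>Where \<open>W 0 = 0\<close>, the bridge is \<open>1 - s\<close> times the increment
  over [0, s] minus \<open>s\<close> times the increment over [s, 1], two independent Gaussian
  variables.\<close>

theorem bm_bridge_char:
 assumes s: "0 <= s" "s <= 1"
 shows "Q.expectation (\<lambda>z. iexp (blinfun_apply l (W s z - s *\<^sub>R W 1 z))) = exp (- (s * (1 - s) * S l l) / 2)"
proof -
 have "Q.expectation (\<lambda>z. iexp (blinfun_apply l (W s z - s *\<^sub>R W 1 z)))
   = Q.expectation (\<lambda>z. iexp (blinfun_apply ((1 - s) *\<^sub>R l) (W s z - W 0 z) + blinfun_apply ((- s) *\<^sub>R l) (W 1 z - W s z)))"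
 proof (rule integral_cong_AE)
  have mi: "(\<lambda>z. iexp (blinfun_apply l (X z))) \<in> borel_measurable Q" if "X \<in> borel_measurable Q" for X l
   by (intro measurable_compose[OF that borel_measurable_continuous_onI[of "\<lambda>x. iexp (blinfun_apply l x)"]] continuous_intros)
  show "(\<lambda>z. iexp (blinfun_apply l (W s z - s *\<^sub>R W 1 z))) \<in> borel_measurable Q"
   using s by (intro mi borel_measurable_diff borel_measurable_scaleR borel_measurable_const bm_meas) auto
  show "(\<lambda>z. iexp (blinfun_apply ((1 - s) *\<^sub>R l) (W s z - W 0 z) + blinfun_apply ((- s) *\<^sub>R l) (W 1 z - W s z))) \<in> borel_measurable Q"
   using s unfolding of_real_add distrib_left exp_add
   by (intro borel_measurable_times mi borel_measurable_diff bm_meas) auto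
  show "AE z in Q. iexp (blinfun_apply l (W s z - s *\<^sub>R W 1 z)) =
   iexp (blinfun_apply ((1 - s) *\<^sub>R l) (W s z - W 0 z) + blinfun_apply ((- s) *\<^sub>R l) (W 1 z - W s z))"
   using bm_start
  proof eventually_elim
   case (elim z)
   have "blinfun_apply l (W s z - s *\<^sub>R W 1 z) = blinfun_apply ((1 - s) *\<^sub>R l) (W s z - W 0 z) + blinfun_apply ((- s) *\<^sub>R l) (W 1 z - W s z)"
    using elim by (simp add: blinfun.diff_right blinfun.scaleR_right blinfun.scaleR_left blinfun.minus_left blinfun.diff_left algebra_simps)
   then show ?case by simp
  qed
 qed
 also have "... = exp (- ((1 - s)\<^sup>2 * (s * S l l)) / 2) * exp (- (s\<^sup>2 * ((1 - s) * S l l)) / 2)"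
  using bm_char_prod[OF s, of "(1 - s) *\<^sub>R l" "(- s) *\<^sub>R l"] bm_variance[of 0 s l] bm_variance[OF s, of l] s
  by (simp add: blinfun.scaleR_left blinfun.minus_left power_mult_distrib)
 also have "... = complex_of_real (exp (- ((1 - s)\<^sup>2 * (s * S l l)) / 2 + - (s\<^sup>2 * ((1 - s) * S l l)) / 2))" 
  by (simp only: exp_add of_real_mult)
 also have "- ((1 - s)\<^sup>2 * (s * S l l)) / 2 + - (s\<^sup>2 * ((1 - s) * S l l)) / 2 = - (s * (1 - s) * S l l) / 2"
  by (simp add: power2_eq_square field_simps)
 finally show ?thesis .
qed

end

section \<open>Weak convergence in L1\<close>

text \<open>Trigonometric polynomials in continuous functionals, in phase form. Convergence of
  characteristic functions gives convergence of their expectations, and the product formula for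
  cosines makes them an algebra, as Stone-Weierstrass requires.\<close>

inductive trig :: "(L1 => real) => bool" where
 cos: "trig (\<lambda>x. c * cos (blinfun_apply l x + e))"
| add: "trig f ==> trig g ==> trig (\<lambda>x. f x + g x)"

lemma trig_cong: "trig f ==> (\<And>x. f x = g x) ==> trig g"
 by (metis ext)

lemma trig_const: "trig (\<lambda>_. c)"
 by (rule trig_cong[OF trig.cos[of c 0 0]]) simp

lemma trig_mult_cos: "trig f ==> trig (\<lambda>x. f x * (c * cos (blinfun_apply l x + e)))"
proof (induction rule: trig.induct)
 case (cos c' l' e')
 have pc: "c' * c / 2 * cos (u - w) + c' * c / 2 * cos (u + w) = c' * cos u * (c * cos w)" for u w :: real
  by (simp add: cos_add cos_diff field_simps)
 show ?case
 proof (rule trig_cong[OF trig.add[OF trig.cos[of "c' * c / 2" "l' - l" "e' - e"] trig.cos[of "c' * c / 2" "l' + l" "e' + e"]]])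
  fix x
  have "blinfun_apply (l' - l) x + (e' - e) = (blinfun_apply l' x + e') - (l x + e)"
   "blinfun_apply (l' + l) x + (e' + e) = (l' x + e') + (l x + e)"
   by (simp_all add: blinfun.diff_left blinfun.add_left)
  then show "c' * c / 2 * cos ((l' - l) x + (e' - e)) + c' * c / 2 * cos ((l' + l) x + (e' + e))
   = c' * cos (l' x + e') * (c * cos (l x + e))" by (simp only: pc)
 qed
next
 case (add f g)
 from trig.add[OF add.IH] show ?case by (rule trig_cong) (simp add: distrib_right)
qed

lemma trig_mult: "trig g ==> trig f ==> trig (\<lambda>x. f x * g x)"
proof (induction rule: trig.induct)
 case (cos c l e)
 then show ?case by (rule trig_mult_cos)
next
 case (add g h)
 from trig.add[OF add.IH(1)[OF add.prems] add.IH(2)[OF add.prems]] show ?case by (rule trig_cong) (simp add: distrib_left)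
qed

lemma trig_continuous: "trig f ==> continuous_on A f"
 by (induction rule: trig.induct) (auto intro!: continuous_intros)

lemma trig_bounded: "trig f ==> \<exists>B. \<forall>x. \<bar>f x\<bar> <= B"
proof (induction rule: trig.induct)
 case (cos c l e)
 show ?case by (rule exI[of _ "\<bar>c\<bar>"]) (simp add: abs_mult mult_left_le)
next
 case (add f g)
 then obtain B C where "\<And>x. \<bar>f x\<bar> <= B" "\<And>x. \<bar>g x\<bar> <= C" by auto
 then have "\<bar>f x + g x\<bar> <= B + C" for x by (meson abs_triangle_ineq add_mono order_trans)
 then show ?case by blast
qed

lemma trig_compose_proj: "trig f ==> trig (\<lambda>x. f (proj m x))"
proof (induction rule: trig.induct)
 case (cos c l e)
 show ?case by (rule trig_cong[OF trig.cos[of c "l o\<^sub>L Blinfun (proj m)" e]])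
   (simp add: bounded_linear_Blinfun_apply[OF bounded_linear_proj])
qed (rule trig.add)

text \<open>The sign of \<open>x - y\<close> gives a functional that separates the points; it is
  scaled so that both values lie in [-1, 1], where the sine is injective.\<close>

lemma trig_separates:
 fixes x y :: L1
 assumes "x \<noteq> y"
 shows "\<exists>f. trig f \<and> f x \<noteq> f y"
proof -
 define e where "e t = sgn (rep_L1 (x - y) t)" for t
 have m: "e \<in> borel_measurable leb01" unfolding e_def[abs_def] by measurable
 have b: "\<bar>e t\<bar> <= 1" for t by (simp add: e_def sgn_if)
 have "dualf e (x - y) = norm (x - y)"
  unfolding dualf_apply[OF m b] norm_L1_rep by (simp add: e_def abs_sgn mult.commute)
 then have uv: "dualf e x \<noteq> dualf e y" using assms by (auto simp: blinfun.diff_right)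
 define c where "c = 1 / (\<bar>dualf e x\<bar> + \<bar>dualf e y\<bar> + 1)"
 have c: "c > 0" by (simp add: c_def add_nonneg_pos)
 have bd: "\<bar>c * dualf e x\<bar> <= 1" "\<bar>c * dualf e y\<bar> <= 1"
  using c by (simp_all add: c_def field_simps abs_mult)
 have "sin (c * dualf e x) \<noteq> sin (c * dualf e y)"
 proof
  assume "sin (c * dualf e x) = sin (c * dualf e y)"
  then have "c * dualf e x = c * dualf e y" by (rule sin_inj_pi[rotated 4]) (use bd pi_gt3 in linarith)+
  then show False using uv c by simp
 qed
 moreover have "cos (t - pi / 2) = sin t" for t :: real by (simp add: cos_diff)
 ultimately show ?thesis
  by (intro exI[of _ "\<lambda>z. 1 * cos (blinfun_apply (c *\<^sub>R dualf e) z + - (pi / 2))"] conjI trig.cos) (simp add: blinfun.scaleR_left)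
qed

lemma trig_polynomial: "real_polynomial_function p ==> trig h ==> trig (\<lambda>x. p (h x))" for p :: "real => real"
proof (induction rule: real_polynomial_function.induct)
 case (linear f)
 have eq: "f t = f 1 * t" for t using linear_scale[OF bounded_linear.linear[OF linear(1)], of t 1] by (simp add: mult.commute)
 show ?case using trig_mult[OF linear(2) trig_const[of "f 1"]] by (rule trig_cong) (rule eq[symmetric])
next
 case (const c)
 show ?case by (rule trig_const)
next
 case (add f g)
 from trig.add[OF add.IH(1)[OF add.prems] add.IH(2)[OF add.prems]] show ?case .
next
 case (mult f g)
 from trig_mult[OF mult.IH(2)[OF mult.prems] mult.IH(1)[OF mult.prems]] show ?case .
qed

text \<open>In use, the vectors \<open>e j\<close> are the indicators of cells: a projection outside
  this compact set has a coefficient larger than \<open>R\<close>.\<close>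

lemma compact_span_box: "compact {(\<Sum>j<n. a j *\<^sub>R e j) |a :: nat => real. \<forall>j<n. \<bar>a j\<bar> <= R}"
 for e :: "nat => 'a::real_normed_vector"
proof (induction n)
 case (Suc n)
 have "compact ((\<lambda>t. t *\<^sub>R e n) ` {-R..R})" by (intro compact_continuous_image continuous_intros) simp
 from compact_sums[OF Suc this] show ?case
 proof (rule back_subst[of compact], intro set_eqI iffI)
  fix z assume "z \<in> {x + y |x y. x \<in> {\<Sum>j<n. a j *\<^sub>R e j |a. \<forall>j<n. \<bar>a j\<bar> <= R} \<and> y \<in> (\<lambda>t. t *\<^sub>R e n) ` {- R..R}}"
  then obtain x y where xy: "z = x + y" "x \<in> {\<Sum>j<n. a j *\<^sub>R e j |a. \<forall>j<n. \<bar>a j\<bar> <= R}" "y \<in> (\<lambda>t. t *\<^sub>R e n) ` {- R..R}" by blast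
  obtain a where a: "x = (\<Sum>j<n. a j *\<^sub>R e j)" "\<forall>j<n. \<bar>a j\<bar> <= R" using xy(2) by blast
  obtain t where t0: "y = t *\<^sub>R e n" "t \<in> {- R..R}" using xy(3) by blast
  then have t: "y = t *\<^sub>R e n" "\<bar>t\<bar> <= R" by (auto simp: abs_le_iff)
  have at: "\<forall>j<n. \<bar>a j\<bar> <= R" "\<bar>t\<bar> <= R" "z = (\<Sum>j<n. a j *\<^sub>R e j) + t *\<^sub>R e n" using xy(1) a t by auto
  then have "z = (\<Sum>j<Suc n. (a(n := t)) j *\<^sub>R e j)" "\<forall>j<Suc n. \<bar>(a(n := t)) j\<bar> <= R" by (auto simp: less_Suc_eq)
  then show "z \<in> {\<Sum>j<Suc n. a j *\<^sub>R e j |a. \<forall>j<Suc n. \<bar>a j\<bar> <= R}" by blast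
 next
  fix z assume "z \<in> {\<Sum>j<Suc n. a j *\<^sub>R e j |a. \<forall>j<Suc n. \<bar>a j\<bar> <= R}"
  then obtain a where a: "z = (\<Sum>j<n. a j *\<^sub>R e j) + a n *\<^sub>R e n" "\<forall>j<n. \<bar>a j\<bar> <= R" "\<bar>a n\<bar> <= R" by auto
  then have "a n \<in> {-R..R}" by (auto simp: abs_le_iff)
  then show "z \<in> {x + y |x y. x \<in> {\<Sum>j<n. a j *\<^sub>R e j |a. \<forall>j<n. \<bar>a j\<bar> <= R} \<and> y \<in> (\<lambda>t. t *\<^sub>R e n) ` {- R..R}}"
   using a by blast
 qed
qed simp

text \<open>Stone-Weierstrass controls the approximation on \<open>S\<close> only. Composing it with
  a polynomial that is close to the clamp to [-K, K] on the whole range of the first approximation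
  restores a bound on all of \<open>L1\<close> and changes little on \<open>S\<close>, since
  \<open>f\<close> has values in [-K, K].\<close>

lemma trig_approx:
 fixes f :: "L1 => real"
 assumes f: "continuous_on UNIV f" "\<And>x. \<bar>f x\<bar> <= K" and S: "compact S" and e: "e > 0"
 shows "\<exists>h. trig h \<and> (\<forall>x\<in>S. \<bar>f x - h x\<bar> <= e) \<and> (\<forall>x. \<bar>h x\<bar> <= K + e)"
proof -
 interpret function_ring_on "Collect trig" S
  by unfold_locales (use S in \<open>auto intro: trig_continuous trig.add trig_mult trig_const dest: trig_separates\<close>)
 obtain h where h: "trig h" "\<And>x. x \<in> S ==> \<bar>f x - h x\<bar> < e / 2"
  using Stone_Weierstrass_basic[OF continuous_on_subset[OF f(1)], of "e / 2"] e by auto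
 obtain B where B: "\<And>x. \<bar>h x\<bar> <= B" using trig_bounded[OF h(1)] by auto
 have K: "K >= 0" using f(2)[of 0] by linarith
 let ?c = "\<lambda>t. max (- K) (min K t) :: real"
 obtain p where p: "real_polynomial_function p" "\<And>t. t \<in> {-B..B} ==> \<bar>?c t - p t\<bar> < e / 2"
 proof (rule Stone_Weierstrass_real_polynomial_function[of "{-B..B}" ?c "e / 2"])
  show "continuous_on {-B..B} ?c" by (intro continuous_intros)
 qed (use e in simp_all)
 have ph: "\<bar>?c (h x) - p (h x)\<bar> < e / 2" for x using p(2)[of "h x"] B[of x] by (simp add: abs_le_iff)
 show ?thesis
 proof (intro exI[of _ "\<lambda>x. p (h x)"] conjI ballI allI trig_polynomial[OF p(1) h(1)])
  fix x assume "x \<in> S"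
  moreover have "\<bar>f x - ?c (h x)\<bar> <= \<bar>f x - h x\<bar>" using f(2)[of x] by linarith
  ultimately show "\<bar>f x - p (h x)\<bar> <= e" using ph[of x] h(2)[of x] by linarith
 next
  fix x show "\<bar>p (h x)\<bar> <= K + e" using ph[of x] K e by linarith
 qed
qed


text \<open>\<open>f\<close> is replaced by \<open>h\<close> composed with \<open>proj m\<close>,
  where \<open>h\<close> approximates \<open>f\<close> on a compact box of coefficients. The
  projection error is controlled by \<open>tail\<close>, exits from the box by \<open>bd\<close>.
  The two replacements, for \<open>V n\<close> and for the limit, cost \<open>3 * r\<close> each,
  the convergence of the trigonometric polynomial costs \<open>r\<close>.\<close>

theorem L1_bounded_lipschitz_tendsto:
 fixes V :: "nat => 'a => L1" and V' :: "'b => L1" and f :: "L1 => real"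
 assumes M: "prob_space M" and Q: "prob_space Q"
  and V: "\<And>n. integrable M (V n)" and V': "integrable Q V'"
  and char: "\<And>l. (\<lambda>n. \<integral>w. iexp (blinfun_apply l (V n w)) \<partial>M) ----> (\<integral>w. iexp (blinfun_apply l (V' w)) \<partial>Q)"
  and bd: "\<And>l :: L1_dual. \<exists>c. \<forall>n. (\<integral>w. \<bar>blinfun_apply l (V n w)\<bar> \<partial>M) <= c"
  and tail: "\<And>r. r > 0 ==> \<exists>m1. \<forall>m\<ge>m1. EV n. (\<integral>w. norm (V n w - proj m (V n w)) \<partial>M) <= r"
  and fL: "\<And>x y. \<bar>f x - f y\<bar> <= L * norm (x - y)" and fK: "\<And>x. \<bar>f x\<bar> <= K"
 shows "(\<lambda>n. \<integral>w. f (V n w) \<partial>M) ----> (\<integral>w. f (V' w) \<partial>Q)"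
proof -
 interpret M: prob_space M by fact
 interpret Q: prob_space Q by fact
 have L: "L >= 0" using fL[of "stepe 1 0" 0] norm_stepe[of 0 1] by simp
 have K: "K >= 0" using fK[of 0] by linarith
 have fc: "continuous_on UNIV f"
  by (rule lipschitz_on_continuous_on[OF lipschitz_onI[OF _ L]]) (use fL in \<open>simp add: dist_norm\<close>)
 have ibM: "integrable M (\<lambda>w. g (V n w))" if "continuous_on UNIV g" "\<And>x. \<bar>g x\<bar> <= C" for g :: "L1 => real" and C n
  using that(2)
  by (intro M.integrable_const_bound[of _ C] AE_I2 measurable_compose[OF borel_measurable_integrable[OF V] borel_measurable_continuous_onI[OF that(1)]]) auto
 have ibQ: "integrable Q (\<lambda>w. g (V' w))" if "continuous_on UNIV g" "\<And>x. \<bar>g x\<bar> <= C" for g :: "L1 => real" and C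
  using that(2)
  by (intro Q.integrable_const_bound[of _ C] AE_I2 measurable_compose[OF borel_measurable_integrable[OF V'] borel_measurable_continuous_onI[OF that(1)]]) auto
 have trig_lim: "(\<lambda>n. \<integral>w. h (V n w) \<partial>M) ----> (\<integral>w. h (V' w) \<partial>Q)" if "trig h" for h
  using that
 proof (induction rule: trig.induct)
  case (cos c l v)
  have e: "c * cos (blinfun_apply l x + v) = Re (c * exp (\<i> * v) * iexp (blinfun_apply l x))" for x
  proof -
   have "c * exp (\<i> * v) * iexp (blinfun_apply l x) = c * exp (\<i> * of_real (blinfun_apply l x + v))"
    by (simp add: distrib_left exp_add mult_ac)
   then show ?thesis by (simp only: Re_complex_of_real times_complex.simps) (simp add: Re_exp)
  qed
  have mi: "(\<lambda>x. iexp (blinfun_apply l x)) \<in> borel_measurable borel" by (intro borel_measurable_continuous_onI continuous_intros)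
  have iM: "integrable M (\<lambda>w. c * exp (\<i> * v) * iexp (blinfun_apply l (V n w)))" for n
   by (intro integrable_mult_right M.integrable_const_bound[of _ 1] measurable_compose[OF borel_measurable_integrable[OF V] mi]) auto
  have iQ: "integrable Q (\<lambda>w. c * exp (\<i> * v) * iexp (blinfun_apply l (V' w)))"
   by (intro integrable_mult_right Q.integrable_const_bound[of _ 1] measurable_compose[OF borel_measurable_integrable[OF V'] mi]) auto
  have "(\<lambda>n. Re (c * exp (\<i> * v) * (\<integral>w. iexp (blinfun_apply l (V n w)) \<partial>M)))
   ----> Re (c * exp (\<i> * v) * (\<integral>w. iexp (blinfun_apply l (V' w)) \<partial>Q))"
   by (intro tendsto_Re tendsto_mult_left char)
  then show ?case unfolding e integral_Re[OF iM] integral_Re[OF iQ] by simp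
 next
  case (add f g)
  obtain B C where BC: "\<And>x. \<bar>f x\<bar> <= B" "\<And>x. \<bar>g x\<bar> <= C" using add(1,2)[THEN trig_bounded] by auto
  note i = ibM[OF trig_continuous[OF add(1)] BC(1)] ibM[OF trig_continuous[OF add(2)] BC(2)]
   ibQ[OF trig_continuous[OF add(1)] BC(1)] ibQ[OF trig_continuous[OF add(2)] BC(2)]
  show ?case using tendsto_add[OF add.IH] i by simp
 qed
 have close: "EV n. \<bar>(\<integral>w. f (V n w) \<partial>M) - (\<integral>w. f (V' w) \<partial>Q)\<bar> <= 7 * r" if r: "r > 0" for r
 proof -
  define r' where "r' = r / (L + 1)"
  have r': "r' > 0" "L * r' <= r" using r L by (simp_all add: r'_def add_nonneg_pos field_simps)
  obtain m1 where m1: "\<And>m. m >= m1 ==> EV n. (\<integral>w. norm (V n w - proj m (V n w)) \<partial>M) <= r'"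
   using tail[OF r'(1)] by auto
  have "EV m. (\<integral>w. norm (V' w - proj m (V' w)) \<partial>Q) < r'"
   using proj_error_tendsto[OF V'] r' by (intro order_tendstoD) auto
  then have "EV m. m1 <= m \<and> (\<integral>w. norm (V' w - proj m (V' w)) \<partial>Q) < r'"
   using eventually_ge_at_top[of m1] by eventually_elim auto
  then obtain m where m: "m1 <= m" "(\<integral>w. norm (V' w - proj m (V' w)) \<partial>Q) < r'"
   by (auto simp: eventually_sequentially)
  define s where "s x = (\<Sum>j<m. \<bar>real m * blinfun_apply (cellf m j) x\<bar>)" for x
  have iN: "integrable N (\<lambda>w. s (X w))" "integrable N (\<lambda>w. norm (X w - proj m (X w)))"
   "integrable N (\<lambda>w. \<bar>blinfun_apply (cellf m j) (X w)\<bar>)"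
   if X: "integrable N X" for N :: "'z measure" and X j
  proof -
   show i: "integrable N (\<lambda>w. \<bar>blinfun_apply (cellf m j) (X w)\<bar>)" for j
    by (intro integrable_abs integrable_bounded_linear[OF blinfun.bounded_linear_right X])
   show "integrable N (\<lambda>w. s (X w))" unfolding s_def abs_mult by (intro intg_sum integrable_mult_right i)
   show "integrable N (\<lambda>w. norm (X w - proj m (X w)))"
    by (intro integrable_norm intg_diff X integrable_bounded_linear[OF bounded_linear_proj X])
  qed
  define c where "c j = (SOME c. \<forall>n. (\<integral>w. \<bar>blinfun_apply (cellf m j) (V n w)\<bar> \<partial>M) <= c)" for j
  have c: "(\<integral>w. \<bar>blinfun_apply (cellf m j) (V n w)\<bar> \<partial>M) <= c j" for j n
   using someI_ex[OF bd[of "cellf m j"]] unfolding c_def by (rule spec)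
  define D where "D = max (\<Sum>j<m. real m * c j) (\<integral>w. s (V' w) \<partial>Q)"
  have D: "(\<integral>w. s (V n w) \<partial>M) <= D" "(\<integral>w. s (V' w) \<partial>Q) <= D" for n
  proof -
   have "(\<integral>w. s (V n w) \<partial>M) = (\<Sum>j<m. real m * (\<integral>w. \<bar>blinfun_apply (cellf m j) (V n w)\<bar> \<partial>M))"
    unfolding s_def abs_mult using iN(3)[OF V] by simp
   also have "... <= (\<Sum>j<m. real m * c j)" using c by (intro sum_mono mult_left_mono) auto
   finally show "(\<integral>w. s (V n w) \<partial>M) <= D" by (simp add: D_def)
  qed (simp add: D_def)
  have "0 <= (\<integral>w. s (V' w) \<partial>Q)" by (simp add: s_def sum_nonneg)
  then have D0: "D >= 0" using D(2) by linarith
  \<comment> \<open>A box so large that leaving it costs at most \<open>r\<close> in mean, when the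
    difference \<open>2 * K + 1\<close> is weighted by \<open>s x / R\<close>.\<close>
  define R where "R = (2 * K + 1) * D / r + 1"
  have R: "R > 0" using K D0 r by (simp add: R_def add_nonneg_pos)
  have RD: "(2 * K + 1) / R * D <= r"
  proof -
   have "(2 * K + 1) * D <= r * R" using r by (simp add: R_def distrib_left)
   then show ?thesis using R by (simp add: field_simps)
  qed
  define S where "S = {(\<Sum>j<m. a j *\<^sub>R stepe m j) |a. \<forall>j<m. \<bar>a j\<bar> <= R}"
  have S: "compact S" unfolding S_def by (rule compact_span_box)
  obtain h where h: "trig h" "\<And>x. x \<in> S ==> \<bar>f x - h x\<bar> <= min r 1" "\<And>x. \<bar>h x\<bar> <= K + min r 1"
   using trig_approx[OF fc fK S, of "min r 1"] r by auto
  define q where "q x = h (proj m x)" for x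
  have q: "trig q" unfolding q_def[abs_def] by (rule trig_compose_proj[OF h(1)])
  have qb: "\<bar>q x\<bar> <= K + 1" for x using h(3)[of "proj m x"] by (simp add: q_def)
  \<comment> \<open>Markov's inequality in pointwise form: outside the box some coefficient exceeds
    \<open>R\<close>, so the last term is at least \<open>2 * K + 1\<close>, an upper bound for the
    difference of the two functions.\<close>
  have pw: "\<bar>f x - q x\<bar> <= L * norm (x - proj m x) + r + (2 * K + 1) / R * s x" for x
  proof -
   have "\<bar>f (proj m x) - h (proj m x)\<bar> <= r + (2 * K + 1) / R * s x"
   proof (cases "proj m x \<in> S")
    case True
    have "0 <= (2 * K + 1) / R * s x" using K R by (simp add: s_def sum_nonneg)
    then show ?thesis using h(2)[OF True] by linarith
   next
    case False
    have "proj m x \<in> S" if "\<forall>j<m. \<bar>real m * blinfun_apply (cellf m j) x\<bar> <= R"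
     unfolding S_def mem_Collect_eq proj_def
     by (rule exI[of _ "\<lambda>j. real m * blinfun_apply (cellf m j) x"]) (use that in simp)
    with False obtain j where j: "j < m" "R < \<bar>real m * blinfun_apply (cellf m j) x\<bar>" unfolding not_le[symmetric] by blast
    have "\<bar>real m * blinfun_apply (cellf m j) x\<bar> <= s x"
     unfolding s_def using j by (intro member_le_sum) auto
    then have "(2 * K + 1) / R * R <= (2 * K + 1) / R * s x" using j K R by (intro mult_left_mono) auto
    then have "2 * K + 1 <= (2 * K + 1) / R * s x" using R by simp
    then show ?thesis using fK[of "proj m x"] h(3)[of "proj m x"] r by linarith
   qed
   then show ?thesis using fL[of x "proj m x"] unfolding q_def by linarith
  qed
  have approx: "\<bar>(\<integral>w. f (X w) \<partial>N) - (\<integral>w. q (X w) \<partial>N)\<bar> <= 3 * r"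
   if N: "prob_space N" and X: "integrable N X" "integrable N (\<lambda>w. f (X w))" "integrable N (\<lambda>w. q (X w))"
    and le: "(\<integral>w. norm (X w - proj m (X w)) \<partial>N) <= r'" "(\<integral>w. s (X w) \<partial>N) <= D" for N :: "'z measure" and X
  proof -
   interpret N: prob_space N by fact
   note i = iN[OF X(1)]
   have "\<bar>(\<integral>w. f (X w) \<partial>N) - (\<integral>w. q (X w) \<partial>N)\<bar>
    <= (\<integral>w. L * norm (X w - proj m (X w)) + r + (2 * K + 1) / R * s (X w) \<partial>N)"
    using i by (intro integral_abs_diff_le X pw intg_add integrable_mult_right) auto
   also have "... = L * (\<integral>w. norm (X w - proj m (X w)) \<partial>N) + r + (2 * K + 1) / R * (\<integral>w. s (X w) \<partial>N)"
    using i by (simp add: N.prob_space)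
   also have "... <= L * r' + r + (2 * K + 1) / R * D"
    using le L K R by (intro add_mono mult_left_mono) auto
   finally show ?thesis using r'(2) RD by linarith
  qed
  have "EV n. dist (\<integral>w. q (V n w) \<partial>M) (\<integral>w. q (V' w) \<partial>Q) < r"
   using trig_lim[OF q] r by (rule tendstoD)
  with m1[OF m(1)] show ?thesis
  proof eventually_elim
   case (elim n)
   have "\<bar>(\<integral>w. f (V n w) \<partial>M) - (\<integral>w. q (V n w) \<partial>M)\<bar> <= 3 * r"
    by (rule approx[OF M V ibM[OF fc fK] ibM[OF trig_continuous[OF q] qb] elim(1) D(1)])
   moreover have "\<bar>(\<integral>w. f (V' w) \<partial>Q) - (\<integral>w. q (V' w) \<partial>Q)\<bar> <= 3 * r"
    by (rule approx[OF Q V' ibQ[OF fc fK] ibQ[OF trig_continuous[OF q] qb] less_imp_le[OF m(2)] D(2)])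
   ultimately show ?case using elim(2) unfolding dist_real_def by linarith
  qed
 qed
 show ?thesis
 proof (rule tendstoI)
  fix e :: real assume "e > 0"
  then show "EV n. dist (\<integral>w. f (V n w) \<partial>M) (\<integral>w. f (V' w) \<partial>Q) < e"
   using close[of "e / 8"] by (auto simp: dist_real_def elim!: eventually_mono)
 qed
qed

section \<open>The CUSUM process of a fixed noise path\<close>

definition psum_seq :: "(nat => L1) => nat => L1" where "psum_seq e j = (\<Sum>i=1..j. e i)"

lemma interp_sum_eq:
 assumes "0 <= x"
 shows "interp_sum e x = (1 - (x - \<lfloor>x\<rfloor>)) *\<^sub>R psum_seq e (nat \<lfloor>x\<rfloor>) + (x - \<lfloor>x\<rfloor>) *\<^sub>R psum_seq e (Suc (nat \<lfloor>x\<rfloor>))"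
 by (simp add: interp_sum_def psum_seq_def scaleR_diff_left scaleR_add_right)

lemma interp_sum_of_nat: "interp_sum e (real k) = psum_seq e k"
 by (simp add: interp_sum_def psum_seq_def)

lemma norm_interp_sum_diff_le:
 assumes x: "0 <= x" and c: "\<And>j. \<bar>real j - x\<bar> < 1 ==> norm (psum_seq e j - y) <= c"
 shows "norm (interp_sum e x - y) <= c"
proof -
 define j where "j = nat \<lfloor>x\<rfloor>"
 define h where "h = x - \<lfloor>x\<rfloor>"
 have h: "0 <= h" "h < 1" "x = real j + h" using x unfolding h_def j_def by linarith+
 have "interp_sum e x - y = (1 - h) *\<^sub>R (psum_seq e j - y) + h *\<^sub>R (psum_seq e (Suc j) - y)"
  unfolding interp_sum_eq[OF x] h_def[symmetric] j_def[symmetric] by (simp add: algebra_simps)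
 then have "norm (interp_sum e x - y) <= (1 - h) * norm (psum_seq e j - y) + h * norm (psum_seq e (Suc j) - y)"
  using norm_triangle_ineq[of "(1 - h) *\<^sub>R (psum_seq e j - y)" "h *\<^sub>R (psum_seq e (Suc j) - y)"] h by simp
 moreover have "(1 - h) * norm (psum_seq e j - y) <= (1 - h) * c"
  using h by (intro mult_left_mono c) auto
 \<comment> \<open>If \<open>h = 0\<close>, the index \<open>Suc j\<close> lies at distance exactly
   1 from \<open>x\<close>, outside the hypothesis, but has weight 0.\<close>
 moreover have "h * norm (psum_seq e (Suc j) - y) <= h * c"
  using h by (cases "h = 0") (auto intro!: mult_left_mono c)
 ultimately show ?thesis by (simp add: algebra_simps)
qed

text \<open>Clipped weights fix the index set. Terms beyond \<open>n\<close> drop out even at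
  \<open>x = n\<close>, where \<open>interp_sum\<close> formally mentions index \<open>n + 1\<close>
  with weight 0, and dependence on \<open>x\<close> is confined to the weights.\<close>

lemma interp_sum_clip:
 assumes "0 <= x" "x <= real n"
 shows "interp_sum e x = (\<Sum>i=1..n. max 0 (min 1 (x - real i + 1)) *\<^sub>R e i)"
proof -
 define j where "j = nat \<lfloor>x\<rfloor>"
 have j: "real j <= x" "x < real j + 1" "j <= n" using assms unfolding j_def by linarith+
 have lo: "(\<Sum>i=1..j. max 0 (min 1 (x - real i + 1)) *\<^sub>R e i) = (\<Sum>i=1..j. e i)"
  using j by (intro sum.cong) (auto simp: max_def min_def)
 have hi: "(\<Sum>i=Suc j..n. max 0 (min 1 (x - real i + 1)) *\<^sub>R e i) = (x - real j) *\<^sub>R e (Suc j)"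
 proof (cases "j = n")
  case True
  then show ?thesis using j assms by simp
 next
  case False
  then have "(\<Sum>i=Suc j..n. max 0 (min 1 (x - real i + 1)) *\<^sub>R e i)
    = max 0 (min 1 (x - real (Suc j) + 1)) *\<^sub>R e (Suc j) + (\<Sum>i=Suc (Suc j)..n. max 0 (min 1 (x - real i + 1)) *\<^sub>R e i)"
   using j by (intro sum.atLeast_Suc_atMost) auto
  also have "(\<Sum>i=Suc (Suc j)..n. max 0 (min 1 (x - real i + 1)) *\<^sub>R e i) = 0"
   using j by (intro sum.neutral) auto
  finally show ?thesis using j by (simp add: max_def min_def)
 qed
 have "{1..n} = {1..j} \<union> {Suc j..n}" using j(3) by auto
 then have "(\<Sum>i=1..n. max 0 (min 1 (x - real i + 1)) *\<^sub>R e i) = (\<Sum>i=1..j. e i) + (x - real j) *\<^sub>R e (Suc j)"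
  by (simp only: lo[symmetric] hi[symmetric]) (rule sum.union_disjoint, auto)
 moreover have "of_int \<lfloor>x\<rfloor> = real j" using assms by (simp add: j_def)
 ultimately show ?thesis by (simp add: interp_sum_def j_def[symmetric])
qed

text \<open>The change occurs at an integer, so linear interpolation reproduces the kink exactly and
  adds no rounding error.\<close>

lemma interp_sum_step:
 assumes "0 <= x"
 shows "interp_sum (\<lambda>i. if i <= k then u else v) x = min x (real k) *\<^sub>R u + (x - min x (real k)) *\<^sub>R v"
proof -
 have S: "psum_seq (\<lambda>i. if i <= k then u else v) j = min (real j) (real k) *\<^sub>R u + (real j - min (real j) (real k)) *\<^sub>R v" for j
 proof (induction j)
  case (Suc j)
  have S: "psum_seq (\<lambda>i. if i <= k then u else v) (Suc j) = psum_seq (\<lambda>i. if i <= k then u else v) j + (if Suc j <= k then u else v)"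
   by (simp add: psum_seq_def)
  consider "j < k" | "j = k" | "k < j" by linarith
  then show ?case unfolding S Suc by cases (auto simp: min_def algebra_simps)
 qed (simp add: psum_seq_def)
 define j where "j = nat \<lfloor>x\<rfloor>"
 define h where "h = x - \<lfloor>x\<rfloor>"
 have h: "0 <= h" "h < 1" "x = real j + h" using assms unfolding h_def j_def by linarith+
 show ?thesis
 proof (cases "Suc j <= k")
  case True
  then have "min (real j) (real k) = real j" "min (real (Suc j)) (real k) = real (Suc j)" "min x (real k) = x" using h by auto
  then show ?thesis
   unfolding interp_sum_eq[OF assms] j_def[symmetric] h_def[symmetric] S using h(3) by (simp add: algebra_simps)
 next
  case False
  then have "min (real j) (real k) = real k" "min (real (Suc j)) (real k) = real k" "min x (real k) = real k" using h by auto
  then show ?thesis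
   unfolding interp_sum_eq[OF assms] j_def[symmetric] h_def[symmetric] S using h(3) by (simp add: algebra_simps)
 qed
qed

text \<open>The CUSUM process as tent plus noise bridge: with \<open>w = k / n\<close> the tent
  \<open>min s w - s * w\<close> has its peak \<open>w * (1 - w)\<close> at
  \<open>w\<close>.\<close>

definition cpU :: "(nat => L1) => L1 => nat => nat => real => L1" where
 "cpU e d n k s = (min s (k / n) - s * (k / n)) *\<^sub>R d + (1 / n) *\<^sub>R (interp_sum e (n * s) - s *\<^sub>R psum_seq e n)"

lemma cusum_eq_cpU:
 assumes n: "n >= 1" and k: "k <= n" and s: "s \<in> {0..1}"
  and x: "\<And>i. 1 <= i ==> i <= n ==> x i = (if i <= k then w1 else w2) + e i"
 shows "cusum x n s = cpU e (w1 - w2) n k s"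
proof -
 let ?m = "\<lambda>i. if i <= k then w1 else w2"
 have ns: "0 <= real n * s" "real n * s <= real n" using s by (auto simp: mult_left_le)
 have "interp_sum x (real n * s) = (\<Sum>i=1..n. max 0 (min 1 (real n * s - real i + 1)) *\<^sub>R (?m i + e i))"
  unfolding interp_sum_clip[OF ns] using x by (intro sum.cong) auto
 also have "... = interp_sum ?m (real n * s) + interp_sum e (real n * s)"
  unfolding interp_sum_clip[OF ns] by (simp add: scaleR_add_right sum.distrib)
 finally have 1: "interp_sum x (real n * s) = interp_sum ?m (real n * s) + interp_sum e (real n * s)" .
 have "(\<Sum>i=1..n. x i) = (\<Sum>i=1..n. ?m i + e i)" using x by (intro sum.cong) auto
 also have "... = psum_seq ?m n + psum_seq e n" by (simp only: psum_seq_def sum.distrib)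
 finally have 2: "(\<Sum>i=1..n. x i) = psum_seq ?m n + psum_seq e n" .
 have 3: "psum_seq ?m n = real k *\<^sub>R w1 + (real n - real k) *\<^sub>R w2"
  using interp_sum_step[of "real n" k w1 w2] k by (simp add: interp_sum_of_nat min_def)
 define h where "h = min (real n * s) (real k)"
 have h: "h / real n = min s (real k / real n)" using n by (simp add: h_def min_def field_simps)
 have "interp_sum ?m (real n * s) - s *\<^sub>R psum_seq ?m n = (h - s * real k) *\<^sub>R (w1 - w2)"
  unfolding 3 interp_sum_step[OF ns(1)] h_def[symmetric] by (simp add: algebra_simps)
 moreover have "cusum x n s = (1 / real n) *\<^sub>R ((interp_sum ?m (real n * s) - s *\<^sub>R psum_seq ?m n) + (interp_sum e (real n * s) - s *\<^sub>R psum_seq e n))"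
  unfolding cusum_def 1 2 by (simp only: scaleR_add_right add_diff_add)
 ultimately have "cusum x n s = (1 / real n) *\<^sub>R ((h - s * real k) *\<^sub>R (w1 - w2) + (interp_sum e (real n * s) - s *\<^sub>R psum_seq e n))"
  by simp
 also have "... = ((h - s * real k) / real n) *\<^sub>R (w1 - w2) + (1 / real n) *\<^sub>R (interp_sum e (real n * s) - s *\<^sub>R psum_seq e n)"
  by (simp add: scaleR_add_right)
 also have "(h - s * real k) / real n = min s (real k / real n) - s * (real k / real n)"
  unfolding h[symmetric] by (simp add: diff_divide_distrib)
 finally show ?thesis by (simp add: cpU_def)
qed

lemma cpU_at_kappa:
 assumes "n >= 1" "k <= n"
 shows "cpU e d n k (k / n) = (k / n * (1 - k / n)) *\<^sub>R d + (1 / n) *\<^sub>R (psum_seq e k - (k / n) *\<^sub>R psum_seq e n)"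
 using assms by (simp add: cpU_def interp_sum_of_nat right_diff_distrib)

text \<open>With \<open>r\<close> the tent at \<open>s\<close> relative to its peak, the process at
  \<open>s\<close> is \<open>r\<close> times its value at the peak plus a noise term. For
  \<open>s\<close> to do as well as the peak, the noise must make up for the loss
  \<open>1 - r\<close>, which is at least the distance to the peak. At distance \<open>m / n\<close>
  this takes noise \<open>c * m\<close>, while the window bound grants at most
  \<open>c / 4 * (m + 1)\<close>.\<close>

lemma cp_localization:
 assumes n: "n >= 1" and k: "0 < k" "k < n" and s: "s \<in> {0..1}"
  and max: "norm (cpU e d n k (k / n)) <= norm (cpU e d n k s)"
  and c: "c > 0" "2 * c <= k / n * (1 - k / n) * norm d"
  and small: "2 * norm (psum_seq e k) + 3 * norm (psum_seq e n) <= c * n"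
  and win: "\<And>j. j <= n ==> real K <= \<bar>real j - real k\<bar> ==> norm (psum_seq e j - psum_seq e k) <= c / 4 * \<bar>real j - real k\<bar>"
 shows "\<bar>n * s - k\<bar> <= K + 1"
proof (rule ccontr)
 assume far: "\<not> \<bar>n * s - k\<bar> <= K + 1"
 define w where "w = real k / real n"
 have w: "0 < w" "w < 1" using k by (auto simp: w_def)
 have kw: "real k = n * w" using n by (simp add: w_def)
 define H where "H = w * (1 - w)"
 have H: "H > 0" using w by (simp add: H_def)
 define R where "R = (\<lambda>s. interp_sum e (real n * s) - s *\<^sub>R psum_seq e n)"
 have Rw: "R w = psum_seq e k - w *\<^sub>R psum_seq e n" using n by (simp add: R_def w_def interp_sum_of_nat)
 define m where "m = \<bar>n * s - k\<bar>"
 have m: "m > K + 1" "m = n * \<bar>s - w\<bar>" using far unfolding m_def kw by (auto simp: right_diff_distrib[symmetric] abs_mult)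
 define r where "r = (min s w - s * w) / H"
 have r: "0 <= r" "\<bar>s - w\<bar> <= 1 - r"
 proof -
  have eq: "r = (if s <= w then s / w else (1 - s) / (1 - w))"
   using w by (simp add: r_def H_def min_def field_simps)
  show "0 <= r" using s w by (simp add: eq)
  have "1 - r = (if s <= w then (w - s) / w else (s - w) / (1 - w))" using w by (simp add: eq field_simps)
  moreover have "w - s <= (w - s) / w" if "s <= w" using that w by (simp add: le_divide_eq mult_left_le)
  moreover have "s - w <= (s - w) / (1 - w)" if "w < s" using that w by (simp add: le_divide_eq mult_left_le)
  ultimately show "\<bar>s - w\<bar> <= 1 - r" by auto
 qed
 have Us: "real n *\<^sub>R cpU e d n k t = (n * (min t w - t * w)) *\<^sub>R d + R t" for t
  using n unfolding cpU_def R_def w_def by (simp add: scaleR_add_right)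
 have e1: "n * (min s w - s * w) = r * (n * H)" using H by (simp add: r_def)
 have e2: "min w w - w * w = H" by (simp add: H_def algebra_simps)
 have dec: "real n *\<^sub>R cpU e d n k s = r *\<^sub>R (real n *\<^sub>R cpU e d n k w) + (R s - r *\<^sub>R R w)"
  unfolding Us e1 e2 by (simp add: scaleR_add_right)
 have "norm (real n *\<^sub>R cpU e d n k w) <= norm (real n *\<^sub>R cpU e d n k s)" using max by (simp add: w_def mult_left_mono)
 also have "... <= r * norm (real n *\<^sub>R cpU e d n k w) + norm (R s - r *\<^sub>R R w)"
  unfolding dec using norm_triangle_ineq[of "r *\<^sub>R (real n *\<^sub>R cpU e d n k w)" "R s - r *\<^sub>R R w"] r(1) by simp
 also have "norm (R s - r *\<^sub>R R w) <= norm (R s - R w) + (1 - r) * norm (R w)"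
 proof -
  have eq: "R s - r *\<^sub>R R w = (R s - R w) + (1 - r) *\<^sub>R R w" by (simp add: scaleR_diff_left)
  show ?thesis unfolding eq using norm_triangle_ineq[of "R s - R w" "(1 - r) *\<^sub>R R w"] r(2) by simp
 qed
 finally have 1: "(1 - r) * (norm (real n *\<^sub>R cpU e d n k w) - norm (R w)) <= norm (R s - R w)"
  by (simp add: algebra_simps)
 have Rwn: "norm (R w) <= norm (psum_seq e k) + norm (psum_seq e n)"
 proof -
  have "norm (R w) <= norm (psum_seq e k) + w * norm (psum_seq e n)"
   unfolding Rw using norm_triangle_ineq4[of "psum_seq e k" "w *\<^sub>R psum_seq e n"] w by simp
  moreover have "w * norm (psum_seq e n) <= norm (psum_seq e n)" using w by (simp add: mult_left_le_one_le)
  ultimately show ?thesis by linarith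
 qed
 have "real n *\<^sub>R cpU e d n k w = (n * H) *\<^sub>R d + R w" unfolding Us by (simp add: H_def algebra_simps)
 then have "n * H * norm d <= norm (real n *\<^sub>R cpU e d n k w) + norm (R w)"
  using norm_triangle_ineq4[of "(n * H) *\<^sub>R d + R w" "R w"] H by (simp add: abs_mult)
 moreover have "real n * (2 * c) <= real n * (H * norm d)"
  using c(2) by (intro mult_left_mono) (simp_all add: H_def w_def)
 \<comment> \<open>The summand \<open>norm (psum_seq e n)\<close> on the left will cancel the same
   term in the bound of \<open>R s - R w\<close>; together with twice \<open>norm (R w)\<close> this
   explains the 3 in \<open>small\<close>.\<close>
 ultimately have big: "c * n + norm (psum_seq e n) <= norm (real n *\<^sub>R cpU e d n k w) - norm (R w)"
  using small Rwn by (simp add: mult.assoc mult.left_commute[of "real n"] mult.commute[of c])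
 then have "\<bar>s - w\<bar> * (c * n + norm (psum_seq e n)) <= (1 - r) * (norm (real n *\<^sub>R cpU e d n k w) - norm (R w))"
  using r(2) c by (intro mult_mono) auto
 also note 1
 also have "norm (R s - R w) <= norm (interp_sum e (real n * s) - psum_seq e k) + \<bar>s - w\<bar> * norm (psum_seq e n)"
 proof -
  have "R s - R w = (interp_sum e (real n * s) - psum_seq e k) - (s - w) *\<^sub>R psum_seq e n"
   unfolding Rw by (simp add: R_def algebra_simps)
  then show ?thesis using norm_triangle_ineq4[of "interp_sum e (real n * s) - psum_seq e k" "(s - w) *\<^sub>R psum_seq e n"] by simp
 qed
 finally have "c * m <= norm (interp_sum e (real n * s) - psum_seq e k)"
  unfolding m(2) by (simp add: algebra_simps)
 also have "... <= c / 4 * (m + 1)"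
 proof (rule norm_interp_sum_diff_le)
  show "0 <= real n * s" using s by simp
  fix j assume j: "\<bar>real j - real n * s\<bar> < 1"
  have "real n * s <= real n" using s by (simp add: mult_left_le)
  then have "j <= n" using j by linarith
  moreover have "real K <= \<bar>real j - real k\<bar>" "\<bar>real j - real k\<bar> <= m + 1" using j m(1) unfolding m_def by linarith+
  ultimately have "norm (psum_seq e j - psum_seq e k) <= c / 4 * \<bar>real j - real k\<bar>" by (intro win)
  also have "... <= c / 4 * (m + 1)" using c \<open>\<bar>real j - real k\<bar> <= m + 1\<close> by (intro mult_left_mono) auto
  finally show "norm (psum_seq e j - psum_seq e k) <= c / 4 * (m + 1)" .
 qed
 also have "... <= c / 4 * (2 * m)" using c m(1) by (intro mult_left_mono) auto
 finally have "c * m <= 0" by simp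
 moreover have "m > 0" using m(1) by linarith
 ultimately show False using c by (simp add: mult_le_0_iff)
qed

lemma cp_close:
 assumes n: "n >= 1" and k: "k <= n" and s: "s \<in> {0..1}" and near: "\<bar>n * s - k\<bar> <= K"
  and B: "\<And>j. j <= n ==> \<bar>real j - real k\<bar> <= K + 1 ==> norm (psum_seq e j - psum_seq e k) <= B"
 shows "norm (cpU e d n k s - cpU e d n k (k / n)) <= (K * (norm d + norm (psum_seq e n) / n) + B) / n"
proof -
 define w where "w = real k / real n"
 have w: "0 <= w" "w <= 1" using k n by (auto simp: w_def)
 have near': "\<bar>s - w\<bar> <= K / n" using near n by (simp add: w_def abs_le_iff field_simps)
 define h where "h = (min s w - s * w) - w * (1 - w)"
 have "\<bar>h\<bar> <= \<bar>s - w\<bar>"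
 proof (cases "s <= w")
  case True
  then have "h = - ((w - s) * (1 - w))" by (simp add: h_def min_def algebra_simps)
  then show ?thesis using True w by (simp add: abs_mult mult_left_le)
 next
  case False
  then have "h = - ((s - w) * w)" by (simp add: h_def min_def algebra_simps)
  then show ?thesis using False w by (simp add: abs_mult mult_left_le)
 qed
 then have h: "\<bar>h\<bar> <= K / n" using near' by linarith
 let ?D = "(interp_sum e (real n * s) - psum_seq e k) - (s - w) *\<^sub>R psum_seq e n"
 have "cpU e d n k s - cpU e d n k (k / n) = h *\<^sub>R d + (1 / n) *\<^sub>R ?D"
  unfolding cpU_at_kappa[OF n k] unfolding cpU_def h_def w_def by (simp add: algebra_simps)
 then have "norm (cpU e d n k s - cpU e d n k (k / n)) <= \<bar>h\<bar> * norm d + (1 / n) * norm ?D"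
  using norm_triangle_ineq[of "h *\<^sub>R d" "(1 / n) *\<^sub>R ?D"] by simp
 also have "norm ?D <= norm (interp_sum e (real n * s) - psum_seq e k) + \<bar>s - w\<bar> * norm (psum_seq e n)"
  using norm_triangle_ineq4[of "interp_sum e (real n * s) - psum_seq e k" "(s - w) *\<^sub>R psum_seq e n"] by simp
 also have "norm (interp_sum e (real n * s) - psum_seq e k) <= B"
 proof (rule norm_interp_sum_diff_le)
  show "0 <= real n * s" using s by simp
  fix j assume j: "\<bar>real j - real n * s\<bar> < 1"
  have "real n * s <= real n" using s by (simp add: mult_left_le)
  then show "norm (psum_seq e j - psum_seq e k) <= B" using j near by (intro B) linarith+
 qed
 also have "\<bar>h\<bar> * norm d + (1 / n) * (B + \<bar>s - w\<bar> * norm (psum_seq e n))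
   <= K / n * norm d + (1 / n) * (B + K / n * norm (psum_seq e n))"
  using h near' by (intro add_mono mult_left_mono mult_right_mono) auto
 also have "... = (K * (norm d + norm (psum_seq e n) / n) + B) / n" by (simp add: add_divide_distrib distrib_left)
 finally show ?thesis by (simp add: divide_right_mono)
qed

text \<open>The vector \<open>interp_sum e (n * s) - s *\<^sub>R psum_seq e n\<close> is seen from the nearer end point of \<open>[0, 1]\<close>.\<close>

lemma bridge_large_imp:
 assumes n: "n >= 1" "K <= n" and s: "s \<in> {0..1}" and w: "w > 0"
  and fw: "\<And>j. j <= n ==> K <= j ==> norm (psum_seq e j) <= w * j"
  and bw: "\<And>j. j <= n ==> K <= n - j ==> norm (psum_seq e j - psum_seq e n) <= w * (real n - real j)"
  and fB: "\<And>j. j <= n ==> j <= K + 2 ==> norm (psum_seq e j) <= B"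
  and bB: "\<And>j. j <= n ==> n - j <= K + 2 ==> norm (psum_seq e j - psum_seq e n) <= B"
  and large: "b <= norm (interp_sum e (n * s) - s *\<^sub>R psum_seq e n)" "B + w * (real K + 1) < b"
 shows "norm (interp_sum e (n * s) - s *\<^sub>R psum_seq e n) <= 6 * w * n * (s * (1 - s))"
proof -
 define R where "R = interp_sum e (n * s) - s *\<^sub>R psum_seq e n"
 have nS: "norm (psum_seq e n) <= w * n" by (rule fw[OF order_refl n(2)])
 have ns: "0 <= real n * s" "real n * s <= real n" using s by (auto simp: mult_left_le)
 \<comment> \<open>\<open>u\<close> is the distance to the nearer end and \<open>A\<close> the
   partial sum seen from there. If \<open>n * u\<close> is beyond the window, \<open>norm A\<close>
   is at most \<open>2 * w * n * u\<close> and the linear part adds \<open>w * n * u\<close>; then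
   \<open>u <= 2 * (u * (1 - u))\<close> doubles 3 to 6. Otherwise the bridge is below
   \<open>b\<close>, against \<open>large\<close>.\<close>
 have key: "norm R <= 6 * w * n * (s * (1 - s))"
  if u: "u = s \<and> 1 - u = 1 - s \<or> u = 1 - s \<and> 1 - u = s" "0 <= u" "u <= 1 / 2"
   and R: "norm R <= norm A + u * norm (psum_seq e n)"
   and A: "real K + 1 <= n * u ==> norm A <= w * (n * u + 1)" "n * u < real K + 1 ==> norm A <= B" for u :: real and A :: L1
 proof (cases "real K + 1 <= n * u")
  case True
  have "n * u + 1 <= 2 * (n * u)" using True by linarith
  then have "norm A <= w * (2 * (n * u))" using w by (intro order_trans[OF A(1)[OF True]] mult_left_mono) auto
  moreover have "u * norm (psum_seq e n) <= u * (w * n)" using nS u by (intro mult_left_mono) auto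
  ultimately have "norm R <= 3 * w * n * u" using R by (simp add: algebra_simps)
  also have "... <= 3 * w * n * (2 * (u * (1 - u)))"
  proof (intro mult_left_mono)
   have "u * (1 / 2) <= u * (1 - u)" using u by (intro mult_left_mono) auto
   then show "u <= 2 * (u * (1 - u))" by simp
  qed (use w in auto)
  also have "u * (1 - u) = s * (1 - s)" using u(1) by auto
  finally show ?thesis by simp
 next
  case False
  have "u * norm (psum_seq e n) <= u * (w * n)" using nS u by (intro mult_left_mono) auto
  also have "... = w * (n * u)" by simp
  also have "... <= w * (real K + 1)" using False w by (intro mult_left_mono) auto
  finally have "norm R <= B + w * (real K + 1)" using A(2) False R by linarith
  then show ?thesis using large unfolding R_def by linarith
 qed
 show ?thesis
 proof (cases "s <= 1 / 2")
  case True
  show ?thesis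
   unfolding R_def[symmetric]
  proof (rule key[of s "interp_sum e (n * s) - 0"])
   show "norm R <= norm (interp_sum e (real n * s) - 0) + s * norm (psum_seq e n)"
    unfolding R_def using norm_triangle_ineq4[of "interp_sum e (n * s)" "s *\<^sub>R psum_seq e n"] s by simp
   show "norm (interp_sum e (real n * s) - 0) <= w * (real n * s + 1)" if "real K + 1 <= real n * s"
   proof (rule norm_interp_sum_diff_le[OF ns(1)])
    fix j assume j: "\<bar>real j - real n * s\<bar> < 1"
    then have "norm (psum_seq e j - 0) <= w * j" using that ns fw[of j] by simp
    also have "... <= w * (real n * s + 1)" using j w by (intro mult_left_mono) auto
    finally show "norm (psum_seq e j - 0) <= w * (real n * s + 1)" .
   qed
   show "norm (interp_sum e (real n * s) - 0) <= B" if "real n * s < real K + 1"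
   proof (rule norm_interp_sum_diff_le[OF ns(1)])
    fix j assume j: "\<bar>real j - real n * s\<bar> < 1"
    then have "j <= n" "j <= K + 2" using that ns by linarith+
    then show "norm (psum_seq e j - 0) <= B" using fB by simp
   qed
  qed (use s True in auto)
 next
  case False
  show ?thesis
   unfolding R_def[symmetric]
  proof (rule key[of "1 - s" "interp_sum e (n * s) - psum_seq e n"])
   have "R = (interp_sum e (n * s) - psum_seq e n) + (1 - s) *\<^sub>R psum_seq e n" by (simp add: R_def algebra_simps)
   then show "norm R <= norm (interp_sum e (real n * s) - psum_seq e n) + (1 - s) * norm (psum_seq e n)"
    using norm_triangle_ineq[of "interp_sum e (n * s) - psum_seq e n" "(1 - s) *\<^sub>R psum_seq e n"] s by simp
   have n1: "real n * (1 - s) = real n - real n * s" by (simp add: right_diff_distrib)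
   show "norm (interp_sum e (real n * s) - psum_seq e n) <= w * (real n * (1 - s) + 1)" if "real K + 1 <= real n * (1 - s)"
   proof (rule norm_interp_sum_diff_le[OF ns(1)])
    fix j assume j: "\<bar>real j - real n * s\<bar> < 1"
    then have "j <= n" "K <= n - j" using that ns unfolding n1 by linarith+
    then have "norm (psum_seq e j - psum_seq e n) <= w * (real n - real j)" by (rule bw)
    also have "... <= w * (real n * (1 - s) + 1)" using j w unfolding n1 by (intro mult_left_mono) auto
    finally show "norm (psum_seq e j - psum_seq e n) <= w * (real n * (1 - s) + 1)" .
   qed
   show "norm (interp_sum e (real n * s) - psum_seq e n) <= B" if "real n * (1 - s) < real K + 1"
   proof (rule norm_interp_sum_diff_le[OF ns(1)])
    fix j assume j: "\<bar>real j - real n * s\<bar> < 1"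
    then have "j <= n" "n - j <= K + 2" using that ns unfolding n1 by linarith+
    then show "norm (psum_seq e j - psum_seq e n) <= B" by (rule bB)
   qed
  qed (use s False in auto)
 qed
qed

lemma T_limit_eq:
 "T_limit d w = (\<integral>t. (if rep_L1 d t = 0 then \<bar>rep_L1 w t\<bar> else sgn (rep_L1 d t) * rep_L1 w t) \<partial>leb01)"
proof -
 define N where "N = {t \<in> {0..1::real}. rep_L1 d t = 0}"
 have N: "N \<in> sets leb01"
 proof -
  have "{t \<in> space leb01. rep_L1 d t = 0} \<in> sets leb01" by measurable
  then show ?thesis by (simp add: N_def)
 qed
 have i1: "integrable leb01 (\<lambda>t. indicator ({0..1} - N) t * (sgn (rep_L1 d t) * rep_L1 w t))"
 proof (rule intg_bound[OF integrable_rep_L1[of w]])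
  have "{0..1} - N \<in> sets leb01" using sets.Diff[OF sets.top[of leb01] N] by simp
  then show "(\<lambda>t. indicator ({0..1} - N) t * (sgn (rep_L1 d t) * rep_L1 w t)) \<in> borel_measurable leb01" by measurable
 qed (auto simp: indicator_def sgn_if)
 have i2: "integrable leb01 (\<lambda>t. indicator N t * \<bar>rep_L1 w t\<bar>)"
 proof (rule intg_bound[OF integrable_rep_L1[of w]])
  show "(\<lambda>t. indicator N t * \<bar>rep_L1 w t\<bar>) \<in> borel_measurable leb01" using N by measurable
 qed (auto simp: indicator_def)
 have "T_limit d w = (\<integral>t. indicator ({0..1} - N) t * (sgn (rep_L1 d t) * rep_L1 w t) \<partial>leb01) + (\<integral>t. indicator N t * \<bar>rep_L1 w t\<bar> \<partial>leb01)"
  unfolding T_limit_def Let_def N_def[symmetric] set_lebesgue_integral_def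
  by (subst (1 2) integral_restrict_space)
   (auto intro!: arg_cong2[where f = plus] Bochner_Integration.integral_cong simp: indicator_def N_def)
 also have "... = (\<integral>t. indicator ({0..1} - N) t * (sgn (rep_L1 d t) * rep_L1 w t) + indicator N t * \<bar>rep_L1 w t\<bar> \<partial>leb01)"
  by (rule Bochner_Integration.integral_add[OF i1 i2, symmetric])
 also have "... = (\<integral>t. (if rep_L1 d t = 0 then \<bar>rep_L1 w t\<bar> else sgn (rep_L1 d t) * rep_L1 w t) \<partial>leb01)"
  by (rule Bochner_Integration.integral_cong) (auto simp: indicator_def N_def)
 finally show ?thesis .
qed

section \<open>The directional derivative of the norm\<close>

definition cpG :: "L1 => real => L1 => real" where
 "cpG d a w = norm (a *\<^sub>R d + w) - a * norm d"

lemma cpG_antimono: "0 <= a ==> a <= b ==> cpG d b w <= cpG d a w"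
proof -
 assume ab: "0 <= a" "a <= b"
 have eq: "b *\<^sub>R d + w = (a *\<^sub>R d + w) + (b - a) *\<^sub>R d" by (simp add: scaleR_diff_left)
 have "norm (b *\<^sub>R d + w) <= norm (a *\<^sub>R d + w) + (b - a) * norm d"
  unfolding eq using norm_triangle_ineq[of "a *\<^sub>R d + w" "(b - a) *\<^sub>R d"] ab by simp
 then show ?thesis by (simp add: cpG_def left_diff_distrib)
qed

lemma cpG_lipschitz: "\<bar>cpG d a v - cpG d a w\<bar> <= norm (v - w)"
 using norm_triangle_ineq3[of "a *\<^sub>R d + v" "a *\<^sub>R d + w"] by (simp add: cpG_def)

lemma cpG_bound: "0 <= a ==> \<bar>cpG d a w\<bar> <= norm w"
 using cpG_lipschitz[of d a w 0] by (simp add: cpG_def)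

text \<open>At each point the integrand is eventually constant: where \<open>d\<close> is not 0 and
  \<open>n\<close> times its absolute value exceeds that of \<open>w\<close>, adding
  \<open>w\<close> does not change the sign. The absolute value of \<open>w\<close>
  dominates.\<close>

lemma cpG_tendsto: "(\<lambda>n. cpG d (real n) w) ----> T_limit d w"
proof -
 define f where "f n t = \<bar>real n * rep_L1 d t + rep_L1 w t\<bar> - real n * \<bar>rep_L1 d t\<bar>" for n t
 have "(\<lambda>n. \<integral>t. f n t \<partial>leb01) ----> T_limit d w"
  unfolding T_limit_eq
 proof (rule integral_dominated_convergence[where w = "\<lambda>t. \<bar>rep_L1 w t\<bar>"])
  show "(\<lambda>t. if rep_L1 d t = 0 then \<bar>rep_L1 w t\<bar> else sgn (rep_L1 d t) * rep_L1 w t) \<in> borel_measurable leb01" by measurable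
  show "f n \<in> borel_measurable leb01" for n unfolding f_def[abs_def] by measurable
  show "integrable leb01 (\<lambda>t. \<bar>rep_L1 w t\<bar>)" by simp
  show "AE t in leb01. norm (f n t) <= \<bar>rep_L1 w t\<bar>" for n
  proof (rule AE_I2)
   fix t
   have "\<bar>real n * rep_L1 d t\<bar> = real n * \<bar>rep_L1 d t\<bar>" by (simp add: abs_mult)
   then show "norm (f n t) <= \<bar>rep_L1 w t\<bar>" unfolding f_def real_norm_def by linarith
  qed
  show "AE t in leb01. (\<lambda>n. f n t) ----> (if rep_L1 d t = 0 then \<bar>rep_L1 w t\<bar> else sgn (rep_L1 d t) * rep_L1 w t)"
  proof (rule AE_I2)
   fix t
   show "(\<lambda>n. f n t) ----> (if rep_L1 d t = 0 then \<bar>rep_L1 w t\<bar> else sgn (rep_L1 d t) * rep_L1 w t)"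
   proof (cases "rep_L1 d t = 0")
    case True
    then show ?thesis by (simp add: f_def)
   next
    case False
    obtain n0 :: nat where n0: "\<bar>rep_L1 w t\<bar> / \<bar>rep_L1 d t\<bar> <= real n0" using real_arch_simple by blast
    have "f n t = sgn (rep_L1 d t) * rep_L1 w t" if "n >= n0" for n
    proof -
     have "\<bar>rep_L1 w t\<bar> / \<bar>rep_L1 d t\<bar> <= real n" using n0 that by linarith
     then have "\<bar>rep_L1 w t\<bar> <= real n * \<bar>rep_L1 d t\<bar>" using False by (simp add: pos_divide_le_eq)
     then show ?thesis using False unfolding f_def by (cases "rep_L1 d t > 0") auto
    qed
    then have "EV n. f n t = sgn (rep_L1 d t) * rep_L1 w t" by (auto simp: eventually_sequentially)
    then show ?thesis using False by (simp add: tendsto_eventually)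
   qed
  qed
 qed
 moreover have "(\<integral>t. f n t \<partial>leb01) = cpG d (real n) w" for n
 proof -
  have "norm (real n *\<^sub>R d + w) = (\<integral>t. \<bar>real n * rep_L1 d t + rep_L1 w t\<bar> \<partial>leb01)"
   unfolding norm_L1_rep
  proof (rule integral_cong_AE)
   show "AE t in leb01. \<bar>rep_L1 (real n *\<^sub>R d + w) t\<bar> = \<bar>real n * rep_L1 d t + rep_L1 w t\<bar>"
    using rep_L1_add[of "real n *\<^sub>R d" w] rep_L1_scaleR[of "real n" d] by eventually_elim simp
  qed measurable
  then show ?thesis unfolding f_def cpG_def norm_L1_rep[of d] by simp
 qed
 ultimately show ?thesis by simp
qed

lemma T_limit_le_cpG: "0 <= a ==> T_limit d w <= cpG d a w"
proof -
 assume a: "0 <= a"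
 obtain n0 :: nat where n0: "a <= real n0" using real_arch_simple by blast
 show ?thesis
 proof (rule LIMSEQ_le_const2[OF cpG_tendsto], intro exI[of _ n0] allI impI)
  fix n assume "n0 <= n"
  then show "cpG d (real n) w <= cpG d a w" using n0 a by (intro cpG_antimono) auto
 qed
qed

lemma T_limit_lipschitz: "\<bar>T_limit d v - T_limit d w\<bar> <= norm (v - w)"
proof (rule LIMSEQ_le_const2)
 show "(\<lambda>n. \<bar>cpG d (real n) v - cpG d (real n) w\<bar>) ----> \<bar>T_limit d v - T_limit d w\<bar>"
  by (intro tendsto_intros cpG_tendsto)
qed (use cpG_lipschitz in blast)

section \<open>Piecewise linear test functions\<close>

lemma cts_step_eq: "x < y ==> cts_step x y t = max 0 (min 1 ((y - t) / (y - x)))"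
 by (auto simp: cts_step_def max_def min_def field_simps)

lemma cts_step_antimono: "x < y ==> s <= t ==> cts_step x y t <= cts_step x y s"
 unfolding cts_step_eq by (intro max.mono min.mono divide_right_mono) auto

lemma cts_step_lipschitz:
 assumes "x < y"
 shows "\<bar>cts_step x y s - cts_step x y t\<bar> <= 1 / (y - x) * \<bar>s - t\<bar>"
proof -
 have "\<bar>cts_step x y s - cts_step x y t\<bar> <= \<bar>(y - s) / (y - x) - (y - t) / (y - x)\<bar>"
  unfolding cts_step_eq[OF assms] by linarith
 also have "(y - s) / (y - x) - (y - t) / (y - x) = (t - s) / (y - x)" by (simp add: diff_divide_distrib)
 also have "\<bar>(t - s) / (y - x)\<bar> = 1 / (y - x) * \<bar>s - t\<bar>" using assms by (simp add: abs_minus_commute)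
 finally show ?thesis .
qed

lemma cts_step_bounds: "x < y ==> 0 <= cts_step x y t" "x < y ==> cts_step x y t <= 1"
 by (simp_all add: cts_step_eq)

lemma cts_step_continuous: "x < y ==> continuous_on UNIV (cts_step x y)"
 by (rule lipschitz_on_continuous_on[OF lipschitz_onI[of _ _ "1 / (y - x)"]])
  (use cts_step_lipschitz in \<open>simp_all add: dist_real_def\<close>)

lemma (in prob_space) expectation_cts_step_close:
 assumes xy: "x < y" and [measurable]: "T \<in> borel_measurable M" "T' \<in> borel_measurable M" and e: "e >= 0"
 shows "\<bar>expectation (\<lambda>z. cts_step x y (T z)) - expectation (\<lambda>z. cts_step x y (T' z))\<bar>
  <= e / (y - x) + prob {z \<in> space M. e < \<bar>T z - T' z\<bar>}"
proof -
 define A where "A = {z \<in> space M. e < \<bar>T z - T' z\<bar>}"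
 have [measurable]: "cts_step x y \<in> borel_measurable borel"
  by (intro borel_measurable_continuous_onI cts_step_continuous xy)
 have [measurable]: "A \<in> events" unfolding A_def by measurable
 have i: "integrable M (\<lambda>z. cts_step x y (T z))" "integrable M (\<lambda>z. cts_step x y (T' z))"
  using cts_step_bounds[OF xy] by (auto intro!: integrable_const_bound[of _ 1])
 have iA: "integrable M (indicator A :: 'a => real)" by (intro integrable_const_bound[of _ 1]) auto
 have pw: "\<bar>cts_step x y (T z) - cts_step x y (T' z)\<bar> <= e / (y - x) + indicator A z" if "z \<in> space M" for z
 proof (cases "z \<in> A")
  case True
  have "0 <= e / (y - x)" using e xy by simp
  then show ?thesis using True cts_step_bounds[OF xy, of "T z"] cts_step_bounds[OF xy, of "T' z"] by simp
 next
  case False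
  then have "1 / (y - x) * \<bar>T z - T' z\<bar> <= 1 / (y - x) * e" using that xy by (intro mult_left_mono) (auto simp: A_def not_less)
  then show ?thesis using False cts_step_lipschitz[OF xy, of "T z" "T' z"] by simp
 qed
 have "\<bar>expectation (\<lambda>z. cts_step x y (T z)) - expectation (\<lambda>z. cts_step x y (T' z))\<bar> <= expectation (\<lambda>z. e / (y - x) + indicator A z)"
  using iA by (intro integral_abs_diff_le i pw intg_add) auto
 also have "... = e / (y - x) + expectation (indicator A)" using iA by (subst Bochner_Integration.integral_add) (simp_all add: prob_space)
 also have "... = e / (y - x) + prob A" by simp
 finally show ?thesis by (simp add: A_def)
qed

text \<open>The functional \<open>cpG d (r n)\<close> changes with \<open>n\<close>, so it is
  enclosed: for \<open>r n >= N\<close> it lies between \<open>T_limit d\<close> and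
  \<open>cpG d N\<close>, both fixed Lipschitz functionals. The test functions decrease, so their
  expectations are enclosed as well. First \<open>n\<close> and then \<open>N\<close> tends to
  infinity, where the two bounds meet by dominated convergence.\<close>

theorem weak_conv_cpG:
 fixes V :: "nat => 'a => L1" and V' :: "'b => L1"
 assumes M: "prob_space M" and Q: "prob_space Q"
  and V: "\<And>n. V n \<in> borel_measurable M" and V': "V' \<in> borel_measurable Q" and T: "\<And>n. T n \<in> borel_measurable M"
  and conv: "\<And>f L. (\<And>x y. \<bar>f x - f y\<bar> <= L * norm (x - y)) ==> (\<And>x. \<bar>f x\<bar> <= 1) ==>
    (\<lambda>n. \<integral>u. f (V n u) \<partial>M) ----> (\<integral>u. f (V' u) \<partial>Q)"
  and a: "filterlim r at_top sequentially"
  and close: "\<And>e. e > 0 ==> (\<lambda>n. measure M {u \<in> space M. e < \<bar>T n u - cpG d (r n) (V n u)\<bar>}) ----> 0"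
 shows "weak_conv_m (\<lambda>n. distr M borel (T n)) (distr Q borel (\<lambda>u. T_limit d (V' u)))"
proof -
 interpret M: prob_space M by fact
 interpret Q: prob_space Q by fact
 have G: "(\<lambda>u. cpG d a (X u)) \<in> borel_measurable N" if "X \<in> borel_measurable N" for a X and N :: "'z measure"
  by (rule measurable_compose[OF that borel_measurable_continuous_onI])
   (unfold cpG_def, intro continuous_intros)
 have Tlc: "continuous_on UNIV (T_limit d)"
  by (rule lipschitz_on_continuous_on[OF lipschitz_onI[of _ _ 1]]) (use T_limit_lipschitz in \<open>simp_all add: dist_real_def dist_norm\<close>)
 have TL: "(\<lambda>u. T_limit d (X u)) \<in> borel_measurable N" if "X \<in> borel_measurable N" for X and N :: "'z measure"
  by (rule measurable_compose[OF that borel_measurable_continuous_onI[OF Tlc]])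
 have conv_step: "(\<lambda>n. M.expectation (\<lambda>u. cts_step x y (T n u))) ----> Q.expectation (\<lambda>u. cts_step x y (T_limit d (V' u)))"
  if xy: "x < y" for x y
 proof -
  note b = cts_step_bounds[OF xy]
  have cm: "cts_step x y \<in> borel_measurable borel"
   by (intro borel_measurable_continuous_onI cts_step_continuous xy)
  have iM: "integrable M (\<lambda>u. cts_step x y (Y u))" if "Y \<in> borel_measurable M" for Y
   using b by (intro M.integrable_const_bound[of _ 1] measurable_compose[OF that cm]) auto
  have iQ: "integrable Q (\<lambda>u. cts_step x y (Y u))" if "Y \<in> borel_measurable Q" for Y
   using b by (intro Q.integrable_const_bound[of _ 1] measurable_compose[OF that cm]) auto
  have lip: "\<bar>cts_step x y (g v) - cts_step x y (g w)\<bar> <= 1 / (y - x) * norm (v - w)"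
   if "\<And>v w. \<bar>g v - g w\<bar> <= norm (v - w)" for g and v w :: L1
  proof -
   have "1 / (y - x) * \<bar>g v - g w\<bar> <= 1 / (y - x) * norm (v - w)" using xy that by (intro mult_left_mono) auto
   then show ?thesis using cts_step_lipschitz[OF xy, of "g v" "g w"] by linarith
  qed
  let ?LT = "Q.expectation (\<lambda>u. cts_step x y (T_limit d (V' u)))"
  let ?EG = "\<lambda>n. M.expectation (\<lambda>u. cts_step x y (cpG d (r n) (V n u)))"
  have up: "(\<lambda>n. M.expectation (\<lambda>u. cts_step x y (T_limit d (V n u)))) ----> ?LT"
   by (rule conv[OF lip[OF T_limit_lipschitz]]) (use b in auto)
  have lowA: "(\<lambda>n. M.expectation (\<lambda>u. cts_step x y (cpG d A (V n u)))) ----> Q.expectation (\<lambda>u. cts_step x y (cpG d A (V' u)))" for A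
   by (rule conv[OF lip[OF cpG_lipschitz]]) (use b in auto)
  have A_lim: "(\<lambda>N. Q.expectation (\<lambda>u. cts_step x y (cpG d (real N) (V' u)))) ----> ?LT"
  proof (rule integral_dominated_convergence[where w = "\<lambda>_. 1"])
   show "AE u in Q. (\<lambda>N. cts_step x y (cpG d (real N) (V' u))) ----> cts_step x y (T_limit d (V' u))"
    by (intro AE_I2 continuous_on_tendsto_compose[OF cts_step_continuous[OF xy] cpG_tendsto]) auto
   show "(\<lambda>u. cts_step x y (T_limit d (V' u))) \<in> borel_measurable Q"
    "(\<lambda>u. cts_step x y (cpG d (real N) (V' u))) \<in> borel_measurable Q" for N
    by (intro measurable_compose[OF _ cm] TL G V')+
  qed (use b in auto)
  have EG: "?EG ----> ?LT"
  proof (rule tendstoI)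
   fix e :: real assume e: "e > 0"
   have "EV N. dist (Q.expectation (\<lambda>u. cts_step x y (cpG d (real N) (V' u)))) ?LT < e / 2"
    using tendstoD[OF A_lim, of "e / 2"] e by simp
   then obtain N where N: "dist (Q.expectation (\<lambda>u. cts_step x y (cpG d (real N) (V' u)))) ?LT < e / 2"
    by (auto simp: eventually_sequentially)
   have "EV n. dist (M.expectation (\<lambda>u. cts_step x y (cpG d (real N) (V n u)))) (Q.expectation (\<lambda>u. cts_step x y (cpG d (real N) (V' u)))) < e / 2"
    using tendstoD[OF lowA, of "e / 2" "real N"] e by simp
   moreover have "EV n. dist (M.expectation (\<lambda>u. cts_step x y (T_limit d (V n u)))) ?LT < e"
    using tendstoD[OF up, of e] e by simp
   moreover have "EV n. real N <= r n" using a by (simp add: filterlim_at_top)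
   ultimately show "EV n. dist (?EG n) ?LT < e"
   proof eventually_elim
    case (elim n)
    have "M.expectation (\<lambda>u. cts_step x y (cpG d (real N) (V n u))) <= ?EG n"
     using elim(3) by (intro integral_mono iM G V cts_step_antimono xy cpG_antimono) auto
    moreover have "?EG n <= M.expectation (\<lambda>u. cts_step x y (T_limit d (V n u)))"
     using elim(3) by (intro integral_mono iM G V TL cts_step_antimono xy T_limit_le_cpG) (auto intro: order_trans[of 0 "real N"])
    ultimately show ?case using elim(1,2) N unfolding dist_real_def by linarith
   qed
  qed
  show ?thesis
  proof (rule tendstoI)
   fix e :: real assume e: "e > 0"
   define h where "h = e / 4 * (y - x)"
   have "y - x \<noteq> 0" using xy by simp
   then have h: "h > 0" "h / (y - x) = e / 4"
    using e xy unfolding h_def by (auto simp del: times_divide_eq_left times_divide_eq_right)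
   have "EV n. measure M {u \<in> space M. h < \<bar>T n u - cpG d (r n) (V n u)\<bar>} < e / 4"
    using close[OF h(1)] e by (intro order_tendstoD) auto
   moreover have "EV n. dist (?EG n) ?LT < e / 4" using tendstoD[OF EG, of "e / 4"] e by simp
   ultimately show "EV n. dist (M.expectation (\<lambda>u. cts_step x y (T n u))) ?LT < e"
   proof eventually_elim
    case (elim n)
    show ?case
     using M.expectation_cts_step_close[OF xy T[of n] G[OF V[of n], of "r n"] less_imp_le[OF h(1)]] elim h(2) e
     unfolding dist_real_def by linarith
   qed
  qed
 qed
 have cm: "cts_step x y \<in> borel_measurable borel" if "x < y" for x y
  by (intro borel_measurable_continuous_onI cts_step_continuous that)
 show ?thesis
 proof (rule integral_cts_step_conv_imp_weak_conv)
  show "(\<lambda>n. integral\<^sup>L (distr M borel (T n)) (cts_step x y)) ----> integral\<^sup>L (distr Q borel (\<lambda>u. T_limit d (V' u))) (cts_step x y)"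
   if "x < y" for x y
   using conv_step[OF that] unfolding integral_distr[OF T cm[OF that]] integral_distr[OF TL[OF V'] cm[OF that]] .
 qed (use T TL[OF V'] M.real_distribution_distr Q.real_distribution_distr in blast)+
qed

section \<open>Events that control the partial sums around an index\<close>

context mixing_seq begin

abbreviation Sn :: "nat => 'a => L1" where "Sn j x \<equiv> psum_seq (\<lambda>i. eps i x) j"

lemma Sn_eq: "Sn j x = psum {1..j} x"
 by (simp add: psum_seq_def psum_def)

lemma Sn_meas: "Sn j \<in> borel_measurable M"
 unfolding Sn_eq by (rule psum_meas) simp

lemma Sn_diff: "k <= j ==> Sn j x - Sn k x = psum {k+1..j} x"
proof -
 assume "k <= j"
 then have "{1..j} = {1..k} \<union> {k+1..j}" by auto
 then have "psum {1..j} x = psum {1..k} x + psum {k+1..j} x"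
  unfolding psum_def by (simp only:) (rule sum.union_disjoint, auto)
 then show ?thesis by (simp add: Sn_eq)
qed

text \<open>The windows \<open>{k+1..k+m}\<close> to the right and \<open>{k-m+1..k}\<close> to the
  left are both nested, and \<open>K\<close> does not depend on \<open>k\<close> because the law of
  large numbers is uniform over windows.\<close>

lemma window_event:
 assumes e: "e > 0" and h: "h > 0"
 shows "\<exists>K. \<forall>n k. k <= n \<longrightarrow> prob {x \<in> space M. \<exists>j\<le>n. real K <= \<bar>real j - real k\<bar> \<and>
  e * \<bar>real j - real k\<bar> < norm (Sn j x - Sn k x)} <= h"
proof -
 obtain K where K: "\<And>N I. window N I ==>
   prob {x \<in> space M. \<exists>m. K <= m \<and> m <= N \<and> e * real m < norm (psum (I m) x)} <= h / 2"
  using slln_window[OF e, of "h / 2"] h by auto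
 have "prob {x \<in> space M. \<exists>j\<le>n. real K <= \<bar>real j - real k\<bar> \<and> e * \<bar>real j - real k\<bar> < norm (Sn j x - Sn k x)} <= h"
  if kn: "k <= n" for n k
 proof -
  define F where "F N I = {x \<in> space M. \<exists>m. K <= m \<and> m <= N \<and> e * real m < norm (psum (I m) x)}" for N and I :: "nat => nat set"
  have Fm: "F N I \<in> events" if "window N I" for N I
  proof -
   have "F N I = (\<Union>m\<in>{K..N}. {x \<in> space M. e * real m < norm (psum (I m) x)})" by (auto simp: F_def)
   moreover have "{x \<in> space M. e * real m < norm (psum (I m) x)} \<in> events" if "m \<in> {K..N}" for m
   proof -
    have "I m \<subseteq> {1..}" using \<open>window N I\<close> that unfolding window_def by simp
    from psum_meas[OF this] show ?thesis by measurable
   qed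
   ultimately show ?thesis by (simp add: sets.finite_UN)
  qed
  have fw: "window (n - k) (\<lambda>m. {k+1..k+m})" by (auto simp: window_def)
  have bw: "window k (\<lambda>m. {k-m+1..k})" by (auto simp: window_def)
  have "prob {x \<in> space M. \<exists>j\<le>n. real K <= \<bar>real j - real k\<bar> \<and> e * \<bar>real j - real k\<bar> < norm (Sn j x - Sn k x)}
   <= prob (F (n - k) (\<lambda>m. {k+1..k+m}) \<union> F k (\<lambda>m. {k-m+1..k}))"
  proof (rule finite_measure_mono)
   show "{x \<in> space M. \<exists>j\<le>n. real K <= \<bar>real j - real k\<bar> \<and> e * \<bar>real j - real k\<bar> < norm (Sn j x - Sn k x)}
    \<subseteq> F (n - k) (\<lambda>m. {k+1..k+m}) \<union> F k (\<lambda>m. {k-m+1..k})"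
   proof
    fix x assume "x \<in> {x \<in> space M. \<exists>j\<le>n. real K <= \<bar>real j - real k\<bar> \<and> e * \<bar>real j - real k\<bar> < norm (Sn j x - Sn k x)}"
    then obtain j where x: "x \<in> space M" and j: "j <= n" "real K <= \<bar>real j - real k\<bar>" "e * \<bar>real j - real k\<bar> < norm (Sn j x - Sn k x)" by auto
    show "x \<in> F (n - k) (\<lambda>m. {k+1..k+m}) \<union> F k (\<lambda>m. {k-m+1..k})"
    proof (cases "k <= j")
     case True
     then have "\<bar>real j - real k\<bar> = real (j - k)" by simp
     then have "K <= j - k" "j - k <= n - k" "e * real (j - k) < norm (psum {k+1..k+(j-k)} x)"
      using j Sn_diff[OF True, of x] True by auto
     then show ?thesis using x unfolding F_def by blast
    next
     case False
     then have kj: "j <= k" by simp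
     have "\<bar>real j - real k\<bar> = real (k - j)" using kj by simp
     moreover have "k - (k - j) = j" using kj by simp
     ultimately have "K <= k - j" "k - j <= k" "e * real (k - j) < norm (psum {k-(k-j)+1..k} x)"
      using j Sn_diff[OF kj, of x] norm_minus_commute[of "Sn j x" "Sn k x"] by auto
     then show ?thesis using x unfolding F_def by blast
    qed
   qed
  qed (use Fm[OF fw] Fm[OF bw] in auto)
  also have "... <= prob (F (n - k) (\<lambda>m. {k+1..k+m})) + prob (F k (\<lambda>m. {k-m+1..k}))"
   by (rule measure_Un_le[OF Fm[OF fw] Fm[OF bw]])
  also have "... <= h / 2 + h / 2" using K[OF fw] K[OF bw] unfolding F_def by (rule add_mono)
  finally show ?thesis by simp
 qed
 then show ?thesis by blast
qed

text \<open>At most \<open>2 * K\<close> errors are involved, so Markov's inequality for the sum of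
  their norms suffices. The 1 in \<open>B\<close> keeps it positive for
  \<open>K = 0\<close>.\<close>

lemma near_event:
 assumes h: "h > 0"
 shows "\<exists>B. \<forall>n k. k <= n \<longrightarrow> prob {x \<in> space M. \<exists>j\<le>n. \<bar>real j - real k\<bar> <= real K \<and> B < norm (Sn j x - Sn k x)} <= h"
proof -
 define B where "B = (2 * real K * m_r + 1) / h"
 have B: "B > 0" using h m_r_ge1 by (auto simp: B_def intro!: divide_pos_pos add_nonneg_pos mult_nonneg_nonneg)
 have "prob {x \<in> space M. \<exists>j\<le>n. \<bar>real j - real k\<bar> <= real K \<and> B < norm (Sn j x - Sn k x)} <= h" if "k <= n" for n k
 proof -
  define J where "J = {i. 1 <= i \<and> k < i + K \<and> i <= k + K}"
  have J: "finite J" "J \<subseteq> {1..}" "J \<subseteq> {k+1-K..k+K}" by (auto simp: J_def intro: finite_subset[of _ "{..k+K}"])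
  have "card J <= card {k+1-K..k+K}" using J by (intro card_mono) auto
  then have cJ: "card J <= 2 * K" by simp
  define Y where "Y x = (\<Sum>i\<in>J. norm (eps i x))" for x
  have iY: "integrable M Y" unfolding Y_def[abs_def] using J(2)
   by (intro intg_sum integrable_norm_eps) auto
  have "expectation Y = (\<Sum>i\<in>J. expectation (\<lambda>x. norm (eps i x)))"
   unfolding Y_def using J(2) by (intro Bochner_Integration.integral_sum integrable_norm_eps) auto
  also have "... <= (\<Sum>i\<in>J. m_r)"
  proof (rule sum_mono)
   fix i assume "i \<in> J"
   then show "expectation (\<lambda>x. norm (eps i x)) <= m_r"
    using integral_norm_psum_le[of "{i}"] by (auto simp: psum_def J_def)
  qed
  also have "... = real (card J) * m_r" by simp
  also have "... <= 2 * real K * m_r"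
  proof (rule mult_right_mono)
   show "real (card J) <= 2 * real K" using cJ by linarith
  qed (use m_r_ge1 in simp)
  finally have EY: "expectation Y <= 2 * real K * m_r" .
  have sub: "{x \<in> space M. \<exists>j\<le>n. \<bar>real j - real k\<bar> <= real K \<and> B < norm (Sn j x - Sn k x)} \<subseteq> {x \<in> space M. B <= Y x}"
  proof
   fix x assume "x \<in> {x \<in> space M. \<exists>j\<le>n. \<bar>real j - real k\<bar> <= real K \<and> B < norm (Sn j x - Sn k x)}"
   then obtain j where x: "x \<in> space M" and j: "\<bar>real j - real k\<bar> <= real K" "B < norm (Sn j x - Sn k x)" by auto
   have "norm (Sn j x - Sn k x) <= Y x"
   proof (cases "k <= j")
    case True
    have "{k+1..j} \<subseteq> J" using j(1) by (auto simp: J_def)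
    then have "(\<Sum>i\<in>{k+1..j}. norm (eps i x)) <= Y x" unfolding Y_def using J(1) by (intro sum_mono2) auto
    then show ?thesis unfolding Sn_diff[OF True] psum_def using norm_sum[of "\<lambda>i. eps i x" "{k+1..j}"] by linarith
   next
    case False
    then have kj: "j <= k" by simp
    have "{j+1..k} \<subseteq> J" using j(1) kj by (auto simp: J_def)
    then have "(\<Sum>i\<in>{j+1..k}. norm (eps i x)) <= Y x" unfolding Y_def using J(1) by (intro sum_mono2) auto
    then show ?thesis unfolding norm_minus_commute[of "Sn j x"] Sn_diff[OF kj] psum_def
     using norm_sum[of "\<lambda>i. eps i x" "{j+1..k}"] by linarith
   qed
   then show "x \<in> {x \<in> space M. B <= Y x}" using x j(2) by simp
  qed
  have "prob {x \<in> space M. \<exists>j\<le>n. \<bar>real j - real k\<bar> <= real K \<and> B < norm (Sn j x - Sn k x)} <= prob {x \<in> space M. B <= Y x}"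
   using borel_measurable_integrable[OF iY] by (intro finite_measure_mono sub) measurable
  also have "... <= expectation Y / B"
  proof (rule integral_Markov_inequality_measure[OF iY sets.top _ B])
   show "AE x in M. 0 <= Y x" by (simp add: Y_def sum_nonneg)
  qed
  also have "... <= (2 * real K * m_r) / B" using EY B by (intro divide_right_mono) auto
  also have "... <= h"
  proof -
   have "h * B = 2 * real K * m_r + 1" using h by (simp add: B_def)
   then show ?thesis using B by (simp add: pos_divide_le_eq)
  qed
  finally show ?thesis .
 qed
 then show ?thesis by blast
qed

lemma events_Sn: "{x \<in> space M. \<exists>j\<le>n. P j \<and> c j < norm (Sn j x - Sn k x)} \<in> events"
proof -
 have "{x \<in> space M. \<exists>j\<le>n. P j \<and> c j < norm (Sn j x - Sn k x)} = (\<Union>j\<in>{j. j <= n \<and> P j}. {x \<in> space M. c j < norm (Sn j x - Sn k x)})" by auto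
 moreover have "{x \<in> space M. c j < norm (Sn j x - Sn k x)} \<in> events" for j
  using Sn_meas[of j] Sn_meas[of k] by measurable
 ultimately show ?thesis by (simp add: sets.finite_UN)
qed

text \<open>Kept literally in the form of \<open>window_event\<close> at index 0, so that its
  probability bound applies by instantiation.\<close>

definition bad0 :: "real => nat => nat => 'a set" where
 "bad0 e K n = {x \<in> space M. \<exists>j\<le>n. real K <= \<bar>real j - real 0\<bar> \<and> e * \<bar>real j - real 0\<bar> < norm (Sn j x - Sn 0 x)}"

lemma not_bad0:
 assumes "x \<in> space M" "x \<notin> bad0 e K n" "j <= n" "K <= j"
 shows "norm (Sn j x) <= e * real j"
proof -
 have "Sn 0 x = 0" by (simp add: psum_seq_def)
 then show ?thesis using assms unfolding bad0_def by (auto simp: not_less)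
qed

end

section \<open>Asymptotics at the change point\<close>

text \<open>For each path the model is reduced to tent plus noise bridge. As \<open>sh\<close> is a
  maximizer, the supremum in the statistic is the value at \<open>sh\<close>, which gives the
  formula for \<open>T\<close>; the path conditions start at \<open>n = 1\<close>, since
  \<open>k n / n\<close> is meaningless at 0.\<close>

locale change_point = mixing_seq M eps \<delta> a B
 for M :: "'a measure" and eps :: "nat => 'a => L1" and \<delta> a B :: real +
 fixes s\<^sub>0 \<Delta> :: real and d :: L1 and k :: "nat => nat" and sh T :: "nat => 'a => real"
 assumes s0: "0 < s\<^sub>0" "s\<^sub>0 < 1"
  and k_def: "\<And>n. k n = nat \<lfloor>real n * s\<^sub>0\<rfloor>"
  and sh: "\<And>n x. n >= 1 ==> x \<in> space M ==> sh n x \<in> {0..1}"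
  and shmax: "\<And>n x s. n >= 1 ==> x \<in> space M ==> s \<in> {0..1} ==>
   norm (cpU (\<lambda>i. eps i x) d n (k n) s) <= norm (cpU (\<lambda>i. eps i x) d n (k n) (sh n x))"
  and T: "\<And>n x. n >= 1 ==> x \<in> space M ==>
   T n x = sqrt n * (norm (cpU (\<lambda>i. eps i x) d n (k n) (sh n x)) - sh n x * (1 - sh n x) * \<Delta>)"
  and Tm: "\<And>n. T n \<in> borel_measurable M"
  and \<Delta>: "\<Delta> > 0"
begin

text \<open>The tent peaks at the grid point \<open>k n / n\<close>, so expansions are made around
  it; \<open>s\<^sub>0\<close> is only its limit.\<close>

definition kr :: "nat => real" where "kr n = real (k n) / real n"

definition V :: "nat => 'a => L1" where
 "V n x = (1 / sqrt n) *\<^sub>R (Sn (k n) x - kr n *\<^sub>R Sn n x)"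

definition an :: "nat => real" where "an n = sqrt n * (kr n * (1 - kr n))"

lemma k_le: "k n <= n"
proof -
 have "real n * s\<^sub>0 <= real n * 1" using s0 by (intro mult_left_mono) auto
 then show ?thesis unfolding k_def by linarith
qed

lemma kr_bounds: "0 <= kr n" "kr n <= 1"
 using k_le[of n] by (auto simp: kr_def divide_le_eq_1)

lemma kr_tendsto: "kr ----> s\<^sub>0"
proof -
 have "\<bar>kr n - s\<^sub>0\<bar> <= 1 / real n" if "n >= 1" for n
 proof -
  have "0 <= real n * s\<^sub>0" using s0 by simp
  then have "\<bar>real (k n) - real n * s\<^sub>0\<bar> <= 1" unfolding k_def by linarith
  then have "\<bar>real (k n) - real n * s\<^sub>0\<bar> / real n <= 1 / real n" by (rule divide_right_mono) simp
  moreover have "kr n - s\<^sub>0 = (real (k n) - real n * s\<^sub>0) / real n" using that by (simp add: kr_def diff_divide_distrib)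
  ultimately show ?thesis by (simp add: abs_divide)
 qed
 then have "EV n. norm (kr n - s\<^sub>0) <= 1 / real n" by (auto simp: eventually_sequentially)
 then have "(\<lambda>n. kr n - s\<^sub>0) ----> 0" by (rule Lim_null_comparison[OF _ lim_1_over_n])
 then show ?thesis by (simp add: LIM_zero_iff)
qed

lemma k_at_top: "filterlim k at_top sequentially"
proof -
 have "filterlim (\<lambda>n. s\<^sub>0 * real n) at_top sequentially"
  using s0 by (intro filterlim_tendsto_pos_mult_at_top[OF tendsto_const] filterlim_real_sequentially)
 then have "filterlim (\<lambda>n. real n * s\<^sub>0) at_top sequentially" by (simp add: mult.commute)
 then show ?thesis unfolding k_def
  by (intro filterlim_compose[OF filterlim_nat_sequentially] filterlim_compose[OF filterlim_floor_sequentially])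
qed

lemma eventually_regular:
 "EV n. n >= 1 \<and> 0 < k n \<and> k n < n \<and> s\<^sub>0 * (1 - s\<^sub>0) / 2 <= kr n * (1 - kr n) \<and> K <= k n"
proof -
 have "(\<lambda>n. kr n * (1 - kr n)) ----> s\<^sub>0 * (1 - s\<^sub>0)" by (intro tendsto_intros kr_tendsto)
 then have "EV n. s\<^sub>0 * (1 - s\<^sub>0) / 2 < kr n * (1 - kr n)"
  using s0 by (intro order_tendstoD) auto
 moreover have "EV n. kr n < 1" "EV n. 0 < kr n" using kr_tendsto s0 by (auto intro: order_tendstoD)
 moreover have "EV n. K <= k n" using k_at_top by (simp add: filterlim_at_top)
 ultimately show ?thesis using eventually_ge_at_top[of 1]
  by eventually_elim (auto simp: kr_def zero_less_divide_iff)
qed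

lemma cpU_kappa_V:
 assumes "n >= 1"
 shows "sqrt n * norm (cpU (\<lambda>i. eps i x) d n (k n) (kr n)) = cpG d (an n) (V n x) + an n * norm d"
proof -
 have s: "sqrt n * (1 / real n) = 1 / sqrt n" using assms by (simp add: real_div_sqrt field_simps)
 have "sqrt n *\<^sub>R cpU (\<lambda>i. eps i x) d n (k n) (kr n) = an n *\<^sub>R d + V n x"
  unfolding kr_def cpU_at_kappa[OF assms k_le] an_def V_def by (simp add: scaleR_add_right s[simplified])
 then have "norm (sqrt n *\<^sub>R cpU (\<lambda>i. eps i x) d n (k n) (kr n)) = norm (an n *\<^sub>R d + V n x)" by simp
 then show ?thesis by (simp add: cpG_def)
qed

lemma V_bound:
 assumes "n >= 1"
 shows "norm (V n x) <= (norm (Sn (k n) x) + norm (Sn n x)) / sqrt n"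
proof -
 have "norm (Sn (k n) x - kr n *\<^sub>R Sn n x) <= norm (Sn (k n) x) + kr n * norm (Sn n x)"
  using norm_triangle_ineq4[of "Sn (k n) x" "kr n *\<^sub>R Sn n x"] kr_bounds[of n] by simp
 also have "kr n * norm (Sn n x) <= norm (Sn n x)" using kr_bounds[of n] by (simp add: mult_left_le_one_le)
 finally show ?thesis by (simp add: V_def divide_right_mono)
qed

text \<open>Outside three unlikely events the maximizer is within \<open>(K + 1) / n\<close> of the
  peak. There the norm and the penalty differ from their values at the peak by a multiple of
  \<open>1 / n\<close>, so the statistic changes by at most \<open>D / sqrt n\<close>.\<close>

lemma T_close:
 assumes d: "d \<noteq> 0" and e: "e > 0" and h: "h > 0"
 shows "EV n. prob {x \<in> space M. e < \<bar>T n x - (cpG d (an n) (V n x) + an n * (norm d - \<Delta>))\<bar>} <= h"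
proof -
 \<comment> \<open>Eventually \<open>2 * c\<close> is at most
   \<open>kr n * (1 - kr n) * norm d\<close>, as \<open>cp_localization\<close> asks; the level
   \<open>c / 5\<close> below matches the 2 + 3 norms of partial sums in its smallness
   condition.\<close>
 define c where "c = s\<^sub>0 * (1 - s\<^sub>0) / 4 * norm d"
 have c: "c > 0" using s0 d by (simp add: c_def)
 obtain K0 where K0: "\<And>n k. k <= n ==> prob {x \<in> space M. \<exists>j\<le>n. real K0 <= \<bar>real j - real k\<bar> \<and>
   c / 5 * \<bar>real j - real k\<bar> < norm (Sn j x - Sn k x)} <= h / 3"
  using window_event[of "c / 5" "h / 3"] c h by auto
 obtain K where K: "\<And>n k. k <= n ==> prob {x \<in> space M. \<exists>j\<le>n. real K <= \<bar>real j - real k\<bar> \<and>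
   c / 4 * \<bar>real j - real k\<bar> < norm (Sn j x - Sn k x)} <= h / 3"
  using window_event[of "c / 4" "h / 3"] c h by auto
 obtain B where B: "\<And>n k. k <= n ==> prob {x \<in> space M. \<exists>j\<le>n. \<bar>real j - real k\<bar> <= real (K + 2) \<and> B < norm (Sn j x - Sn k x)} <= h / 3"
  using near_event[of "h / 3" "K + 2"] h by auto
 define D where "D = (real K + 1) * (norm d + c + \<Delta>) + B"
 have "(\<lambda>n. D * inverse (sqrt n)) ----> D * 0"
  by (intro tendsto_mult tendsto_const tendsto_inverse_0_at_top filterlim_compose[OF sqrt_at_top filterlim_real_sequentially])
 then have "EV n. D * inverse (sqrt n) < e" using e by (intro order_tendstoD) auto
 with eventually_regular[of K0] show ?thesis
 proof eventually_elim
  case (elim n)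
  then have n: "n >= 1" and kk: "0 < k n" "k n < n" "K0 <= k n" and Hn: "s\<^sub>0 * (1 - s\<^sub>0) / 2 <= kr n * (1 - kr n)" by auto
  define E1 where "E1 = bad0 (c / 5) K0 n"
  define E2 where "E2 = {x \<in> space M. \<exists>j\<le>n. real K <= \<bar>real j - real (k n)\<bar> \<and> c / 4 * \<bar>real j - real (k n)\<bar> < norm (Sn j x - Sn (k n) x)}"
  define E3 where "E3 = {x \<in> space M. \<exists>j\<le>n. \<bar>real j - real (k n)\<bar> <= real (K + 2) \<and> B < norm (Sn j x - Sn (k n) x)}"
  have ev: "E1 \<in> events" "E2 \<in> events" "E3 \<in> events" unfolding E1_def E2_def E3_def bad0_def by (rule events_Sn)+
  have sub: "{x \<in> space M. e < \<bar>T n x - (cpG d (an n) (V n x) + an n * (norm d - \<Delta>))\<bar>} \<subseteq> E1 \<union> (E2 \<union> E3)"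
  proof (rule subsetI, rule ccontr)
   fix x assume "x \<in> {x \<in> space M. e < \<bar>T n x - (cpG d (an n) (V n x) + an n * (norm d - \<Delta>))\<bar>}"
    and no: "x \<notin> E1 \<union> (E2 \<union> E3)"
   then have x: "x \<in> space M" and far: "e < \<bar>T n x - (cpG d (an n) (V n x) + an n * (norm d - \<Delta>))\<bar>" by auto
   let ?e = "\<lambda>i. eps i x"
   have S: "norm (Sn j x) <= c / 5 * real n" if "j <= n" "K0 <= j" for j
   proof -
    have "norm (Sn j x) <= c / 5 * real j" using no x that unfolding E1_def by (intro not_bad0[of x _ K0 n]) auto
    also have "... <= c / 5 * real n" using c that by (intro mult_left_mono) auto
    finally show ?thesis .
   qed
   have Sk: "norm (Sn (k n) x) <= c / 5 * real n" and Snn: "norm (Sn n x) <= c / 5 * real n"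
    using S[of "k n"] S[of n] kk by auto
   have near': "\<bar>real n * sh n x - real (k n)\<bar> <= real (K + 1)"
   proof (rule cp_localization[OF n kk(1,2) sh[OF n x] _ c])
    have "kr n \<in> {0..1}" using kr_bounds[of n] by simp
    then show "norm (cpU ?e d n (k n) (real (k n) / real n)) <= norm (cpU ?e d n (k n) (sh n x))"
     using shmax[OF n x, of "kr n"] by (simp add: kr_def)
    have "2 * c = s\<^sub>0 * (1 - s\<^sub>0) / 2 * norm d" by (simp add: c_def)
    also have "... <= kr n * (1 - kr n) * norm d" by (rule mult_right_mono[OF Hn]) simp
    finally show "2 * c <= real (k n) / real n * (1 - real (k n) / real n) * norm d" by (simp only: kr_def)
    have "5 * (c / 5 * real n) = c * real n" by simp
    then show "2 * norm (Sn (k n) x) + 3 * norm (Sn n x) <= c * real n" using Sk Snn by linarith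
    show "norm (Sn j x - Sn (k n) x) <= c / 4 * \<bar>real j - real (k n)\<bar>" if "j <= n" "real K <= \<bar>real j - real (k n)\<bar>" for j
     using no x that unfolding E2_def by (auto simp: not_less)
   qed
   then have near: "\<bar>real n * sh n x - real (k n)\<bar> <= real K + 1" by simp
   have cl: "norm (cpU ?e d n (k n) (sh n x) - cpU ?e d n (k n) (kr n)) <= ((real K + 1) * (norm d + norm (Sn n x) / n) + B) / n"
    unfolding kr_def
   proof (rule cp_close[OF n k_le sh[OF n x] near])
    show "norm (Sn j x - Sn (k n) x) <= B" if "j <= n" "\<bar>real j - real (k n)\<bar> <= real K + 1 + 1" for j
     using no x that unfolding E3_def by (auto simp: not_less)
   qed
   have "norm (Sn n x) / n <= c / 5 * real n / n" using Snn by (rule divide_right_mono) simp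
   also have "... <= c" using c n by simp
   finally have "((real K + 1) * (norm d + norm (Sn n x) / n) + B) / n <= ((real K + 1) * (norm d + c) + B) / n"
    by (intro divide_right_mono add_right_mono mult_left_mono) auto
   then have cl2: "\<bar>norm (cpU ?e d n (k n) (sh n x)) - norm (cpU ?e d n (k n) (kr n))\<bar> <= ((real K + 1) * (norm d + c) + B) / n"
    using cl norm_triangle_ineq3[of "cpU ?e d n (k n) (sh n x)" "cpU ?e d n (k n) (kr n)"] by linarith
   have sk: "\<bar>sh n x - kr n\<bar> <= (real K + 1) / n" using near n by (simp add: kr_def abs_le_iff field_simps)
   have q: "\<bar>sh n x * (1 - sh n x) - kr n * (1 - kr n)\<bar> <= (real K + 1) / n"
   proof -
    have eq: "sh n x * (1 - sh n x) - kr n * (1 - kr n) = (sh n x - kr n) * (1 - sh n x - kr n)" by (simp add: algebra_simps)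
    have "\<bar>1 - sh n x - kr n\<bar> <= 1" using sh[OF n x] kr_bounds[of n] by (auto simp: abs_le_iff)
    then have "\<bar>sh n x * (1 - sh n x) - kr n * (1 - kr n)\<bar> <= \<bar>sh n x - kr n\<bar> * 1" unfolding eq abs_mult by (rule mult_left_mono) simp
    then show ?thesis unfolding mult_1_right using sk by (rule order_trans)
   qed
   have T': "T n x - (cpG d (an n) (V n x) + an n * (norm d - \<Delta>))
    = sqrt n * ((norm (cpU ?e d n (k n) (sh n x)) - norm (cpU ?e d n (k n) (kr n))) - (sh n x * (1 - sh n x) - kr n * (1 - kr n)) * \<Delta>)"
    unfolding T[OF n x] using cpU_kappa_V[OF n, of x] by (simp add: an_def algebra_simps)
   have "\<bar>(norm (cpU ?e d n (k n) (sh n x)) - norm (cpU ?e d n (k n) (kr n))) - (sh n x * (1 - sh n x) - kr n * (1 - kr n)) * \<Delta>\<bar>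
    <= ((real K + 1) * (norm d + c) + B) / n + (real K + 1) / n * \<Delta>"
   proof (rule order_trans[OF abs_triangle_ineq4 add_mono[OF cl2]])
    show "\<bar>(sh n x * (1 - sh n x) - kr n * (1 - kr n)) * \<Delta>\<bar> <= (real K + 1) / n * \<Delta>"
     using mult_right_mono[OF q, of \<Delta>] \<Delta> unfolding abs_mult[of _ \<Delta>] by simp
   qed
   also have "... = D / n" by (simp add: D_def add_divide_distrib[symmetric] algebra_simps)
   finally have "\<bar>T n x - (cpG d (an n) (V n x) + an n * (norm d - \<Delta>))\<bar> <= sqrt n * (D / n)"
    unfolding T' abs_mult[of "sqrt n"] abs_of_nonneg[OF real_sqrt_ge_zero[OF of_nat_0_le_iff]] by (rule mult_left_mono) simp
   also have "... = D * (sqrt n / n)" by simp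
   also have "... = D * inverse (sqrt n)" by (simp add: sqrt_divide_self_eq)
   finally show False using far elim by linarith
  qed
  have "prob {x \<in> space M. e < \<bar>T n x - (cpG d (an n) (V n x) + an n * (norm d - \<Delta>))\<bar>} <= prob (E1 \<union> (E2 \<union> E3))"
   using ev by (intro finite_measure_mono sub) auto
  also have "... <= prob E1 + (prob E2 + prob E3)"
   using measure_Un_le[of E1 M "E2 \<union> E3"] measure_Un_le[of E2 M E3] ev by auto
  also have "... <= h / 3 + (h / 3 + h / 3)"
   using K0[of 0 n] K[OF k_le] B[OF k_le] unfolding E1_def E2_def E3_def bad0_def by (intro add_mono) simp_all
  finally show ?case by simp
 qed
qed

lemma an_at_top: "filterlim an at_top sequentially"
proof -
 have "filterlim (\<lambda>n. kr n * (1 - kr n) * sqrt n) at_top sequentially"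
 proof (rule filterlim_tendsto_pos_mult_at_top)
  show "(\<lambda>n. kr n * (1 - kr n)) ----> s\<^sub>0 * (1 - s\<^sub>0)" by (intro tendsto_intros kr_tendsto)
  show "filterlim (\<lambda>n. sqrt n) at_top sequentially" by (rule filterlim_compose[OF sqrt_at_top filterlim_real_sequentially])
 qed (use s0 in simp)
 then show ?thesis unfolding an_def[abs_def] by (simp add: mult.commute)
qed

text \<open>The noise contribution \<open>cpG d (an n) (V n)\<close> is of smaller order than the drift \<open>an n\<close>.\<close>

lemma T_near_drift:
 assumes d: "d \<noteq> 0" and e: "e > 0" and h: "h > 0"
 shows "EV n. prob {x \<in> space M. e * an n + 1 < \<bar>T n x - an n * (norm d - \<Delta>)\<bar>} <= h"
proof -
 \<comment> \<open>Two partial sums of size at most \<open>z * n\<close>, divided by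
   \<open>sqrt n\<close>, give \<open>e / 2 * (s\<^sub>0 * (1 - s\<^sub>0)) * sqrt n\<close>, which
   is eventually at most \<open>e * an n\<close>.\<close>
 define z where "z = e * (s\<^sub>0 * (1 - s\<^sub>0)) / 4"
 have z: "z > 0" using e s0 by (simp add: z_def)
 obtain K0 where K0: "\<And>n k. k <= n ==> prob {x \<in> space M. \<exists>j\<le>n. real K0 <= \<bar>real j - real k\<bar> \<and>
   z * \<bar>real j - real k\<bar> < norm (Sn j x - Sn k x)} <= h / 2"
  using window_event[of z "h / 2"] z h by auto
 have "EV n. prob {x \<in> space M. 1 < \<bar>T n x - (cpG d (an n) (V n x) + an n * (norm d - \<Delta>))\<bar>} <= h / 2"
  using T_close[OF d, of 1 "h / 2"] h by simp
 with eventually_regular[of K0] show ?thesis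
 proof eventually_elim
  case (elim n)
  then have n: "n >= 1" and kk: "K0 <= k n" and Hn: "s\<^sub>0 * (1 - s\<^sub>0) / 2 <= kr n * (1 - kr n)" by auto
  define E2 where "E2 = {x \<in> space M. 1 < \<bar>T n x - (cpG d (an n) (V n x) + an n * (norm d - \<Delta>))\<bar>}"
  have Vm: "V n \<in> borel_measurable M"
   unfolding V_def[abs_def] by (intro borel_measurable_scaleR borel_measurable_const borel_measurable_diff Sn_meas)
  have "(\<lambda>x. cpG d (an n) (V n x)) \<in> borel_measurable M"
   by (rule measurable_compose[OF Vm borel_measurable_continuous_onI]) (unfold cpG_def, intro continuous_intros)
  then have ev: "bad0 z K0 n \<in> events" "E2 \<in> events"
   unfolding bad0_def E2_def using Tm[of n] by (rule_tac events_Sn, measurable)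
  have an0: "0 <= an n" using kr_bounds[of n] by (simp add: an_def)
  have sub: "{x \<in> space M. e * an n + 1 < \<bar>T n x - an n * (norm d - \<Delta>)\<bar>} \<subseteq> bad0 z K0 n \<union> E2"
  proof (rule subsetI, rule ccontr)
   fix x assume "x \<in> {x \<in> space M. e * an n + 1 < \<bar>T n x - an n * (norm d - \<Delta>)\<bar>}" and no: "x \<notin> bad0 z K0 n \<union> E2"
   then have x: "x \<in> space M" and far: "e * an n + 1 < \<bar>T n x - an n * (norm d - \<Delta>)\<bar>" by auto
   have "norm (Sn (k n) x) <= z * real (k n)" "norm (Sn n x) <= z * real n"
    using no x kk k_le[of n] by (auto intro!: not_bad0[of x _ K0 n])
   moreover have "z * real (k n) <= z * real n" using z k_le[of n] by simp
   ultimately have "(norm (Sn (k n) x) + norm (Sn n x)) / sqrt n <= (2 * z * real n) / sqrt n" by (intro divide_right_mono) auto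
   also have "... = 2 * z * (real n / sqrt n)" by simp
   also have "... = e * (sqrt n * (s\<^sub>0 * (1 - s\<^sub>0) / 2))" by (simp add: z_def real_div_sqrt)
   also have "... <= e * an n" unfolding an_def using Hn e by (intro mult_left_mono) auto
   finally have "norm (V n x) <= e * an n" using V_bound[OF n, of x] by linarith
   then have "\<bar>cpG d (an n) (V n x)\<bar> <= e * an n" using cpG_bound[OF an0, of d "V n x"] by linarith
   moreover have "\<bar>T n x - (cpG d (an n) (V n x) + an n * (norm d - \<Delta>))\<bar> <= 1" using no x by (auto simp: E2_def)
   ultimately show False using far by linarith
  qed
  have "prob {x \<in> space M. e * an n + 1 < \<bar>T n x - an n * (norm d - \<Delta>)\<bar>} <= prob (bad0 z K0 n \<union> E2)"
   using ev by (intro finite_measure_mono sub) auto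
  also have "... <= prob (bad0 z K0 n) + prob E2" using ev by (rule measure_Un_le)
  also have "... <= h / 2 + h / 2" using K0[of 0 n] elim unfolding E2_def bad0_def by (intro add_mono) simp_all
  finally show ?case by simp
 qed
qed

section \<open>Divergence away from the threshold, with a change present\<close>

lemma prob_tendsto_1:
 assumes "\<And>n. A n \<in> events" "\<And>h. h > 0 ==> EV n. prob (space M - A n) <= h"
 shows "(\<lambda>n. prob (A n)) ----> 1"
proof (rule tendstoI)
 fix e :: real assume "e > 0"
 then have "EV n. prob (space M - A n) <= e / 2" by (intro assms(2)) simp
 then show "EV n. dist (prob (A n)) 1 < e"
 proof eventually_elim
  case (elim n)
  then show ?case using \<open>e > 0\<close> prob_compl[OF assms(1)[of n]] prob_le_1[of "A n"] by (simp add: dist_real_def)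
 qed
qed

lemma diverges_PInf:
 assumes d: "norm d > \<Delta>"
 shows "diverges_to_PInf_in_prob M T"
 unfolding diverges_to_PInf_in_prob_def
proof (intro allI prob_tendsto_1)
 fix K h :: real assume h: "h > 0"
 define e where "e = (norm d - \<Delta>) / 2"
 have e: "e > 0" "d \<noteq> 0" using d \<Delta> by (auto simp: e_def)
 have "EV n. (K + 1) / e < an n" using an_at_top by (simp add: filterlim_at_top_dense)
 with T_near_drift[OF e(2,1) h]
 show "EV n. prob (space M - {x \<in> space M. K < T n x}) <= h"
 proof eventually_elim
  case (elim n)
  have "K + 1 < e * an n" using elim(2) e(1) by (simp add: pos_divide_less_eq mult.commute)
  moreover have "an n * (norm d - \<Delta>) = 2 * (e * an n)" by (simp add: e_def)
  ultimately have "e * an n + 1 < \<bar>T n x - an n * (norm d - \<Delta>)\<bar>" if "T n x <= K" for x using that by linarith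
  then have sub: "space M - {x \<in> space M. K < T n x} \<subseteq> {x \<in> space M. e * an n + 1 < \<bar>T n x - an n * (norm d - \<Delta>)\<bar>}"
   by (auto simp: not_less)
  have "{x \<in> space M. e * an n + 1 < \<bar>T n x - an n * (norm d - \<Delta>)\<bar>} \<in> events" using Tm[of n] by measurable
  then show ?case using finite_measure_mono[OF sub] elim(1) by linarith
 qed
qed (use Tm in measurable)

lemma diverges_MInf:
 assumes d: "norm d < \<Delta>" "d \<noteq> 0"
 shows "diverges_to_MInf_in_prob M T"
 unfolding diverges_to_MInf_in_prob_def
proof (intro allI prob_tendsto_1)
 fix K h :: real assume h: "h > 0"
 define e where "e = (\<Delta> - norm d) / 2"
 have e: "e > 0" using d by (simp add: e_def)
 have "EV n. (1 - K) / e < an n" using an_at_top by (simp add: filterlim_at_top_dense)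
 with T_near_drift[OF d(2) e h]
 show "EV n. prob (space M - {x \<in> space M. T n x < K}) <= h"
 proof eventually_elim
  case (elim n)
  have "1 - K < e * an n" using elim(2) e by (simp add: pos_divide_less_eq mult.commute)
  moreover have "an n * (norm d - \<Delta>) = - 2 * (e * an n)" by (simp add: e_def algebra_simps)
  ultimately have "e * an n + 1 < \<bar>T n x - an n * (norm d - \<Delta>)\<bar>" if "K <= T n x" for x using that by linarith
  then have sub: "space M - {x \<in> space M. T n x < K} \<subseteq> {x \<in> space M. e * an n + 1 < \<bar>T n x - an n * (norm d - \<Delta>)\<bar>}"
   by (auto simp: not_less)
  have "{x \<in> space M. e * an n + 1 < \<bar>T n x - an n * (norm d - \<Delta>)\<bar>} \<in> events" using Tm[of n] by measurable
  then show ?case using finite_measure_mono[OF sub] elim(1) by linarith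
 qed
qed (use Tm in measurable)

end

section \<open>Divergence without a change: nondegenerate noise\<close>

context mixing_seq begin

text \<open>Polarization: a covariance operator that does not vanish is already nonzero on the
  diagonal, which yields a functional with positive long run variance.\<close>

lemma long_run_cov_polarization:
 "2 * lrc l l' = lrc (l + l') (l + l') - lrc l l - lrc l' l'"
proof -
 let ?f = "\<lambda>j. (\<E> x. l (eps 1 x) * l' (eps (1 + j) x)) + (\<E> x. l (eps (1 + j) x) * l' (eps 1 x))"
 note i = functional_product_integrable
 have f: "?f j = acov (l + l') j - acov l j - acov l' j" for j
  using i[of 1 "1 + j" l l] i[of 1 "1 + j" l l'] i[of 1 "1 + j" l' l] i[of 1 "1 + j" l' l']
  by (simp add: acov_def blinfun.add_left distrib_left distrib_right mult.commute)
 have S: "(\<Sum>j. ?f (Suc j)) = (\<Sum>j. acov (l + l') (Suc j)) - (\<Sum>j. acov l (Suc j)) - (\<Sum>j. acov l' (Suc j))"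
  unfolding f by (simp add: suminf_diff summable_diff summable_acov(3))
 have 0: "2 * (\<E> x. l (eps 1 x) * l' (eps 1 x)) = acov (l + l') 0 - acov l 0 - acov l' 0"
  using f[of 0] by simp
 show ?thesis
  unfolding long_run_cov_eq unfolding long_run_cov_def S distrib_left 0 by (simp add: algebra_simps)
qed

lemma long_run_cov_pos:
 assumes "\<exists>l l'. lrc l l' \<noteq> 0"
 shows "\<exists>l. lrc l l > 0"
proof (rule ccontr)
 assume no: "\<nexists>l. lrc l l > 0"
 then have z: "lrc l l = 0" for l
 proof -
  have "\<not> lrc l l > 0" using no by blast
  then show ?thesis using long_run_cov_nonneg[of l] by simp
 qed
 then have "lrc l l' = 0" for l l' using long_run_cov_polarization[of l l'] by simp
 then show False using assms by simp
qed

end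

lemma std_normal_small_ball:
 assumes "c >= 0"
 shows "measure std_normal_distribution {-c..c} <= 2 * c"
proof -
 have "emeasure std_normal_distribution {-c..c} = (\<integral>\<^sup>+x. ennreal (std_normal_density x) * indicator {-c..c} x \<partial>lborel)"
  by (subst emeasure_density) auto
 also have "... <= (\<integral>\<^sup>+x. indicator {-c..c} x \<partial>lborel)"
 proof (rule nn_integral_mono)
  fix x :: real
  have "1 <= sqrt (2 * pi)" using pi_gt3 by simp
  then have "std_normal_density x <= 1" unfolding std_normal_density_def by (intro mult_le_one) auto
  then show "ennreal (std_normal_density x) * indicator {-c..c} x <= indicator {-c..c} x"
   by (auto simp: indicator_def)
 qed
 also have "... = ennreal (2 * c)" using assms by simp
 finally show ?thesis using assms by (simp add: measure_def enn2real_leI)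
qed

context change_point begin

lemma V_meas: "V n \<in> borel_measurable M"
 unfolding V_def[abs_def] using Sn_meas[of "k n"] Sn_meas[of n] by measurable

lemma V_char_tendsto:
 "(\<lambda>n. \<E> x. iexp (blinfun_apply l (V n x))) ----> exp (- (s\<^sub>0 * (1 - s\<^sub>0) * lrc l l) / 2)"
proof -
 have "l (V n x) = l (psum {1..k n} x - (real (k n) / real n) *\<^sub>R psum {1..n} x) / sqrt n" for n x
  unfolding V_def Sn_eq kr_def by (simp add: blinfun.scaleR_right)
 then show ?thesis
  using char_bridge_tendsto[OF s0, of k l] k_le kr_tendsto unfolding kr_def[abs_def] by simp
qed

text \<open>The projection converges to a nondegenerate centered normal law, so small intervals
  around 0 have small probability; \<open>b = h * e / 4\<close> makes the limiting probability at
  most \<open>h / 2\<close>.\<close>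

lemma V_anticoncentration:
 fixes l :: L1_dual
 assumes l: "lrc l l > 0" and h: "h > 0"
 shows "\<exists>b>0. EV n. prob {z \<in> space M. \<bar>l (V n z)\<bar> <= b} <= h"
proof -
 define e where "e = sqrt (s\<^sub>0 * (1 - s\<^sub>0) * lrc l l)"
 have e: "e > 0" "e\<^sup>2 = s\<^sub>0 * (1 - s\<^sub>0) * lrc l l" using l s0 by (simp_all add: e_def)
 interpret S: real_distribution std_normal_distribution by (rule real_dist_normal_dist)
 have Ym: "(\<lambda>z. l (V n z)) \<in> borel_measurable M" for n
  by (rule measurable_compose[OF V_meas borel_measurable_continuous_onI]) (intro continuous_intros)
 define N where "N = distr std_normal_distribution borel (\<lambda>x. e * x)"
 have wc: "weak_conv_m (\<lambda>n. distr M borel (\<lambda>z. l (V n z))) N"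
 proof (rule levy_continuity)
  show "real_distribution (distr M borel (\<lambda>z. l (V n z)))" for n using Ym by (rule real_distribution_distr)
  show "real_distribution N" unfolding N_def by (rule S.real_distribution_distr) simp
  fix t
  have "char N t = exp (- ((e * t)\<^sup>2) / 2)"
   unfolding N_def char_def using fun_cong[OF char_std_normal_distribution, of "e * t"]
   by (subst integral_distr) (auto simp: char_def mult_ac)
  also have "... = exp (- (s\<^sub>0 * (1 - s\<^sub>0) * lrc (t *\<^sub>R l) (t *\<^sub>R l)) / 2)"
   unfolding power_mult_distrib e(2) long_run_cov_scaleR by (simp add: mult_ac)
  finally have N: "char N t = ..." .
  have "char (distr M borel (\<lambda>z. l (V n z))) t = (\<E> z. iexp (blinfun_apply (t *\<^sub>R l) (V n z)))" for n
   unfolding char_def using Ym[of n] by (subst integral_distr) (auto simp: blinfun.scaleR_left)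
  then show "(\<lambda>n. char (distr M borel (\<lambda>z. l (V n z))) t) ----> char N t"
   unfolding N using V_char_tendsto[of "t *\<^sub>R l"] by simp
 qed
 define b where "b = h * e / 4"
 have b: "b > 0" using h e by (simp add: b_def)
 have pre: "measure N A = measure std_normal_distribution ((\<lambda>x. e * x) -` A)" "emeasure N A = emeasure std_normal_distribution ((\<lambda>x. e * x) -` A)"
  if "A \<in> sets borel" for A
  unfolding N_def using that by (simp_all add: measure_distr emeasure_distr)
 have fr: "emeasure N (frontier {-b..b}) = 0"
 proof -
  have "(\<lambda>x. e * x) -` {-b, b} \<subseteq> {-b / e, b / e}" using e by (auto simp: field_simps)
  then have fin: "finite ((\<lambda>x. e * x) -` {-b, b})" by (rule finite_subset) simp
  have "(\<lambda>x. e * x) -` {-b, b} \<in> null_sets lborel"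
   using emeasure_lborel_countable[OF countable_finite[OF fin]] borel_closed[OF finite_imp_closed[OF fin]] by (simp add: null_sets_def)
  then have "(\<lambda>x. e * x) -` {-b, b} \<in> null_sets std_normal_distribution"
   using absolutely_continuousI_density[of std_normal_density lborel] unfolding absolutely_continuous_def by auto
  then have "emeasure std_normal_distribution ((\<lambda>x. e * x) -` {-b, b}) = 0" by (rule null_setsD1)
  moreover have "frontier {-b..b} = {-b, b}" using b by (auto simp: frontier_def)
  ultimately show ?thesis by (simp add: pre)
 qed
 have "(\<lambda>n. measure (distr M borel (\<lambda>z. l (V n z))) {-b..b}) ----> measure N {-b..b}"
  using fr real_distribution_distr[OF Ym] wc S.real_distribution_distr
  by (intro weak_conv_imp_continuity_set_conv) (auto simp: N_def)
 moreover have "measure N {-b..b} <= h / 2"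
 proof -
  have "(\<lambda>x. e * x) -` {-b..b} = {-(b / e)..b / e}" using e by (auto simp: field_simps)
  then have "measure N {-b..b} <= 2 * (b / e)" using std_normal_small_ball[of "b / e"] b e by (simp add: pre)
  then show ?thesis using e by (simp add: b_def)
 qed
 then have "measure N {-b..b} < h" using h by linarith
 ultimately have "EV n. measure (distr M borel (\<lambda>z. l (V n z))) {-b..b} < h"
  by (rule order_tendstoD(2))
 moreover have "measure (distr M borel (\<lambda>z. l (V n z))) {-b..b} = prob {z \<in> space M. \<bar>l (V n z)\<bar> <= b}" for n
  by (subst measure_distr[OF Ym]) (auto intro!: arg_cong[where f = prob] simp: abs_le_iff)
 ultimately show ?thesis using b by (auto elim!: eventually_mono intro!: exI[of _ b])
qed

text \<open>Without drift the statistic is \<open>norm (R s) / sqrt n\<close> minus the penalty. The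
  maximum of \<open>norm (R s)\<close> is at least \<open>g * sqrt n\<close>, too large for a point
  near an end, so \<open>bridge_large_imp\<close> bounds it by
  \<open>6 * w * n * (s * (1 - s))\<close>. As \<open>12 * w <= \<Delta>\<close>, half of the
  penalty survives, and the same inequality forces the penalty to be at least of order
  \<open>g / w\<close>: the smaller \<open>w\<close>, the more negative the statistic.\<close>

lemma T_no_change:
 assumes n: "n >= 1" "K <= n" and x: "x \<in> space M" and d: "d = 0"
  and w: "w > 0" "12 * w <= \<Delta>"
  and fw: "\<And>j. j <= n ==> K <= j ==> norm (Sn j x) <= w * real j"
  and bw: "\<And>j. j <= n ==> K <= n - j ==> norm (Sn j x - Sn n x) <= w * (real n - real j)"
  and fB: "\<And>j. j <= n ==> j <= K + 2 ==> norm (Sn j x) <= B'"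
  and bB: "\<And>j. j <= n ==> n - j <= K + 2 ==> norm (Sn j x - Sn n x) <= B'"
  and V: "g <= norm (V n x)" and large: "B' + w * (real K + 1) < g * sqrt n"
 shows "T n x <= - (g * \<Delta> / (12 * w))"
proof -
 let ?e = "\<lambda>i. eps i x"
 define s where "s = sh n x"
 define R where "R s = interp_sum ?e (real n * s) - s *\<^sub>R Sn n x" for s
 have s: "s \<in> {0..1}" using sh[OF n(1) x] by (simp add: s_def)
 have U: "norm (cpU ?e d n (k n) s) = norm (R s) / real n" for s by (simp add: cpU_def d R_def)
 have sq: "sqrt n * sqrt n = real n" "sqrt n > 0" using n(1) by auto
 have "kr n \<in> {0..1}" using kr_bounds[of n] by simp
 from shmax[OF n(1) x this] have "norm (R (kr n)) <= norm (R s)"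
  unfolding U s_def using n(1) by (simp add: divide_le_cancel)
 moreover have "norm (R (kr n)) = sqrt n * norm (V n x)"
  using n(1) by (simp add: R_def V_def kr_def interp_sum_of_nat)
 moreover have "sqrt n * g <= sqrt n * norm (V n x)" using V by (intro mult_left_mono) auto
 ultimately have Rb: "g * sqrt n <= norm (R s)" by (simp add: mult.commute)
 have R6: "norm (R s) <= 6 * w * n * (s * (1 - s))"
  using bridge_large_imp[OF n s w(1) fw bw fB bB, of "g * sqrt n"] Rb large unfolding R_def by auto
 define q where "q = sqrt n * (s * (1 - s))"
 have q: "real n * (s * (1 - s)) = sqrt n * q" by (simp only: q_def mult.assoc[symmetric] sq(1))
 have q6: "6 * w * real n * (s * (1 - s)) = sqrt n * (6 * w * q)"
  unfolding mult.assoc[of "6 * w"] q by (simp only: mult_ac)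
 have "sqrt n * g <= sqrt n * (6 * w * q)"
  using order_trans[OF Rb R6] unfolding q6 mult.commute[of g] .
 then have bq: "g <= 6 * w * q" using sq(2) by simp
 have q0: "q >= 0" using s by (simp add: q_def)
 have "sqrt n * (norm (R s) / real n) <= sqrt n * ((6 * w * n * (s * (1 - s))) / real n)"
  using R6 by (intro mult_left_mono divide_right_mono) auto
 also have "... = 6 * w * q" using n(1) by (simp add: q_def)
 also have "... <= \<Delta> / 2 * q" using w q0 by (intro mult_right_mono) auto
 finally have "T n x <= - (\<Delta> / 2 * q)"
  unfolding T[OF n(1) x] s_def[symmetric] U by (simp add: right_diff_distrib q_def mult_ac)
 also have "... <= - (\<Delta> / 2 * (g / (6 * w)))"
  using bq \<Delta> w(1) by (intro le_imp_neg_le mult_left_mono) (auto simp: pos_divide_le_eq mult.commute)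
 finally show ?thesis by (simp add: mult.commute)
qed

lemma diverges_MInf_no_change:
 assumes d: "d = 0" and C: "\<exists>l l'. lrc l l' \<noteq> 0"
 shows "diverges_to_MInf_in_prob M T"
 unfolding diverges_to_MInf_in_prob_def
proof (intro allI prob_tendsto_1)
 fix L h :: real assume h: "h > 0"
 define h' where "h' = h / 5"
 have h': "h' > 0" using h by (simp add: h'_def)
 obtain l :: L1_dual where l: "lrc l l > 0" using long_run_cov_pos[OF C] by auto
 obtain b' where b: "b' > 0" "EV n. prob {x \<in> space M. \<bar>l (V n x)\<bar> <= b'} <= h'"
  using V_anticoncentration[OF l h'] by auto
 define w where "w = b' / (norm l + 1)"
 have w: "w > 0" using b by (simp add: w_def add_nonneg_pos)
 \<comment> \<open>The first bound is the condition \<open>12 * e <= \<Delta>\<close>; the second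
   makes \<open>w * \<Delta> / (12 * e)\<close> exceed the absolute value of
   \<open>L\<close>.\<close>
 define e where "e = min (\<Delta> / 12) (w * \<Delta> / (12 * (\<bar>L\<bar> + 1)))"
 have e: "e > 0" "12 * e <= \<Delta>" using \<Delta> w by (auto simp: e_def)
 have L: "- (w * \<Delta> / (12 * e)) < L"
 proof -
  have L0: "\<bar>L\<bar> + 1 > 0" by linarith
  have "e * (12 * (\<bar>L\<bar> + 1)) <= w * \<Delta>"
   using L0 by (subst pos_le_divide_eq[symmetric]) (simp_all add: e_def)
  then have "(\<bar>L\<bar> + 1) * (12 * e) <= w * \<Delta>" by (simp only: mult_ac)
  then have "\<bar>L\<bar> + 1 <= w * \<Delta> / (12 * e)" using e(1) by (subst pos_le_divide_eq) simp_all
  then show ?thesis by linarith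
 qed
 obtain K where K: "\<And>n k. k <= n ==> prob {x \<in> space M. \<exists>j\<le>n. real K <= \<bar>real j - real k\<bar> \<and>
   e * \<bar>real j - real k\<bar> < norm (Sn j x - Sn k x)} <= h'"
  using window_event[OF e(1) h'] by auto
 obtain B' where B': "\<And>n k. k <= n ==> prob {x \<in> space M. \<exists>j\<le>n. \<bar>real j - real k\<bar> <= real (K + 2) \<and> B' < norm (Sn j x - Sn k x)} <= h'"
  using near_event[OF h', of "K + 2"] by auto
 have "filterlim (\<lambda>n. w * sqrt n) at_top sequentially"
  using w by (intro filterlim_tendsto_pos_mult_at_top[OF tendsto_const] filterlim_compose[OF sqrt_at_top filterlim_real_sequentially])
 then have "EV n. B' + e * (real K + 1) < w * sqrt n" by (simp add: filterlim_at_top_dense)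
 with b(2) eventually_ge_at_top[of "max 1 K"]
 show "EV n. prob (space M - {x \<in> space M. T n x < L}) <= h"
 proof eventually_elim
  case (elim n)
  then have n: "n >= 1" "K <= n" by auto
  define E1 where "E1 = {x \<in> space M. \<bar>l (V n x)\<bar> <= b'}"
  define E2 where "E2 k = {x \<in> space M. \<exists>j\<le>n. real K <= \<bar>real j - real k\<bar> \<and> e * \<bar>real j - real k\<bar> < norm (Sn j x - Sn k x)}" for k
  define E3 where "E3 k = {x \<in> space M. \<exists>j\<le>n. \<bar>real j - real k\<bar> <= real (K + 2) \<and> B' < norm (Sn j x - Sn k x)}" for k
  have "(\<lambda>x. l (V n x)) \<in> borel_measurable M"
   by (rule measurable_compose[OF V_meas borel_measurable_continuous_onI]) (intro continuous_intros)
  then have ev1: "E1 \<in> events" unfolding E1_def by measurable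
  have ev: "E2 k \<in> events" "E3 k \<in> events" for k unfolding E2_def E3_def by (rule events_Sn)+
  let ?E = "E1 \<union> ((E2 0 \<union> E2 n) \<union> (E3 0 \<union> E3 n))"
  have S0: "Sn 0 x = 0" for x by (simp add: psum_seq_def)
  have sub: "space M - {x \<in> space M. T n x < L} \<subseteq> ?E"
  proof (rule subsetI, rule ccontr)
   fix x assume "x \<in> space M - {x \<in> space M. T n x < L}" and no: "x \<notin> ?E"
   then have x: "x \<in> space M" "L <= T n x" by auto
   have "T n x <= - (w * \<Delta> / (12 * e))"
   proof (rule T_no_change[OF n x(1) d e])
    show "norm (Sn j x) <= e * real j" if "j <= n" "K <= j" for j
     using no x that by (auto simp: E2_def S0 not_less)
    show "norm (Sn j x - Sn n x) <= e * (real n - real j)" if "j <= n" "K <= n - j" for j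
    proof -
     have "\<bar>real j - real n\<bar> = real n - real j" "real K <= real n - real j" using that n by linarith+
     moreover have "\<not> (real K <= \<bar>real j - real n\<bar> \<and> e * \<bar>real j - real n\<bar> < norm (Sn j x - Sn n x))"
      using no x(1) that(1) unfolding E2_def by blast
     ultimately show ?thesis by (simp add: not_less)
    qed
    show "norm (Sn j x) <= B'" if "j <= n" "j <= K + 2" for j
     using no x that by (auto simp: E3_def S0 not_less)
    show "norm (Sn j x - Sn n x) <= B'" if "j <= n" "n - j <= K + 2" for j
    proof -
     have "\<bar>real j - real n\<bar> <= real (K + 2)" using that by linarith
     then show ?thesis using no x(1) that(1) unfolding E3_def by (simp add: not_less)
    qed
    have "b' < \<bar>l (V n x)\<bar>" using no x by (auto simp: E1_def not_le)
    also have "... <= norm l * norm (V n x)" using norm_blinfun[of l "V n x"] by simp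
    also have "... <= (norm l + 1) * norm (V n x)" by (simp add: mult_right_mono)
    finally show "w <= norm (V n x)"
     unfolding w_def by (simp add: pos_divide_le_eq add_nonneg_pos mult.commute)
   qed (rule elim(3))
   then show False using L x(2) by linarith
  qed
  have "prob (space M - {x \<in> space M. T n x < L}) <= prob ?E"
   using ev1 ev by (intro finite_measure_mono sub) auto
  also have "... <= prob E1 + ((prob (E2 0) + prob (E2 n)) + (prob (E3 0) + prob (E3 n)))"
   using ev1 ev by (intro order_trans[OF measure_Un_le] add_mono order_refl) auto
  also have "... <= h' + ((h' + h') + (h' + h'))"
   using elim(1) K[of 0 n] K[of n n] B'[of 0 n] B'[of n n] unfolding E1_def E2_def E3_def
   by (intro add_mono) simp_all
  finally show ?case by (simp add: h'_def)
 qed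
qed (use Tm in measurable)

section \<open>Weak convergence at the threshold\<close>

lemma V_integrable: "integrable M (V n)"
 unfolding V_def[abs_def] Sn_eq
 by (intro integrable_scaleR_right intg_diff integrable_psum) auto

text \<open>At the threshold the drift \<open>an n * (norm d - \<Delta>)\<close> is identically 0,
  so the statistic is asymptotically \<open>cpG d (an n) (V n)\<close>. Characteristic functions,
  bounded projections and small tails of \<open>V n\<close> give the convergence in
  \<open>L1\<close> that \<open>weak_conv_cpG\<close> needs.\<close>

theorem weak_conv_T:
 assumes d: "norm d = \<Delta>"
  and P: "prob_space P" and G: "is_N0 P G (cov_op M (eps 1))" and g: "g > 0" and C1: "C1 > 0"
  and A4: "\<And>y. y >= 0 ==> integrable P (\<lambda>z. (norm (G z - shift_L1 y (G z)))\<^sup>2) \<and>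
      sqrt (\<integral>z. (norm (G z - shift_L1 y (G z)))\<^sup>2 \<partial>P) <= C1 * y powr g"
  and W: "brownian_motion_L1 Q W (lrc)"
 shows "weak_conv_m (\<lambda>n. distr M borel (T n)) (distr Q borel (\<lambda>z. T_limit d (W s\<^sub>0 z - s\<^sub>0 *\<^sub>R W 1 z)))"
proof -
 have Q: "prob_space Q" by (rule bm_prob[OF W])
 note Wm = bm_meas[OF W]
 define V' where "V' z = W s\<^sub>0 z - s\<^sub>0 *\<^sub>R W 1 z" for z
 have V'm: "V' \<in> borel_measurable Q"
  unfolding V'_def[abs_def] using s0
  by (intro borel_measurable_diff borel_measurable_scaleR borel_measurable_const Wm) auto
 have inc: "integrable Q (\<lambda>z. W t z - W 0 z)" if "0 <= t" for t
  using bm_gauss[OF W order_refl that] by (simp add: gaussian_L1_def)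
 \<comment> \<open>\<open>W 0 = 0\<close> holds only almost surely and Gaussianity is given for
   increments, so the bridge is expressed by increments from time 0.\<close>
 have V'i: "integrable Q V'"
 proof (rule integrable_cong_AE_imp[OF _ V'm])
  show "integrable Q (\<lambda>z. (W s\<^sub>0 z - W 0 z) - s\<^sub>0 *\<^sub>R (W 1 z - W 0 z))"
   using s0 by (intro intg_diff integrable_scaleR_right inc) auto
  show "AE z in Q. (W s\<^sub>0 z - W 0 z) - s\<^sub>0 *\<^sub>R (W 1 z - W 0 z) = V' z"
   using bm_start[OF W] by eventually_elim (simp add: V'_def)
 qed
 have char: "(\<lambda>n. \<E> z. iexp (blinfun_apply l (V n z))) ----> (\<integral>z. iexp (l (V' z)) \<partial>Q)" for l
  using V_char_tendsto[of l] bm_bridge_char[OF W, of s\<^sub>0 l] s0 by (simp add: V'_def)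
 have bd: "\<exists>c. \<forall>n. (\<E> z. \<bar>l (V n z)\<bar>) <= c" for l :: L1_dual
 proof -
  obtain c where c: "c >= 0" "\<And>n m. m <= n ==> (\<E> z. \<bar>l (Sn m z)\<bar>) <= c * sqrt n"
   using integral_abs_functional_psum_sqrt[of l] unfolding Sn_eq by auto
  have i: "integrable M (\<lambda>z. \<bar>l (Sn m z)\<bar>)" for m
   unfolding Sn_eq by (intro integrable_abs integrable_functional_psum) auto
  have "(\<E> z. \<bar>l (V n z)\<bar>) <= 2 * c" for n
  proof -
   have "(\<E> z. \<bar>l (V n z)\<bar>) <= (\<E> z. (1 / sqrt n) * (\<bar>l (Sn (k n) z)\<bar> + \<bar>l (Sn n z)\<bar>))"
   proof (rule integral_mono)
    show "integrable M (\<lambda>z. \<bar>l (V n z)\<bar>)"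
     by (intro integrable_abs integrable_bounded_linear[OF blinfun.bounded_linear_right V_integrable])
    fix z
    have "\<bar>l (Sn (k n) z) - kr n * l (Sn n z)\<bar> <= \<bar>l (Sn (k n) z)\<bar> + kr n * \<bar>l (Sn n z)\<bar>"
     using abs_triangle_ineq4[of "l (Sn (k n) z)" "kr n * l (Sn n z)"] kr_bounds[of n] by (simp add: abs_mult)
    also have "kr n * \<bar>l (Sn n z)\<bar> <= \<bar>l (Sn n z)\<bar>" using kr_bounds[of n] by (simp add: mult_left_le_one_le)
    finally have "\<bar>l (Sn (k n) z) - kr n * l (Sn n z)\<bar> <= \<bar>l (Sn (k n) z)\<bar> + \<bar>l (Sn n z)\<bar>" by simp
    then have "(1 / sqrt n) * \<bar>l (Sn (k n) z) - kr n * l (Sn n z)\<bar>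
     <= (1 / sqrt n) * (\<bar>l (Sn (k n) z)\<bar> + \<bar>l (Sn n z)\<bar>)" by (rule mult_left_mono) simp
    then show "\<bar>l (V n z)\<bar> <= (1 / sqrt n) * (\<bar>l (Sn (k n) z)\<bar> + \<bar>l (Sn n z)\<bar>)"
     by (simp add: V_def blinfun.scaleR_right blinfun.diff_right abs_mult)
   qed (use i in simp)
   also have "... = (1 / sqrt n) * ((\<E> z. \<bar>l (Sn (k n) z)\<bar>) + (\<E> z. \<bar>l (Sn n z)\<bar>))"
    using i by simp
   also have "... <= (1 / sqrt n) * (c * sqrt n + c * sqrt n)"
    by (intro mult_left_mono add_mono c(2) k_le) auto
   also have "... <= 2 * c" using c(1) by (cases "n = 0") auto
   finally show ?thesis .
  qed
  then show ?thesis by blast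
 qed
 have tail: "\<exists>m1. \<forall>m\<ge>m1. EV n. (\<E> z. norm (V n z - proj m (V n z))) <= w" if w: "w > 0" for w
 proof -
  define E where "E m n = (\<E> z. norm (Sn n z - proj m (Sn n z)))" for m n
  obtain m1 where m1: "\<And>m. m >= m1 ==> EV n. E m n <= w / 2 * sqrt n"
   using psum_tail_small[OF P G g C1 A4 Q bm_N0[OF W], of "w / 2"] w unfolding E_def Sn_eq by auto
  have i: "integrable M (\<lambda>z. norm (Sn n z - proj m (Sn n z)))" for n m
  proof -
   have S: "integrable M (Sn n)" unfolding Sn_eq by (rule integrable_psum) auto
   show ?thesis by (intro integrable_norm intg_diff S integrable_bounded_linear[OF bounded_linear_proj S])
  qed
  have "EV n. (\<E> z. norm (V n z - proj m (V n z))) <= w" if m: "m >= m1" for m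
  proof -
   \<comment> \<open>Since \<open>k n\<close> tends to infinity, the estimate for full samples also
     holds along the shorter sums.\<close>
   have "EV n. E m (k n) <= w / 2 * sqrt (real (k n))"
    using eventually_compose_filterlim[OF m1[OF m] k_at_top] .
   with m1[OF m] eventually_ge_at_top[of 1] show ?thesis
   proof eventually_elim
    case (elim n)
    have "(\<E> z. norm (V n z - proj m (V n z)))
     <= (\<E> z. (1 / sqrt n) * (norm (Sn (k n) z - proj m (Sn (k n) z)) + norm (Sn n z - proj m (Sn n z))))"
    proof (rule integral_mono)
     show "integrable M (\<lambda>z. norm (V n z - proj m (V n z)))"
      by (intro integrable_norm intg_diff V_integrable integrable_bounded_linear[OF bounded_linear_proj V_integrable])
     fix z
     let ?x = "Sn (k n) z - proj m (Sn (k n) z)" and ?y = "Sn n z - proj m (Sn n z)"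
     have eq: "V n z - proj m (V n z) = (1 / sqrt n) *\<^sub>R (?x - kr n *\<^sub>R ?y)"
      unfolding V_def proj_scaleR proj_diff by (simp add: algebra_simps)
     have "norm (?x - kr n *\<^sub>R ?y) <= norm ?x + kr n * norm ?y"
      using norm_triangle_ineq4[of ?x "kr n *\<^sub>R ?y"] kr_bounds[of n] by simp
     also have "kr n * norm ?y <= norm ?y" using kr_bounds[of n] by (simp add: mult_left_le_one_le)
     finally have "norm (?x - kr n *\<^sub>R ?y) <= norm ?x + norm ?y" by simp
     then have "(1 / sqrt n) * norm (?x - kr n *\<^sub>R ?y) <= (1 / sqrt n) * (norm ?x + norm ?y)" by (rule mult_left_mono) simp
     then show "norm (V n z - proj m (V n z)) <= (1 / sqrt n) * (norm ?x + norm ?y)" unfolding eq by simp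
    qed (use i in simp)
    also have "... = (1 / sqrt n) * (E m (k n) + E m n)" unfolding E_def using i by simp
    also have "... <= (1 / sqrt n) * (w / 2 * sqrt n + w / 2 * sqrt n)"
    proof (intro mult_left_mono add_mono elim(1))
     have "w / 2 * sqrt (real (k n)) <= w / 2 * sqrt n" using w k_le[of n] by simp
     with elim(3) show "E m (k n) <= w / 2 * sqrt n" by (rule order_trans)
    qed simp
    also have "... = w" using elim(2) by simp
    finally show ?case .
   qed
  qed
  then show ?thesis by blast
 qed
 have d0: "d \<noteq> 0" using d \<Delta> by auto
 have "weak_conv_m (\<lambda>n. distr M borel (T n)) (distr Q borel (\<lambda>z. T_limit d (V' z)))"
 proof (rule weak_conv_cpG[OF prob_space_axioms Q V_meas V'm Tm _ an_at_top])
  show "(\<lambda>n. \<E> z. f (V n z)) ----> (\<integral>z. f (V' z) \<partial>Q)"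
   if "\<And>x y. \<bar>f x - f y\<bar> <= L * norm (x - y)" "\<And>x. \<bar>f x\<bar> <= 1" for f L
   by (rule L1_bounded_lipschitz_tendsto[OF prob_space_axioms Q V_integrable V'i char bd tail that])
  fix e :: real assume e: "e > 0"
  show "(\<lambda>n. prob {z \<in> space M. e < \<bar>T n z - cpG d (an n) (V n z)\<bar>}) ----> 0"
  proof (rule tendstoI)
   fix h :: real assume h: "h > 0"
   have "EV n. prob {z \<in> space M. e < \<bar>T n z - cpG d (an n) (V n z)\<bar>} <= h / 2"
    using T_close[OF d0 e, of "h / 2"] h by (simp add: d)
   then show "EV n. dist (prob {z \<in> space M. e < \<bar>T n z - cpG d (an n) (V n z)\<bar>}) 0 < h"
    using h by (auto simp: dist_real_def elim!: eventually_mono)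
  qed
 qed
 then show ?thesis by (simp add: V'_def)
qed

end

section \<open>From the model and its assumptions to the abstract setting\<close>

lemma beta_bound_of_summable:
 assumes sm: "summable (\<lambda>k. real (Suc k) powr a * b (Suc k) powr p)" and p: "p > 0"
 shows "\<exists>B>0. \<forall>k\<ge>1. b k <= (B * real k powr - a) powr (1 / p)"
proof -
 have "Bseq (\<lambda>k. real (Suc k) powr a * b (Suc k) powr p)"
  using sm by (intro convergent_imp_Bseq) (auto simp: convergent_def dest: summable_LIMSEQ_zero)
 then obtain B where B: "B > 0" "\<And>k. norm (real (Suc k) powr a * b (Suc k) powr p) <= B" by (auto simp: Bseq_def)
 have "b k <= (B * real k powr - a) powr (1 / p)" if k: "k >= 1" for k
 proof (cases "b k > 0")
  case True
  have "real k powr a * b k powr p <= B" using B(2)[of "k - 1"] k by simp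
  then have "b k powr p <= B * real k powr - a" using k by (simp add: powr_minus_divide field_simps)
  then have "(b k powr p) powr (1 / p) <= (B * real k powr - a) powr (1 / p)" using p by (intro powr_mono2) auto
  then show ?thesis using True p by (simp add: powr_powr)
 qed (simp add: order_trans[OF _ powr_ge_zero] not_less)
 then show ?thesis using B(1) by blast
qed

lemma T_stat_arg_max:
 assumes n: "n >= 1" and k: "k <= n"
  and x: "\<And>i. 1 <= i ==> i <= n ==> x i = (if i <= k then w1 else w2) + e i"
  and max: "is_arg_max (\<lambda>s. norm (cusum x n s)) (\<lambda>s. s \<in> {0..1}) t"
 shows "t \<in> {0..1}"
  and "s \<in> {0..1} ==> norm (cpU e (w1 - w2) n k s) <= norm (cpU e (w1 - w2) n k t)"
  and "T_stat \<Delta> n x t = sqrt n * (norm (cpU e (w1 - w2) n k t) - t * (1 - t) * \<Delta>)"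
proof -
 show t: "t \<in> {0..1}" using max by (simp add: is_arg_max_def)
 note eq = cusum_eq_cpU[OF n k _ x]
 have le: "norm (cusum x n s) <= norm (cusum x n t)" if "s \<in> {0..1}" for s
  using max that unfolding is_arg_max_def by (auto simp: not_less)
 then show "s \<in> {0..1} ==> norm (cpU e (w1 - w2) n k s) <= norm (cpU e (w1 - w2) n k t)"
  using eq t by simp
 have "(SUP s\<in>{0..1}. norm (cusum x n s)) = norm (cusum x n t)"
  using t le by (intro cSup_eq_maximum) auto
 then show "T_stat \<Delta> n x t = sqrt n * (norm (cpU e (w1 - w2) n k t) - t * (1 - t) * \<Delta>)"
  unfolding T_stat_def using eq[OF t] by simp
qed

text \<open>The interpolation index depends on the random point \<open>t x\<close>; in the clipped
  form the sum runs over a fixed index set and only its weights are random.\<close>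

lemma measurable_cpU:
 assumes e: "\<And>i. i >= 1 ==> eps i \<in> borel_measurable M" and t: "t \<in> borel_measurable M" "\<And>x. x \<in> space M ==> t x \<in> {0..1}"
 shows "(\<lambda>x. cpU (\<lambda>i. eps i x) d n k (t x)) \<in> borel_measurable M"
proof -
 have S: "(\<lambda>x. psum_seq (\<lambda>i. eps i x) n) \<in> borel_measurable M"
  unfolding psum_seq_def using e by (intro borel_measurable_sum) auto
 have "(\<lambda>x. \<Sum>i=1..n. max 0 (min 1 (real n * t x - real i + 1)) *\<^sub>R eps i x) \<in> borel_measurable M"
  using e t(1) by (intro borel_measurable_sum borel_measurable_scaleR) auto
 then have I: "(\<lambda>x. interp_sum (\<lambda>i. eps i x) (real n * t x)) \<in> borel_measurable M"
 proof (rule measurable_cong[THEN iffD1, rotated])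
  fix x assume "x \<in> space M"
  then have "0 <= real n * t x" "real n * t x <= real n" using t(2)[of x] by (auto simp: mult_left_le)
  then show "(\<Sum>i=1..n. max 0 (min 1 (real n * t x - real i + 1)) *\<^sub>R eps i x) = interp_sum (\<lambda>i. eps i x) (real n * t x)"
   by (simp add: interp_sum_clip)
 qed
 show ?thesis unfolding cpU_def using S I t(1) by measurable
qed

theorem theorem4p1:
  fixes M :: "'a measure" and \<epsilon> :: "nat \<Rightarrow> 'a \<Rightarrow> L1" and X :: "nat \<Rightarrow> nat \<Rightarrow> 'a \<Rightarrow> L1"
    and \<mu>1 \<mu>2 :: L1 and s_star \<Delta> \<delta> \<eta> \<tau> \<alpha> C1 :: real
    and s_hat :: "nat \<Rightarrow> 'a \<Rightarrow> real"
    and P :: "'b measure" and G :: "'b \<Rightarrow> L1" and Q :: "'c measure"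
  assumes "prob_space M" and "prob_space P"
    and "\<Delta> > 0"
    \<comment> \<open>model\<close>
    and "s_star \<in> {0<..<1}"
    and "\<And>i. i \<ge> 1 \<Longrightarrow> \<epsilon> i \<in> borel_measurable M"
    and "stationary_seq M \<epsilon>"
    and "\<And>i. i \<ge> 1 \<Longrightarrow> integral\<^sup>L M (\<epsilon> i) = 0"
    and "\<And>n i \<omega>. 1 \<le> i \<Longrightarrow> i \<le> n \<Longrightarrow> \<omega> \<in> space M \<Longrightarrow>
           X n i \<omega> = (if int i \<le> \<lfloor>real n * s_star\<rfloor> then \<mu>1 else \<mu>2) + \<epsilon> i \<omega>"
    \<comment> \<open>A1\<close>
    and "\<delta> > 0" and "\<And>i. i \<ge> 1 \<Longrightarrow> integrable M (\<lambda>\<omega>. norm (\<epsilon> i \<omega>) powr (2 + \<delta>))"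
    \<comment> \<open>A2\<close>
    and "\<eta> > 0" and "1 / (2 + 2 * \<delta>) < \<tau>" and "\<tau> < 1 / 2"
    and "\<And>k. k \<ge> 1 \<Longrightarrow> beta_coeff M \<epsilon> k \<le> real k powr (- ((1 + \<eta>) * (1 + 2 / \<delta>)))"
    and "summable (\<lambda>k. real (Suc k) powr (1 / (1 / 2 - \<tau>)) *
                       beta_coeff M \<epsilon> (Suc k) powr (\<delta> / (2 + \<delta>)))"
    \<comment> \<open>A3\<close>
    and "\<And>i. i \<ge> 1 \<Longrightarrow> integrable_pointwise_sd M (\<epsilon> i)"
    \<comment> \<open>A4\<close>
    and "is_N0 P G (cov_op M (\<epsilon> 1))"
    and "\<alpha> > 0" and "C1 > 0"
    and "\<And>y. y \<ge> 0 \<Longrightarrow> integrable P (\<lambda>\<omega>. (norm (G \<omega> - shift_L1 y (G \<omega>)))\<^sup>2) \<and>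
           sqrt (\<integral>\<omega>. (norm (G \<omega> - shift_L1 y (G \<omega>)))\<^sup>2 \<partial>P) \<le> C1 * y powr \<alpha>"
    \<comment> \<open>any measurable choice of the arg max\<close>
    and "\<And>n. n \<ge> 1 \<Longrightarrow> s_hat n \<in> borel_measurable M"
    and "\<And>n \<omega>. n \<ge> 1 \<Longrightarrow> \<omega> \<in> space M \<Longrightarrow>
           is_arg_max (\<lambda>s. norm (cusum (\<lambda>i. X n i \<omega>) n s)) (\<lambda>s. s \<in> {0..1}) (s_hat n \<omega>)"
    \<comment> \<open>if there is no change at all, the long run covariance operator must not vanish\<close>
    and "\<mu>1 = \<mu>2 \<Longrightarrow> \<exists>l l'. long_run_cov M \<epsilon> l l' \<noteq> 0"
  defines "T_hat \<equiv> \<lambda>n \<omega>. T_stat \<Delta> n (\<lambda>i. X n i \<omega>) (s_hat n \<omega>)"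
  shows "(norm (\<mu>1 - \<mu>2) < \<Delta> \<longrightarrow> diverges_to_MInf_in_prob M T_hat) \<and>
         (norm (\<mu>1 - \<mu>2) = \<Delta> \<longrightarrow>
            (\<forall>W. brownian_motion_L1 Q W (long_run_cov M \<epsilon>) \<longrightarrow>
               weak_conv_m (\<lambda>n. distr M borel (T_hat n))
                 (distr Q borel (\<lambda>\<omega>. T_limit (\<mu>1 - \<mu>2) (W s_star \<omega> - s_star *\<^sub>R W 1 \<omega>))))) \<and>
         (norm (\<mu>1 - \<mu>2) > \<Delta> \<longrightarrow> diverges_to_PInf_in_prob M T_hat)"
proof -
  interpret prob_space M by fact
  note asm = assms
  define a where "a = 1 / (1 / 2 - \<tau>)"
  define p where "p = \<delta> / (2 + \<delta>)"
  have \<delta>: "\<delta> > 0" and \<tau>: "1 / (2 + 2 * \<delta>) < \<tau>" "\<tau> < 1 / 2" using asm(9,12,13) by auto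
  have p: "p > 0" "1 / p = (2 + \<delta>) / \<delta>" using \<delta> by (simp_all add: p_def)
  obtain B where B: "B > 0" "\<And>k. k \<ge> 1 \<Longrightarrow> beta_coeff M \<epsilon> k \<le> (B * real k powr - a) powr (1 / p)"
    using beta_bound_of_summable[OF asm(15)[folded a_def p_def] p(1)] by auto
  have a: "a > 2 + 2 / \<delta>"
  proof -
    have "1 / 2 - \<tau> < \<delta> / (2 * (1 + \<delta>))" using \<tau>(1) \<delta> by (simp add: field_simps)
    then have "1 / (\<delta> / (2 * (1 + \<delta>))) < a" unfolding a_def using \<tau>(2) \<delta> by (intro divide_strict_left_mono) auto
    then show ?thesis using \<delta> by (simp add: field_simps)
  qed
  interpret mixing_seq M \<epsilon> \<delta> a B
    using asm(5,6,7,9,10) a B p(2) by unfold_locales auto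
  define k where "k n = nat \<lfloor>real n * s_star\<rfloor>" for n
  have s: "0 < s_star" "s_star < 1" using asm(4) by auto
  have fl: "0 \<le> \<lfloor>real n * s_star\<rfloor>" for n using s by simp
  have kn: "k n \<le> n" for n
  proof -
    have "real n * s_star \<le> real n * 1" using s by (intro mult_left_mono) auto
    then show ?thesis unfolding k_def by linarith
  qed
  have x: "X n i \<omega> = (if i \<le> k n then \<mu>1 else \<mu>2) + \<epsilon> i \<omega>" if "1 \<le> i" "i \<le> n" "\<omega> \<in> space M" for n i \<omega>
    unfolding asm(8)[OF that] k_def using fl[of n] by (simp add: le_nat_iff)
  have sh: "s_hat n \<omega> \<in> {0..1}" if "n \<ge> 1" "\<omega> \<in> space M" for n \<omega>
    by (rule T_stat_arg_max(1)[OF that(1) kn x asm(22)]) (use that in auto)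
  have max: "norm (cpU (\<lambda>i. \<epsilon> i \<omega>) (\<mu>1 - \<mu>2) n (k n) s) \<le> norm (cpU (\<lambda>i. \<epsilon> i \<omega>) (\<mu>1 - \<mu>2) n (k n) (s_hat n \<omega>))"
    if "n \<ge> 1" "\<omega> \<in> space M" "s \<in> {0..1}" for n \<omega> s
    by (rule T_stat_arg_max(2)[OF that(1) kn x asm(22) that(3)]) (use that in auto)
  have T: "T_hat n \<omega> = sqrt n * (norm (cpU (\<lambda>i. \<epsilon> i \<omega>) (\<mu>1 - \<mu>2) n (k n) (s_hat n \<omega>)) - s_hat n \<omega> * (1 - s_hat n \<omega>) * \<Delta>)"
    if "n \<ge> 1" "\<omega> \<in> space M" for n \<omega>
    unfolding T_hat_def by (rule T_stat_arg_max(3)[OF that(1) kn x asm(22)]) (use that in auto)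
  have Tm: "T_hat n \<in> borel_measurable M" for n
  proof (cases "n = 0")
    \<comment> \<open>At \<open>n = 0\<close> the factor \<open>sqrt 0\<close> makes the statistic
      constant, whatever \<open>s_hat 0\<close> is.\<close>
    case True
    then show ?thesis by (simp add: T_hat_def T_stat_def)
  next
    case False
    then have n: "n \<ge> 1" by simp
    have "(\<lambda>\<omega>. sqrt n * (norm (cpU (\<lambda>i. \<epsilon> i \<omega>) (\<mu>1 - \<mu>2) n (k n) (s_hat n \<omega>)) - s_hat n \<omega> * (1 - s_hat n \<omega>) * \<Delta>)) \<in> borel_measurable M"
      using measurable_cpU[OF asm(5) asm(21)[OF n] sh[OF n], where d = "\<mu>1 - \<mu>2" and n = n and k = "k n"] asm(21)[OF n] by measurable
    then show ?thesis by (rule measurable_cong[THEN iffD1, rotated]) (simp add: T[OF n])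
  qed
  interpret change_point M \<epsilon> \<delta> a B s_star \<Delta> "\<mu>1 - \<mu>2" k s_hat T_hat
    by unfold_locales (use s k_def sh max T Tm asm(3) in auto)
  show ?thesis
  proof (intro conjI impI allI)
    assume "norm (\<mu>1 - \<mu>2) < \<Delta>"
    then show "diverges_to_MInf_in_prob M T_hat"
      using diverges_MInf diverges_MInf_no_change asm(23) by (cases "\<mu>1 = \<mu>2") auto
  next
    fix W assume "norm (\<mu>1 - \<mu>2) = \<Delta>" "brownian_motion_L1 Q W (long_run_cov M \<epsilon>)"
    then show "weak_conv_m (\<lambda>n. distr M borel (T_hat n)) (distr Q borel (\<lambda>\<omega>. T_limit (\<mu>1 - \<mu>2) (W s_star \<omega> - s_star *\<^sub>R W 1 \<omega>)))"
      by (intro weak_conv_T[OF _ asm(2) asm(17-20)])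
  next
    assume "norm (\<mu>1 - \<mu>2) > \<Delta>"
    then show "diverges_to_PInf_in_prob M T_hat" by (rule diverges_PInf)
  qed
qed

end
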